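(* Let $a,b>-1$ with $\alpha:=a+b>-1$. For $\zeta,\xi>0$ put $$x=\frac{\zeta}{n^2}\Big(\frac n{n+1}\Big)^{\alpha},\qquad y=\frac{\xi}{n^2}\Big(\frac n{n+1}\Big)^{\alpha}.$$ Then for all four choices $\mu\nu\in\{01,00,11,10\}$ $$\lim_{n\to\infty}\frac1{n^2}\Big(\frac n{n+1}\Big)^{\alpha}H^{(n)}_{\mu\nu}(x,y)=\mathcal G_{\mu\nu}(\zeta,\xi),$$ where $$\mathcal G_{01}(\zeta,\xi)=\int_0^1H_a(t\zeta)\widetilde H_b(t\xi)\,dt,\qquad \mathcal G_{00}(\zeta,\xi)=\int_0^1H_a(t\zeta)H_b(t\xi)\,dt,$$ $$\mathcal G_{11}(\zeta,\xi)=\int_0^1\widetilde H_a(t\zeta)\widetilde H_b(t\xi)\,dt-\frac1{\zeta+\xi},\qquad \mathcal G_{10}(\zeta,\xi)=\int_0^1\widetilde H_a(t\zeta)H_b(t\xi)\,dt,$$ and for $c\in\{a,b\}$ $$H_c(\zeta)=\int_\gamma\frac{du}{2\pi i}\frac{\Gamma(u+c)}{\Gamma(1-u)\Gamma(\alpha-c+1-u)}\zeta^{-u},\qquad \widetilde H_c(\zeta)=\int_\gamma\frac{du}{2\pi i}\frac{\Gamma(u)\Gamma(u+c)}{\Gamma(\alpha-c+1-u)}\zeta^{-u}.$$ The convergence is uniform for $\zeta,\xi$ within compact subsets of $(0,\infty)$, with error $\mathcal O(n^{-2})$. Consequently, in this scaling limit the correlations of the eigenvalues of $M_1,M_2$ are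 determined by the two-level determinantal random point field on $\mathbb R_+\sqcup\mathbb R_+$ with kernels $R^{(++)}=\mathcal G_{01}$, $R^{(+-)}=\mathcal G_{00}$, $R^{(-+)}=\mathcal G_{11}$, $R^{(--)}=\mathcal G_{10}$; that is, the eigenvalue correlation functions $\rho^{(n)}_{(r,s)}(x_1,\dots,x_r;y_1,\dots,y_s)$, evaluated at the points $x_i=\frac{\zeta_i}{n^2}\big(\frac n{n+1}\big)^{\alpha}$ ($1\le i\le r$) and $y_j=\frac{\xi_j}{n^2}\big(\frac n{n+1}\big)^{\alpha}$ ($1\le j\le s$) with $\zeta_i,\xi_j>0$, and multiplied by $\big(n^{-2}(n/(n+1))^\alpha\big)^{r+s}$, converge to $$\det\begin{bmatrix}[R^{(++)}(\zeta_i,\zeta_j)]_{i,j\le r}&[R^{(+-)}(\zeta_i,\xi_j)]_{i\le r,j\le s}\\ [R^{(-+)}(\xi_i,\zeta_j)]_{i\le s,j\le r}&[R^{(--)}(\xi_i,\xi_j)]_{i,j\le s}\end{bmatrix}.$$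
   Context: The matrix model: the probability measure on pairs $(M_1,M_2)$ of positive definite Hermitian $n\times n$ matrices with density proportional to $\det(M_1)^a\det(M_2)^be^{-\mathrm{Tr}(M_1+M_2)}/\det(M_1+M_2)^n$ with respect to Lebesgue measure. Let $p_j,q_j$ be the polynomials of exact degree $j$ with identical positive leading coefficients such that $\int_0^\infty\!\int_0^\infty \frac{x^ay^be^{-x-y}}{x+y}p_\ell(x)q_m(y)\,dx\,dy=\delta_{\ell m}$. Define, for $x,y>0$, $$K^{(n)}_{00}(x,y)=\sum_{j=0}^{n-1}p_j(x)q_j(y),\quad K^{(n)}_{01}(x,y)=\int_0^\infty K^{(n)}_{00}(x,y')\frac{y'^be^{-y'}}{y+y'}dy',\quad K^{(n)}_{10}(x,y)=\int_0^\infty K^{(n)}_{00}(x',y)\frac{x'^ae^{-x'}}{x+x'}dx',$$ $$K^{(n)}_{11}(x,y)=\int_0^\infty\!\!\int_0^\infty K^{(n)}_{00}(x',y')\frac{x'^ae^{-x'}}{x+x'}\frac{y'^be^{-y'}}{y+y'}dx'dy'-\frac1{x+y},$$ and $H^{(n)}_{01}=x^ae^{-x}K^{(n)}_{01}$, $H^{(n)}_{00}=x^ay^be^{-x-y}K^{(n)}_{00}$, $H^{(n)}_{11}=K^{(n)}_{11}$, $H^{(n)}_{10}=y^be^{-y}K^{(n)}_{10}$. It is known that the correlation function of $r$ eigenvalues $x_i$ of $M_1$ and $s$ eigenvalues $y_j$ of $M_2$ is $$\rho^{(n)}_{(r,s)}(x_1,\dots,x_r;y_1,\dots,y_s)=\det\begin{bmatrix}[H^{(n)}_{01}(x_i,x_j)]&[H^{(n)}_{00}(x_i,y_j)]\\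 [H^{(n)}_{11}(y_i,x_j)]&[H^{(n)}_{10}(y_i,y_j)]\end{bmatrix}.$$ A two-level determinantal random point field on $\mathbb R_+\sqcup\mathbb R_+$ is a random point field whose correlation functions (for $r$ points $x_i$ in the first copy of $\mathbb R_+$ and $s$ points $y_j$ in the second) are block determinants of the form $$\rho_{(r,s)}(x_1,\dots,x_r;y_1,\dots,y_s)=\det\begin{bmatrix}[R^{(++)}(x_i,x_j)]_{i,j\le r}&[R^{(+-)}(x_i,y_j)]_{i\le r,j\le s}\\ [R^{(-+)}(y_i,x_j)]_{i\le s,j\le r}&[R^{(--)}(y_i,y_j)]_{i,j\le s}\end{bmatrix}$$ built from four kernels $R^{(\pm\pm)}$; points in the first copy of $\mathbb R_+$ are the "$+$ field", those in the second the "$-$ field". The contour $\gamma$ originates at $-\infty$ in the lower half-plane, returns to $-\infty$ in the upper half-plane, and encloses all poles of the numerator of the integrand. Powers are principal branches. *)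

theory Defs
  imports
    "HOL-Complex_Analysis.Complex_Analysis"
    "HOL-Computational_Algebra.Fundamental_Theorem_Algebra"
    "Jordan_Normal_Form.Char_Poly"
    "Jordan_Normal_Form.Conjugate"
begin

text \<open>Cauchy--Laguerre biorthogonal polynomials and the finite-size kernels\<close>

definition cauchy_laguerre_biorthonormal ::
  "real \<Rightarrow> real \<Rightarrow> (nat \<Rightarrow> real poly) \<Rightarrow> (nat \<Rightarrow> real poly) \<Rightarrow> bool" where
  "cauchy_laguerre_biorthonormal a b p q \<longleftrightarrow>
     (\<forall>j. degree (p j) = j \<and> degree (q j) = j \<and>
          lead_coeff (p j) = lead_coeff (q j) \<and> lead_coeff (p j) > 0) \<and>
     (\<forall>l m. (LBINT x=0..\<infinity>. (LBINT y=0..\<infinity>.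
               x powr a * y powr b * exp (- x - y) / (x + y) * poly (p l) x * poly (q m) y))
            = (if l = m then 1 else 0))"

context
  fixes a b :: real and p q :: "nat \<Rightarrow> real poly" and n :: nat
begin

definition K00 :: "real \<Rightarrow> real \<Rightarrow> real" where
  "K00 x y = (\<Sum>j<n. poly (p j) x * poly (q j) y)"

definition K01 :: "real \<Rightarrow> real \<Rightarrow> real" where
  "K01 x y = (LBINT y'=0..\<infinity>. K00 x y' * (y' powr b * exp (- y') / (y + y')))"

definition K10 :: "real \<Rightarrow> real \<Rightarrow> real" where
  "K10 x y = (LBINT x'=0..\<infinity>. K00 x' y * (x' powr a * exp (- x') / (x + x')))"

definition K11 :: "real \<Rightarrow> real \<Rightarrow> real" where
  "K11 x y =
     (LBINT x'=0..\<infinity>. (LBINT y'=0..\<infinity>.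
        K00 x' y' * (x' powr a * exp (- x') / (x + x')) * (y' powr b * exp (- y') / (y + y'))))
     - 1 / (x + y)"

definition H01 :: "real \<Rightarrow> real \<Rightarrow> real" where
  "H01 x y = x powr a * exp (- x) * K01 x y"

definition H00 :: "real \<Rightarrow> real \<Rightarrow> real" where
  "H00 x y = x powr a * y powr b * exp (- x - y) * K00 x y"

definition H11 :: "real \<Rightarrow> real \<Rightarrow> real" where
  "H11 x y = K11 x y"

definition H10 :: "real \<Rightarrow> real \<Rightarrow> real" where
  "H10 x y = y powr b * exp (- y) * K10 x y"

end

text \<open>
  The contour \<open>\<gamma>\<close> is the positively oriented boundary of the half-strip
  \<open>{u. Re u < \<sigma> \<and> \<bar>Im u\<bar> < \<delta>}\<close>, running from \<open>-\<infinity> - i\<delta>\<close> to \<open>-\<infinity> + i\<delta>\<close>; the integral over it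
  is the limit of the integrals over its truncations to \<open>Re u \<ge> -R\<close>. All poles of
  the numerators used below are real and at most \<open>max 0 (-c)\<close>, so \<open>\<gamma>\<close> encloses them as soon
  as \<open>\<sigma> > 0\<close>, \<open>\<sigma> > -c\<close> and \<open>\<delta> > 0\<close>.
\<close>

definition truncated_loop :: "real \<Rightarrow> real \<Rightarrow> real \<Rightarrow> real \<Rightarrow> complex" where
  "truncated_loop \<sigma> \<delta> R =
     linepath (Complex (- R) (- \<delta>)) (Complex \<sigma> (- \<delta>)) +++
     linepath (Complex \<sigma> (- \<delta>)) (Complex \<sigma> \<delta>) +++
     linepath (Complex \<sigma> \<delta>) (Complex (- R) \<delta>)"

definition loop_integral :: "real \<Rightarrow> real \<Rightarrow> (complex \<Rightarrow> complex) \<Rightarrow> complex" where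
  "loop_integral \<sigma> \<delta> f = Lim at_top (\<lambda>R. contour_integral (truncated_loop \<sigma> \<delta> R) f)"

text \<open>
  Where \<open>Gamma\<close> has a pole, its library value is \<open>0\<close> and division by it gives \<open>0\<close>, which is
  the correct value of the entire function \<open>1 / Gamma\<close>.
\<close>

definition meijer_H :: "real \<Rightarrow> real \<Rightarrow> real \<Rightarrow> real \<Rightarrow> real \<Rightarrow> complex" where
  "meijer_H \<sigma> \<delta> \<alpha> c \<zeta> =
     loop_integral \<sigma> \<delta> (\<lambda>u. 1 / (2 * of_real pi * \<i>) *
       (Gamma (u + of_real c) / (Gamma (1 - u) * Gamma (of_real (\<alpha> - c + 1) - u))) *
       of_real \<zeta> powr (- u))"

definition meijer_Ht :: "real \<Rightarrow> real \<Rightarrow> real \<Rightarrow> real \<Rightarrow> real \<Rightarrow> complex" where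
  "meijer_Ht \<sigma> \<delta> \<alpha> c \<zeta> =
     loop_integral \<sigma> \<delta> (\<lambda>u. 1 / (2 * of_real pi * \<i>) *
       (Gamma u * Gamma (u + of_real c) / Gamma (of_real (\<alpha> - c + 1) - u)) *
       of_real \<zeta> powr (- u))"

context
  fixes \<sigma> \<delta> a b :: real
begin

definition G01 :: "real \<Rightarrow> real \<Rightarrow> complex" where
  "G01 \<zeta> \<xi> = (LBINT t=0..1. meijer_H \<sigma> \<delta> (a + b) a (t * \<zeta>) * meijer_Ht \<sigma> \<delta> (a + b) b (t * \<xi>))"

definition G00 :: "real \<Rightarrow> real \<Rightarrow> complex" where
  "G00 \<zeta> \<xi> = (LBINT t=0..1. meijer_H \<sigma> \<delta> (a + b) a (t * \<zeta>) * meijer_H \<sigma> \<delta> (a + b) b (t * \<xi>))"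

definition G11 :: "real \<Rightarrow> real \<Rightarrow> complex" where
  "G11 \<zeta> \<xi> = (LBINT t=0..1. meijer_Ht \<sigma> \<delta> (a + b) a (t * \<zeta>) * meijer_Ht \<sigma> \<delta> (a + b) b (t * \<xi>))
              - of_real (1 / (\<zeta> + \<xi>))"

definition G10 :: "real \<Rightarrow> real \<Rightarrow> complex" where
  "G10 \<zeta> \<xi> = (LBINT t=0..1. meijer_Ht \<sigma> \<delta> (a + b) a (t * \<zeta>) * meijer_H \<sigma> \<delta> (a + b) b (t * \<xi>))"

end

definition edge_scale :: "real \<Rightarrow> nat \<Rightarrow> real" where
  "edge_scale \<alpha> n = 1 / real n ^ 2 * (real n / (real n + 1)) powr \<alpha>"

definition hard_edge_limit ::
  "real \<Rightarrow> (nat \<Rightarrow> real \<Rightarrow> real \<Rightarrow> real) \<Rightarrow> (real \<Rightarrow> real \<Rightarrow> complex) \<Rightarrow> bool" where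
  "hard_edge_limit \<alpha> H G \<longleftrightarrow>
     (\<forall>\<zeta>>0. \<forall>\<xi>>0.
        (\<lambda>n. of_real (edge_scale \<alpha> n * H n (edge_scale \<alpha> n * \<zeta>) (edge_scale \<alpha> n * \<xi>)))
          \<longlonglongrightarrow> G \<zeta> \<xi>) \<and>
     (\<forall>S. compact S \<and> S \<subseteq> {0<..} \<times> {0<..} \<longrightarrow>
        (\<exists>C. \<forall>\<^sub>F n in sequentially. \<forall>(\<zeta>, \<xi>)\<in>S.
           norm (of_real (edge_scale \<alpha> n * H n (edge_scale \<alpha> n * \<zeta>) (edge_scale \<alpha> n * \<xi>)) - G \<zeta> \<xi>)
             \<le> C / real n ^ 2))"

definition two_level_det ::
  "(real \<Rightarrow> real \<Rightarrow> 'a::comm_ring_1) \<Rightarrow> (real \<Rightarrow> real \<Rightarrow> 'a) \<Rightarrow> (real \<Rightarrow> real \<Rightarrow> 'a) \<Rightarrow>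
   (real \<Rightarrow> real \<Rightarrow> 'a) \<Rightarrow> nat \<Rightarrow> nat \<Rightarrow> (nat \<Rightarrow> real) \<Rightarrow> (nat \<Rightarrow> real) \<Rightarrow> 'a" where
  "two_level_det Rpp Rpm Rmp Rmm r s x y =
     Determinant.det (four_block_mat
       (Matrix.mat r r (\<lambda>(i, j). Rpp (x i) (x j))) (Matrix.mat r s (\<lambda>(i, j). Rpm (x i) (y j)))
       (Matrix.mat s r (\<lambda>(i, j). Rmp (y i) (x j))) (Matrix.mat s s (\<lambda>(i, j). Rmm (y i) (y j))))"

text \<open>
  The matrix model. A Hermitian \<open>n \<times> n\<close> matrix is given by its \<open>n\<^sup>2\<close> real coordinates: the
  diagonal, and the real (\<open>h (i, j)\<close>) and imaginary (\<open>h (j, i)\<close>) part of each entry above it.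
  Lebesgue measure on Hermitian matrices is the product Lebesgue measure in these coordinates.
\<close>

definition hermitian_of :: "nat \<Rightarrow> (nat \<times> nat \<Rightarrow> real) \<Rightarrow> complex mat" where
  "hermitian_of n h = Matrix.mat n n (\<lambda>(i, j).
     if i = j then of_real (h (i, i))
     else if i < j then Complex (h (i, j)) (h (j, i))
     else Complex (h (j, i)) (- h (i, j)))"

definition positive_definite :: "complex mat \<Rightarrow> bool" where
  "positive_definite A \<longleftrightarrow>
     (\<forall>v \<in> carrier_vec (dim_row A). v \<noteq> 0\<^sub>v (dim_row A) \<longrightarrow> 0 < Re ((A *\<^sub>v v) \<bullet>c v))"

definition mat_trace :: "complex mat \<Rightarrow> complex" where
  "mat_trace A = (\<Sum>i<dim_row A. A $$ (i, i))"

definition hermitian_pair_lebesgue ::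
  "nat \<Rightarrow> ((nat \<times> nat \<Rightarrow> real) \<times> (nat \<times> nat \<Rightarrow> real)) measure" where
  "hermitian_pair_lebesgue n =
     (PiM ({..<n} \<times> {..<n}) (\<lambda>_. lborel)) \<Otimes>\<^sub>M (PiM ({..<n} \<times> {..<n}) (\<lambda>_. lborel))"

definition matrix_weight ::
  "real \<Rightarrow> real \<Rightarrow> nat \<Rightarrow> (nat \<times> nat \<Rightarrow> real) \<times> (nat \<times> nat \<Rightarrow> real) \<Rightarrow> real" where
  "matrix_weight a b n \<omega> =
     (let M1 = hermitian_of n (fst \<omega>); M2 = hermitian_of n (snd \<omega>) in
      if positive_definite M1 \<and> positive_definite M2 then
        Re (Determinant.det M1) powr a * Re (Determinant.det M2) powr b
          * exp (- Re (mat_trace (M1 + M2))) / Re (Determinant.det (M1 + M2)) ^ n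
      else 0)"

definition matrix_model ::
  "real \<Rightarrow> real \<Rightarrow> nat \<Rightarrow> ((nat \<times> nat \<Rightarrow> real) \<times> (nat \<times> nat \<Rightarrow> real)) measure" where
  "matrix_model a b n =
     density (hermitian_pair_lebesgue n)
       (\<lambda>\<omega>. ennreal (matrix_weight a b n \<omega> /
          (LINT \<omega>'|hermitian_pair_lebesgue n. matrix_weight a b n \<omega>')))"

definition eigenvalue_list :: "complex mat \<Rightarrow> real list" where
  "eigenvalue_list A = sorted_list_of_multiset (image_mset Re (proots (char_poly A)))"

text \<open>
  Number of ways to choose \<open>r\<close> distinctly indexed eigenvalues of \<open>M\<^sub>1\<close> and \<open>s\<close> distinctly indexed
  eigenvalues of \<open>M\<^sub>2\<close>, in order, such that the resulting pair of tuples lies in \<open>B\<close>. Tuples are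
  extensional functions on \<open>{..<r}\<close> and \<open>{..<s}\<close>.
\<close>

definition eigenvalue_tuple_count ::
  "nat \<Rightarrow> nat \<Rightarrow> nat \<Rightarrow> ((nat \<Rightarrow> real) \<times> (nat \<Rightarrow> real)) set \<Rightarrow>
   (nat \<times> nat \<Rightarrow> real) \<times> (nat \<times> nat \<Rightarrow> real) \<Rightarrow> nat" where
  "eigenvalue_tuple_count n r s B \<omega> =
     card {(i, j). i \<in> {..<r} \<rightarrow>\<^sub>E {..<n} \<and> inj_on i {..<r} \<and>
                   j \<in> {..<s} \<rightarrow>\<^sub>E {..<n} \<and> inj_on j {..<s} \<and>
                   (\<lambda>k\<in>{..<r}. eigenvalue_list (hermitian_of n (fst \<omega>)) ! i k,
                    \<lambda>k\<in>{..<s}. eigenvalue_list (hermitian_of n (snd \<omega>)) ! j k) \<in> B}"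

definition tuple_lebesgue :: "nat \<Rightarrow> nat \<Rightarrow> ((nat \<Rightarrow> real) \<times> (nat \<Rightarrow> real)) measure" where
  "tuple_lebesgue r s = (PiM {..<r} (\<lambda>_. lborel)) \<Otimes>\<^sub>M (PiM {..<s} (\<lambda>_. lborel))"

definition pos_orthant :: "nat \<Rightarrow> nat \<Rightarrow> ((nat \<Rightarrow> real) \<times> (nat \<Rightarrow> real)) set" where
  "pos_orthant r s = ({..<r} \<rightarrow>\<^sub>E {0<..}) \<times> ({..<s} \<rightarrow>\<^sub>E {0<..})"

text \<open>
  The correlation function is the Lebesgue density of the factorial moment measure of the
  eigenvalues. Continuity selects the version that can be evaluated pointwise.
\<close>

definition eigenvalue_correlation ::
  "real \<Rightarrow> real \<Rightarrow> nat \<Rightarrow> nat \<Rightarrow> nat \<Rightarrow> ((nat \<Rightarrow> real) \<times> (nat \<Rightarrow> real) \<Rightarrow> real) \<Rightarrow> bool" where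
  "eigenvalue_correlation a b n r s \<rho> \<longleftrightarrow>
     continuous_on (pos_orthant r s) \<rho> \<and>
     set_borel_measurable (tuple_lebesgue r s) (pos_orthant r s) \<rho> \<and>
     (\<forall>z\<in>pos_orthant r s. 0 \<le> \<rho> z) \<and>
     (\<forall>B \<in> sets (tuple_lebesgue r s). B \<subseteq> pos_orthant r s \<longrightarrow>
        (\<integral>\<^sup>+\<omega>. of_nat (eigenvalue_tuple_count n r s B \<omega>) \<partial>matrix_model a b n)
          = (\<integral>\<^sup>+z\<in>B. ennreal (\<rho> z) \<partial>tuple_lebesgue r s))"

definition kernel_correlation ::
  "real \<Rightarrow> real \<Rightarrow> (nat \<Rightarrow> real poly) \<Rightarrow> (nat \<Rightarrow> real poly) \<Rightarrow> nat \<Rightarrow> nat \<Rightarrow> nat \<Rightarrow>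
   (nat \<Rightarrow> real) \<times> (nat \<Rightarrow> real) \<Rightarrow> real" where
  "kernel_correlation a b p q n r s z =
     two_level_det (H01 a b p q n) (H00 a b p q n) (H11 a b p q n) (H10 a b p q n)
       r s (fst z) (snd z)"

end

theory Submission
  imports Defs "HOL-Real_Asymp.Real_Asymp"
begin

text \<open>
  The moments of the weight are \<open>\<Gamma>(a + j + 1) \<Gamma>(b + k + 1) / (j + k + \<alpha> + 1)\<close> with \<open>\<alpha> = a + b\<close>, a
  diagonally scaled Cauchy matrix, so the coefficients of \<open>K\<^sub>0\<^sub>0\<close> are those of its inverse \<open>B\<close>.
  With \<open>f z = (\<alpha> + 1 - z)\<^sub>n / (z)\<^sub>n\<close> one has
  \<open>\<Sum>\<^sub>k \<Sum>\<^sub>l B\<^sub>k\<^sub>l / ((z + k) (w + l)) = (f z * f w - 1) / (\<alpha> + 1 - z - w)\<close>.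
  The functions \<open>x powr (c + k) / \<Gamma>(c + k + 1)\<close> and, up to elementary factors, their Stieltjes transforms
  are loop integrals of \<open>x powr (- u) / (u + c + k)\<close> against \<open>1 / \<Gamma>(1 - u)\<close> and \<open>\<Gamma>(u)\<close>. Since
  \<open>1 / (1 - u - v)\<close> is the integral of \<open>t powr (- u - v)\<close> over \<open>(0, 1)\<close>, each finite kernel is, up to the
  factors \<open>exp (\<plusminus> x \<plusminus> y)\<close> and the term \<open>1 / (x + y)\<close>, exactly an integral over \<open>t\<close> of a product of two
  Meijer-type loop integrals in which \<open>\<Gamma>(z) / \<Gamma>(\<alpha> + 1 - z)\<close> is replaced by \<open>f z\<close>. After rescaling, \<open>f\<close> agrees
  with that quotient on the whole loop up to \<open>O(n\<^sup>-\<^sup>2)\<close> times an exponential in \<open>- Re z\<close>, and the exponential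
  is absorbed by the superexponential decay of \<open>1 / \<Gamma>(1 - u)\<close> and \<open>\<Gamma>(u)\<close> along the loop.
\<close>

text \<open>The rate O(n^-2) rests on the factor (n/(n+1))^\<alpha> of the scale: with n^-2 alone,
  both the comparison of consecutive n and the shift z -> z - 1 would carry errors one order too
  large when \<alpha> is nonzero. Stirling's formula is avoided. f is compared with its limit on a
  compact piece of the loop, and the comparison is carried to the left in unit steps by the
  functional equations of both; each step costs a constant factor, which is the source of the
  exponential in - Re z. When \<Gamma>(u) is the weight, infinitely many poles lie inside the loop.
  Splitting Euler's integral at 1 isolates them, so that only contours around one or two poles have
  to be closed. This uses y < 1 for the power y powr (- u), which holds for large n because the
  rescaled points tend to 0. The t-integral needs Re u + Re v < 1 on the two loops, while the loops
  must pass to the right of 0 and of -a, respectively of 0 and of -b. Both demands are compatible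
  exactly because a, b and a + b exceed -1. The double sum over B collapses because of the
  reflection f z * f (\<alpha> + 1 - z) = 1.\<close>

subsection \<open>Integrals along the infinite loop\<close>

text \<open>Arc length parametrization of \<open>\<gamma>\<close>, with corners at \<open>v = - \<delta>\<close> and \<open>v = \<delta>\<close>, and its derivative.\<close>

definition lpath :: "real \<Rightarrow> real \<Rightarrow> real \<Rightarrow> complex" where
  "lpath \<sigma> \<delta> v = Complex (\<sigma> - max 0 (\<bar>v\<bar> - \<delta>)) (max (- \<delta>) (min \<delta> v))"

definition ldir :: "real \<Rightarrow> real \<Rightarrow> complex" where
  "ldir \<delta> v = (if v < - \<delta> then 1 else if v \<le> \<delta> then \<i> else - 1)"

text \<open>An absolutely convergent Lebesgue integral over the parameter line, so that Fubini,
  dominated convergence and termwise summation apply directly. \<open>loop_integral_eq_cloop\<close>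
  links it to the limit of truncated contours.\<close>

definition cloop :: "real \<Rightarrow> real \<Rightarrow> (complex \<Rightarrow> complex) \<Rightarrow> complex" where
  "cloop \<sigma> \<delta> f = (LINT v|lborel. f (lpath \<sigma> \<delta> v) * ldir \<delta> v)"

lemma Re_lpath [simp]: "Re (lpath \<sigma> \<delta> v) = \<sigma> - max 0 (\<bar>v\<bar> - \<delta>)"
  and Im_lpath [simp]: "Im (lpath \<sigma> \<delta> v) = max (- \<delta>) (min \<delta> v)"
  by (simp_all add: lpath_def)

lemma Re_lpath_le: "Re (lpath \<sigma> \<delta> v) \<le> \<sigma>"
  by simp

lemma norm_ldir [simp]: "norm (ldir \<delta> v) = 1"
  by (simp add: ldir_def)

lemma continuous_lpath [continuous_intros]: "continuous_on A (lpath \<sigma> \<delta>)"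
  unfolding lpath_def by (intro continuous_intros)

lemma measurable_lpath [measurable]: "lpath \<sigma> \<delta> \<in> borel_measurable borel"
  by (intro borel_measurable_continuous_onI continuous_lpath)

lemma measurable_ldir [measurable]: "ldir \<delta> \<in> borel_measurable borel"
  unfolding ldir_def by measurable

text \<open>\<open>linepath\<close> runs over the unit interval; a linear substitution lets each
  side of the loop be traversed over [p, q] with constant derivative d, as the arc length parameter
  demands.\<close>

lemma has_contour_integral_affine_linepath:
  assumes "p < q" "B - A = of_real (q - p) * d" "continuous_on (closed_segment A B) f"
  shows "(f has_contour_integral integral {p..q} (\<lambda>v. f (A + of_real (v - p) * d) * d)) (linepath A B)"
proof -
  let ?h = "\<lambda>v. f (A + of_real (v - p) * d) * d"
  have seg: "A + of_real (v - p) * d \<in> closed_segment A B" if "v \<in> {p..q}" for v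
  proof -
    have "A + of_real (v - p) * d = A + ((v - p) / (q - p)) *\<^sub>R (B - A)"
      using assms(1,2) by (simp add: scaleR_conv_of_real)
    then show ?thesis
      using that assms(1) unfolding closed_segment_def
      by (auto intro!: exI[of _ "(v - p) / (q - p)"] simp: algebra_simps)
  qed
  have "?h integrable_on {p..q}"
    by (intro integrable_continuous_real continuous_intros continuous_on_compose2[OF assms(3)]) (use seg in auto)
  then have "(?h has_integral integral {p..q} ?h) (cbox p q)" unfolding cbox_interval by (rule integrable_integral)
  from has_integral_affinity'[OF this, of "q - p" p] assms(1)
  have "((\<lambda>x. ?h ((q - p) *\<^sub>R x + p)) has_integral integral {p..q} ?h /\<^sub>R (q - p)) {0..1}"
    by (simp)
  then have "((\<lambda>x. (q - p) *\<^sub>R ?h ((q - p) *\<^sub>R x + p)) has_integral (q - p) *\<^sub>R (integral {p..q} ?h /\<^sub>R (q - p))) {0..1}"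
    by (rule has_integral_cmul)
  moreover have "(q - p) *\<^sub>R ?h ((q - p) *\<^sub>R x + p) = f (linepath A B x) * (B - A)" for x
  proof -
    have e: "A + of_real (((q - p) *\<^sub>R x + p) - p) * d = linepath A B x"
    proof -
      have "of_real (((q - p) *\<^sub>R x + p) - p) * d = of_real x * (of_real (q - p) * d)"
        by simp
      then show ?thesis
        unfolding assms(2)[symmetric] by (simp add: linepath_def scaleR_conv_of_real algebra_simps)
    qed
    show ?thesis
      unfolding e assms(2) by (simp add: scaleR_conv_of_real)
  qed
  ultimately show ?thesis
    using assms(1) by (simp add: has_contour_integral_linepath)
qed

text \<open>Truncation at abscissa -R is the symmetric window of half-width \<delta> + \<sigma> + R
  in arc length: half of the vertical side plus one arm. The corners, where \<open>ldir\<close>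
  follows only one of the adjacent sides, are null sets.\<close>

lemma has_contour_integral_truncated_loop:
  assumes "\<delta> > 0" "R + \<sigma> > 0" "continuous_on (range (lpath \<sigma> \<delta>)) f"
  shows "(f has_contour_integral integral {-(\<delta>+\<sigma>+R)..\<delta>+\<sigma>+R} (\<lambda>v. f (lpath \<sigma> \<delta> v) * ldir \<delta> v))
           (truncated_loop \<sigma> \<delta> R)"
proof -
  let ?F = "\<lambda>v. f (lpath \<sigma> \<delta> v) * ldir \<delta> v"
  let ?r = "\<delta>+\<sigma>+R"
  let ?A = "Complex (-R) (-\<delta>)" and ?B = "Complex \<sigma> (-\<delta>)" and ?C = "Complex \<sigma> \<delta>" and ?D = "Complex (-R) \<delta>"
  note r = assms(1,2)
  have l1: "?A + of_real (v + ?r) = lpath \<sigma> \<delta> v" if "v \<le> -\<delta>" for v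
    using that r by (auto simp: complex_eq_iff)
  have l2: "?B + of_real (v + \<delta>) * \<i> = lpath \<sigma> \<delta> v" if "-\<delta> \<le> v" "v \<le> \<delta>" for v
    using that r by (auto simp: complex_eq_iff)
  have l3: "?C + of_real (v - \<delta>) * (-1) = lpath \<sigma> \<delta> v" if "\<delta> \<le> v" for v
    using that r by (auto simp: complex_eq_iff)
  have seg: "closed_segment A B \<subseteq> range (lpath \<sigma> \<delta>)"
    if "p < q" "B - A = of_real (q - p) * d" "\<And>v. p \<le> v \<Longrightarrow> v \<le> q \<Longrightarrow> A + of_real (v - p) * d = lpath \<sigma> \<delta> v"
    for A B d p q
  proof
    fix z assume "z \<in> closed_segment A B"
    then obtain u where u: "0 \<le> u" "u \<le> 1" "z = A + u *\<^sub>R (B - A)"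
      by (auto simp: in_segment algebra_simps)
    have "z = A + of_real ((p + u * (q - p)) - p) * d"
      using u that(2) by (simp add: scaleR_conv_of_real)
    also have "\<dots> = lpath \<sigma> \<delta> (p + u * (q - p))"
      proof (rule that(3))
      have "0 \<le> u * (q - p)" "u * (q - p) \<le> q - p"
        using u(1,2) that(1) by (auto intro: mult_left_le_one_le)
      then show "p \<le> p + u * (q - p)" "p + u * (q - p) \<le> q" by linarith+
    qed
    finally show "z \<in> range (lpath \<sigma> \<delta>)" by blast
  qed
  have piece: "(f has_contour_integral integral {p..q} ?F) (linepath A B) \<and> ?F integrable_on {p..q}"
    if "p < q" "B - A = of_real (q - p) * d" "\<And>v. p \<le> v \<Longrightarrow> v \<le> q \<Longrightarrow> A + of_real (v - p) * d = lpath \<sigma> \<delta> v"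
       "\<And>v. p < v \<Longrightarrow> v < q \<Longrightarrow> ldir \<delta> v = d" for A B d p q
  proof
    have c: "continuous_on (closed_segment A B) f"
      by (rule continuous_on_subset[OF assms(3) seg[OF that(1-3)]])
    have "integral {p..q} (\<lambda>v. f (A + of_real (v - p) * d) * d) = integral {p..q} ?F"
      by (rule integral_spike[of "{p,q}"]) (use that in auto)
    then show "(f has_contour_integral integral {p..q} ?F) (linepath A B)"
      using has_contour_integral_affine_linepath[OF that(1,2) c] by simp
    have "(\<lambda>v. f (lpath \<sigma> \<delta> v) * d) integrable_on {p..q}"
      by (intro integrable_continuous_real continuous_intros continuous_on_compose2[OF assms(3)]) auto
    then show "?F integrable_on {p..q}"
      by (rule integrable_spike[of _ _ "{p,q}"]) (use that in auto)
  qed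
  have 1: "(f has_contour_integral integral {-?r..-\<delta>} ?F) (linepath ?A ?B) \<and> ?F integrable_on {-?r..-\<delta>}"
    by (rule piece[of _ _ _ _ 1]) (use r l1 in \<open>auto simp: complex_eq_iff ldir_def\<close>)
  have 2: "(f has_contour_integral integral {-\<delta>..\<delta>} ?F) (linepath ?B ?C) \<and> ?F integrable_on {-\<delta>..\<delta>}"
    by (rule piece[of _ _ _ _ \<i>]) (use r l2 in \<open>auto simp: complex_eq_iff ldir_def\<close>)
  have 3: "(f has_contour_integral integral {\<delta>..?r} ?F) (linepath ?C ?D) \<and> ?F integrable_on {\<delta>..?r}"
    by (rule piece[of _ _ _ _ "-1"]) (use r l3 in \<open>auto simp: complex_eq_iff ldir_def\<close>)
  have i23: "?F integrable_on {-\<delta>..?r}"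
    by (rule Henstock_Kurzweil_Integration.integrable_combine[of _ \<delta>]) (use r 2 3 in auto)
  have i13: "?F integrable_on {-?r..?r}"
    by (rule Henstock_Kurzweil_Integration.integrable_combine[of _ "-\<delta>"]) (use r 1 i23 in auto)
  have "integral {-\<delta>..?r} ?F = integral {-\<delta>..\<delta>} ?F + integral {\<delta>..?r} ?F"
    by (rule Henstock_Kurzweil_Integration.integral_combine[symmetric]) (use r i23 in auto)
  moreover have "integral {-?r..?r} ?F = integral {-?r..-\<delta>} ?F + integral {-\<delta>..?r} ?F"
    by (rule Henstock_Kurzweil_Integration.integral_combine[symmetric]) (use r i13 in auto)
  ultimately show ?thesis unfolding truncated_loop_def
    using has_contour_integral_join[OF conjunct1[OF 1] has_contour_integral_join[OF conjunct1[OF 2] conjunct1[OF 3]]]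
    by (simp add: add.assoc)
qed

section \<open>Integrability along the loop and closing of the contour\<close>

lemma integrable_exp_minus_abs:
  assumes "\<eta> > 0" shows "integrable lborel (\<lambda>v::real. exp (- (\<eta> * \<bar>v\<bar>)))"
proof -
  have "((\<lambda>x. exp (- \<eta> * x)) has_integral exp (- \<eta> * 0) / \<eta>) {0..}"
    by (rule has_integral_exp_minus_to_infinity) fact
  then have "(\<lambda>x. exp (- \<eta> * x)) absolutely_integrable_on {0..}"
    by (intro nonnegative_absolutely_integrable_1) auto
  then have i: "integrable lborel (\<lambda>x. indicator {0..} x * exp (- \<eta> * x))"
    by (auto simp: set_integrable_def integrable_completion)
  have j: "integrable lborel (\<lambda>x. indicator {0..} (-x) * exp (- \<eta> * - x))"
    using lborel_integrable_real_affine[OF i, of "-1" 0] by simp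
  show ?thesis
  proof (rule Bochner_Integration.integrable_bound[OF Bochner_Integration.integrable_add[OF i j]])
    show "AE v in lborel. norm (exp (- (\<eta> * \<bar>v\<bar>))) \<le> norm (indicator {0..} v * exp (- \<eta> * v)
        + indicator {0..} (-v) * exp (- \<eta> * - v))"
      by (intro AE_I2) (auto simp: indicator_def abs_if)
  qed measurable
qed

lemma integrable_exp_Re_lpath:
  assumes "\<eta> > 0" shows "integrable lborel (\<lambda>v. exp (\<eta> * Re (lpath \<sigma> \<delta> v)))"
proof (rule Bochner_Integration.integrable_bound)
  show "integrable lborel (\<lambda>v. exp (\<eta> * (\<sigma> + \<delta>)) * exp (- (\<eta> * \<bar>v\<bar>)))"
    using integrable_exp_minus_abs[OF assms] by simp
  show "AE v in lborel. norm (exp (\<eta> * Re (lpath \<sigma> \<delta> v))) \<le> norm (exp (\<eta> * (\<sigma> + \<delta>)) * exp (- (\<eta> * \<bar>v\<bar>)))"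
    using assms mult_left_mono[of "\<sigma> - max 0 (\<bar>v\<bar> - \<delta>)" "\<sigma> + \<delta> - \<bar>v\<bar>" \<eta> for v]
    by (intro AE_I2) (auto simp: exp_add[symmetric] algebra_simps)
qed measurable

lemma measurable_on_lpath:
  assumes "continuous_on (range (lpath \<sigma> \<delta>)) f"
  shows "(\<lambda>v. f (lpath \<sigma> \<delta> v)) \<in> borel_measurable borel"
  by (intro borel_measurable_continuous_onI continuous_on_compose2[OF assms] continuous_lpath) auto

text \<open>Both arms run to Re u = -\<infinity>, so a bound by exp (\<eta> * Re u) with \<eta> > 0
  is exponential decay in arc length. The closing arguments below use decay in this form.\<close>

lemma integrable_cloop:
  fixes f :: "complex \<Rightarrow> complex"
  assumes "continuous_on (range (lpath \<sigma> \<delta>)) f" "\<eta> > 0"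
    and "\<And>v. norm (f (lpath \<sigma> \<delta> v)) \<le> C * exp (\<eta> * Re (lpath \<sigma> \<delta> v))"
  shows "integrable lborel (\<lambda>v. f (lpath \<sigma> \<delta> v) * ldir \<delta> v)"
proof (rule Bochner_Integration.integrable_bound)
  show "integrable lborel (\<lambda>v. C * exp (\<eta> * Re (lpath \<sigma> \<delta> v)))"
    using integrable_exp_Re_lpath[OF assms(2)] by simp
  show "AE v in lborel. norm (f (lpath \<sigma> \<delta> v) * ldir \<delta> v) \<le> norm (C * exp (\<eta> * Re (lpath \<sigma> \<delta> v)))"
    using assms(3) by (auto simp: norm_mult intro: order_trans[OF _ abs_ge_self])
qed (use measurable_on_lpath[OF assms(1)] in measurable)

lemma truncated_loop_tendsto_cloop:
  assumes "\<delta> > 0" "continuous_on (range (lpath \<sigma> \<delta>)) f"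
    and "integrable lborel (\<lambda>v. f (lpath \<sigma> \<delta> v) * ldir \<delta> v)"
  shows "((\<lambda>R. contour_integral (truncated_loop \<sigma> \<delta> R) f) \<longlongrightarrow> cloop \<sigma> \<delta> f) at_top"
proof -
  let ?F = "\<lambda>v. f (lpath \<sigma> \<delta> v) * ldir \<delta> v"
  have "((\<lambda>R. LINT v|lborel. indicator {-(\<delta>+\<sigma>+R)..\<delta>+\<sigma>+R} v *\<^sub>R ?F v) \<longlongrightarrow> (LINT v|lborel. ?F v)) at_top"
  proof (rule integral_dominated_convergence_at_top[where w = "\<lambda>v. norm (?F v)"])
    show "AE v in lborel. ((\<lambda>R. indicator {-(\<delta>+\<sigma>+R)..\<delta>+\<sigma>+R} v *\<^sub>R ?F v) \<longlongrightarrow> ?F v) at_top"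
    proof (intro AE_I2 tendsto_eventually)
      fix v show "\<forall>\<^sub>F R in at_top. indicator {-(\<delta>+\<sigma>+R)..\<delta>+\<sigma>+R} v *\<^sub>R ?F v = ?F v"
        using eventually_ge_at_top[of "\<bar>v\<bar> - \<delta> - \<sigma>"] by eventually_elim (auto simp: indicator_def)
    qed
  qed (use assms(3) in \<open>auto simp: indicator_def intro!: always_eventually\<close>)
  moreover have "\<forall>\<^sub>F R in at_top. (LINT v|lborel. indicator {-(\<delta>+\<sigma>+R)..\<delta>+\<sigma>+R} v *\<^sub>R ?F v)
        = contour_integral (truncated_loop \<sigma> \<delta> R) f"
    using eventually_gt_at_top[of "-\<sigma>"]
  proof eventually_elim
    case (elim R)
    have "set_integrable lborel {-(\<delta>+\<sigma>+R)..\<delta>+\<sigma>+R} ?F"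
      using assms(3) unfolding set_integrable_def by (intro integrable_mult_indicator) auto
    then have "(LINT v:{-(\<delta>+\<sigma>+R)..\<delta>+\<sigma>+R}|lborel. ?F v) = integral {-(\<delta>+\<sigma>+R)..\<delta>+\<sigma>+R} ?F"
      by (rule set_borel_integral_eq_integral)
    also have "\<dots> = contour_integral (truncated_loop \<sigma> \<delta> R) f"
      using elim by (intro contour_integral_unique[symmetric] has_contour_integral_truncated_loop assms) auto
    finally show ?case by (simp add: set_lebesgue_integral_def)
  qed
  ultimately show ?thesis unfolding cloop_def by (rule Lim_transform_eventually)
qed

lemma loop_integral_eq_cloop:
  assumes "\<delta> > 0" "continuous_on (range (lpath \<sigma> \<delta>)) f"
    and "integrable lborel (\<lambda>v. f (lpath \<sigma> \<delta> v) * ldir \<delta> v)"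
  shows "loop_integral \<sigma> \<delta> f = cloop \<sigma> \<delta> f"
  unfolding loop_integral_def by (rule tendsto_Lim[OF _ truncated_loop_tendsto_cloop[OF assms]]) auto

lemma rectpath_truncated_loop:
  assumes "(f has_contour_integral c) (rectpath (Complex (-R) (-\<delta>)) (Complex \<sigma> \<delta>))"
  shows "contour_integral (truncated_loop \<sigma> \<delta> R) f
           + contour_integral (linepath (Complex (-R) \<delta>) (Complex (-R) (-\<delta>))) f = c"
proof -
  let ?A = "Complex (-R) (-\<delta>)" and ?B = "Complex \<sigma> (-\<delta>)" and ?C = "Complex \<sigma> \<delta>" and ?D = "Complex (-R) \<delta>"
  have i: "f contour_integrable_on linepath ?A ?B +++ linepath ?B ?C +++ linepath ?C ?D +++ linepath ?D ?A"
    using assms by (auto simp: rectpath_def Let_def contour_integrable_on_def)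
  then have i1: "f contour_integrable_on linepath ?A ?B" "f contour_integrable_on linepath ?B ?C"
     "f contour_integrable_on linepath ?C ?D" "f contour_integrable_on linepath ?D ?A"
    by (auto)
  have "c = contour_integral (linepath ?A ?B +++ linepath ?B ?C +++ linepath ?C ?D +++ linepath ?D ?A) f"
    using assms by (simp add: rectpath_def Let_def contour_integral_unique)
  then show ?thesis
    using i1 unfolding truncated_loop_def by simp
qed

text \<open>A segment on Re u = -R closes the truncated loop to a rectangle. It has length 2\<delta>
  and carries an exponentially small integrand, so the loop integral equals the rectangle integral
  c, which is the same for all large R. The bound is asked for only on the loop and far to the left
  because poles may lie in between.\<close>

lemma cloop_eqI:
  assumes "\<delta> > 0" "continuous_on (range (lpath \<sigma> \<delta>)) f" "\<eta> > 0"
    and bound: "\<And>u. \<bar>Im u\<bar> \<le> \<delta> \<Longrightarrow> Re u \<le> \<sigma> \<Longrightarrow> u \<in> range (lpath \<sigma> \<delta>) \<or> Re u \<le> Ra \<Longrightarrow> norm (f u) \<le> C * exp (\<eta> * Re u)"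
    and rect: "\<And>R. R \<ge> Rb \<Longrightarrow> (f has_contour_integral c) (rectpath (Complex (-R) (-\<delta>)) (Complex \<sigma> \<delta>))"
  shows "cloop \<sigma> \<delta> f = c"
proof -
  have int: "integrable lborel (\<lambda>v. f (lpath \<sigma> \<delta> v) * ldir \<delta> v)"
    by (rule integrable_cloop[OF assms(2,3), of C]) (use assms(1) in \<open>auto intro!: bound simp del: Re_lpath simp: Re_lpath_le\<close>)
  let ?L = "\<lambda>R. linepath (Complex (-R) \<delta>) (Complex (-R) (-\<delta>))"
  have "((\<lambda>R. contour_integral (?L R) f) \<longlongrightarrow> 0) at_top"
  proof (rule Lim_null_comparison)
    show "((\<lambda>R. C * exp (- \<eta> * R) * (2 * \<delta>)) \<longlongrightarrow> 0) at_top"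
      using assms(3) by real_asymp
    show "\<forall>\<^sub>F R in at_top. norm (contour_integral (?L R) f) \<le> C * exp (- \<eta> * R) * (2 * \<delta>)"
      using eventually_ge_at_top[of Rb] eventually_ge_at_top[of "-\<sigma>"] eventually_ge_at_top[of "-Ra"]
    proof eventually_elim
      case (elim R)
      have "f contour_integrable_on ?L R"
        using rect[OF elim(1)] unfolding contour_integrable_on_def[symmetric]
        by (auto simp: rectpath_def Let_def dest!: has_contour_integral_integrable)
      moreover have b: "norm (f u) \<le> C * exp (- \<eta> * R)" if "u \<in> closed_segment (Complex (-R) \<delta>) (Complex (-R) (-\<delta>))" for u
      proof -
        have "Re u = -R \<and> \<bar>Im u\<bar> \<le> \<delta>"
          using that assms(1) by (auto simp: closed_segment_same_Re closed_segment_eq_real_ivl)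
        then show ?thesis using bound[of u] elim by auto
      qed
      moreover have "0 \<le> C * exp (- \<eta> * R)"
        using order_trans[OF norm_ge_zero b[of "Complex (-R) \<delta>"]] by simp
      ultimately have "norm (contour_integral (?L R) f) \<le> C * exp (- \<eta> * R) * norm (Complex (-R) (-\<delta>) - Complex (-R) \<delta>)"
        by (intro contour_integral_bound_linepath) auto
      also have "norm (Complex (-R) (-\<delta>) - Complex (-R) \<delta>) = 2 * \<delta>"
        using assms(1) by (simp add: cmod_def real_sqrt_mult)
      finally show ?case .
    qed
  qed
  then have "((\<lambda>R. contour_integral (truncated_loop \<sigma> \<delta> R) f + contour_integral (?L R) f) \<longlongrightarrow> cloop \<sigma> \<delta> f + 0) at_top"
    by (intro tendsto_add truncated_loop_tendsto_cloop assms int)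
  moreover have "\<forall>\<^sub>F R in at_top. contour_integral (truncated_loop \<sigma> \<delta> R) f + contour_integral (?L R) f = c"
    using eventually_ge_at_top[of Rb] by eventually_elim (rule rectpath_truncated_loop[OF rect])
  ultimately have "cloop \<sigma> \<delta> f + 0 = c"
    by (intro tendsto_unique[OF _ _ tendsto_eventually]) auto
  then show ?thesis by simp
qed

subsection \<open>From Pochhammer quotients to Gamma quotients\<close>

definition cauchy_rat :: "real \<Rightarrow> nat \<Rightarrow> complex \<Rightarrow> complex" where
  "cauchy_rat \<alpha> n z = pochhammer (of_real \<alpha> + 1 - z) n / pochhammer z n"

text \<open>The exponent splits the scale evenly between the two variables: for z = u + a and w = v
  + b the two powers multiply to \<open>edge_scale\<close> to the power 1 - u - v, that is, one
  factor for the prefactor of the kernel and one power to rescale each of x and y.\<close>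

definition scaled_rat :: "real \<Rightarrow> nat \<Rightarrow> complex \<Rightarrow> complex" where
  "scaled_rat \<alpha> n z = of_real (edge_scale \<alpha> n) powr (of_real ((\<alpha> + 1) / 2) - z) * cauchy_rat \<alpha> n z"

text \<open>At z = u + c this is \<Gamma>(u + c) / \<Gamma>(\<alpha> - c + 1 - u), the factor shared
  by \<open>meijer_H\<close> and \<open>meijer_Ht\<close>.\<close>

definition gamma_quot :: "real \<Rightarrow> complex \<Rightarrow> complex" where
  "gamma_quot \<alpha> z = Gamma z * rGamma (of_real \<alpha> + 1 - z)"

lemma edge_scale_pos: "n > 0 \<Longrightarrow> edge_scale \<alpha> n > 0"
  by (simp add: edge_scale_def)

lemma ln_edge_scale: "n > 0 \<Longrightarrow> ln (edge_scale \<alpha> n) = \<alpha> * ln (real n / (real n + 1)) - 2 * ln (real n)"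
  by (simp add: edge_scale_def ln_mult ln_powr ln_div ln_realpow)

lemma scaled_rat_eq:
  "n > 0 \<Longrightarrow> scaled_rat \<alpha> n z = exp ((of_real ((\<alpha> + 1) / 2) - z) * of_real (ln (edge_scale \<alpha> n))) * cauchy_rat \<alpha> n z"
  using edge_scale_pos[of n \<alpha>] by (simp add: scaled_rat_def powr_def Ln_of_real)

text \<open>Euler's limit formulas for \<Gamma>(z) and for 1 / \<Gamma>(w), w = \<alpha> + 1 - z,
  with the same n: the factorials cancel and n^(z - w) remains, which the power of
  \<open>edge_scale\<close> supplies up to a factor tending to 1.\<close>

lemma scaled_rat_tendsto:
  assumes "z \<notin> \<int>\<^sub>\<le>\<^sub>0"
  shows "(\<lambda>n. scaled_rat \<alpha> n z) \<longlonglongrightarrow> gamma_quot \<alpha> z"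
proof -
  define w where "w = of_real \<alpha> + 1 - z"
  define c where "c = of_real ((\<alpha> + 1) / 2) - z"
  \<comment> \<open>The last factor turns the Pochhammer symbols of length n + 1 in
    \<open>Gamma_series\<close> and \<open>rGamma_series\<close> into those of length n.\<close>
  let ?e = "\<lambda>n. exp (c * of_real (\<alpha> * ln (real n / (real n + 1)))) * (1 + (z - w) / (w + of_nat n))"
  have "(\<lambda>n. \<alpha> * ln (real n / (real n + 1))) \<longlonglongrightarrow> 0" by real_asymp
  then have "(\<lambda>n. complex_of_real (\<alpha> * ln (real n / (real n + 1)))) \<longlonglongrightarrow> of_real 0" by (rule tendsto_of_real)
  from tendsto_exp[OF tendsto_mult[OF tendsto_const this]] have e1: "(\<lambda>n. exp (c * of_real (\<alpha> * ln (real n / (real n + 1))))) \<longlonglongrightarrow> exp (c * of_real 0)" .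
  have "filterlim (\<lambda>n. w + of_nat n :: complex) at_infinity sequentially"
    by (intro tendsto_add_filterlim_at_infinity[OF tendsto_const] tendsto_of_nat)
  then have e2: "(\<lambda>n. 1 + (z - w) / (w + of_nat n)) \<longlonglongrightarrow> 1 + 0"
    by (intro tendsto_add tendsto_const tendsto_divide_0[OF tendsto_const])
  have "(\<lambda>n. Gamma_series z n * rGamma_series w n * ?e n) \<longlonglongrightarrow> Gamma z * rGamma w * (exp (c * of_real 0) * (1 + 0))"
    by (intro tendsto_mult e1 e2 Gamma_series_LIMSEQ rGamma_series_LIMSEQ)
  moreover have "\<forall>\<^sub>F n in sequentially. Gamma_series z n * rGamma_series w n * ?e n = scaled_rat \<alpha> n z"
    using eventually_gt_at_top[of "nat \<lceil>norm w\<rceil>"] eventually_gt_at_top[of 0]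
  proof eventually_elim
    case (elim n)
    have "norm w < real n" using elim by linarith
    then have wn: "w + of_nat n \<noteq> 0"
      by (metis add_eq_0_iff norm_minus_cancel norm_of_nat less_irrefl)
    have zn: "z + of_nat n \<noteq> 0" "pochhammer z n \<noteq> 0"
      using assms plus_of_nat_eq_0_imp by (auto simp: pochhammer_eq_0_iff)
    have n: "of_nat n = (exp (of_real (ln (real n))) :: complex)"
      using elim by (simp add: exp_of_real)
    have zw: "z - w = - 2 * c" by (simp add: w_def c_def field_simps)
    have "c * of_real (ln (edge_scale \<alpha> n)) = c * of_real (\<alpha> * ln (real n / (real n + 1))) + (z - w) * of_real (ln n)"
      unfolding zw using elim by (simp add: ln_edge_scale algebra_simps)
    then have "exp (c * of_real (ln (edge_scale \<alpha> n)))
       = exp (c * of_real (\<alpha> * ln (real n / (real n + 1)))) * (exp (z * of_real (ln n)) / exp (w * of_real (ln n)))"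
      by (simp add: exp_add left_diff_distrib exp_diff)
    then have S: "scaled_rat \<alpha> n z = exp (c * of_real (\<alpha> * ln (real n / (real n + 1)))) *
        (exp (z * of_real (ln n)) / exp (w * of_real (ln n))) * (pochhammer w n / pochhammer z n)"
      using scaled_rat_eq[of n \<alpha> z, folded c_def] elim by (simp add: cauchy_rat_def w_def)
    show ?case
      unfolding S Gamma_series_def rGamma_series_def Suc_eq_plus1[symmetric] pochhammer_rec' using wn zn
      by (simp add: divide_simps)
  qed
  ultimately show ?thesis
    by (simp add: Lim_transform_eventually gamma_quot_def w_def)
qed

section \<open>Rate of convergence on compact sets\<close>

text \<open>
  The ratio of consecutive terms of \<open>scaled_rat\<close> has this form with \<open>x = O(n\<^sup>-\<^sup>1)\<close> and \<open>d = O(n\<^sup>-\<^sup>3)\<close>; the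
  vanishing of the quadratic term makes the rate of convergence \<open>O(n\<^sup>-\<^sup>2)\<close>.
\<close>

lemma norm_exp_pade_le:
  fixes x d :: complex
  assumes "norm x \<le> 1" "norm d \<le> 1"
  shows "norm (exp (x + d) * ((1 - x / 2) / (1 + x / 2)) - 1) \<le> 30 * norm d + 8 * norm x ^ 3"
proof -
  have e3: "exp \<bar>Re y\<bar> \<le> 3" if "norm y \<le> 1" for y :: complex
    using that abs_Re_le_cmod[of y] exp_le by (smt (verit) exp_le_cancel_iff)
  have d1: "norm (exp d - 1) \<le> 3 * norm d"
    using Taylor_exp[of d 0] e3[OF assms(2)] mult_right_mono[of "exp \<bar>Re d\<bar>" 3 "norm d"] by simp
  define P where "P = exp x - (1 + x + x^2 / 2)"
  have P: "norm P \<le> 3 / 2 * norm x ^ 3"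
    using Taylor_exp[of x 2] e3[OF assms(1)] mult_right_mono[of "exp \<bar>Re x\<bar>" 3 "norm x ^ 3"]
    by (simp add: P_def numeral_2_eq_2 eval_nat_numeral)
  \<comment> \<open>Here (1 + x + x^2/2) (1 - x/2) = 1 + x/2 - x^3/4: the exponential agrees with
    its Pade quotient through second order, so only cubic terms survive.\<close>
  have Q: "exp x * (1 - x / 2) - (1 + x / 2) = P * (1 - x / 2) - x ^ 3 / 4"
    by (simp add: P_def field_simps power2_eq_square power3_eq_cube)
  have h: "norm (1 - x / 2) \<le> 3 / 2"
    using norm_triangle_ineq4[of 1 "x/2"] assms(1) by (simp add: norm_divide)
  have h2: "norm (1 + x / 2) \<ge> 1 / 2"
    using norm_diff_ineq[of 1 "x/2"] assms(1) by (simp add: norm_divide)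
  have "norm (exp x * (1 - x / 2) - (1 + x / 2)) \<le> norm P * norm (1 - x/2) + norm x ^ 3 / 4"
    unfolding Q using norm_triangle_ineq4[of "P * (1 - x / 2)" "x^3/4"] by (simp add: norm_mult norm_divide norm_power)
  also have "\<dots> \<le> 3 / 2 * norm x ^ 3 * (3 / 2) + norm x ^ 3 / 4"
    by (intro add_right_mono mult_mono P h) auto
  also have "\<dots> \<le> 4 * norm x ^ 3" using zero_le_power[OF norm_ge_zero, of x 3] by linarith
  finally have Q': "norm (exp x * (1 - x / 2) - (1 + x / 2)) \<le> 4 * norm x ^ 3" .
  have ex: "norm (exp x * (1 - x/2)) \<le> 5"
  proof -
    have "norm (exp x) \<le> 3" using e3[OF assms(1)] by (smt (verit) norm_exp_eq_Re exp_le_cancel_iff)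
    then have "norm (exp x) * norm (1 - x/2) \<le> 3 * (3/2)" by (intro mult_mono h) auto
    then show ?thesis by (simp add: norm_mult)
  qed
  have "norm ((exp d - 1) * (exp x * (1 - x / 2)) + (exp x * (1 - x / 2) - (1 + x / 2)))
      \<le> norm (exp d - 1) * norm (exp x * (1 - x / 2)) + 4 * norm x ^ 3"
    using norm_triangle_ineq[of "(exp d - 1) * (exp x * (1 - x / 2))" "exp x * (1 - x / 2) - (1 + x / 2)"] Q'
    by (simp add: norm_mult)
  also have "norm (exp d - 1) * norm (exp x * (1 - x / 2)) \<le> (3 * norm d) * 5"
    by (intro mult_mono d1 ex) auto
  finally have N: "norm ((exp d - 1) * (exp x * (1 - x / 2)) + (exp x * (1 - x / 2) - (1 + x / 2)))
      \<le> 15 * norm d + 4 * norm x ^ 3" by simp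
  have nz: "1 + x / 2 \<noteq> 0" using h2 by auto
  moreover have "4 + x * 2 = 4 * (1 + x / 2)" by simp
  ultimately have nz': "4 + x * 2 \<noteq> 0" by (metis mult_eq_0_iff zero_neq_numeral)
  have "exp (x + d) * ((1 - x / 2) / (1 + x / 2)) - 1
     = ((exp d - 1) * (exp x * (1 - x / 2)) + (exp x * (1 - x / 2) - (1 + x / 2))) / (1 + x/2)"
    using nz nz' by (simp add: exp_add divide_simps) (simp add: algebra_simps)
  also have "norm \<dots> \<le> (15 * norm d + 4 * norm x ^ 3) / (1/2)"
    unfolding norm_divide by (intro frac_le N h2) auto
  finally show ?thesis by simp
qed

text \<open>In the centred variables w and N the quotient (\<alpha> + 1 - z + n) / (z + n) becomes
  (N - w) / (N + w), whose logarithm is odd in w / N. This is why no quadratic term arises. The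
  lower bound on n gives |w| < N, so the denominator is nonzero.\<close>

lemma scaled_rat_Suc:
  assumes "n > 0" "n > 2 * norm z + 2 * \<bar>\<alpha>\<bar> + 2"
  defines "N \<equiv> real n + (\<alpha> + 1) / 2" and "w \<equiv> z - of_real ((\<alpha> + 1) / 2)"
  shows "scaled_rat \<alpha> (Suc n) z = exp (- w * of_real (ln (edge_scale \<alpha> (Suc n)) - ln (edge_scale \<alpha> n)))
           * ((1 - 2 * w / of_real N / 2) / (1 + 2 * w / of_real N / 2)) * scaled_rat \<alpha> n z"
proof -
  have N: "N > 0" using assms(2) norm_ge_zero[of z] unfolding N_def by argo
  have nw: "norm w < N"
  proof -
    have "norm w \<le> norm z + norm (complex_of_real ((\<alpha> + 1) / 2))"
      unfolding w_def by (rule norm_triangle_ineq4)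
    then have "norm w \<le> norm z + \<bar>(\<alpha> + 1) / 2\<bar>" by (simp only: norm_of_real)
    then show ?thesis using assms(2) norm_ge_zero[of z] unfolding N_def by argo
  qed
  have r: "(1 - 2 * w / of_real N / 2) / (1 + 2 * w / of_real N / 2) = (of_real \<alpha> + 1 - z + of_nat n) / (z + of_nat n)"
  proof -
    have a: "of_real \<alpha> + 1 - z + of_nat n = of_real N - w" "z + of_nat n = of_real N + w"
      by (simp_all add: N_def w_def field_simps)
    have "of_real N + w \<noteq> 0"
      using nw N by (metis add_eq_0_iff2 norm_minus_cancel norm_of_real abs_of_pos less_irrefl)
    then show ?thesis using N unfolding a by (simp add: divide_simps)
  qed
  have "cauchy_rat \<alpha> (Suc n) z = (of_real \<alpha> + 1 - z + of_nat n) / (z + of_nat n) * cauchy_rat \<alpha> n z"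
    by (simp add: cauchy_rat_def pochhammer_rec')
  then show ?thesis
    using assms(1) unfolding r by (simp add: scaled_rat_eq w_def flip: exp_add) (simp add: algebra_simps)
qed

text \<open>With x = 2w / N and d = -w (L + 2 / N), where L is the increment of ln
  \<open>edge_scale\<close>, the ratio of consecutive terms has the form treated in
  \<open>norm_exp_pade_le\<close>. The error is relative to the current value, as no bound on
  \<open>scaled_rat\<close> uniform in n is available yet.\<close>

lemma scaled_rat_step:
  obtains C n0 where "C \<ge> 0" "n0 \<ge> 2" "\<And>n z::complex. n \<ge> n0 \<Longrightarrow> norm z \<le> M \<Longrightarrow>
    norm (scaled_rat \<alpha> (Suc n) z - scaled_rat \<alpha> n z) \<le> C / real n ^ 3 * norm (scaled_rat \<alpha> n z)"
proof -
  define L where "L = (\<lambda>n. ln (edge_scale \<alpha> (Suc n)) - ln (edge_scale \<alpha> n))"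
  \<comment> \<open>The factor (n/(n+1))^\<alpha> of the scale matters here: for n^-2 alone, L + 2 /
    N would only be of order \<alpha> / n^2.\<close>
  have "(\<lambda>n. \<alpha> * ln (real (Suc n) / (real (Suc n) + 1)) - 2 * ln (real (Suc n))
           - (\<alpha> * ln (real n / (real n + 1)) - 2 * ln (real n)) + 2 / (real n + (\<alpha> + 1) / 2)) \<in> O(\<lambda>n. 1 / real n ^ 3)"
    by real_asymp
  then obtain c where c: "\<forall>\<^sub>F n in sequentially. norm (\<alpha> * ln (real (Suc n) / (real (Suc n) + 1)) - 2 * ln (real (Suc n))
           - (\<alpha> * ln (real n / (real n + 1)) - 2 * ln (real n)) + 2 / (real n + (\<alpha> + 1) / 2)) \<le> c * norm (1 / real n ^ 3)"
    by (auto elim!: landau_o.bigE)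
  define M' where "M' = \<bar>M\<bar> + \<bar>\<alpha>\<bar> + 1"
  define C where "C = 30 * (M' * \<bar>c\<bar>) + 8 * (4 * M') ^ 3"
  have lim: "\<forall>\<^sub>F n in sequentially. M' * (\<bar>c\<bar> / real n ^ 3) \<le> 1"
    by real_asymp
  have "\<forall>\<^sub>F n in sequentially. n \<ge> 2 \<and> (\<forall>z. norm z \<le> M \<longrightarrow>
    norm (scaled_rat \<alpha> (Suc n) z - scaled_rat \<alpha> n z) \<le> C / real n ^ 3 * norm (scaled_rat \<alpha> n z))"
    using c lim eventually_ge_at_top[of 2] eventually_gt_at_top[of "nat \<lceil>4 * M' + 2 * \<bar>\<alpha>\<bar> + 2\<rceil>"]
  proof eventually_elim
    case (elim n)
    have n0: "n > 0" using elim by auto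
    have ng: "real n > 4 * M' + 2 * \<bar>\<alpha>\<bar> + 2" using elim by linarith
    define N where "N = real n + (\<alpha> + 1) / 2"
    have Nn: "N \<ge> real n / 2" using ng unfolding N_def M'_def by argo
    have Npos: "N > 0" using Nn n0 by simp
    have "L n + 2 / N = \<alpha> * ln (real (Suc n) / (real (Suc n) + 1)) - 2 * ln (real (Suc n))
           - (\<alpha> * ln (real n / (real n + 1)) - 2 * ln (real n)) + 2 / (real n + (\<alpha> + 1) / 2)"
      using n0 unfolding L_def N_def by (simp only: ln_edge_scale zero_less_Suc)
    then have "\<bar>L n + 2 / N\<bar> \<le> c * norm (1 / real n ^ 3)" using elim(1) by simp
    also have "\<dots> \<le> \<bar>c\<bar> / real n ^ 3" by (auto simp: divide_simps)
    finally have Lb: "\<bar>L n + 2 / N\<bar> \<le> \<bar>c\<bar> / real n ^ 3" .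
    show ?case
    proof (intro conjI allI impI)
      fix z :: complex assume z: "norm z \<le> M"
      define w where "w = z - of_real ((\<alpha> + 1) / 2)"
      have "norm w \<le> norm z + norm (complex_of_real ((\<alpha> + 1) / 2))"
        unfolding w_def by (rule norm_triangle_ineq4)
      then have "norm w \<le> norm z + \<bar>(\<alpha> + 1) / 2\<bar>" by (simp only: norm_of_real)
      then have w: "norm w \<le> M'" using z unfolding M'_def by argo
      define x where "x = 2 * w / of_real N"
      define d where "d = - w * of_real (L n + 2 / N)"
      have "2 * norm w / N \<le> 2 * M' / (real n / 2)"
        using w Nn n0 order_trans[OF norm_ge_zero w] by (intro frac_le) auto
      then have x: "norm x \<le> 4 * M' / real n"
        using Npos by (simp add: x_def norm_divide norm_mult)
      moreover have "4 * M' / real n \<le> 1" using ng n0 by (simp add: divide_simps)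
      ultimately have x1: "norm x \<le> 1" by linarith
      have d: "norm d \<le> M' * (\<bar>c\<bar> / real n ^ 3)"
        unfolding d_def norm_mult norm_minus_cancel norm_of_real using w Lb order_trans[OF norm_ge_zero w] by (intro mult_mono) auto
      then have d1: "norm d \<le> 1" using elim(2) by linarith
      have xd: "- w * of_real (L n) = x + d"
        by (simp add: x_def d_def algebra_simps)
      have h: "2 * norm z + 2 * \<bar>\<alpha>\<bar> + 2 < real n"
        using ng z norm_ge_zero[of z] unfolding M'_def by argo
      have "scaled_rat \<alpha> (Suc n) z = exp (x + d) * ((1 - x/2) / (1 + x/2)) * scaled_rat \<alpha> n z"
        unfolding xd[symmetric] unfolding x_def w_def N_def L_def by (rule scaled_rat_Suc[OF n0 h])
      then have "scaled_rat \<alpha> (Suc n) z - scaled_rat \<alpha> n z = (exp (x + d) * ((1 - x/2) / (1 + x/2)) - 1) * scaled_rat \<alpha> n z"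
        by (simp add: algebra_simps)
      also have "norm \<dots> \<le> (30 * norm d + 8 * norm x ^ 3) * norm (scaled_rat \<alpha> n z)"
        unfolding norm_mult by (intro mult_right_mono norm_exp_pade_le x1 d1) auto
      also have "\<dots> \<le> (30 * (M' * (\<bar>c\<bar> / real n ^ 3)) + 8 * (4 * M' / real n) ^ 3) * norm (scaled_rat \<alpha> n z)"
        by (intro mult_right_mono add_mono mult_left_mono d power_mono x) auto
      also have "30 * (M' * (\<bar>c\<bar> / real n ^ 3)) + 8 * (4 * M' / real n) ^ 3 = C / real n ^ 3"
        by (simp add: C_def power_divide add_divide_distrib)
      finally show "norm (scaled_rat \<alpha> (Suc n) z - scaled_rat \<alpha> n z) \<le> C / real n ^ 3 * norm (scaled_rat \<alpha> n z)" .
    qed (use elim in auto)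
  qed
  then obtain n0 where "\<And>n. n \<ge> n0 \<Longrightarrow> n \<ge> 2 \<and> (\<forall>z. norm z \<le> M \<longrightarrow>
    norm (scaled_rat \<alpha> (Suc n) z - scaled_rat \<alpha> n z) \<le> C / real n ^ 3 * norm (scaled_rat \<alpha> n z))"
    by (auto simp: eventually_at_top_linorder)
  moreover have "C \<ge> 0" by (auto simp: C_def M'_def)
  ultimately show ?thesis by (intro that[of C n0]) auto
qed

text \<open>The right side is (2n - 1) / (n (n - 1))^2. It gives cubically small increments a
  telescoping majorant with tail of order n^-2.\<close>

lemma inverse_cube_le_telescope:
  assumes "n \<ge> 2" shows "1 / real n ^ 3 \<le> 1 / (real n - 1)\<^sup>2 - 1 / (real (Suc n) - 1)\<^sup>2"
proof -
  obtain m where m: "n = m + 2" using assms by (metis add.commute le_Suc_ex)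
  show ?thesis unfolding m by (simp add: divide_simps power2_eq_square power3_eq_cube) (simp add: algebra_simps)
qed

lemma cubic_tail_bound:
  fixes t :: "nat \<Rightarrow> complex"
  assumes "C \<ge> 0" "n0 \<ge> 2" "\<And>n. n \<ge> n0 \<Longrightarrow> norm (t (Suc n) - t n) \<le> C / real n ^ 3" "t \<longlonglongrightarrow> L" "n \<ge> n0"
  shows "norm (t n - L) \<le> 4 * C / real n ^ 2"
proof -
  have tel: "norm (t (n + k) - t n) \<le> C * (1 / (real n - 1)\<^sup>2 - 1 / (real (n + k) - 1)\<^sup>2)" for k
  proof (induction k)
    case (Suc k)
    have "norm (t (Suc (n + k)) - t (n + k)) \<le> C * (1 / real (n + k) ^ 3)"
      using assms(3)[of "n+k"] assms(5) by simp
    also have "\<dots> \<le> C * (1 / (real (n+k) - 1)\<^sup>2 - 1 / (real (Suc (n+k)) - 1)\<^sup>2)"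
      using assms by (intro mult_left_mono inverse_cube_le_telescope) auto
    finally have "norm (t (Suc (n + k)) - t (n + k)) \<le> C * (1 / (real (n+k) - 1)\<^sup>2 - 1 / (real (Suc (n+k)) - 1)\<^sup>2)" .
    then have "norm ((t (Suc (n + k)) - t (n + k)) + (t (n + k) - t n)) \<le>
      C * (1 / (real (n+k) - 1)\<^sup>2 - 1 / (real (Suc (n+k)) - 1)\<^sup>2) + C * (1 / (real n - 1)\<^sup>2 - 1 / (real (n + k) - 1)\<^sup>2)"
      using Suc by (intro norm_triangle_le add_mono)
    then show ?case by (simp add: algebra_simps)
  qed auto
  have b: "norm (t (n + k) - t n) \<le> 4 * C / real n ^ 2" for k
  proof -
    have n2: "real n \<ge> 2" using assms by simp
    have "norm (t (n + k) - t n) \<le> C * (1 / (real n - 1)\<^sup>2)"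
      using tel[of k] assms(1) by (simp add: algebra_simps) (smt (verit) divide_nonneg_nonneg zero_le_power2)
    \<comment> \<open>For n >= 2 one has n - 1 >= n / 2, which costs the factor 4.\<close>
    also have "\<dots> \<le> C * (1 / (real n / 2)\<^sup>2)"
      using n2 assms(1) by (intro mult_left_mono divide_left_mono power_mono) auto
    finally show ?thesis by (simp add: power_divide mult.commute)
  qed
  have "(\<lambda>k. norm (t (n + k) - t n)) \<longlonglongrightarrow> norm (L - t n)"
    using LIMSEQ_ignore_initial_segment[OF assms(4), of n] by (intro tendsto_intros) (simp add: add.commute)
  then have "norm (L - t n) \<le> 4 * C / real n ^ 2"
    by (rule LIMSEQ_le_const2) (use b in auto)
  then show ?thesis by (simp add: norm_minus_commute)
qed

text \<open>Since increments are controlled only relative to the current value, a discrete Gronwall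
  argument precedes the summation: the product of the factors 1 + C / n^3 is at most an exponential
  of the telescoping sum, uniformly on K. After that the increments are O(n^-3) in absolute terms
  and their tails O(n^-2).\<close>

lemma scaled_rat_asymp_compact:
  assumes "compact K" "K \<inter> \<int>\<^sub>\<le>\<^sub>0 = {}"
  obtains C n0 where "\<And>n z. n \<ge> n0 \<Longrightarrow> z \<in> K \<Longrightarrow> norm (scaled_rat \<alpha> n z - gamma_quot \<alpha> z) \<le> C / real n ^ 2"
proof -
  obtain M where M: "\<And>z. z \<in> K \<Longrightarrow> norm z \<le> M"
    using compact_imp_bounded[OF assms(1)] by (auto simp: bounded_iff)
  obtain C n0 where C: "C \<ge> 0" "n0 \<ge> 2" and step: "\<And>n z. n \<ge> n0 \<Longrightarrow> norm z \<le> M \<Longrightarrow>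
    norm (scaled_rat \<alpha> (Suc n) z - scaled_rat \<alpha> n z) \<le> C / real n ^ 3 * norm (scaled_rat \<alpha> n z)"
    by (rule scaled_rat_step[of M \<alpha>]) (rule that, assumption+)
  have "continuous_on K (scaled_rat \<alpha> n0)"
    unfolding scaled_rat_def cauchy_rat_def
  proof (intro continuous_intros)
    show "\<forall>z\<in>K. pochhammer z n0 \<noteq> 0"
      using assms(2) by (auto simp: pochhammer_eq_0_iff)
  qed (use C edge_scale_pos[of n0 \<alpha>] in \<open>auto simp: pochhammer_prod intro!: continuous_intros\<close>)
  then have "compact (scaled_rat \<alpha> n0 ` K)" using assms(1) by (rule compact_continuous_image)
  from compact_imp_bounded[OF this]
  obtain B where B: "\<And>z. z \<in> K \<Longrightarrow> norm (scaled_rat \<alpha> n0 z) \<le> B"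
    by (auto simp: bounded_iff)
  let ?g = "\<lambda>n. C * (1 / (real n0 - 1)\<^sup>2 - 1 / (real n - 1)\<^sup>2)"
  have bnd: "norm (scaled_rat \<alpha> n z) \<le> \<bar>B\<bar> * exp (?g n)" if z: "z \<in> K" and "n \<ge> n0" for n z
    using that(2)
  proof (induction n rule: dec_induct)
    case base
    show ?case using B[OF z] by simp
  next
    case (step n)
    have "norm (scaled_rat \<alpha> (Suc n) z) \<le> norm (scaled_rat \<alpha> n z) + norm (scaled_rat \<alpha> (Suc n) z - scaled_rat \<alpha> n z)"
      by (rule norm_triangle_sub)
    also have "\<dots> \<le> norm (scaled_rat \<alpha> n z) + C / real n ^ 3 * norm (scaled_rat \<alpha> n z)"
      by (intro add_left_mono \<open>\<And>n z. n \<ge> n0 \<Longrightarrow> norm z \<le> M \<Longrightarrow> _\<close> step M z)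
    also have "\<dots> = (1 + C / real n ^ 3) * norm (scaled_rat \<alpha> n z)" by (simp add: algebra_simps)
    also have "\<dots> \<le> exp (C * (1 / real n ^ 3)) * (\<bar>B\<bar> * exp (?g n))"
      using C step by (intro mult_mono) auto
    also have "\<dots> \<le> exp (C * (1 / (real n - 1)\<^sup>2 - 1 / (real (Suc n) - 1)\<^sup>2)) * (\<bar>B\<bar> * exp (?g n))"
      using C step by (intro mult_right_mono iffD2[OF exp_le_cancel_iff] mult_left_mono inverse_cube_le_telescope) auto
    also have "\<dots> = \<bar>B\<bar> * exp (?g (Suc n))" by (simp flip: exp_add) (simp add: algebra_simps)
    finally show ?case .
  qed
  define B' where "B' = \<bar>B\<bar> * exp C"
  have gC: "?g n \<le> C" for n
  proof -
    have "1 / (real n0 - 1)\<^sup>2 \<le> 1" using C by (simp add: divide_simps)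
    moreover have "0 \<le> 1 / (real n - 1)\<^sup>2" by simp
    ultimately have "1 / (real n0 - 1)\<^sup>2 - 1 / (real n - 1)\<^sup>2 \<le> 1" by linarith
    from mult_left_mono[OF this C(1)] show ?thesis by simp
  qed
  have bnd': "norm (scaled_rat \<alpha> n z) \<le> B'" if "z \<in> K" and "n \<ge> n0" for n z
    using bnd[OF that] mult_left_mono[OF iffD2[OF exp_le_cancel_iff gC[of n]], of "\<bar>B\<bar>"] by (simp add: B'_def)
  show ?thesis
  proof (rule that[of n0 "4 * (C * B')"])
    fix n z assume n: "n \<ge> n0" and z: "z \<in> K"
    have "norm (scaled_rat \<alpha> (Suc m) z - scaled_rat \<alpha> m z) \<le> C * B' / real m ^ 3" if "m \<ge> n0" for m
      using order_trans[OF step[OF that M[OF z]] mult_left_mono[OF bnd'[OF z that]]] C(1) by simp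
    moreover have "z \<notin> \<int>\<^sub>\<le>\<^sub>0" using z assms(2) by auto
    ultimately show "norm (scaled_rat \<alpha> n z - gamma_quot \<alpha> z) \<le> 4 * (C * B') / real n ^ 2"
      using n C by (intro cubic_tail_bound[of "C * B'" n0 "\<lambda>n. scaled_rat \<alpha> n z"] scaled_rat_tendsto) (auto simp: B'_def)
  qed
qed

section \<open>Transport of the estimate along the loop by functional equations\<close>

lemma cauchy_rat_minus_one:
  assumes "z \<noteq> 1" "z \<noteq> of_real \<alpha> + 1" "\<And>k. z - 1 + of_nat k \<noteq> 0"
  shows "cauchy_rat \<alpha> n (z - 1) = cauchy_rat \<alpha> n z *
    ((of_real \<alpha> + 1 - z + of_nat n) * (z - 1 + of_nat n) / ((of_real \<alpha> + 1 - z) * (z - 1)))"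
proof -
  define w where "w = of_real \<alpha> + 1 - z"
  have w: "w \<noteq> 0" "of_real \<alpha> + 1 - (z - 1) = w + 1"
    using assms(2) by (auto simp: w_def)
  have 1: "w * pochhammer (w + 1) n = (w + of_nat n) * pochhammer w n"
    by (metis pochhammer_rec pochhammer_rec')
  have 2: "(z - 1) * pochhammer z n = (z - 1 + of_nat n) * pochhammer (z - 1) n"
    using pochhammer_rec[of "z - 1" n] pochhammer_rec'[of "z - 1" n] by simp
  have nz: "pochhammer (z - 1) n \<noteq> 0"
    using assms(3) by (auto simp: pochhammer_eq_0_iff) (metis add.commute add.right_inverse)
  have p1: "pochhammer (w + 1) n = (w + of_nat n) * pochhammer w n / w"
    using 1 w(1) by (simp add: field_simps)
  have p2: "pochhammer z n = (z - 1 + of_nat n) * pochhammer (z - 1) n / (z - 1)"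
    using 2 assms(1) by (simp add: field_simps)
  show ?thesis
    using w(1) assms(1,3) nz unfolding cauchy_rat_def w(2) w_def[symmetric] p1 p2 by (simp add: mult_ac)
qed

lemma gamma_quot_minus_one:
  assumes "z \<noteq> 1" "z \<noteq> of_real \<alpha> + 1"
  shows "gamma_quot \<alpha> (z - 1) = gamma_quot \<alpha> z / ((of_real \<alpha> + 1 - z) * (z - 1))"
proof -
  define w where "w = of_real \<alpha> + 1 - z"
  have w: "w \<noteq> 0" "of_real \<alpha> + 1 - (z - 1) = w + 1"
    using assms(2) by (auto simp: w_def)
  have "rGamma (w + 1) = rGamma w / w"
    using rGamma_plus1[of w] w(1) by (simp add: field_simps)
  moreover have "Gamma (z - 1) = Gamma z / (z - 1)"
  proof -
    have "(z - 1) * rGamma z = rGamma (z - 1)" using rGamma_plus1[of "z - 1"] by simp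
    then have "inverse (inverse (Gamma (z - 1))) = inverse ((z - 1) * inverse (Gamma z))"
      by (simp only: rGamma_inverse_Gamma)
    then show ?thesis by (simp add: divide_inverse mult.commute)
  qed
  ultimately show ?thesis
    unfolding gamma_quot_def w(2) w_def[symmetric] by simp
qed

text \<open>(n/(n+1))^\<alpha> (1 + \<alpha>/n) = 1 + O(n^-2). The sum n^2 + \<alpha> n is the
  leading part of the product (\<alpha> + 1 - z + n) (z - 1 + n) that appears when z is lowered by
  1.\<close>

lemma edge_scale_defect:
  obtains c n0 where "c \<ge> 0" "n0 \<ge> 1" "\<And>n. n \<ge> n0 \<Longrightarrow> edge_scale \<alpha> n \<le> c / real n ^ 2"
    "\<And>n. n \<ge> n0 \<Longrightarrow> \<bar>edge_scale \<alpha> n * (real n ^ 2 + \<alpha> * real n) - 1\<bar> \<le> c / real n ^ 2"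
proof -
  have "(\<lambda>n. edge_scale \<alpha> n) \<in> O(\<lambda>n. 1 / real n ^ 2)"
    unfolding edge_scale_def by real_asymp
  then obtain c1 where c1: "\<forall>\<^sub>F n in sequentially. norm (edge_scale \<alpha> n) \<le> c1 * norm (1 / real n ^ 2)"
    by (auto elim!: landau_o.bigE)
  have "(\<lambda>n. edge_scale \<alpha> n * (real n ^ 2 + \<alpha> * real n) - 1) \<in> O(\<lambda>n. 1 / real n ^ 2)"
    unfolding edge_scale_def by real_asymp
  then obtain c2 where c2: "\<forall>\<^sub>F n in sequentially. norm (edge_scale \<alpha> n * (real n ^ 2 + \<alpha> * real n) - 1) \<le> c2 * norm (1 / real n ^ 2)"
    by (auto elim!: landau_o.bigE)
  define c where "c = max 0 (max c1 c2)"
  have "\<forall>\<^sub>F n in sequentially. n \<ge> 1 \<and> edge_scale \<alpha> n \<le> c / real n ^ 2 \<and>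
      \<bar>edge_scale \<alpha> n * (real n ^ 2 + \<alpha> * real n) - 1\<bar> \<le> c / real n ^ 2"
    using c1 c2 eventually_ge_at_top[of 1]
  proof eventually_elim
    case (elim n)
    have "c1 / real n ^ 2 \<le> c / real n ^ 2" "c2 / real n ^ 2 \<le> c / real n ^ 2"
      by (auto simp: c_def intro!: divide_right_mono)
    then show ?case using elim by (auto simp: abs_if split: if_splits)
  qed
  then obtain n0 where "\<forall>n\<ge>n0. n \<ge> 1 \<and> edge_scale \<alpha> n \<le> c / real n ^ 2 \<and>
      \<bar>edge_scale \<alpha> n * (real n ^ 2 + \<alpha> * real n) - 1\<bar> \<le> c / real n ^ 2"
    by (auto simp: eventually_at_top_linorder)
  then show ?thesis by (intro that[of c n0]) (auto simp: c_def)
qed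

text \<open>Lowering z by 1 multiplies the limit by r = 1 / ((\<alpha> + 1 - z) (z - 1)) and the
  scaled quotient by r (1 + k) + e, with k and e of order n^-2. On the arms the imaginary part keeps
  both factors of the denominator at least \<delta> in modulus, so r is bounded and the error grows
  by at most a constant factor.\<close>

lemma scaled_rat_shift:
  assumes "\<delta> > 0"
  obtains B n0 where "B \<ge> 0" "n0 \<ge> 1"
    "\<And>z. \<bar>Im z\<bar> = \<delta> \<Longrightarrow> norm (gamma_quot \<alpha> (z - 1)) \<le> B * norm (gamma_quot \<alpha> z)"
    "\<And>n z. n \<ge> n0 \<Longrightarrow> \<bar>Im z\<bar> = \<delta> \<Longrightarrow> norm (scaled_rat \<alpha> n (z - 1) - gamma_quot \<alpha> (z - 1)) \<le>
       B * norm (scaled_rat \<alpha> n z - gamma_quot \<alpha> z) + B / real n ^ 2 * norm (gamma_quot \<alpha> z)"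
proof -
  obtain c n0 where c: "c \<ge> 0" "n0 \<ge> 1" "\<And>n. n \<ge> n0 \<Longrightarrow> edge_scale \<alpha> n \<le> c / real n ^ 2"
    "\<And>n. n \<ge> n0 \<Longrightarrow> \<bar>edge_scale \<alpha> n * (real n ^ 2 + \<alpha> * real n) - 1\<bar> \<le> c / real n ^ 2"
    by (rule edge_scale_defect[of \<alpha>]) (rule that, assumption+)
  \<comment> \<open>B is the bound obtained for |\<rho>|; it also dominates |r| and n^2 |\<rho> -
    r|.\<close>
  define B where "B = (1 + c) * (1 / \<delta>\<^sup>2) + c"
  have B: "1 / \<delta>\<^sup>2 \<le> B" "c * (1 / \<delta>\<^sup>2) + c \<le> B" "B \<ge> 0"
    using c(1) by (auto simp: B_def algebra_simps add_divide_distrib)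
  define r where "r = (\<lambda>z::complex. 1 / ((of_real \<alpha> + 1 - z) * (z - 1)))"
  have nz: "z \<noteq> 1" "z \<noteq> of_real \<alpha> + 1" "z - 1 + of_nat k \<noteq> 0" if "\<bar>Im z\<bar> = \<delta>" for z k
    using that assms by (auto simp: complex_eq_iff)
  have r: "norm (r z) \<le> 1 / \<delta>\<^sup>2" if "\<bar>Im z\<bar> = \<delta>" for z
  proof -
    have "norm (of_real \<alpha> + 1 - z) \<ge> \<delta>" "norm (z - 1) \<ge> \<delta>"
      using abs_Im_le_cmod[of "of_real \<alpha> + 1 - z"] abs_Im_le_cmod[of "z - 1"] that by auto
    then show ?thesis
      unfolding r_def norm_divide norm_mult power2_eq_square using assms by (intro frac_le mult_mono) auto
  qed
  show ?thesis
  proof (rule that[of B n0])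
    fix z assume z: "\<bar>Im z\<bar> = \<delta>"
    have "gamma_quot \<alpha> (z - 1) = r z * gamma_quot \<alpha> z"
      using gamma_quot_minus_one[OF nz(1,2)[OF z]] by (simp add: r_def)
    then show "norm (gamma_quot \<alpha> (z - 1)) \<le> B * norm (gamma_quot \<alpha> z)"
      using order_trans[OF r[OF z] B(1)] by (simp add: norm_mult mult_right_mono)
  next
    fix n z assume n: "n \<ge> n0" and z: "\<bar>Im z\<bar> = \<delta>"
    define k where "k = edge_scale \<alpha> n * (real n ^ 2 + \<alpha> * real n) - 1"
    define e where "e = edge_scale \<alpha> n"
    have n0: "n > 0" using n c(2) by simp
    have e0: "e > 0" using edge_scale_pos[OF n0] by (simp add: e_def)
    have n1: "1 / real n ^ 2 \<le> 1" using n0 by (simp add: divide_simps)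
    have e1: "e \<le> c / real n ^ 2" and k1: "\<bar>k\<bar> \<le> c / real n ^ 2" using c(3,4)[OF n] by (auto simp: e_def k_def)
    have cn: "c / real n ^ 2 \<le> c" using mult_left_mono[OF n1 c(1)] by simp
    define \<rho> where "\<rho> = r z * (1 + of_real k) + of_real e"
    have T: "scaled_rat \<alpha> n (z - 1) = \<rho> * scaled_rat \<alpha> n z"
    proof -
      have ex: "exp ((of_real ((\<alpha> + 1) / 2) - (z - 1)) * of_real (ln e)) = of_real e * exp ((of_real ((\<alpha> + 1) / 2) - z) * of_real (ln e))"
      proof -
        have "exp (of_real (ln e)) = complex_of_real e" using e0 by (simp add: exp_of_real)
        moreover have "(of_real ((\<alpha> + 1) / 2) - (z - 1)) * of_real (ln e) = of_real (ln e) + (of_real ((\<alpha> + 1) / 2) - z) * of_real (ln e)"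
          by (simp add: algebra_simps)
        ultimately show ?thesis by (simp only: exp_add)
      qed
      have nn: "of_real \<alpha> + 1 - z \<noteq> 0" "z - 1 \<noteq> 0" using nz[OF z] by auto
      have "of_real e * ((of_real \<alpha> + 1 - z + of_nat n) * (z - 1 + of_nat n)) * r z = \<rho>"
      proof -
        have "(of_real \<alpha> + 1 - z + of_nat n) * (z - 1 + of_nat n) = of_real (real n ^ 2 + \<alpha> * real n) + (of_real \<alpha> + 1 - z) * (z - 1)"
          by (simp add: algebra_simps power2_eq_square)
        then have "of_real e * ((of_real \<alpha> + 1 - z + of_nat n) * (z - 1 + of_nat n)) = (1 + of_real k) + of_real e * ((of_real \<alpha> + 1 - z) * (z - 1))"
          by (simp add: k_def e_def algebra_simps)
        then have "of_real e * ((of_real \<alpha> + 1 - z + of_nat n) * (z - 1 + of_nat n)) * r z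
            = (1 + of_real k) * r z + of_real e * (((of_real \<alpha> + 1 - z) * (z - 1)) * r z)"
          by (simp only: distrib_right mult.assoc)
        also have "((of_real \<alpha> + 1 - z) * (z - 1)) * r z = 1" using nn by (simp add: r_def)
        finally show ?thesis by (simp add: \<rho>_def mult.commute)
      qed
      from this[symmetric] show ?thesis
        unfolding scaled_rat_eq[OF n0] e_def[symmetric] ex cauchy_rat_minus_one[OF nz[OF z]]
        by (simp add: r_def)
    qed
    have F: "gamma_quot \<alpha> (z - 1) = r z * gamma_quot \<alpha> z"
      using gamma_quot_minus_one[OF nz(1,2)[OF z]] by (simp add: r_def)
    have "norm (\<rho> - r z) = norm (r z * of_real k + of_real e)"
      by (simp add: \<rho>_def algebra_simps)
    also have "\<dots> \<le> norm (r z) * \<bar>k\<bar> + e"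
      using norm_triangle_ineq[of "r z * of_real k" "of_real e"] e0 by (simp add: norm_mult)
    also have "\<dots> \<le> 1 / \<delta>\<^sup>2 * (c / real n ^ 2) + c / real n ^ 2"
      by (intro add_mono mult_mono r z k1 e1) auto
    also have "\<dots> = (c * (1 / \<delta>\<^sup>2) + c) / real n ^ 2" by (simp add: add_divide_distrib)
    finally have d: "norm (\<rho> - r z) \<le> (c * (1 / \<delta>\<^sup>2) + c) / real n ^ 2" .
    then have d': "norm (\<rho> - r z) \<le> B / real n ^ 2"
      by (rule order_trans) (intro divide_right_mono B, simp)
    have "norm \<rho> \<le> norm (r z) + norm (\<rho> - r z)" by (rule norm_triangle_sub)
    also have "\<dots> \<le> 1 / \<delta>\<^sup>2 + (c * (1 / \<delta>\<^sup>2) + c) * 1"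
    proof (intro add_mono r z order_trans[OF d])
      have "(c * (1 / \<delta>\<^sup>2) + c) * (1 / real n ^ 2) \<le> (c * (1 / \<delta>\<^sup>2) + c) * 1"
        using c(1) n1 by (intro mult_left_mono) auto
      then show "(c * (1 / \<delta>\<^sup>2) + c) / real n ^ 2 \<le> (c * (1 / \<delta>\<^sup>2) + c) * 1" by simp
    qed
    also have "\<dots> = B" by (simp add: B_def algebra_simps add_divide_distrib)
    finally have \<rho>: "norm \<rho> \<le> B" .
    have "scaled_rat \<alpha> n (z - 1) - gamma_quot \<alpha> (z - 1)
       = \<rho> * (scaled_rat \<alpha> n z - gamma_quot \<alpha> z) + (\<rho> - r z) * gamma_quot \<alpha> z"
      unfolding T F by (simp add: algebra_simps)
    also have "norm \<dots> \<le> norm \<rho> * norm (scaled_rat \<alpha> n z - gamma_quot \<alpha> z) + norm (\<rho> - r z) * norm (gamma_quot \<alpha> z)"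
      by (intro norm_triangle_le) (simp add: norm_mult)
    also have "\<dots> \<le> B * norm (scaled_rat \<alpha> n z - gamma_quot \<alpha> z) + B / real n ^ 2 * norm (gamma_quot \<alpha> z)"
      by (intro add_mono mult_right_mono \<rho> d') auto
    finally show "norm (scaled_rat \<alpha> n (z - 1) - gamma_quot \<alpha> (z - 1)) \<le>
       B * norm (scaled_rat \<alpha> n z - gamma_quot \<alpha> z) + B / real n ^ 2 * norm (gamma_quot \<alpha> z)" .
  qed (use B c in auto)
qed

lemma lpath_notin_nonpos_Ints:
  assumes "\<delta> > 0" "\<sigma> > 0" shows "lpath \<sigma> \<delta> v \<notin> \<int>\<^sub>\<le>\<^sub>0"
proof
  assume "lpath \<sigma> \<delta> v \<in> \<int>\<^sub>\<le>\<^sub>0"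
  then obtain k where "lpath \<sigma> \<delta> v = - of_nat k" by (auto elim!: nonpos_Ints_cases')
  then have "Re (lpath \<sigma> \<delta> v) = - real k" "Im (lpath \<sigma> \<delta> v) = 0" by simp_all
  then show False using assms by (auto simp: max_def min_def split: if_splits)
qed

lemma lpath_step:
  assumes "\<bar>v\<bar> > \<delta> + 1" "\<delta> > 0"
  shows "lpath \<sigma> \<delta> v = lpath \<sigma> \<delta> (v - sgn v) - 1" "\<bar>v - sgn v\<bar> = \<bar>v\<bar> - 1"
    "\<bar>Im (lpath \<sigma> \<delta> (v - sgn v))\<bar> = \<delta>"
  using assms by (auto simp: complex_eq_iff sgn_if abs_if max_def min_def split: if_splits)

text \<open>Beyond arc length \<delta> + 1 every point of an arm is the translate by -1 of an
  earlier point of the same arm (\<open>lpath_step\<close>). Functional equations thus carry a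
  property from the compact piece |v| <= M to the whole loop, and a large M restricts the step to
  points far to the left.\<close>

lemma loop_induct:
  assumes "\<delta> > 0" "M \<ge> \<delta> + 1" "\<And>v. \<bar>v\<bar> \<le> M \<Longrightarrow> P (lpath \<sigma> \<delta> v)"
    and "\<And>z. \<bar>Im z\<bar> = \<delta> \<Longrightarrow> Re z \<le> \<sigma> + \<delta> + 1 - M \<Longrightarrow> P z \<Longrightarrow> P (z - 1)"
  shows "P (lpath \<sigma> \<delta> v)"
proof -
  have "P (lpath \<sigma> \<delta> v)" if "\<bar>v\<bar> \<le> M + real k" for k v
    using that
  proof (induction k arbitrary: v)
    case (Suc k)
    show ?case
    proof (cases "\<bar>v\<bar> \<le> M")
      case False
      then have f: "\<bar>v\<bar> > \<delta> + 1" using assms(2) by simp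
      have "P (lpath \<sigma> \<delta> (v - sgn v))"
        using Suc.prems lpath_step(2)[OF f assms(1)] by (intro Suc.IH) auto
      moreover have "Re (lpath \<sigma> \<delta> (v - sgn v)) \<le> \<sigma> + \<delta> + 1 - M"
        unfolding Re_lpath lpath_step(2)[OF f assms(1)] using False by simp
      ultimately show ?thesis
        unfolding lpath_step(1)[OF f assms(1), of \<sigma>]
        by (intro assms(4) lpath_step(3)[OF f assms(1)])
    qed (use assms in auto)
  qed (use assms in auto)
  moreover obtain k where "\<bar>v\<bar> - M \<le> real k" using real_arch_simple by blast
  ultimately show ?thesis by (metis diff_le_eq add.commute)
qed

lemma scaled_rat_asymp_loop:
  assumes "\<delta> > 0" "\<sigma> > 0"
  obtains C D n0 where "C \<ge> 0" "D \<ge> 0" "n0 \<ge> 1"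
    "\<And>v. norm (gamma_quot \<alpha> (lpath \<sigma> \<delta> v)) \<le> C * exp (- D * Re (lpath \<sigma> \<delta> v))"
    "\<And>n v. n \<ge> n0 \<Longrightarrow> norm (scaled_rat \<alpha> n (lpath \<sigma> \<delta> v) - gamma_quot \<alpha> (lpath \<sigma> \<delta> v))
        \<le> C / real n ^ 2 * exp (- D * Re (lpath \<sigma> \<delta> v))"
proof -
  define K where "K = lpath \<sigma> \<delta> ` {-(\<delta>+1)..\<delta>+1}"
  have K: "compact K" unfolding K_def by (intro compact_continuous_image continuous_lpath) auto
  have K0: "K \<inter> \<int>\<^sub>\<le>\<^sub>0 = {}" using lpath_notin_nonpos_Ints[OF assms] by (auto simp: K_def)
  obtain C1 n1 where C1: "\<And>n z. n \<ge> n1 \<Longrightarrow> z \<in> K \<Longrightarrow> norm (scaled_rat \<alpha> n z - gamma_quot \<alpha> z) \<le> C1 / real n ^ 2"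
    by (rule scaled_rat_asymp_compact[OF K K0, of \<alpha>]) (rule that, assumption+)
  have "continuous_on K (gamma_quot \<alpha>)"
    unfolding gamma_quot_def using K0
    by (intro continuous_intros continuous_on_Gamma continuous_on_compose2[OF continuous_on_rGamma[of UNIV]]) auto
  then have "compact (gamma_quot \<alpha> ` K)" using K by (rule compact_continuous_image)
  from compact_imp_bounded[OF this] obtain C2 where C2: "\<And>z. z \<in> K \<Longrightarrow> norm (gamma_quot \<alpha> z) \<le> C2"
    by (auto simp: bounded_iff)
  obtain B n2 where B: "B \<ge> 0" "n2 \<ge> 1"
    "\<And>z. \<bar>Im z\<bar> = \<delta> \<Longrightarrow> norm (gamma_quot \<alpha> (z - 1)) \<le> B * norm (gamma_quot \<alpha> z)"
    "\<And>n z. n \<ge> n2 \<Longrightarrow> \<bar>Im z\<bar> = \<delta> \<Longrightarrow> norm (scaled_rat \<alpha> n (z - 1) - gamma_quot \<alpha> (z - 1)) \<le>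
       B * norm (scaled_rat \<alpha> n z - gamma_quot \<alpha> z) + B / real n ^ 2 * norm (gamma_quot \<alpha> z)"
    by (rule scaled_rat_shift[OF assms(1), of \<alpha>]) (rule that, assumption+)
  \<comment> \<open>In one step the error receives B times the old error and B / n^2 times the old
    limit value. Both obey the same exponential, so a factor 2 B per step suffices; adding 1 gives D
    >= 0.\<close>
  define D where "D = ln (2 * B + 1)"
  have D: "D \<ge> 0" "exp D = 2 * B + 1" using B(1) by (auto simp: D_def)
  define C0 where "C0 = max \<bar>C1\<bar> \<bar>C2\<bar>"
  \<comment> \<open>The factor exp (D * \<sigma>) makes the exponential bound at least C0 on the
    whole loop, where Re u <= \<sigma>.\<close>
  define C where "C = C0 * exp (D * \<sigma>)"
  have C: "C \<ge> 0" by (auto simp: C_def C0_def)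
  have base: "C0 \<le> C * exp (- D * Re (lpath \<sigma> \<delta> v))" for v
  proof -
    have "C * exp (- D * Re (lpath \<sigma> \<delta> v)) = C0 * exp (D * (\<sigma> - Re (lpath \<sigma> \<delta> v)))"
      by (simp add: C_def exp_add[symmetric] algebra_simps del: Re_lpath)
    moreover have "1 \<le> exp (D * (\<sigma> - Re (lpath \<sigma> \<delta> v)))"
      using D(1) Re_lpath_le[of \<sigma> \<delta> v] by (simp del: Re_lpath)
    ultimately show ?thesis
      using mult_left_mono[of 1 "exp (D * (\<sigma> - Re (lpath \<sigma> \<delta> v)))" C0] by (simp add: C0_def del: Re_lpath)
  qed
  have expo: "exp (- D * Re (z - 1)) = (2 * B + 1) * exp (- D * Re z)" for z
  proof -
    have "- D * Re (z - 1) = D + - D * Re z" by (simp add: algebra_simps)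
    then show ?thesis by (simp only: exp_add D(2))
  qed
  show ?thesis
  proof (rule that[of C D "max n1 n2"])
    fix v show F: "norm (gamma_quot \<alpha> (lpath \<sigma> \<delta> v)) \<le> C * exp (- D * Re (lpath \<sigma> \<delta> v))" for v
    proof (rule loop_induct[where M = "\<delta> + 1" and P = "\<lambda>z. norm (gamma_quot \<alpha> z) \<le> C * exp (- D * Re z)"])
      fix v assume "\<bar>v\<bar> \<le> \<delta> + 1"
      then have "lpath \<sigma> \<delta> v \<in> K" unfolding K_def by (intro imageI) (simp add: abs_le_iff)
      from C2[OF this] show "norm (gamma_quot \<alpha> (lpath \<sigma> \<delta> v)) \<le> C * exp (- D * Re (lpath \<sigma> \<delta> v))"
        using base[of v] by (auto simp: C0_def simp del: Re_lpath)
    next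
      fix z assume z: "\<bar>Im z\<bar> = \<delta>" and I: "norm (gamma_quot \<alpha> z) \<le> C * exp (- D * Re z)"
      have "norm (gamma_quot \<alpha> (z - 1)) \<le> B * (C * exp (- D * Re z))"
        using B(3)[OF z] mult_left_mono[OF I B(1)] by linarith
      also have "\<dots> \<le> (2 * B + 1) * (C * exp (- D * Re z))"
        using B(1) C by (intro mult_right_mono) auto
      finally show "norm (gamma_quot \<alpha> (z - 1)) \<le> C * exp (- D * Re (z - 1))"
        unfolding expo by (simp add: mult_ac)
    qed (use assms in auto)
    fix n v assume n: "n \<ge> max n1 n2"
    \<comment> \<open>The induction is on the conjunction, since the step for the error also uses
      the bound on the limit.\<close>
    have "norm (scaled_rat \<alpha> n (lpath \<sigma> \<delta> v) - gamma_quot \<alpha> (lpath \<sigma> \<delta> v)) \<le> C / real n ^ 2 * exp (- D * Re (lpath \<sigma> \<delta> v))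
       \<and> norm (gamma_quot \<alpha> (lpath \<sigma> \<delta> v)) \<le> C * exp (- D * Re (lpath \<sigma> \<delta> v))"
    proof (rule loop_induct[where M = "\<delta> + 1" and P = "\<lambda>z. norm (scaled_rat \<alpha> n z - gamma_quot \<alpha> z) \<le> C / real n ^ 2 * exp (- D * Re z)
       \<and> norm (gamma_quot \<alpha> z) \<le> C * exp (- D * Re z)"], fact, simp)
      fix v assume "\<bar>v\<bar> \<le> \<delta> + 1"
      then have "lpath \<sigma> \<delta> v \<in> K" unfolding K_def by (intro imageI) (simp add: abs_le_iff)
      with n have "norm (scaled_rat \<alpha> n (lpath \<sigma> \<delta> v) - gamma_quot \<alpha> (lpath \<sigma> \<delta> v)) \<le> C1 / real n ^ 2"
        by (intro C1) auto
      also have "\<dots> \<le> C * exp (- D * Re (lpath \<sigma> \<delta> v)) / real n ^ 2"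
        using base[of v] by (intro divide_right_mono) (auto simp: C0_def simp del: Re_lpath)
      finally show "norm (scaled_rat \<alpha> n (lpath \<sigma> \<delta> v) - gamma_quot \<alpha> (lpath \<sigma> \<delta> v)) \<le> C / real n ^ 2 * exp (- D * Re (lpath \<sigma> \<delta> v))
       \<and> norm (gamma_quot \<alpha> (lpath \<sigma> \<delta> v)) \<le> C * exp (- D * Re (lpath \<sigma> \<delta> v))"
        using F[of v] by (simp del: Re_lpath)
    next
      fix z assume z: "\<bar>Im z\<bar> = \<delta>"
        and "norm (scaled_rat \<alpha> n z - gamma_quot \<alpha> z) \<le> C / real n ^ 2 * exp (- D * Re z)
           \<and> norm (gamma_quot \<alpha> z) \<le> C * exp (- D * Re z)"
      then have I: "norm (scaled_rat \<alpha> n z - gamma_quot \<alpha> z) \<le> C / real n ^ 2 * exp (- D * Re z)"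
         and I2: "norm (gamma_quot \<alpha> z) \<le> C * exp (- D * Re z)" by auto
      have "norm (gamma_quot \<alpha> (z - 1)) \<le> B * (C * exp (- D * Re z))"
        using B(3)[OF z] mult_left_mono[OF I2 B(1)] by linarith
      also have "\<dots> \<le> (2 * B + 1) * (C * exp (- D * Re z))"
        using B(1) C by (intro mult_right_mono) auto
      finally have 1: "norm (gamma_quot \<alpha> (z - 1)) \<le> C * exp (- D * Re (z - 1))"
        unfolding expo by (simp add: mult_ac)
      have "norm (scaled_rat \<alpha> n (z - 1) - gamma_quot \<alpha> (z - 1)) \<le>
        B * (C / real n ^ 2 * exp (- D * Re z)) + B / real n ^ 2 * (C * exp (- D * Re z))"
        using n by (intro order_trans[OF B(4)] z add_mono mult_left_mono I I2 B(1) divide_nonneg_nonneg) auto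
      also have "\<dots> = 2 * B * (C / real n ^ 2 * exp (- D * Re z))" by simp
      also have "\<dots> \<le> (2 * B + 1) * (C / real n ^ 2 * exp (- D * Re z))"
        using C by (intro mult_right_mono) auto
      finally have 2: "norm (scaled_rat \<alpha> n (z - 1) - gamma_quot \<alpha> (z - 1)) \<le> C / real n ^ 2 * exp (- D * Re (z - 1))"
        unfolding expo by (simp add: mult_ac)
      show "norm (scaled_rat \<alpha> n (z - 1) - gamma_quot \<alpha> (z - 1)) \<le> C / real n ^ 2 * exp (- D * Re (z - 1))
           \<and> norm (gamma_quot \<alpha> (z - 1)) \<le> C * exp (- D * Re (z - 1))"
        using 1 2 by blast
    qed
    then show "norm (scaled_rat \<alpha> n (lpath \<sigma> \<delta> v) - gamma_quot \<alpha> (lpath \<sigma> \<delta> v)) \<le> C / real n ^ 2 * exp (- D * Re (lpath \<sigma> \<delta> v))"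
      by blast
  qed (use C D B in auto)
qed

subsection \<open>Residues along the loop\<close>

lemma norm_of_real_powr_minus: "y > 0 \<Longrightarrow> norm (of_real y powr (- u) :: complex) = exp (- ln y * Re u)"
  by (subst norm_powr_real) (auto simp: mult.commute)

lemma lpath_add_dist:
  assumes "\<delta> > 0" "\<sigma> + s > 0"
  shows "min \<delta> (\<sigma> + s) \<le> norm (lpath \<sigma> \<delta> v + of_real s)"
proof (cases "\<bar>v\<bar> \<le> \<delta>")
  case True
  then have "\<sigma> + s \<le> norm (lpath \<sigma> \<delta> v + of_real s)"
    using abs_Re_le_cmod[of "lpath \<sigma> \<delta> v + of_real s"] by simp
  then show ?thesis by simp
next
  case False
  then have "\<bar>Im (lpath \<sigma> \<delta> v + of_real s)\<bar> = \<delta>" using assms(1) by (auto simp: max_def min_def)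
  then show ?thesis using abs_Im_le_cmod[of "lpath \<sigma> \<delta> v + of_real s"] by simp
qed

lemma lpath_add_nonzero:
  "\<delta> > 0 \<Longrightarrow> \<sigma> + s > 0 \<Longrightarrow> z \<in> range (lpath \<sigma> \<delta>) \<Longrightarrow> z + of_real s \<noteq> 0"
  using lpath_add_dist[of \<delta> \<sigma> s] by (auto simp: min_def split: if_splits) (metis norm_zero not_le)+

lemma strip_pole_dist:
  assumes "\<delta> > 0" "\<sigma> + s > 0" "u \<in> range (lpath \<sigma> \<delta>) \<or> Re u \<le> - s - 1"
  shows "min 1 (min \<delta> (\<sigma> + s)) \<le> norm (u + of_real s)"
proof -
  have "1 \<le> norm (u + of_real s)" if "Re u \<le> - s - 1"
    using that abs_Re_le_cmod[of "u + of_real s"] by simp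
  then show ?thesis using assms(3) lpath_add_dist[OF assms(1,2)] by (auto simp: min_le_iff_disj)
qed

lemma rect_contains_pole:
  assumes "\<delta> > 0" "\<sigma> + s > 0" "R \<ge> s + 1"
  shows "- of_real s \<in> box (Complex (- R) (- \<delta>)) (Complex \<sigma> \<delta>)"
    "path_image (rectpath (Complex (- R) (- \<delta>)) (Complex \<sigma> \<delta>)) \<subseteq> UNIV - {- of_real s}"
proof -
  show "- of_real s \<in> box (Complex (- R) (- \<delta>)) (Complex \<sigma> \<delta>)"
    using assms by (auto simp: in_box_complex_iff)
  then show "path_image (rectpath (Complex (- R) (- \<delta>)) (Complex \<sigma> \<delta>)) \<subseteq> UNIV - {- of_real s}"
    using path_image_rectpath_inter_box[of "Complex (- R) (- \<delta>)" "Complex \<sigma> \<delta>"] assms by auto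
qed

lemma strip_quot_bound:
  fixes g :: "complex \<Rightarrow> complex"
  assumes "norm (g u) \<le> C * e" "m > 0" "m \<le> norm d"
  shows "norm (g u / d) \<le> C / m * e"
  using frac_le[OF _ assms(1) assms(2,3)] order_trans[OF norm_ge_zero assms(1)]
  by (simp add: norm_divide)

text \<open>Only the simple pole at -s lies inside. Every rectangle with R >= s + 1 contains it, and
  its integral is given by Cauchy's formula for g.\<close>

lemma cloop_Cauchy:
  assumes "\<delta> > 0" "\<sigma> + s > 0" "g holomorphic_on UNIV" "\<eta> > 0"
    and bound: "\<And>u. \<bar>Im u\<bar> \<le> \<delta> \<Longrightarrow> Re u \<le> \<sigma> \<Longrightarrow> norm (g u) \<le> C * exp (\<eta> * Re u)"
  shows "cloop \<sigma> \<delta> (\<lambda>u. g u / (u + of_real s)) = 2 * of_real pi * \<i> * g (- of_real s)"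
proof (rule cloop_eqI[where \<eta> = \<eta> and Ra = "- s - 1" and Rb = "s + 1" and C = "C / min 1 (min \<delta> (\<sigma> + s))"])
  show "continuous_on (range (lpath \<sigma> \<delta>)) (\<lambda>u. g u / (u + of_real s))"
    using holomorphic_on_imp_continuous_on[OF assms(3)] lpath_add_nonzero[OF assms(1,2)]
    by (intro continuous_intros) (auto intro: continuous_on_subset)
  show "norm (g u / (u + of_real s)) \<le> C / min 1 (min \<delta> (\<sigma> + s)) * exp (\<eta> * Re u)"
    if "\<bar>Im u\<bar> \<le> \<delta>" "Re u \<le> \<sigma>" "u \<in> range (lpath \<sigma> \<delta>) \<or> Re u \<le> - s - 1" for u
    using that assms(1,2) by (intro strip_quot_bound bound strip_pole_dist) auto
  show "((\<lambda>u. g u / (u + of_real s)) has_contour_integral 2 * of_real pi * \<i> * g (- of_real s))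
         (rectpath (Complex (- R) (- \<delta>)) (Complex \<sigma> \<delta>))" if "R \<ge> s + 1" for R
    using Cauchy_integral_formula_convex_simple[of UNIV g "- of_real s" "rectpath (Complex (- R) (- \<delta>)) (Complex \<sigma> \<delta>)"]
      winding_number_rectpath[OF rect_contains_pole(1)[OF assms(1,2) that]] rect_contains_pole(2)[OF assms(1,2) that] assms(3)
    by simp
qed (use assms in auto)

lemma cloop_entire:
  assumes "\<delta> > 0" "g holomorphic_on UNIV" "\<eta> > 0"
    and bound: "\<And>u. \<bar>Im u\<bar> \<le> \<delta> \<Longrightarrow> Re u \<le> \<sigma> \<Longrightarrow> norm (g u) \<le> C * exp (\<eta> * Re u)"
  shows "cloop \<sigma> \<delta> g = 0"
proof (rule cloop_eqI[where \<eta> = \<eta> and Ra = 0 and Rb = 0 and C = C])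
  show "continuous_on (range (lpath \<sigma> \<delta>)) g"
    using holomorphic_on_imp_continuous_on[OF assms(2)] by (auto intro: continuous_on_subset)
  show "(g has_contour_integral 0) (rectpath (Complex (- R) (- \<delta>)) (Complex \<sigma> \<delta>))" for R
    by (rule Cauchy_theorem_convex_simple[OF assms(2)]) auto
qed (use assms in auto)

lemma cloop_cmult: "cloop \<sigma> \<delta> (\<lambda>u. c * f u) = c * cloop \<sigma> \<delta> f"
  unfolding cloop_def by (simp add: mult.assoc)

text \<open>The modulus of y powr (- u) is exp (- ln y * Re u), so decay to the left means y < 1.
  This restriction reappears in the evaluations with weight \<Gamma> below.\<close>

lemma cloop_powr:
  assumes "\<delta> > 0" "0 < y" "y < 1"
  shows "cloop \<sigma> \<delta> (\<lambda>u. of_real y powr (- u)) = 0"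
    and "\<sigma> + s > 0 \<Longrightarrow> cloop \<sigma> \<delta> (\<lambda>u. of_real y powr (- u) / (u + of_real s)) = 2 * of_real pi * \<i> * of_real (y powr s)"
proof -
  have h: "(\<lambda>u. of_real y powr (- u) :: complex) holomorphic_on UNIV" by (intro holomorphic_intros)
  have e: "- ln y > 0" using assms by simp
  show "cloop \<sigma> \<delta> (\<lambda>u. of_real y powr (- u)) = 0"
    by (rule cloop_entire[OF assms(1) h e, of _ 1]) (use assms in \<open>simp add: norm_of_real_powr_minus\<close>)
  show "cloop \<sigma> \<delta> (\<lambda>u. of_real y powr (- u) / (u + of_real s)) = 2 * of_real pi * \<i> * of_real (y powr s)" if "\<sigma> + s > 0"
    by (subst cloop_Cauchy[OF assms(1) that h e, of 1]) (use assms in \<open>simp_all add: norm_of_real_powr_minus powr_of_real\<close>)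
qed

text \<open>The function - y powr (- u) / (u + s) is single valued off the pole, and its derivative
  is ln y times the simple-pole integrand plus the double-pole one; the two integrals cancel. Such a
  double pole occurs when s is a natural number, so that 1 / (u + s) meets a pole of
  \<Gamma>.\<close>

lemma cloop_powr_double_pole:
  assumes "\<delta> > 0" "0 < y" "y < 1" "\<sigma> + s > 0"
  shows "cloop \<sigma> \<delta> (\<lambda>u. of_real y powr (- u) / (u + of_real s) / (u + of_real s))
           = - (2 * of_real pi * \<i> * of_real (ln y * y powr s))"
proof (rule cloop_eqI[where \<eta> = "- ln y" and Ra = "- s - 1" and Rb = "s + 1"
    and C = "1 / min 1 (min \<delta> (\<sigma> + s)) / min 1 (min \<delta> (\<sigma> + s))"])
  show "continuous_on (range (lpath \<sigma> \<delta>)) (\<lambda>u. of_real y powr (- u) / (u + of_real s) / (u + of_real s))"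
    using lpath_add_nonzero[OF assms(1,4)] assms(2) by (intro continuous_intros) auto
  show "norm (of_real y powr (- u) / (u + of_real s) / (u + of_real s) :: complex)
      \<le> 1 / min 1 (min \<delta> (\<sigma> + s)) / min 1 (min \<delta> (\<sigma> + s)) * exp (- ln y * Re u)"
    if "\<bar>Im u\<bar> \<le> \<delta>" "Re u \<le> \<sigma>" "u \<in> range (lpath \<sigma> \<delta>) \<or> Re u \<le> - s - 1" for u
    using that assms
    by (intro strip_quot_bound[where g = "\<lambda>u. of_real y powr (- u) / (u + of_real s)"]
         strip_quot_bound[where g = "\<lambda>u. of_real y powr (- u)"] strip_pole_dist) (auto simp: norm_of_real_powr_minus)
  fix R assume R: "R \<ge> s + 1"
  let ?r = "rectpath (Complex (- R) (- \<delta>)) (Complex \<sigma> \<delta>)"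
  note pole = rect_contains_pole[OF assms(1,4) R]
  have 1: "((\<lambda>u. of_real y powr (- u) / (u + of_real s)) has_contour_integral 2 * of_real pi * \<i> * of_real (y powr s)) ?r"
    using Cauchy_integral_formula_convex_simple[of UNIV "\<lambda>u. of_real y powr (- u)" "- of_real s" ?r]
      winding_number_rectpath[OF pole(1)] pole(2) assms(2)
    by (simp add: holomorphic_intros powr_of_real)
  have 2: "((\<lambda>u. of_real (ln y) * (of_real y powr (- u) / (u + of_real s)) + of_real y powr (- u) / (u + of_real s) / (u + of_real s))
      has_contour_integral 0) ?r"
  proof (rule Cauchy_theorem_primitive[where S = "UNIV - {- of_real s}" and f = "\<lambda>u. - (of_real y powr (- u) / (u + of_real s))"])
    fix u :: complex assume "u \<in> UNIV - {- of_real s}"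
    then have u: "u + of_real s \<noteq> 0" by (auto simp: add_eq_0_iff2)
    have D: "((\<lambda>u. of_real y powr (- u)) has_field_derivative - of_real (ln y) * of_real y powr (- u)) (at u within UNIV - {- of_real s})"
      using assms(2) unfolding powr_def by (auto intro!: derivative_eq_intros simp: Ln_of_real)
    show "((\<lambda>u. - (of_real y powr (- u) / (u + of_real s))) has_field_derivative
       of_real (ln y) * (of_real y powr (- u) / (u + of_real s)) + of_real y powr (- u) / (u + of_real s) / (u + of_real s)) (at u within UNIV - {- of_real s})"
      using u by (auto intro!: derivative_eq_intros D simp: divide_simps)
  qed (use pole in auto)
  have "((\<lambda>u. (of_real (ln y) * (of_real y powr (- u) / (u + of_real s)) + of_real y powr (- u) / (u + of_real s) / (u + of_real s))
       - of_real (ln y) * (of_real y powr (- u) / (u + of_real s)))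
      has_contour_integral (0 - of_real (ln y) * (2 * of_real pi * \<i> * of_real (y powr s)))) ?r"
    by (intro has_contour_integral_diff 2 has_contour_integral_lmul 1)
  then show "((\<lambda>u. of_real y powr (- u) / (u + of_real s) / (u + of_real s))
      has_contour_integral - (2 * of_real pi * \<i> * of_real (ln y * y powr s))) ?r"
    by (simp add: mult_ac)
qed (use assms in auto)

lemma cloop_add:
  assumes "integrable lborel (\<lambda>v. f (lpath \<sigma> \<delta> v) * ldir \<delta> v)" "integrable lborel (\<lambda>v. g (lpath \<sigma> \<delta> v) * ldir \<delta> v)"
  shows "cloop \<sigma> \<delta> (\<lambda>u. f u + g u) = cloop \<sigma> \<delta> f + cloop \<sigma> \<delta> g"
  using assms unfolding cloop_def by (simp add: distrib_right)

lemma cloop_cong: "(\<And>v. f (lpath \<sigma> \<delta> v) = g (lpath \<sigma> \<delta> v)) \<Longrightarrow> cloop \<sigma> \<delta> f = cloop \<sigma> \<delta> g"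
  unfolding cloop_def by simp

lemma integrable_cloop_powr:
  assumes "0 < y" "y < 1" "continuous_on (range (lpath \<sigma> \<delta>)) h" "\<And>v. norm (h (lpath \<sigma> \<delta> v)) \<le> H"
  shows "integrable lborel (\<lambda>v. of_real y powr (- lpath \<sigma> \<delta> v) * h (lpath \<sigma> \<delta> v) * ldir \<delta> v)"
proof (rule integrable_cloop[of \<sigma> \<delta> "\<lambda>u. of_real y powr (- u) * h u" "- ln y" H])
  show "continuous_on (range (lpath \<sigma> \<delta>)) (\<lambda>u. of_real y powr (- u) * h u)"
    using assms(1,3) by (intro continuous_intros) auto
  show "norm (of_real y powr (- lpath \<sigma> \<delta> v) * h (lpath \<sigma> \<delta> v)) \<le> H * exp (- ln y * Re (lpath \<sigma> \<delta> v))" for v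
    using mult_left_mono[OF assms(4)[of v], of "exp (- ln y * Re (lpath \<sigma> \<delta> v))"] assms(1)
    by (simp add: norm_mult norm_of_real_powr_minus mult.commute del: Re_lpath)
qed (use assms in auto)

lemma lpath_inverse_bound:
  assumes "\<delta> > 0" "\<sigma> + s > 0"
  shows "norm (1 / (lpath \<sigma> \<delta> v + of_real s)) \<le> 1 / min \<delta> (\<sigma> + s)"
proof -
  have "0 < min \<delta> (\<sigma> + s)" using assms by simp
  then show ?thesis
    unfolding norm_divide norm_one using lpath_add_dist[OF assms, of v]
    by (intro divide_left_mono) (auto intro!: mult_pos_pos simp del: min_less_iff_conj zero_less_norm_iff)
qed

lemma continuous_lpath_inverse:
  assumes "\<delta> > 0" "\<sigma> + s > 0"
  shows "continuous_on (range (lpath \<sigma> \<delta>)) (\<lambda>u. 1 / (u + of_real s))"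
  using lpath_add_nonzero[OF assms] by (intro continuous_intros) auto

text \<open>The residues give (y powr s - y powr m) / (m - s), which degenerates for m = s. Written
  as y powr s times an integral over [y, 1] it covers the logarithmic case too, and the sum over m
  against (-1)^m / m! can be taken under that integral.\<close>

lemma cloop_powr_two_poles:
  assumes "\<delta> > 0" "0 < y" "y < 1" "\<sigma> + s > 0" "\<sigma> + m > 0"
  shows "cloop \<sigma> \<delta> (\<lambda>u. of_real y powr (- u) * (1 / (u + of_real s)) / (u + of_real m))
           = 2 * of_real pi * \<i> * of_real (y powr s * (LINT r:{y..1}|lborel. r powr (m - s - 1)))"
proof -
  have "((\<lambda>r. r powr (m - s - 1)) has_integral (if m = s then - ln y else (1 - y powr (m - s)) / (m - s))) {y..1}"
  proof (cases "m = s")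
    case True
    have "((\<lambda>r. r powr (m - s - 1)) has_integral (ln 1 - ln y)) {y..1}"
      by (rule fundamental_theorem_of_calculus)
         (use assms True in \<open>auto intro!: derivative_eq_intros simp: has_real_derivative_iff_has_vector_derivative[symmetric] powr_minus_divide\<close>)
    then show ?thesis using True by simp
  next
    case False
    have "((\<lambda>r. r powr (m - s - 1)) has_integral (1 powr (m - s) / (m - s) - y powr (m - s) / (m - s))) {y..1}"
      by (rule fundamental_theorem_of_calculus)
         (use assms False in \<open>auto intro!: derivative_eq_intros simp: has_real_derivative_iff_has_vector_derivative[symmetric]\<close>)
    then show ?thesis using False by (simp add: diff_divide_distrib)
  qed
  moreover have "set_integrable lborel {y..1} (\<lambda>r. r powr (m - s - 1))"
    using assms by (intro borel_integrable_atLeastAtMost') (auto intro!: continuous_intros)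
  ultimately have I: "(LINT r:{y..1}|lborel. r powr (m - s - 1)) = (if m = s then - ln y else (1 - y powr (m - s)) / (m - s))"
    by (simp add: set_borel_integral_eq_integral integral_unique)
  show ?thesis
  proof (cases "m = s")
    case True
    then show ?thesis
      unfolding I using cloop_powr_double_pole[OF assms(1-4)] by (simp add: mult_ac)
  next
    case False
    let ?P = "\<lambda>u. of_real y powr (- u) :: complex"
    have eq: "cloop \<sigma> \<delta> (\<lambda>u. ?P u * (1 / (u + of_real s)) / (u + of_real m))
      = cloop \<sigma> \<delta> (\<lambda>u. 1 / of_real (m - s) * (?P u * (1 / (u + of_real s))) + - 1 / of_real (m - s) * (?P u * (1 / (u + of_real m))))"
    proof (rule cloop_cong)
      fix v
      have "lpath \<sigma> \<delta> v + of_real s \<noteq> 0" "lpath \<sigma> \<delta> v + of_real m \<noteq> 0" "complex_of_real m - of_real s \<noteq> 0"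
        using lpath_add_nonzero[OF assms(1)] assms False by auto
      then show "?P (lpath \<sigma> \<delta> v) * (1 / (lpath \<sigma> \<delta> v + of_real s)) / (lpath \<sigma> \<delta> v + of_real m)
        = 1 / of_real (m - s) * (?P (lpath \<sigma> \<delta> v) * (1 / (lpath \<sigma> \<delta> v + of_real s))) + - 1 / of_real (m - s) * (?P (lpath \<sigma> \<delta> v) * (1 / (lpath \<sigma> \<delta> v + of_real m)))"
        by (simp add: divide_simps) (simp add: algebra_simps)
    qed
    have int: "integrable lborel (\<lambda>v. ?P (lpath \<sigma> \<delta> v) * (1 / (lpath \<sigma> \<delta> v + of_real k)) * ldir \<delta> v)" if "\<sigma> + k > 0" for k
      by (rule integrable_cloop_powr[OF assms(2,3) continuous_lpath_inverse[OF assms(1) that] lpath_inverse_bound[OF assms(1) that]])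
    have "cloop \<sigma> \<delta> (\<lambda>u. 1 / of_real (m - s) * (?P u * (1 / (u + of_real s))) + - 1 / of_real (m - s) * (?P u * (1 / (u + of_real m))))
       = cloop \<sigma> \<delta> (\<lambda>u. 1 / of_real (m - s) * (?P u * (1 / (u + of_real s)))) + cloop \<sigma> \<delta> (\<lambda>u. - 1 / of_real (m - s) * (?P u * (1 / (u + of_real m))))"
      using integrable_mult_right[OF int[OF assms(4)], of "1 / of_real (m - s)"]
        integrable_mult_right[OF int[OF assms(5)], of "- 1 / of_real (m - s)"]
      by (intro cloop_add) (simp_all add: mult_ac)
    also have "\<dots> = 1 / of_real (m - s) * (2 * of_real pi * \<i> * of_real (y powr s)) - 1 / of_real (m - s) * (2 * of_real pi * \<i> * of_real (y powr m))"
      unfolding cloop_cmult using cloop_powr(2)[OF assms(1-4)] cloop_powr(2)[OF assms(1-3,5)] by simp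
    also have "\<dots> = 2 * of_real pi * \<i> * of_real ((y powr s - y powr m) / (m - s))"
      using False by (simp add: diff_divide_distrib algebra_simps)
    also have "(y powr s - y powr m) / (m - s) = y powr s * ((1 - y powr (m - s)) / (m - s))"
      using assms by (simp add: right_diff_distrib powr_add[symmetric])
    finally show ?thesis unfolding eq I using False by simp
  qed
qed

subsection \<open>Loop integrals of the Gamma function\<close>

text \<open>Moving u one unit to the left divides 1 / \<Gamma>(1 - u) by a factor of modulus at
  least exp \<eta> once Re u < -M, while the bound exp (\<eta> * Re u) shrinks by exactly exp
  \<eta>. The compact rectangle to the right of -M supplies the start.\<close>

lemma rGamma_strip_bound:
  assumes "\<eta> > 0"
  obtains C where "\<And>u. \<bar>Im u\<bar> \<le> \<delta> \<Longrightarrow> Re u \<le> \<sigma> \<Longrightarrow> norm (rGamma (1 - u)) \<le> C * exp (\<eta> * Re u)"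
proof -
  define M where "M = exp \<eta> + \<bar>\<sigma>\<bar> + 1"
  let ?K = "cbox (Complex (- M) (- \<delta>)) (Complex \<sigma> \<delta>)"
  have "continuous_on ?K (\<lambda>u. rGamma (1 - u))"
    by (intro continuous_on_compose2[OF continuous_on_rGamma[of UNIV]] continuous_intros) auto
  then have "compact ((\<lambda>u. rGamma (1 - u)) ` ?K)" by (intro compact_continuous_image compact_cbox)
  from compact_imp_bounded[OF this] obtain B where B: "\<And>u. u \<in> ?K \<Longrightarrow> norm (rGamma (1 - u)) \<le> B"
    by (auto simp: bounded_iff)
  define C where "C = \<bar>B\<bar> * exp (\<eta> * M)"
  have bnd: "norm (rGamma (1 - u)) \<le> C * exp (\<eta> * Re u)" if "\<bar>Im u\<bar> \<le> \<delta>" "Re u \<le> \<sigma>" "Re u \<ge> - M - real k" for k u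
    using that
  proof (induction k arbitrary: u)
    case 0
    then have "u \<in> ?K" by (auto simp: in_cbox_complex_iff)
    then have "norm (rGamma (1 - u)) \<le> \<bar>B\<bar>" using B by fastforce
    also have "\<dots> \<le> \<bar>B\<bar> * exp (\<eta> * (M + Re u))" using 0 assms by (simp add: mult_le_cancel_left1)
    also have "\<dots> = C * exp (\<eta> * Re u)" by (simp add: C_def algebra_simps exp_add)
    finally show ?case .
  next
    case (Suc k)
    show ?case
    proof (cases "Re u \<ge> - M")
      case True
      then show ?thesis using Suc.prems by (intro Suc.IH) auto
    next
      case False
      have IH: "norm (rGamma (1 - (u + 1))) \<le> C * exp (\<eta> * Re (u + 1))"
      proof (rule Suc.IH)
        show "Re (u + 1) \<le> \<sigma>"
        proof -
          have "Re u + 1 \<le> \<sigma>" using False exp_gt_zero[of \<eta>] unfolding M_def by linarith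
          then show ?thesis by simp
        qed
      qed (use Suc.prems in auto)
      have nu: "norm (- u) \<ge> exp \<eta>"
        using False abs_Re_le_cmod[of u] unfolding M_def by simp
      then have u0: "u \<noteq> 0" using exp_gt_zero[of \<eta>] by auto
      have "rGamma (1 - u) = rGamma (1 - (u + 1)) / (- u)"
      proof -
        have "- u * rGamma (- u + 1) = rGamma (- u)" by (rule rGamma_plus1)
        moreover have "- u + 1 = 1 - u" "1 - (u + 1) = - u" by simp_all
        ultimately have "rGamma (1 - u) * - u = rGamma (1 - (u + 1))" by (simp only: mult.commute)
        then show ?thesis using u0 by (simp only: eq_divide_eq neg_equal_0_iff_equal if_True simp_thms)
      qed
      also have "norm \<dots> \<le> C * exp (\<eta> * Re (u + 1)) / exp \<eta>"
        unfolding norm_divide by (intro frac_le IH nu order_trans[OF norm_ge_zero IH] exp_gt_zero)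
      also have "\<dots> = C * exp (\<eta> * Re u)" by (simp add: algebra_simps exp_add)
      finally show ?thesis .
    qed
  qed
  show ?thesis
  proof (rule that)
    fix u assume u: "\<bar>Im u\<bar> \<le> \<delta>" "Re u \<le> \<sigma>"
    obtain k where "- M - Re u \<le> real k" using real_arch_simple by blast
    then show "norm (rGamma (1 - u)) \<le> C * exp (\<eta> * Re u)"
      by (intro bnd[OF u, of k]) auto
  qed
qed

text \<open>The recursion is the one used for 1 / \<Gamma>(1 - u), but it runs only along the loop
  since \<Gamma> has poles inside the strip. The choice of M confines the step to Re z <= - exp
  \<eta>.\<close>

lemma Gamma_loop_bound:
  assumes "\<eta> > 0" "\<delta> > 0" "\<sigma> > 0"
  obtains C where "\<And>v. norm (Gamma (lpath \<sigma> \<delta> v)) \<le> C * exp (\<eta> * Re (lpath \<sigma> \<delta> v))"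
proof -
  define M where "M = \<sigma> + \<delta> + 1 + exp \<eta>"
  define K where "K = lpath \<sigma> \<delta> ` {-M..M}"
  have "compact K" unfolding K_def by (intro compact_continuous_image continuous_lpath) auto
  moreover have "K \<inter> \<int>\<^sub>\<le>\<^sub>0 = {}" using lpath_notin_nonpos_Ints[OF assms(2,3)] by (auto simp: K_def)
  then have "continuous_on K (\<lambda>u. Gamma u * exp (- of_real \<eta> * u))"
    by (intro continuous_intros continuous_on_Gamma) auto
  ultimately have "compact ((\<lambda>u. Gamma u * exp (- of_real \<eta> * u)) ` K)" by (intro compact_continuous_image)
  from compact_imp_bounded[OF this] obtain C where C: "\<And>u. u \<in> K \<Longrightarrow> norm (Gamma u * exp (- of_real \<eta> * u)) \<le> C"
    by (auto simp: bounded_iff)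
  show ?thesis
  proof (rule that)
    fix v show "norm (Gamma (lpath \<sigma> \<delta> v)) \<le> C * exp (\<eta> * Re (lpath \<sigma> \<delta> v))"
    proof (rule loop_induct[where M = M and P = "\<lambda>u. norm (Gamma u) \<le> C * exp (\<eta> * Re u)"])
      fix v assume "\<bar>v\<bar> \<le> M"
      then have "lpath \<sigma> \<delta> v \<in> K" unfolding K_def by (intro imageI) (simp add: abs_le_iff)
      from C[OF this] show "norm (Gamma (lpath \<sigma> \<delta> v)) \<le> C * exp (\<eta> * Re (lpath \<sigma> \<delta> v))"
        by (simp add: norm_mult norm_divide exp_minus field_simps del: Re_lpath)
    next
      fix z assume z: "\<bar>Im z\<bar> = \<delta>" "Re z \<le> \<sigma> + \<delta> + 1 - M" and IH: "norm (Gamma z) \<le> C * exp (\<eta> * Re z)"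
      have nz: "norm (z - 1) \<ge> exp \<eta>"
        using z(2) abs_Re_le_cmod[of "z - 1"] exp_gt_zero[of \<eta>] unfolding M_def by simp
      then have z0: "z - 1 \<noteq> 0" using exp_gt_zero[of \<eta>] by auto
      have "(z - 1) * rGamma z = rGamma (z - 1)" using rGamma_plus1[of "z - 1"] by simp
      then have "inverse (inverse (Gamma (z - 1))) = inverse ((z - 1) * inverse (Gamma z))"
        by (simp only: rGamma_inverse_Gamma)
      then have "Gamma (z - 1) = Gamma z / (z - 1)" by (simp add: divide_inverse mult.commute)
      also have "norm \<dots> \<le> C * exp (\<eta> * Re z) / exp \<eta>"
        unfolding norm_divide by (intro frac_le IH nz order_trans[OF norm_ge_zero IH] exp_gt_zero)
      also have "\<dots> = C * exp (\<eta> * Re (z - 1))" by (simp add: algebra_simps exp_diff)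
      finally show "norm (Gamma (z - 1)) \<le> C * exp (\<eta> * Re (z - 1))" .
    qed (use assms in \<open>auto simp: M_def\<close>)
  qed
qed

text \<open>
  Prym's decomposition of \<open>\<Gamma>\<close>: the part of Euler's integral over \<open>(0, 1)\<close> becomes a series that carries all
  the poles and can be integrated termwise along the loop.
\<close>

definition prym_series :: "complex \<Rightarrow> complex" where
  "prym_series u = (\<Sum>m. (-1) ^ m / fact m * (1 / (u + of_nat m)))"

definition prym_integral :: "complex \<Rightarrow> complex" where
  "prym_integral u = (LINT t:{1..}|lborel. of_real t powr (u - 1) * of_real (exp (- t)))"

lemma summable_prym: "summable (\<lambda>m. norm ((-1) ^ m / fact m * (1 / (u + of_nat m)) :: complex))"
proof (rule summable_comparison_test_ev)
  show "\<forall>\<^sub>F m in sequentially. norm (norm ((-1) ^ m / fact m * (1 / (u + of_nat m)) :: complex)) \<le> 1 / fact m"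
    using eventually_ge_at_top[of "nat \<lceil>norm u\<rceil> + 1"]
  proof eventually_elim
    case (elim m)
    have "1 \<le> norm (of_nat m + u)"
      using norm_diff_ineq[of "of_nat m" u] elim by (simp add: norm_of_nat) linarith
    then show ?case by (simp add: norm_mult norm_divide norm_power divide_simps add.commute)
  qed
  show "summable (\<lambda>m. 1 / fact m :: real)"
    using summable_exp[of "1::real"] by (simp add: inverse_eq_divide)
qed

lemma prym_series_sums: "(\<lambda>m. (-1) ^ m / fact m * (1 / (u + of_nat m))) sums prym_series u"
  unfolding prym_series_def by (intro summable_sums summable_norm_cancel[OF summable_prym])

text \<open>The boundary term exp (- 1) enters here and in \<open>prym_integral_rec\<close> in such
  a way that it cancels in the sum: series plus integral satisfies the functional equation of
  \<Gamma>.\<close>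

lemma prym_series_rec:
  assumes "u \<notin> \<int>\<^sub>\<le>\<^sub>0"
  shows "u * prym_series u = exp (- 1) + prym_series (u + 1)"
proof -
  have nz: "u + of_nat m \<noteq> 0" for m using assms plus_of_nat_eq_0_imp by blast
  have "(\<lambda>m. (-1) ^ m / fact m) sums exp (- 1 :: complex)"
    using exp_converges[of "- 1 :: complex"] by (simp add: scaleR_conv_of_real field_simps)
  from sums_diff[OF this sums_mult[OF prym_series_sums[of u], of u]]
  have "(\<lambda>m. (-1) ^ m / fact m * (of_nat m / (u + of_nat m))) sums (exp (- 1) - u * prym_series u)"
  proof (rule sums_cong[THEN iffD1, rotated])
    fix m
    have "1 - u * (1 / (u + of_nat m)) = of_nat m / (u + of_nat m)"
      using nz[of m] by (simp add: field_simps)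
    moreover have "(-1) ^ m / fact m - u * ((-1) ^ m / fact m * (1 / (u + of_nat m)))
        = (-1) ^ m / fact m * (1 - u * (1 / (u + of_nat m)))"
      by (simp add: algebra_simps)
    ultimately show "(-1) ^ m / fact m - u * ((-1) ^ m / fact m * (1 / (u + of_nat m)))
        = (-1) ^ m / fact m * (of_nat m / (u + of_nat m))" by simp
  qed
  \<comment> \<open>The term for m = 0 vanishes through the factor m, which permits the shift of
    index.\<close>
  then have "(\<lambda>m. (-1) ^ Suc m / fact (Suc m) * (of_nat (Suc m) / (u + of_nat (Suc m)))) sums (exp (- 1) - u * prym_series u)"
    by (subst sums_Suc_iff) simp
  moreover have "(-1) ^ Suc m / fact (Suc m) * (of_nat (Suc m) / (u + of_nat (Suc m))) = - ((-1) ^ m / fact m * (1 / (u + 1 + of_nat m)))" for m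
    using of_nat_neq_0[of m, where 'a = complex] by (simp add: add_ac divide_simps del: of_nat_Suc) (simp add: algebra_simps)
  ultimately have "(\<lambda>m. - ((-1) ^ m / fact m * (1 / (u + 1 + of_nat m)))) sums (exp (- 1) - u * prym_series u)"
    by simp
  from sums_unique2[OF this sums_minus[OF prym_series_sums]] show ?thesis by (simp add: algebra_simps)
qed

lemma integrable_powr_exp_pos:
  fixes s :: real
  assumes "s > 0" shows "set_integrable lborel {0<..} (\<lambda>t. t powr (s - 1) * exp (- t))"
proof -
  have "set_integrable lebesgue {0<..} (\<lambda>t. complex_of_real t powr (of_real s - 1) / of_real (exp t))"
    by (rule absolutely_integrable_Gamma_integral') (use assms in auto)
  from integrable_norm[OF this[unfolded set_integrable_def]]
  have "integrable lebesgue (\<lambda>t. indicator {0<..} t * (t powr (s - 1) * exp (- t)))"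
    by (rule Bochner_Integration.integrable_cong[THEN iffD1, rotated -1])
       (auto simp: indicator_def norm_divide norm_powr_real_powr exp_minus field_simps)
  then show ?thesis by (simp add: set_integrable_def integrable_completion)
qed

lemma measurable_powr_exp [measurable]:
  "(\<lambda>t. complex_of_real t powr (u - 1) * of_real (exp (- t))) \<in> borel_measurable borel"
  by measurable

lemma integrable_prym:
  "set_integrable lborel {1..} (\<lambda>t. of_real t powr (u - 1) * of_real (exp (- t)) :: complex)"
  unfolding set_integrable_def
proof (rule Bochner_Integration.integrable_bound[OF integrable_powr_exp_pos[unfolded set_integrable_def, of "max 1 (Re u)"]])
  show "AE t in lborel. norm (indicator {1..} t *\<^sub>R (of_real t powr (u - 1) * of_real (exp (- t)) :: complex))
     \<le> norm (indicator {0<..} t *\<^sub>R (t powr (max 1 (Re u) - 1) * exp (- t)))"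
    by (intro AE_I2) (auto simp: indicator_def norm_mult norm_powr_real_powr intro!: powr_mono)
qed auto

text \<open>The function t powr u * exp (- t) is a primitive of the difference of the two
  integrands; it is exp (- 1) at t = 1 and tends to 0 at infinity.\<close>

lemma prym_integral_rec: "prym_integral (u + 1) = exp (- 1) + u * prym_integral u"
proof -
  let ?f = "\<lambda>t. u * (of_real t powr (u - 1) * of_real (exp (- t))) - of_real t powr (u + 1 - 1) * of_real (exp (- t)) :: complex"
  let ?F = "\<lambda>t. of_real t powr u * of_real (exp (- t)) :: complex"
  have int: "set_integrable lborel {1..} ?f"
    by (intro set_integral_diff(1) set_integrable_mult_right integrable_prym)
  have I: "(LINT t:{1..}|lborel. ?f t) = u * prym_integral u - prym_integral (u + 1)"
    unfolding prym_integral_def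
    by (subst set_integral_diff(2)) (intro set_integrable_mult_right integrable_prym | simp)+
  have "((\<lambda>X. LINT t:{1..X}|lborel. ?f t) \<longlongrightarrow> (LINT t:{1..}|lborel. ?f t)) at_top"
    by (intro tendsto_set_lebesgue_integral_at_top int) auto
  moreover have "\<forall>\<^sub>F X in at_top. (LINT t:{1..X}|lborel. ?f t) = ?F X - exp (- 1)"
    using eventually_ge_at_top[of 1]
  proof eventually_elim
    case (elim X)
    have "(?f has_integral (?F X - ?F 1)) {1..X}"
    proof (rule fundamental_theorem_of_calculus[OF elim])
      fix t assume t: "t \<in> {1..X}"
      have D: "((\<lambda>z. z powr u * exp (- z)) has_field_derivative
          (u * (of_real t powr (u - 1) * exp (- of_real t)) - of_real t powr u * exp (- of_real t))) (at (of_real t))"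
        using t by (auto intro!: derivative_eq_intros simp: algebra_simps)
      have "((\<lambda>x. of_real x powr u * exp (- of_real x)) has_vector_derivative
          (u * (of_real t powr (u - 1) * exp (- of_real t)) - of_real t powr u * exp (- of_real t))) (at t within {1..X})"
        by (rule has_vector_derivative_real_field[OF has_field_derivative_subset[OF D]]) simp
      then show "(?F has_vector_derivative ?f t) (at t within {1..X})"
        by (simp add: exp_of_real[symmetric])
    qed
    moreover have "set_integrable lborel {1..X} ?f"
      by (rule set_integrable_subset[OF int]) auto
    ultimately show ?case
      using exp_of_real[of "- 1", where 'a = complex] by (simp add: set_borel_integral_eq_integral integral_unique)
  qed
  ultimately have "((\<lambda>X. ?F X - exp (- 1)) \<longlongrightarrow> (LINT t:{1..}|lborel. ?f t)) at_top"
    by (rule Lim_transform_eventually)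
  moreover have "((\<lambda>X. ?F X - exp (- 1)) \<longlongrightarrow> 0 - exp (- 1)) at_top"
  proof (intro tendsto_diff tendsto_const)
    show "(?F \<longlongrightarrow> 0) at_top"
    proof (rule Lim_null_comparison)
      show "((\<lambda>X. X powr Re u * exp (- X)) \<longlongrightarrow> 0) at_top" by real_asymp
      show "\<forall>\<^sub>F X in at_top. norm (?F X) \<le> X powr Re u * exp (- X)"
        using eventually_gt_at_top[of 0] by eventually_elim (simp add: norm_mult norm_powr_real_powr)
    qed
  qed
  ultimately have "(LINT t:{1..}|lborel. ?f t) = 0 - exp (- 1)"
    by (rule tendsto_unique[rotated]) auto
  with I show ?thesis by (simp add: algebra_simps)
qed

lemma has_integral_powr_unit:
  assumes "Re z > 0"
  shows "((\<lambda>t. of_real t powr (z - 1)) has_integral 1 / z) {0..1}"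
proof -
  have z: "z \<noteq> 0" using assms by auto
  have "((\<lambda>t. of_real t powr (z - 1)) has_integral (of_real 1 powr z / z - of_real 0 powr z / z)) {0..1::real}"
  proof (rule fundamental_theorem_of_calculus_interior)
    show "continuous_on {0..1} (\<lambda>t. complex_of_real t powr z / z)"
      using z assms by (intro continuous_intros) auto
    fix t :: real assume t: "t \<in> {0<..<1}"
    have "((\<lambda>w. w powr z / z) has_field_derivative of_real t powr (z - 1)) (at (of_real t))"
      using t z by (auto intro!: derivative_eq_intros)
    then show "((\<lambda>t. complex_of_real t powr z / z) has_vector_derivative of_real t powr (z - 1)) (at t)"
      by (rule has_vector_derivative_real_field)
  qed simp
  then show ?thesis using z by simp
qed

lemma set_integrable_powr_unit:
  assumes "Re z > 0"
  shows "set_integrable lborel {0..1} (\<lambda>t. complex_of_real t powr (z - 1))"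
    and "(LINT t:{0..1}|lborel. norm (complex_of_real t powr (z - 1))) = 1 / Re z"
proof -
  have n: "norm (complex_of_real t powr (z - 1)) = t powr (Re z - 1)" if "t \<in> {0..1}" for t
    using that by (simp add: norm_powr_real_powr)
  have hi: "((\<lambda>t. t powr (Re z - 1)) has_integral 1 / Re z) {0..1}"
    using has_integral_powr_from_0[of "Re z - 1" 1] assms by simp
  then have "(\<lambda>t. t powr (Re z - 1)) absolutely_integrable_on {0..1}"
    by (intro nonnegative_absolutely_integrable_1) auto
  then have r: "set_integrable lborel {0..1} (\<lambda>t. t powr (Re z - 1))"
    by (auto simp: set_integrable_def integrable_completion)
  show "set_integrable lborel {0..1} (\<lambda>t. complex_of_real t powr (z - 1))"
    unfolding set_integrable_def
    by (rule Bochner_Integration.integrable_bound[OF r[unfolded set_integrable_def]])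
       (auto simp: n indicator_def)
  have "(LINT t:{0..1}|lborel. norm (complex_of_real t powr (z - 1))) = (LINT t:{0..1}|lborel. t powr (Re z - 1))"
    by (intro set_lebesgue_integral_cong) (auto simp: n)
  then show "(LINT t:{0..1}|lborel. norm (complex_of_real t powr (z - 1))) = 1 / Re z"
    using set_borel_integral_eq_integral(2)[OF r] integral_unique[OF hi] by simp
qed

text \<open>For Re u > 0 Euler's integral is split at 1 and exp (- t) is expanded on (0, 1). The
  common functional equation then extends the identity to the left one unit at a time, in place of
  analytic continuation.\<close>

lemma Gamma_prym:
  assumes "u \<notin> \<int>\<^sub>\<le>\<^sub>0"
  shows "Gamma u = prym_series u + prym_integral u"
proof -
  have pos: "Gamma u = prym_series u + prym_integral u" if u: "Re u > 0" for u
  proof -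
    let ?g = "\<lambda>t. of_real t powr (u - 1) * of_real (exp (- t)) :: complex"
    have int0: "set_integrable lborel {0<..} ?g"
      unfolding set_integrable_def
      by (rule Bochner_Integration.integrable_bound[OF integrable_powr_exp_pos[unfolded set_integrable_def, OF u]])
         (auto simp: indicator_def norm_mult norm_powr_real_powr)
    have "(?g has_integral Gamma u) {0<..}"
      using Gamma_integral_complex'[OF u] by (simp add: exp_minus divide_inverse)
    then have "Gamma u = (LINT t:{0<..}|lborel. ?g t)"
      using set_borel_integral_eq_integral(2)[OF int0] by (simp add: integral_unique)
    also have "\<dots> = (LINT t:{0<..<1} \<union> {1..}|lborel. ?g t)"
      by (intro set_lebesgue_integral_cong arg_cong2[where f = "set_lebesgue_integral lborel"]) auto
    also have "\<dots> = (LINT t:{0<..<1}|lborel. ?g t) + prym_integral u"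
      unfolding prym_integral_def
      by (rule set_integral_Un) (auto intro: set_integrable_subset[OF int0])
    also have "(LINT t:{0<..<1}|lborel. ?g t) = (LINT t:{0..1}|lborel. ?g t)"
      unfolding set_lebesgue_integral_def
    proof (rule integral_cong_AE)
      have "AE t in lborel. t \<noteq> 0 \<and> t \<noteq> (1::real)" using AE_lborel_singleton[of 0] AE_lborel_singleton[of 1] by auto
      then show "AE t in lborel. indicator {0<..<1} t *\<^sub>R ?g t = indicator {0..1} t *\<^sub>R ?g t"
        by eventually_elim (auto simp: indicator_def)
    qed auto
    also have "\<dots> = prym_series u"
    proof -
      let ?f = "\<lambda>m t. indicator {0..1} t *\<^sub>R ((-1) ^ m / fact m * (of_real t powr (u + of_nat m - 1))) :: complex"
      have rm: "Re (u + of_nat m) > 0" for m using u by simp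
      have fi: "integrable lborel (?f m)" for m
        using integrable_mult_right[OF set_integrable_powr_unit(1)[OF rm[of m], unfolded set_integrable_def], of "(-1) ^ m / fact m"]
        by (simp add: mult_ac)
      have I: "integral\<^sup>L lborel (?f m) = (-1) ^ m / fact m * (1 / (u + of_nat m))" for m
      proof -
        have "?f m = (\<lambda>t. (-1) ^ m / fact m * (indicator {0..1} t *\<^sub>R (of_real t powr (u + of_nat m - 1))))"
          by (auto simp: fun_eq_iff)
        then have "integral\<^sup>L lborel (?f m) = (-1) ^ m / fact m * (LINT t:{0..1}|lborel. of_real t powr (u + of_nat m - 1))"
          by (simp only: set_lebesgue_integral_def integral_mult_right_zero)
        then show ?thesis
          using set_borel_integral_eq_integral(2)[OF set_integrable_powr_unit(1)[OF rm[of m]]]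
            integral_unique[OF has_integral_powr_unit[OF rm[of m]]] by simp
      qed
      have N: "(LINT t|lborel. norm (?f m t)) = 1 / fact m * (1 / (Re u + real m))" for m
      proof -
        have "norm (?f m t) = 1 / fact m * (indicator {0..1} t *\<^sub>R norm (complex_of_real t powr (u + of_nat m - 1)))" for t
          by (simp add: norm_mult norm_divide norm_power)
        then have "(LINT t|lborel. norm (?f m t)) = 1 / fact m * (LINT t:{0..1}|lborel. norm (complex_of_real t powr (u + of_nat m - 1)))"
          by (simp only: set_lebesgue_integral_def integral_mult_right_zero)
        then show ?thesis using set_integrable_powr_unit(2)[OF rm[of m]] by simp
      qed
      have "(\<lambda>m. integral\<^sup>L lborel (?f m)) sums (LINT t|lborel. (\<Sum>m. ?f m t))"
      proof (rule sums_integral[OF fi])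
        have "summable (\<lambda>m. norm (?f m t))" for t
        proof (rule summable_comparison_test'[of "\<lambda>m. norm (of_real t powr (u - 1) :: complex) * (1 / fact m)" 0])
          show "summable (\<lambda>m. norm (of_real t powr (u - 1) :: complex) * (1 / fact m))"
            using summable_exp[of "1::real"] by (intro summable_mult) (simp add: inverse_eq_divide)
          show "norm (norm (?f m t)) \<le> norm (of_real t powr (u - 1) :: complex) * (1 / fact m)" for m
            by (auto simp: indicator_def norm_mult norm_divide norm_power norm_powr_real_powr intro!: divide_right_mono powr_mono')
        qed
        then show "AE t in lborel. summable (\<lambda>m. norm (?f m t))" by simp
        show "summable (\<lambda>m. LINT t|lborel. norm (?f m t))"
          unfolding N
        proof (rule summable_comparison_test'[of "\<lambda>m. (1 / fact m) * (1 / Re u)" 0])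
          show "summable (\<lambda>m. (1 / fact m) * (1 / Re u))"
            using summable_exp[of "1::real"] by (intro summable_mult2) (simp add: inverse_eq_divide)
          show "norm (1 / fact m * (1 / (Re u + real m))) \<le> 1 / fact m * (1 / Re u)" for m
            using u by (simp add: divide_simps)
        qed
      qed
      then have "(\<lambda>m. (-1) ^ m / fact m * (1 / (u + of_nat m))) sums (LINT t|lborel. (\<Sum>m. ?f m t))"
        unfolding I .
      moreover have "(LINT t|lborel. (\<Sum>m. ?f m t)) = (LINT t:{0..1}|lborel. ?g t)"
        unfolding set_lebesgue_integral_def
      proof (rule integral_cong_AE)
        have "AE t in lborel. t \<noteq> (0::real)" by (rule AE_lborel_singleton)
        then show "AE t in lborel. (\<Sum>m. ?f m t) = indicator {0..1} t *\<^sub>R ?g t"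
        proof eventually_elim
          case (elim t)
          show ?case
          proof (cases "t \<in> {0..1}")
            case True
            have "(\<lambda>m. (of_real (- t)) ^ m /\<^sub>R fact m) sums exp (of_real (- t) :: complex)" by (rule exp_converges)
            from sums_mult[OF this, of "of_real t powr (u - 1)"]
            have "(\<lambda>m. of_real t powr (u - 1) * ((of_real (- t)) ^ m /\<^sub>R fact m)) sums ?g t"
              by (simp only: exp_of_real)
            moreover have "of_real t powr (u - 1) * ((of_real (- t)) ^ m /\<^sub>R fact m) = ?f m t" for m
            proof -
              have "complex_of_real t powr (u + of_nat m - 1) = of_real t powr (u - 1) * of_real t ^ m"
              proof -
                have "u + of_nat m - 1 = (u - 1) + of_nat m" by simp
                then show ?thesis using elim by (simp only: powr_add) simp
              qed
              moreover have "(of_real (- t)) ^ m = (-1) ^ m * complex_of_real t ^ m"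
                by (simp only: of_real_minus power_minus[of "complex_of_real t"])
              ultimately show ?thesis
                using True by (simp add: scaleR_conv_of_real divide_inverse mult_ac)
            qed
            ultimately show ?thesis using True by (simp add: sums_iff)
          qed (auto simp: indicator_def)
        qed
      qed auto
      ultimately show ?thesis using sums_unique2[OF prym_series_sums[of u]] by simp
    qed
    finally show ?thesis .
  qed
  have "Gamma u = prym_series u + prym_integral u" if "u \<notin> \<int>\<^sub>\<le>\<^sub>0" "Re u > - real k" for u k
    using that
  proof (induction k arbitrary: u)
    case (Suc k)
    have u0: "u \<noteq> 0" using Suc.prems by auto
    have u1: "u + 1 \<notin> \<int>\<^sub>\<le>\<^sub>0" if "u + 1 \<noteq> 1"
      using Suc.prems(1) plus_one_in_nonpos_Ints_imp by blast
    have "u * Gamma u = Gamma (u + 1)" using Gamma_plus1[OF Suc.prems(1)] by simp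
    also have "\<dots> = prym_series (u + 1) + prym_integral (u + 1)"
      using Suc.prems u1 u0 by (intro Suc.IH) auto
    also have "\<dots> = u * (prym_series u + prym_integral u)"
      unfolding prym_integral_rec distrib_left prym_series_rec[OF Suc.prems(1)] by simp
    finally show ?case using u0 by simp
  qed (use pos in auto)
  moreover obtain k where "- Re u < real k" using reals_Archimedean2 by blast
  ultimately show ?thesis using assms minus_less_iff[of "Re u" "real k"] by blast
qed

lemma integrable_lborel_prod:
  fixes G W :: "real \<Rightarrow> real"
  assumes "integrable lborel G" "integrable lborel W"
  shows "integrable (lborel \<Otimes>\<^sub>M lborel) (\<lambda>(x, y). G x * W y)"
proof (rule lborel_pair.Fubini_integrable)
  have [measurable]: "G \<in> borel_measurable borel" "W \<in> borel_measurable borel"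
    using assms by auto
  show "(\<lambda>(x, y). G x * W y) \<in> borel_measurable (lborel \<Otimes>\<^sub>M lborel)" by measurable
  have "(\<lambda>x. LINT y|lborel. norm (case (x, y) of (x, y) \<Rightarrow> G x * W y)) = (\<lambda>x. norm (G x) * (LINT y|lborel. norm (W y)))"
    by (auto simp: abs_mult)
  then show "integrable lborel (\<lambda>x. LINT y|lborel. norm (case (x, y) of (x, y) \<Rightarrow> G x * W y))"
    using assms by simp
  show "AE x in lborel. integrable lborel (\<lambda>y. case (x, y) of (x, y) \<Rightarrow> G x * W y)"
    using assms by simp
qed

lemma of_real_powr_divide:
  "0 < y \<Longrightarrow> 0 < t \<Longrightarrow> complex_of_real (y / t) powr (- u) = of_real y powr (- u) * of_real t powr u"
  by (simp add: powr_def Ln_of_real ln_div flip: exp_add of_real_divide) (simp add: algebra_simps)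

text \<open>Termwise integration of the series part leaves loop integrals with one additional simple
  pole at -m; Fubini on the integral part replaces y by y / t with t >= 1, which is still below 1.
  Both families have residue formulas, so no contour has to pass between the poles of \<Gamma>. The
  bounded function h will be 1 or 1 / (u + s).\<close>

lemma cloop_Gamma_split:
  assumes "\<delta> > 0" "\<sigma> > 0" "0 < y" "y < 1" "continuous_on (range (lpath \<sigma> \<delta>)) h" "\<And>v. norm (h (lpath \<sigma> \<delta> v)) \<le> H"
  shows "(\<lambda>m. (-1) ^ m / fact m * cloop \<sigma> \<delta> (\<lambda>u. of_real y powr (- u) * h u / (u + of_real (real m)))) sums
    (cloop \<sigma> \<delta> (\<lambda>u. Gamma u * (of_real y powr (- u) * h u))
      - (LINT t:{1..}|lborel. of_real (exp (- t) / t) * cloop \<sigma> \<delta> (\<lambda>u. of_real (y / t) powr (- u) * h u)))"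
proof -
  let ?L = "lpath \<sigma> \<delta>" and ?d = "ldir \<delta>" and ?P = "\<lambda>u. of_real y powr (- u) :: complex"
  define \<eta> where "\<eta> = - ln y"
  have \<eta>: "\<eta> > 0" using assms by (simp add: \<eta>_def)
  have H: "H \<ge> 0" using order_trans[OF norm_ge_zero assms(6)] .
  have hm [measurable]: "(\<lambda>v. h (?L v)) \<in> borel_measurable borel" by (rule measurable_on_lpath[OF assms(5)])
  have nP: "norm (?P (?L v)) = exp (\<eta> * Re (?L v))" for v
    using assms(3) by (simp add: norm_of_real_powr_minus \<eta>_def del: Re_lpath)
  define \<mu> where "\<mu> = min \<delta> \<sigma>"
  have \<mu>: "\<mu> > 0" using assms by (simp add: \<mu>_def)
  have inv: "norm (1 / (?L v + of_real (real m))) \<le> 1 / \<mu>" for v m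
  proof -
    have "1 / min \<delta> (\<sigma> + real m) \<le> 1 / \<mu>"
      using assms \<mu> by (intro divide_left_mono) (auto simp: \<mu>_def min_def)
    then show ?thesis using lpath_inverse_bound[OF assms(1), of \<sigma> "real m" v] assms(2) by linarith
  qed
  define G where "G = (\<lambda>v. H * exp (\<eta> * Re (?L v)))"
  have G: "integrable lborel G" unfolding G_def by (intro integrable_mult_right integrable_exp_Re_lpath \<eta>)
  have Gb: "norm (?P (?L v) * h (?L v)) \<le> G v" for v
    unfolding G_def norm_mult nP using assms(6)[of v] by (simp add: mult.commute mult_left_mono)
  let ?f = "\<lambda>m v. (-1) ^ m / fact m * (?P (?L v) * h (?L v) / (?L v + of_real (real m)) * ?d v)"
  have fb: "norm (?f m v) \<le> 1 / fact m * (1 / \<mu> * G v)" for m v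
  proof -
    have "norm (?P (?L v) * h (?L v)) * norm (1 / (?L v + of_real (real m))) \<le> G v * (1 / \<mu>)"
      by (intro mult_mono Gb inv) (use H in \<open>auto simp: G_def\<close>)
    then have "norm (?P (?L v) * h (?L v) / (?L v + of_real (real m)) * ?d v) \<le> 1 / \<mu> * G v"
      by (simp add: norm_mult norm_divide mult_ac)
    from mult_left_mono[OF this, of "1 / fact m"] show ?thesis by (simp add: norm_mult norm_divide norm_power)
  qed
  have fi: "integrable lborel (?f m)" for m
  proof (rule Bochner_Integration.integrable_bound)
    show "integrable lborel (\<lambda>v. 1 / fact m * (1 / \<mu> * G v))" using G by simp
    show "AE v in lborel. norm (?f m v) \<le> norm (1 / fact m * (1 / \<mu> * G v))"
      by (intro AE_I2, rule order_trans[OF fb], simp only: real_norm_def abs_ge_self)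
  qed measurable
  have sume: "summable (\<lambda>m. 1 / fact m :: real)"
    using summable_exp[of "1::real"] by (simp add: inverse_eq_divide)
  have 1: "(\<lambda>m. integral\<^sup>L lborel (?f m)) sums (LINT v|lborel. (\<Sum>m. ?f m v))"
  proof (rule sums_integral[OF fi])
    show "AE v in lborel. summable (\<lambda>m. norm (?f m v))"
    proof (intro AE_I2, rule summable_comparison_test')
      fix v show "summable (\<lambda>m. 1 / fact m * (1 / \<mu> * G v))" by (intro summable_mult2 sume)
      show "norm (norm (?f m v)) \<le> 1 / fact m * (1 / \<mu> * G v)" for m using fb by simp
    qed
    show "summable (\<lambda>m. LINT v|lborel. norm (?f m v))"
    proof (rule summable_comparison_test'[of "\<lambda>m. 1 / fact m * (1 / \<mu> * integral\<^sup>L lborel G)" 0])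
      show "summable (\<lambda>m. 1 / fact m * (1 / \<mu> * integral\<^sup>L lborel G))" by (intro summable_mult2 sume)
      fix m
      have "(LINT v|lborel. norm (?f m v)) \<le> (LINT v|lborel. 1 / fact m * (1 / \<mu> * G v))"
        by (intro integral_mono integrable_norm fi fb) (use G in simp)
      then show "norm (LINT v|lborel. norm (?f m v)) \<le> 1 / fact m * (1 / \<mu> * integral\<^sup>L lborel G)" by simp
    qed
  qed
  have If: "integral\<^sup>L lborel (?f m) = (-1) ^ m / fact m * cloop \<sigma> \<delta> (\<lambda>u. ?P u * h u / (u + of_real (real m)))" for m
    unfolding cloop_def by (rule integral_mult_right_zero)
  have S: "(\<Sum>m. ?f m v) = prym_series (?L v) * (?P (?L v) * h (?L v) * ?d v)" for v
    using sums_mult2[OF prym_series_sums[of "?L v"], of "?P (?L v) * h (?L v) * ?d v"]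
    by (intro sums_unique[symmetric]) (simp add: mult_ac)
  define F where "F = (\<lambda>v t. indicator {1..} t *\<^sub>R (of_real t powr (?L v - 1) * of_real (exp (- t)) * (?P (?L v) * h (?L v) * ?d v)))"
  \<comment> \<open>On t >= 1 this dominates t powr (u - 1) * exp (- t) for all u on the loop at
    once, as Re u <= \<sigma>.\<close>
  let ?W = "\<lambda>t. indicator {0<..} t *\<^sub>R (t powr (max 1 \<sigma> - 1) * exp (- t)) :: real"
  have Fi: "integrable (lborel \<Otimes>\<^sub>M lborel) (\<lambda>(v, t). F v t)"
  proof (rule Bochner_Integration.integrable_bound)
    show "integrable (lborel \<Otimes>\<^sub>M lborel) (\<lambda>(v, t). G v * ?W t)"
      by (intro integrable_lborel_prod G integrable_powr_exp_pos[unfolded set_integrable_def]) simp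
    show "(\<lambda>(v, t). F v t) \<in> borel_measurable (lborel \<Otimes>\<^sub>M lborel)" unfolding F_def by measurable
    have "norm (F v t) \<le> G v * ?W t" for v t
    proof (cases "t \<ge> 1")
      case True
      have "t powr (Re (?L v) - 1) \<le> t powr (max 1 \<sigma> - 1)"
        using True Re_lpath_le[of \<sigma> \<delta> v] by (intro powr_mono) (auto simp del: Re_lpath)
      then have "t powr (Re (?L v) - 1) * exp (- t) * norm (?P (?L v) * h (?L v)) \<le> t powr (max 1 \<sigma> - 1) * exp (- t) * G v"
        by (intro mult_mono Gb) auto
      then show ?thesis using True by (simp add: F_def norm_mult norm_powr_real_powr mult_ac del: Re_lpath)
    qed (use H in \<open>simp add: F_def G_def\<close>)
    then show "AE x in lborel \<Otimes>\<^sub>M lborel. norm (case x of (v, t) \<Rightarrow> F v t) \<le> norm (case x of (v, t) \<Rightarrow> G v * ?W t)"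
      by (intro AE_I2) (auto intro: order_trans[OF _ abs_ge_self])
  qed
  have E: "(LINT t|lborel. F v t) = prym_integral (?L v) * (?P (?L v) * h (?L v) * ?d v)" for v
    unfolding F_def prym_integral_def set_lebesgue_integral_def
    by (subst integral_mult_left_zero[symmetric]) (simp add: mult_ac)
  have E': "(LINT v|lborel. F v t) = indicator {1..} t *\<^sub>R (of_real (exp (- t) / t) * cloop \<sigma> \<delta> (\<lambda>u. of_real (y / t) powr (- u) * h u))" for t
  proof (cases "t \<ge> 1")
    case True
    have "F v t = of_real (exp (- t) / t) * (of_real (y / t) powr (- ?L v) * h (?L v) * ?d v)" for v
      using True of_real_powr_divide[OF assms(3), of t "?L v"] by (simp add: F_def powr_diff mult_ac)
    then show ?thesis using True by (simp add: cloop_def)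
  qed (simp add: F_def)
  have iE: "integrable lborel (\<lambda>v. prym_integral (?L v) * (?P (?L v) * h (?L v) * ?d v))"
    using lborel_pair.integrable_fst'[OF Fi] by (simp add: E)
  have iS: "integrable lborel (\<lambda>v. prym_series (?L v) * (?P (?L v) * h (?L v) * ?d v))"
  proof -
    have "integrable lborel (\<lambda>v. (\<Sum>m. ?f m v))"
    proof (rule integrable_suminf[OF fi])
      show "AE v in lborel. summable (\<lambda>m. norm (?f m v))"
      proof (intro AE_I2, rule summable_comparison_test')
        fix v show "summable (\<lambda>m. 1 / fact m * (1 / \<mu> * G v))" by (intro summable_mult2 sume)
        show "norm (norm (?f m v)) \<le> 1 / fact m * (1 / \<mu> * G v)" for m using fb by simp
      qed
      show "summable (\<lambda>m. LINT v|lborel. norm (?f m v))"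
      proof (rule summable_comparison_test'[of "\<lambda>m. 1 / fact m * (1 / \<mu> * integral\<^sup>L lborel G)" 0])
        show "summable (\<lambda>m. 1 / fact m * (1 / \<mu> * integral\<^sup>L lborel G))" by (intro summable_mult2 sume)
        fix m
        have "(LINT v|lborel. norm (?f m v)) \<le> (LINT v|lborel. 1 / fact m * (1 / \<mu> * G v))"
          by (intro integral_mono integrable_norm fi fb) (use G in simp)
        then show "norm (LINT v|lborel. norm (?f m v)) \<le> 1 / fact m * (1 / \<mu> * integral\<^sup>L lborel G)" by simp
      qed
    qed
    then show ?thesis by (simp only: S)
  qed
  have "cloop \<sigma> \<delta> (\<lambda>u. Gamma u * (?P u * h u)) = (LINT v|lborel. prym_series (?L v) * (?P (?L v) * h (?L v) * ?d v)
      + prym_integral (?L v) * (?P (?L v) * h (?L v) * ?d v))"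
    unfolding cloop_def
    by (intro Bochner_Integration.integral_cong refl)
       (simp add: Gamma_prym[OF lpath_notin_nonpos_Ints[OF assms(1,2)]] algebra_simps)
  also have "\<dots> = (LINT v|lborel. (\<Sum>m. ?f m v)) + (LINT v|lborel. LINT t|lborel. F v t)"
    unfolding S E by (rule Bochner_Integration.integral_add[OF iS iE])
  also have "(LINT v|lborel. LINT t|lborel. F v t) = (LINT t|lborel. LINT v|lborel. F v t)"
    by (rule lborel_pair.Fubini_integral[symmetric, OF Fi])
  also have "\<dots> = (LINT t:{1..}|lborel. of_real (exp (- t) / t) * cloop \<sigma> \<delta> (\<lambda>u. of_real (y / t) powr (- u) * h u))"
    unfolding E' set_lebesgue_integral_def ..
  finally have "(LINT v|lborel. (\<Sum>m. ?f m v)) = cloop \<sigma> \<delta> (\<lambda>u. Gamma u * (?P u * h u))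
     - (LINT t:{1..}|lborel. of_real (exp (- t) / t) * cloop \<sigma> \<delta> (\<lambda>u. of_real (y / t) powr (- u) * h u))"
    by simp
  with 1 show ?thesis unfolding If by simp
qed

section \<open>Loop integrals of the weights against powers and simple poles\<close>

text \<open>The integral part of the splitting vanishes because the loop integral of a pure power is
  0, and the residues (-1)^m y^m / m! sum to exp (- y).\<close>

lemma cloop_Gamma_powr:
  assumes "\<delta> > 0" "\<sigma> > 0" "0 < y" "y < 1"
  shows "cloop \<sigma> \<delta> (\<lambda>u. Gamma u * of_real y powr (- u)) = 2 * of_real pi * \<i> * of_real (exp (- y))"
proof -
  have z: "indicator {1..} t *\<^sub>R (of_real (exp (- t) / t) * cloop \<sigma> \<delta> (\<lambda>u. of_real (y / t) powr (- u) * 1)) = 0" for t :: real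
  proof (cases "t \<ge> 1")
    case True
    then have "0 < y / t" "y / t < 1" using assms by (auto simp: divide_simps)
    then have "cloop \<sigma> \<delta> (\<lambda>u. of_real (y / t) powr (- u)) = 0" using cloop_powr(1)[OF assms(1)] by blast
    then show ?thesis by (simp del: of_real_divide)
  qed simp
  have E: "(LINT t:{1..}|lborel. of_real (exp (- t) / t) * cloop \<sigma> \<delta> (\<lambda>u. of_real (y / t) powr (- u) * 1)) = 0"
    unfolding set_lebesgue_integral_def z by simp
  have "(\<lambda>m. (-1) ^ m / fact m * cloop \<sigma> \<delta> (\<lambda>u. of_real y powr (- u) * 1 / (u + of_real (real m)))) sums
    (cloop \<sigma> \<delta> (\<lambda>u. Gamma u * (of_real y powr (- u) * 1)) - (LINT t:{1..}|lborel. of_real (exp (- t) / t) * cloop \<sigma> \<delta> (\<lambda>u. of_real (y / t) powr (- u) * 1)))"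
    by (rule cloop_Gamma_split[where H = 1]) (use assms in auto)
  then have "(\<lambda>m. (-1) ^ m / fact m * cloop \<sigma> \<delta> (\<lambda>u. of_real y powr (- u) / (u + of_real (real m)))) sums
    cloop \<sigma> \<delta> (\<lambda>u. Gamma u * of_real y powr (- u))"
    unfolding E by simp
  moreover have "(-1) ^ m / fact m * cloop \<sigma> \<delta> (\<lambda>u. of_real y powr (- u) / (u + of_real (real m)))
      = 2 * of_real pi * \<i> * (of_real (- y) ^ m /\<^sub>R fact m)" for m
  proof -
    have "cloop \<sigma> \<delta> (\<lambda>u. of_real y powr (- u) / (u + of_real (real m))) = 2 * of_real pi * \<i> * of_real (y powr real m)"
      using assms by (intro cloop_powr) auto
    moreover have "y powr real m = y ^ m" using assms by (simp add: powr_realpow)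
    moreover have "of_real (- y) ^ m = (-1) ^ m * complex_of_real y ^ m" by (simp only: of_real_minus power_minus[of "complex_of_real y"])
    ultimately show ?thesis by (simp add: scaleR_conv_of_real divide_inverse mult_ac)
  qed
  ultimately have "(\<lambda>m. 2 * of_real pi * \<i> * (of_real (- y) ^ m /\<^sub>R fact m)) sums cloop \<sigma> \<delta> (\<lambda>u. Gamma u * of_real y powr (- u))"
    by simp
  from sums_unique2[OF this sums_mult[OF exp_converges]] show ?thesis by (simp only: exp_of_real)
qed

text \<open>This is y^s \<Gamma>(-s, y) with the upper incomplete Gamma function, equivalently the
  generalised exponential integral of order s + 1 at y.\<close>

definition upper_gamma_scaled :: "real \<Rightarrow> real \<Rightarrow> real" where
  "upper_gamma_scaled s y = (LINT r:{1..}|lborel. r powr (- s - 1) * exp (- (y * r)))"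

lemma integrable_upper_gamma:
  assumes "y > 0" shows "set_integrable lborel {y..} (\<lambda>t. t powr (- s - 1) * exp (- t :: real))"
proof -
  let ?f = "\<lambda>t. t powr (- s - 1) * exp (- t :: real)"
  have m: "max 1 (- s) > 0" by simp
  have 1: "set_integrable lborel {1..} ?f"
    unfolding set_integrable_def
  proof (rule Bochner_Integration.integrable_bound[OF integrable_powr_exp_pos[unfolded set_integrable_def, OF m]])
    show "AE t in lborel. norm (indicator {1..} t *\<^sub>R ?f t) \<le> norm (indicator {0<..} t *\<^sub>R (t powr (max 1 (- s) - 1) * exp (- t)))"
      by (intro AE_I2) (auto simp: indicator_def intro!: powr_mono)
  qed auto
  have "set_integrable lborel {y..1} ?f"
    using assms by (intro borel_integrable_atLeastAtMost') (auto intro!: continuous_intros)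
  from set_integrable_Un[OF this 1] have "set_integrable lborel ({y..1} \<union> {1..}) ?f" by simp
  then show ?thesis by (rule set_integrable_subset) auto
qed

lemma upper_gamma_scaled_eq:
  assumes "y > 0"
  shows "upper_gamma_scaled s y = y powr s * (LINT t:{y..}|lborel. t powr (- s - 1) * exp (- t))"
proof -
  have "(LINT t:{y..}|lborel. t powr (- s - 1) * exp (- t)) = y * (LINT r|lborel. indicator {y..} (0 + y * r) *\<^sub>R ((0 + y * r) powr (- s - 1) * exp (- (0 + y * r))))"
    unfolding set_lebesgue_integral_def using assms
    by (subst lborel_integral_real_affine[of y _ 0]) auto
  also have "(LINT r|lborel. indicator {y..} (0 + y * r) *\<^sub>R ((0 + y * r) powr (- s - 1) * exp (- (0 + y * r))))
     = (LINT r|lborel. y powr (- s - 1) * (indicator {1..} r *\<^sub>R (r powr (- s - 1) * exp (- (y * r)))))"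
    using assms by (intro Bochner_Integration.integral_cong refl) (auto simp: indicator_def powr_mult)
  finally have "(LINT t:{y..}|lborel. t powr (- s - 1) * exp (- t)) = y * (y powr (- s - 1) * upper_gamma_scaled s y)"
    by (simp add: upper_gamma_scaled_def set_lebesgue_integral_def)
  moreover have "y powr s * (y * y powr (- s - 1)) = 1"
    using assms by (simp add: powr_diff powr_minus divide_simps)
  ultimately show ?thesis by (simp add: mult.assoc[symmetric])
qed

text \<open>The series part of the splitting, summed under the integrals of
  \<open>cloop_powr_two_poles\<close>, is the portion over [y, 1] of the incomplete Gamma integral;
  the Fubini part is the portion over [1, \<infinity>).\<close>

lemma cloop_Gamma_powr_pole:
  assumes "\<delta> > 0" "\<sigma> > 0" "\<sigma> + s > 0" "0 < y" "y < 1"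
  shows "cloop \<sigma> \<delta> (\<lambda>u. Gamma u * of_real y powr (- u) / (u + of_real s)) = 2 * of_real pi * \<i> * of_real (upper_gamma_scaled s y)"
proof -
  let ?h = "\<lambda>u. 1 / (u + of_real s) :: complex"
  let ?c = "2 * of_real pi * \<i> :: complex"
  let ?f = "\<lambda>t::real. t powr (- s - 1) * exp (- t)"
  have hc: "continuous_on (range (lpath \<sigma> \<delta>)) ?h" using continuous_lpath_inverse[OF assms(1,3)] .
  have f1: "set_integrable lborel {y..1} ?f" "set_integrable lborel {1..} ?f" "set_integrable lborel {1<..} ?f"
    using assms by (auto intro!: set_integrable_subset[OF integrable_upper_gamma[OF assms(4)]])
  have E: "(LINT t:{1..}|lborel. of_real (exp (- t) / t) * cloop \<sigma> \<delta> (\<lambda>u. of_real (y / t) powr (- u) * ?h u))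
     = ?c * of_real (y powr s * (LINT t:{1..}|lborel. ?f t))"
  proof -
    have "(LINT t:{1..}|lborel. of_real (exp (- t) / t) * cloop \<sigma> \<delta> (\<lambda>u. of_real (y / t) powr (- u) * ?h u))
        = (LINT t:{1..}|lborel. ?c * of_real (y powr s * ?f t))"
    proof (intro set_lebesgue_integral_cong allI impI)
      fix t :: real assume t: "t \<in> {1..}"
      then have "0 < y / t" "y / t < 1" using assms by (auto simp: divide_simps)
      then have "cloop \<sigma> \<delta> (\<lambda>u. of_real (y / t) powr (- u) * ?h u) = ?c * of_real ((y / t) powr s)"
        using cloop_powr(2)[OF assms(1) _ _ assms(3), of "y/t"] by simp
      moreover have "exp (- t) / t * (y / t) powr s = y powr s * ?f t"
        using t assms by (simp add: powr_divide powr_diff powr_minus divide_simps)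
      ultimately show "of_real (exp (- t) / t) * cloop \<sigma> \<delta> (\<lambda>u. of_real (y / t) powr (- u) * ?h u) = ?c * of_real (y powr s * ?f t)"
        by (metis (no_types, lifting) mult.left_commute of_real_mult)
    qed simp
    also have "\<dots> = ?c * of_real (y powr s * (LINT t:{1..}|lborel. ?f t))"
    proof -
      have "indicator {1..} t *\<^sub>R (?c * of_real (y powr s * ?f t)) = (?c * of_real (y powr s)) * of_real (indicator {1..} t *\<^sub>R ?f t)" for t
        by (simp add: scaleR_conv_of_real mult_ac)
      then show ?thesis
        unfolding set_lebesgue_integral_def by (simp only: integral_mult_right_zero integral_complex_of_real of_real_mult mult.assoc)
    qed
    finally show ?thesis .
  qed
  have "(\<lambda>m. (-1) ^ m / fact m * cloop \<sigma> \<delta> (\<lambda>u. of_real y powr (- u) * ?h u / (u + of_real (real m)))) sums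
    (cloop \<sigma> \<delta> (\<lambda>u. Gamma u * (of_real y powr (- u) * ?h u)) - (LINT t:{1..}|lborel. of_real (exp (- t) / t) * cloop \<sigma> \<delta> (\<lambda>u. of_real (y / t) powr (- u) * ?h u)))"
    by (rule cloop_Gamma_split[OF assms(1,2,4,5) hc lpath_inverse_bound[OF assms(1,3)]])
  moreover have "(-1) ^ m / fact m * cloop \<sigma> \<delta> (\<lambda>u. of_real y powr (- u) * ?h u / (u + of_real (real m)))
      = of_real ((-1) ^ m / fact m * (LINT r:{y..1}|lborel. r powr (real m - s - 1))) * (?c * of_real (y powr s))" for m
    using cloop_powr_two_poles[OF assms(1,4,5,3), of "real m"] assms(2) by simp
  moreover have "(\<lambda>m. (-1) ^ m / fact m * (LINT r:{y..1}|lborel. r powr (real m - s - 1))) sums (LINT r:{y..1}|lborel. ?f r)"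
  proof -
    let ?g = "\<lambda>m r. indicator {y..1} r *\<^sub>R ((-1) ^ m / fact m * r powr (real m - s - 1)) :: real"
    let ?b = "\<lambda>r. indicator {y..1} r *\<^sub>R (r powr (- s - 1)) :: real"
    have bi: "integrable lborel ?b"
    proof -
      have "continuous_on {y..1} (\<lambda>r. r powr (- s - 1))"
        using assms by (intro continuous_intros) auto
      from borel_integrable_atLeastAtMost'[OF this] show ?thesis by (simp add: set_integrable_def)
    qed
    have gb: "norm (?g m r) \<le> 1 / fact m * ?b r" for m r
      using assms by (auto simp: indicator_def abs_mult power_abs intro!: divide_right_mono powr_mono')
    have gi: "integrable lborel (?g m)" for m
    proof (rule Bochner_Integration.integrable_bound)
      show "integrable lborel (\<lambda>r. 1 / fact m * ?b r)" using bi by simp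
      show "AE r in lborel. norm (?g m r) \<le> norm (1 / fact m * ?b r)"
        by (intro AE_I2, rule order_trans[OF gb], simp only: real_norm_def abs_ge_self)
    qed measurable
    have sume: "summable (\<lambda>m. 1 / fact m :: real)"
      using summable_exp[of "1::real"] by (simp add: inverse_eq_divide)
    have "(\<lambda>m. integral\<^sup>L lborel (?g m)) sums (LINT r|lborel. (\<Sum>m. ?g m r))"
    proof (rule sums_integral[OF gi])
      show "AE v in lborel. summable (\<lambda>m. norm (?g m v))"
      proof (intro AE_I2, rule summable_comparison_test')
        fix v show "summable (\<lambda>m. 1 / fact m * ?b v)" by (intro summable_mult2 sume)
        show "norm (norm (?g m v)) \<le> 1 / fact m * ?b v" for m using gb by simp
      qed
      show "summable (\<lambda>m. LINT v|lborel. norm (?g m v))"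
      proof (rule summable_comparison_test'[of "\<lambda>m. 1 / fact m * (integral\<^sup>L lborel ?b)" 0])
        show "summable (\<lambda>m. 1 / fact m * (integral\<^sup>L lborel ?b))" by (intro summable_mult2 sume)
        fix m
        have "(LINT v|lborel. norm (?g m v)) \<le> (LINT v|lborel. 1 / fact m * ?b v)"
          by (intro integral_mono integrable_norm gi gb) (use bi in simp)
        then show "norm (LINT v|lborel. norm (?g m v)) \<le> 1 / fact m * integral\<^sup>L lborel ?b" by simp
      qed
    qed
    moreover have "(\<Sum>m. ?g m r) = indicator {y..1} r *\<^sub>R ?f r" for r
    proof (cases "r \<in> {y..1}")
      case True
      have "(\<lambda>m. r powr (- s - 1) * ((- r) ^ m /\<^sub>R fact m)) sums (r powr (- s - 1) * exp (- r))"
        by (intro sums_mult exp_converges)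
      moreover have "r powr (- s - 1) * ((- r) ^ m /\<^sub>R fact m) = ?g m r" for m
      proof -
        have "real m - s - 1 = (- s - 1) + real m" by simp
        then have "r powr (real m - s - 1) = r powr (- s - 1) * r ^ m"
          using True assms powr_realpow[of r m] by (simp only: powr_add) auto
        then show ?thesis using True by (simp add: power_minus[of r] divide_inverse mult_ac)
      qed
      ultimately show ?thesis using True by (simp add: sums_iff)
    qed simp
    moreover have "integral\<^sup>L lborel (?g m) = (-1) ^ m / fact m * (LINT r:{y..1}|lborel. r powr (real m - s - 1))" for m
    proof -
      have "?g m = (\<lambda>r. (-1) ^ m / fact m * (indicator {y..1} r *\<^sub>R r powr (real m - s - 1)))"
        by (simp add: fun_eq_iff)
      then show ?thesis by (simp only: set_lebesgue_integral_def integral_mult_right_zero)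
    qed
    ultimately show ?thesis unfolding set_lebesgue_integral_def[of _ _ ?f] by (simp only:)
  qed
  then have "(\<lambda>m. complex_of_real ((-1) ^ m / fact m * (LINT r:{y..1}|lborel. r powr (real m - s - 1))) * (?c * of_real (y powr s)))
     sums (of_real (LINT r:{y..1}|lborel. ?f r) * (?c * of_real (y powr s)))"
    by (intro sums_mult2 sums_of_real)
  ultimately have "cloop \<sigma> \<delta> (\<lambda>u. Gamma u * (of_real y powr (- u) * ?h u)) - ?c * of_real (y powr s * (LINT t:{1..}|lborel. ?f t))
      = of_real (LINT r:{y..1}|lborel. ?f r) * (?c * of_real (y powr s))"
    unfolding E by (simp only: sums_unique2)
  then have "cloop \<sigma> \<delta> (\<lambda>u. Gamma u * (of_real y powr (- u) * ?h u))
      = ?c * of_real (y powr s * ((LINT r:{y..1}|lborel. ?f r) + (LINT t:{1..}|lborel. ?f t)))"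
    by (simp add: algebra_simps)
  also have "(LINT r:{y..1}|lborel. ?f r) + (LINT t:{1..}|lborel. ?f t) = (LINT t:{y..}|lborel. ?f t)"
  proof -
    have "(LINT t:{1..}|lborel. ?f t) = (LINT t:{1<..}|lborel. ?f t)"
      unfolding set_lebesgue_integral_def
    proof (rule integral_cong_AE)
      have "AE t in lborel. t \<noteq> (1::real)" by (rule AE_lborel_singleton)
      then show "AE t in lborel. indicator {1..} t *\<^sub>R ?f t = indicator {1<..} t *\<^sub>R ?f t"
        by eventually_elim (auto simp: indicator_def)
    qed auto
    moreover have "(LINT t:{y..1} \<union> {1<..}|lborel. ?f t) = (LINT r:{y..1}|lborel. ?f r) + (LINT t:{1<..}|lborel. ?f t)"
      by (rule set_integral_Un) (use f1 in auto)
    moreover have "{y..1} \<union> {1<..} = {y..}" using assms by auto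
    ultimately show ?thesis by simp
  qed
  finally show ?thesis by (simp add: upper_gamma_scaled_eq[OF assms(4)] del: of_real_mult)
qed

text \<open>Decay of 1 / \<Gamma>(1 - u) at rate |ln x| + 1 leaves a positive rate after the power
  of x is absorbed, whatever x > 0.\<close>

lemma rGamma_powr_strip_bound:
  assumes "x > 0"
  obtains C \<eta> where "\<eta> > 0" "\<And>u. \<bar>Im u\<bar> \<le> \<delta> \<Longrightarrow> Re u \<le> \<sigma> \<Longrightarrow> norm (rGamma (1 - u) * of_real x powr (- u)) \<le> C * exp (\<eta> * Re u)"
proof -
  have p: "\<bar>ln x\<bar> + 1 > 0" by simp
  obtain C where C: "\<And>u. \<bar>Im u\<bar> \<le> \<delta> \<Longrightarrow> Re u \<le> \<sigma> \<Longrightarrow> norm (rGamma (1 - u)) \<le> C * exp ((\<bar>ln x\<bar> + 1) * Re u)"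
    using rGamma_strip_bound[OF p, of \<delta> \<sigma>] by blast
  show ?thesis
  proof (rule that[of "\<bar>ln x\<bar> + 1 - ln x" C])
    fix u assume u: "\<bar>Im u\<bar> \<le> \<delta>" "Re u \<le> \<sigma>"
    have "norm (rGamma (1 - u) * of_real x powr (- u)) \<le> C * exp ((\<bar>ln x\<bar> + 1) * Re u) * exp (- ln x * Re u)"
      unfolding norm_mult norm_of_real_powr_minus[OF assms] by (intro mult_right_mono C u) auto
    then show "norm (rGamma (1 - u) * of_real x powr (- u)) \<le> C * exp ((\<bar>ln x\<bar> + 1 - ln x) * Re u)"
      by (simp add: algebra_simps flip: exp_add)
  qed linarith
qed

lemma cloop_rGamma_powr:
  assumes "\<delta> > 0" "x > 0"
  shows "cloop \<sigma> \<delta> (\<lambda>u. rGamma (1 - u) * of_real x powr (- u)) = 0"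
    and "\<sigma> + s > 0 \<Longrightarrow> cloop \<sigma> \<delta> (\<lambda>u. rGamma (1 - u) * of_real x powr (- u) / (u + of_real s))
           = 2 * of_real pi * \<i> * of_real (rGamma (s + 1) * x powr s)"
proof -
  obtain C \<eta> where C: "\<eta> > 0" "\<And>u. \<bar>Im u\<bar> \<le> \<delta> \<Longrightarrow> Re u \<le> \<sigma> \<Longrightarrow> norm (rGamma (1 - u) * of_real x powr (- u)) \<le> C * exp (\<eta> * Re u)"
    using rGamma_powr_strip_bound[OF assms(2), of \<delta> \<sigma>] by blast
  have h: "(\<lambda>u. rGamma (1 - u) * of_real x powr (- u)) holomorphic_on UNIV"
    by (intro holomorphic_intros)
  show "cloop \<sigma> \<delta> (\<lambda>u. rGamma (1 - u) * of_real x powr (- u)) = 0"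
    by (rule cloop_entire[OF assms(1) h C])
  show "cloop \<sigma> \<delta> (\<lambda>u. rGamma (1 - u) * of_real x powr (- u) / (u + of_real s)) = 2 * of_real pi * \<i> * of_real (rGamma (s + 1) * x powr s)"
    if "\<sigma> + s > 0"
    using assms(2) by (subst cloop_Cauchy[OF assms(1) that h C]) (simp_all add: powr_of_real rGamma_complex_of_real[symmetric] add.commute)
qed

subsection \<open>The inverse Cauchy matrix\<close>

text \<open>The residue of \<open>cauchy_rat\<close> at \<open>- k\<close>; used only for \<open>k < n\<close>, so that \<open>n - 1 - k\<close> is not truncated.\<close>

definition cauchy_coeff :: "real \<Rightarrow> nat \<Rightarrow> nat \<Rightarrow> real" where
  "cauchy_coeff \<alpha> n k = (-1) ^ k * pochhammer (real k + \<alpha> + 1) n / (fact k * fact (n - 1 - k))"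

lemma prod_differences_nat:
  fixes l n :: nat
  assumes "l < n"
  shows "(\<Prod>j\<in>{..<n}-{l}. of_nat j - of_nat l :: 'a :: {comm_ring_1,semiring_char_0}) = (-1) ^ l * fact l * fact (n - 1 - l)"
proof -
  have "{..<n} - {l} = {..<l} \<union> {Suc l..<n}" using assms by auto
  moreover have "(\<Prod>j\<in>{..<l} \<union> {Suc l..<n}. of_nat j - of_nat l :: 'a) = (\<Prod>j<l. of_nat j - of_nat l) * (\<Prod>j\<in>{Suc l..<n}. of_nat j - of_nat l)"
    by (rule prod.union_disjoint) auto
  ultimately have "(\<Prod>j\<in>{..<n}-{l}. of_nat j - of_nat l :: 'a) = (\<Prod>j<l. of_nat j - of_nat l) * (\<Prod>j\<in>{Suc l..<n}. of_nat j - of_nat l)"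
    by (rule ssubst)
  also have "(\<Prod>j<l. of_nat j - of_nat l :: 'a) = (\<Prod>j<l. - 1 * of_nat (l - j))"
    by (intro prod.cong) (auto simp: of_nat_diff)
  also have "\<dots> = (-1) ^ l * (\<Prod>j<l. of_nat (l - j))" by (simp only: prod.distrib) simp
  also have "(\<Prod>j<l. of_nat (l - j) :: 'a) = (\<Prod>i\<in>{1..l}. of_nat i)"
    by (rule prod.reindex_bij_witness[of _ "\<lambda>i. l - i" "\<lambda>j. l - j"]) auto
  also have "\<dots> = fact l" by (simp add: fact_prod)
  also have "(\<Prod>j\<in>{Suc l..<n}. of_nat j - of_nat l :: 'a) = (\<Prod>i\<in>{1..n - 1 - l}. of_nat i)"
    using assms by (intro prod.reindex_bij_witness[of _ "\<lambda>i. i + l" "\<lambda>j. j - l"]) (auto simp: of_nat_diff)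
  also have "\<dots> = fact (n - 1 - l)" by (simp add: fact_prod)
  finally show ?thesis .
qed

lemma prod_upto_eq_pochhammer: "(\<Prod>j<n. z + of_nat j) = pochhammer z n"
  by (simp add: pochhammer_prod lessThan_atLeast0)

text \<open>Lagrange interpolation: both sides are polynomials in z of degree below n, and at z = -l
  only the l-th summand survives. There the factorials in \<open>cauchy_coeff\<close> cancel the
  product of differences, leaving the Pochhammer symbol without its k-th factor.\<close>

lemma cauchy_lagrange:
  fixes z :: complex
  assumes "\<alpha> > -1" "k < n"
  shows "(\<Sum>l<n. of_real (cauchy_coeff \<alpha> n l / (real k + \<alpha> + 1 + real l)) * (\<Prod>j\<in>{..<n}-{l}. z + of_nat j))
       = (\<Prod>m\<in>{..<n}-{k}. of_nat m + of_real \<alpha> + 1 - z)"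
proof -
  define p :: "complex poly" where "p = (\<Sum>l<n. Polynomial.smult (of_real (cauchy_coeff \<alpha> n l / (real k + \<alpha> + 1 + real l))) (\<Prod>j\<in>{..<n}-{l}. [:of_nat j, 1:]))"
  define q :: "complex poly" where "q = (\<Prod>m\<in>{..<n}-{k}. [:of_nat m + of_real \<alpha> + 1, -1:])"
  have deg: "degree (\<Prod>m\<in>{..<n}-{i}. [:c m, d:] :: complex poly) \<le> n - 1" if "i < n" for c d i
  proof -
    have "degree (\<Prod>m\<in>{..<n}-{i}. [:c m, d:] :: complex poly) \<le> (\<Sum>m\<in>{..<n}-{i}. degree [:c m, d:])"
      using degree_prod_sum_le[of "{..<n}-{i}" "\<lambda>m. [:c m, d:]"] by (simp add: o_def)
    also have "\<dots> \<le> (\<Sum>m\<in>{..<n}-{i}. 1)" by (intro sum_mono) (auto simp: degree_pCons_eq_if)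
    finally show ?thesis using that by simp
  qed
  have "p = q"
  proof (rule poly_eqI_degree[of "(\<lambda>l. - of_nat l) ` {..<n}"])
    have card: "card ((\<lambda>l. - of_nat l :: complex) ` {..<n}) = n" by (subst card_image) (auto simp: inj_on_def)
    have "degree p \<le> n - 1" unfolding p_def
      by (intro degree_sum_le order_trans[OF degree_smult_le] deg) auto
    then show "degree p < card ((\<lambda>l. - of_nat l :: complex) ` {..<n})" using assms(2) card by simp
    have "degree q \<le> n - 1" unfolding q_def by (rule deg[OF assms(2)])
    then show "degree q < card ((\<lambda>l. - of_nat l :: complex) ` {..<n})" using assms(2) card by simp
    fix x :: complex assume "x \<in> (\<lambda>l. - of_nat l) ` {..<n}"
    then obtain l where l: "l < n" "x = - of_nat l" by auto
    have pos: "real k + \<alpha> + 1 + real l > 0" using assms(1) by simp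
    have "poly p x = (\<Sum>i<n. if i = l then of_real (cauchy_coeff \<alpha> n l / (real k + \<alpha> + 1 + real l)) * (\<Prod>j\<in>{..<n}-{l}. of_nat j - of_nat l) else 0)"
      unfolding p_def poly_sum
    proof (intro sum.cong refl)
      fix i assume i: "i \<in> {..<n}"
      have "(\<Prod>j\<in>{..<n}-{i}. of_nat j - of_nat l :: complex) = 0" if "i \<noteq> l"
        using that l by (intro prod_zero) auto
      then show "poly (Polynomial.smult (of_real (cauchy_coeff \<alpha> n i / (real k + \<alpha> + 1 + real i))) (\<Prod>j\<in>{..<n}-{i}. [:of_nat j, 1:])) x
        = (if i = l then of_real (cauchy_coeff \<alpha> n l / (real k + \<alpha> + 1 + real l)) * (\<Prod>j\<in>{..<n}-{l}. of_nat j - of_nat l) else 0)"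
        by (simp add: poly_prod l(2))
    qed
    also have "\<dots> = of_real (cauchy_coeff \<alpha> n l / (real k + \<alpha> + 1 + real l)) * ((-1) ^ l * fact l * fact (n - 1 - l))"
      using l(1) by (simp add: prod_differences_nat)
    also have "\<dots> = of_real (cauchy_coeff \<alpha> n l / (real k + \<alpha> + 1 + real l) * ((-1) ^ l * fact l * fact (n - 1 - l)))"
      by simp
    also have "cauchy_coeff \<alpha> n l / (real k + \<alpha> + 1 + real l) * ((-1) ^ l * fact l * fact (n - 1 - l))
        = pochhammer (real l + \<alpha> + 1) n / (real k + \<alpha> + 1 + real l)"
      by (simp add: cauchy_coeff_def)
    also have "pochhammer (real l + \<alpha> + 1) n = (\<Prod>m<n. real l + \<alpha> + 1 + real m)"
      by (simp add: prod_upto_eq_pochhammer)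
    also have "\<dots> = (real l + \<alpha> + 1 + real k) * (\<Prod>m\<in>{..<n}-{k}. real l + \<alpha> + 1 + real m)"
      using assms(2) by (subst prod.remove[of _ k]) auto
    also have "\<dots> / (real k + \<alpha> + 1 + real l) = (\<Prod>m\<in>{..<n}-{k}. real l + \<alpha> + 1 + real m)"
      using pos by (simp add: add_ac)
    also have "of_real \<dots> = poly q x"
      unfolding q_def l(2) poly_prod by (simp add: add_ac)
    finally show "poly p x = poly q x" .
  qed
  then have "poly p z = poly q z" by simp
  then show ?thesis
    unfolding p_def q_def by (simp add: poly_sum poly_prod add.commute[of _ z])
qed

text \<open>The Lagrange formula divided by \<open>pochhammer z n\<close>. It sums one row of
  \<open>cauchy_inv\<close>, up to its row factor, against 1 / (z + l) and serves both the
  generating function and the inverse property.\<close>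

lemma cauchy_partial_fraction:
  fixes z :: complex
  assumes "\<alpha> > -1" "k < n" "\<And>j. z + of_nat j \<noteq> 0"
  shows "(\<Sum>l<n. of_real (cauchy_coeff \<alpha> n l) / (of_real (real k + \<alpha> + 1 + real l) * (z + of_nat l)))
       = (\<Prod>m\<in>{..<n}-{k}. of_nat m + of_real \<alpha> + 1 - z) / pochhammer z n"
proof -
  have nz: "pochhammer z n \<noteq> 0" using assms(3) by (auto simp: pochhammer_prod)
  have "(\<Sum>l<n. of_real (cauchy_coeff \<alpha> n l) / (of_real (real k + \<alpha> + 1 + real l) * (z + of_nat l)))
     = (\<Sum>l<n. of_real (cauchy_coeff \<alpha> n l / (real k + \<alpha> + 1 + real l)) * (\<Prod>j\<in>{..<n}-{l}. z + of_nat j) / pochhammer z n)"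
  proof (intro sum.cong refl)
    fix l assume "l \<in> {..<n}"
    then have "pochhammer z n = (z + of_nat l) * (\<Prod>j\<in>{..<n}-{l}. z + of_nat j)"
      by (subst prod_upto_eq_pochhammer[symmetric], subst prod.remove[of _ l]) auto
    moreover have "(\<Prod>j\<in>{..<n}-{l}. z + of_nat j) \<noteq> 0" using assms(3) by auto
    ultimately show "of_real (cauchy_coeff \<alpha> n l) / (of_real (real k + \<alpha> + 1 + real l) * (z + of_nat l))
       = of_real (cauchy_coeff \<alpha> n l / (real k + \<alpha> + 1 + real l)) * (\<Prod>j\<in>{..<n}-{l}. z + of_nat j) / pochhammer z n"
      by simp
  qed
  then show ?thesis
    unfolding sum_divide_distrib[symmetric] cauchy_lagrange[OF assms(1,2)] .
qed

lemma cauchy_rat_remove: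
  assumes "k < n" "of_nat k + of_real \<alpha> + 1 - z \<noteq> 0"
  shows "(\<Prod>m\<in>{..<n}-{k}. of_nat m + of_real \<alpha> + 1 - z) / pochhammer z n = cauchy_rat \<alpha> n z / (of_nat k + of_real \<alpha> + 1 - z)"
proof -
  have "pochhammer (of_real \<alpha> + 1 - z) n = (\<Prod>m<n. of_nat m + of_real \<alpha> + 1 - z)"
    by (subst prod_upto_eq_pochhammer[symmetric]) (simp add: algebra_simps)
  also have "\<dots> = (of_nat k + of_real \<alpha> + 1 - z) * (\<Prod>m\<in>{..<n}-{k}. of_nat m + of_real \<alpha> + 1 - z)"
    using assms(1) by (subst prod.remove[of _ k]) auto
  finally show ?thesis using assms(2) by (simp add: cauchy_rat_def)
qed

lemma cauchy_rat_diff: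
  fixes z c :: complex
  assumes "\<alpha> > -1" "0 < n" "\<And>j. z + of_nat j \<noteq> 0" "\<And>j. c + of_nat j \<noteq> 0"
  shows "cauchy_rat \<alpha> n z - cauchy_rat \<alpha> n c = (\<Sum>l<n. of_real (cauchy_coeff \<alpha> n l) * (c - z) / ((z + of_nat l) * (c + of_nat l)))"
proof -
  define s where "s = (\<Sum>l<n. of_real (cauchy_coeff \<alpha> n l) / of_real (\<alpha> + 1 + real l) :: complex)"
  have rat: "cauchy_rat \<alpha> n z = (\<Sum>l<n. of_real (cauchy_coeff \<alpha> n l) / (z + of_nat l)) - s" if z: "\<And>j. z + of_nat j \<noteq> 0" for z :: complex
  proof -
    \<comment> \<open>This is the row k = 0 of the interpolation formula, multiplied by its missing
      factor \<alpha> + 1 - z.\<close>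
    have "cauchy_rat \<alpha> n z = (of_real \<alpha> + 1 - z) * ((\<Prod>m\<in>{..<n}-{0}. of_nat m + of_real \<alpha> + 1 - z) / pochhammer z n)"
    proof (cases "of_real \<alpha> + 1 - z = 0")
      case True
      then show ?thesis using assms(2) by (simp add: cauchy_rat_def pochhammer_0_left)
    next
      case False
      then show ?thesis using cauchy_rat_remove[OF assms(2), of \<alpha> z] by simp
    qed
    also have "\<dots> = (\<Sum>l<n. (of_real \<alpha> + 1 - z) * (of_real (cauchy_coeff \<alpha> n l) / (of_real (real 0 + \<alpha> + 1 + real l) * (z + of_nat l))))"
      unfolding cauchy_partial_fraction[OF assms(1,2) z, symmetric] by (rule sum_distrib_left)
    also have "\<dots> = (\<Sum>l<n. of_real (cauchy_coeff \<alpha> n l) / (z + of_nat l) - of_real (cauchy_coeff \<alpha> n l) / of_real (\<alpha> + 1 + real l))"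
    proof (intro sum.cong refl)
      fix l
      have "\<alpha> + 1 + real l > 0" using assms(1) by simp
      then have nz: "complex_of_real (\<alpha> + 1 + real l) \<noteq> 0" by (simp only: of_real_eq_0_iff)
      have e: "of_real \<alpha> + 1 - z = complex_of_real (\<alpha> + 1 + real l) - (z + of_nat l)" by simp
      have "(A - B) * (C / (A * B)) = C / B - C / A" if "A \<noteq> 0" "B \<noteq> 0" for A B C :: complex
        using that by (simp add: divide_simps) (simp add: algebra_simps)
      from this[OF nz z[of l]]
      show "(of_real \<alpha> + 1 - z) * (of_real (cauchy_coeff \<alpha> n l) / (of_real (real 0 + \<alpha> + 1 + real l) * (z + of_nat l)))
         = of_real (cauchy_coeff \<alpha> n l) / (z + of_nat l) - of_real (cauchy_coeff \<alpha> n l) / of_real (\<alpha> + 1 + real l)"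
        unfolding e by (simp only: of_nat_0 add_0)
    qed
    finally show ?thesis by (simp add: s_def sum_subtractf)
  qed
  have "cauchy_rat \<alpha> n z - cauchy_rat \<alpha> n c = (\<Sum>l<n. of_real (cauchy_coeff \<alpha> n l) / (z + of_nat l) - of_real (cauchy_coeff \<alpha> n l) / (c + of_nat l))"
    unfolding rat[OF assms(3)] rat[OF assms(4)] by (simp add: sum_subtractf)
  also have "\<dots> = (\<Sum>l<n. of_real (cauchy_coeff \<alpha> n l) * (c - z) / ((z + of_nat l) * (c + of_nat l)))"
  proof (intro sum.cong refl)
    fix l
    show "of_real (cauchy_coeff \<alpha> n l) / (z + of_nat l) - of_real (cauchy_coeff \<alpha> n l) / (c + of_nat l)
       = of_real (cauchy_coeff \<alpha> n l) * (c - z) / ((z + of_nat l) * (c + of_nat l))"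
      using assms(3,4)[of l] by (simp add: divide_simps) (simp add: algebra_simps)
  qed
  finally show ?thesis .
qed

definition cauchy_inv :: "real \<Rightarrow> nat \<Rightarrow> nat \<Rightarrow> nat \<Rightarrow> real" where
  "cauchy_inv \<alpha> n k l = cauchy_coeff \<alpha> n k * cauchy_coeff \<alpha> n l / (real k + real l + \<alpha> + 1)"

text \<open>The sum over l is f w / (c + k) with the reflected point c = \<alpha> + 1 - w, where f
  is \<open>cauchy_rat\<close>; the sum over k is then a difference quotient of f between z and c.
  The reflection f w * f c = 1 produces the -1. The bound on Re w keeps c off the poles of
  f.\<close>

lemma cauchy_inv_rat:
  fixes z w :: complex
  assumes "\<alpha> > -1" "0 < n" "\<And>j. z + of_nat j \<noteq> 0" "\<And>j. w + of_nat j \<noteq> 0" "Re w < \<alpha> + 1" "z + w \<noteq> of_real \<alpha> + 1"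
  shows "(\<Sum>k<n. \<Sum>l<n. of_real (cauchy_inv \<alpha> n k l) / ((z + of_nat k) * (w + of_nat l)))
      = (cauchy_rat \<alpha> n z * cauchy_rat \<alpha> n w - 1) / (of_real \<alpha> + 1 - z - w)"
proof -
  define c where "c = of_real \<alpha> + 1 - w"
  have c: "c + of_nat j \<noteq> 0" for j
  proof -
    have "Re (c + of_nat j) > 0" using assms(5) by (simp add: c_def)
    then show ?thesis by (metis less_irrefl zero_complex.sel(1))
  qed
  have pw: "pochhammer w n \<noteq> 0" using assms(4) by (auto simp: pochhammer_prod)
  have pc: "pochhammer c n \<noteq> 0" using c by (auto simp: pochhammer_prod)
  have fc: "cauchy_rat \<alpha> n w * cauchy_rat \<alpha> n c = 1"
    using pw pc by (simp add: cauchy_rat_def c_def)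
  have cz: "c - z \<noteq> 0" using assms(6) by (auto simp: c_def algebra_simps)
  have "(\<Sum>k<n. \<Sum>l<n. of_real (cauchy_inv \<alpha> n k l) / ((z + of_nat k) * (w + of_nat l)))
     = (\<Sum>k<n. of_real (cauchy_coeff \<alpha> n k) / (z + of_nat k) * (\<Sum>l<n. of_real (cauchy_coeff \<alpha> n l) / (of_real (real k + \<alpha> + 1 + real l) * (w + of_nat l))))"
    unfolding sum_distrib_left by (intro sum.cong refl) (simp add: cauchy_inv_def add_ac)
  also have "\<dots> = (\<Sum>k<n. of_real (cauchy_coeff \<alpha> n k) / (z + of_nat k) * (cauchy_rat \<alpha> n w / (c + of_nat k)))"
  proof (intro sum.cong refl)
    fix k assume k: "k \<in> {..<n}"
    have e: "of_nat k + of_real \<alpha> + 1 - w = c + of_nat k" by (simp add: c_def)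
    have "(\<Sum>l<n. of_real (cauchy_coeff \<alpha> n l) / (of_real (real k + \<alpha> + 1 + real l) * (w + of_nat l))) = cauchy_rat \<alpha> n w / (c + of_nat k)"
      using cauchy_partial_fraction[OF assms(1) _ assms(4), of k n] cauchy_rat_remove[of k n \<alpha> w] k c[of k] unfolding e by simp
    then show "of_real (cauchy_coeff \<alpha> n k) / (z + of_nat k) * (\<Sum>l<n. of_real (cauchy_coeff \<alpha> n l) / (of_real (real k + \<alpha> + 1 + real l) * (w + of_nat l)))
       = of_real (cauchy_coeff \<alpha> n k) / (z + of_nat k) * (cauchy_rat \<alpha> n w / (c + of_nat k))" by simp
  qed
  also have "\<dots> = cauchy_rat \<alpha> n w / (c - z) * (\<Sum>l<n. of_real (cauchy_coeff \<alpha> n l) * (c - z) / ((z + of_nat l) * (c + of_nat l)))"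
    unfolding sum_distrib_left using cz by (intro sum.cong refl) simp
  also have "\<dots> = cauchy_rat \<alpha> n w / (c - z) * (cauchy_rat \<alpha> n z - cauchy_rat \<alpha> n c)"
    using cauchy_rat_diff[OF assms(1-3) c] by simp
  also have "\<dots> = (cauchy_rat \<alpha> n z * cauchy_rat \<alpha> n w - cauchy_rat \<alpha> n w * cauchy_rat \<alpha> n c) / (c - z)"
    by (simp add: algebra_simps diff_divide_distrib)
  finally show ?thesis unfolding fc by (simp add: c_def algebra_simps)
qed

text \<open>At z = j + \<alpha> + 1 the numerator in \<open>cauchy_partial_fraction\<close> is the
  product of m - j over m different from k, which vanishes unless j = k.\<close>

lemma cauchy_inv_inverse:
  assumes "\<alpha> > -1" "k < n" "j < n"
  shows "(\<Sum>l<n. cauchy_inv \<alpha> n l k / (real j + real l + \<alpha> + 1)) = (if j = k then 1 else 0)"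
proof -
  have pos: "real j + \<alpha> + 1 > 0" using assms(1) by simp
  have nz: "complex_of_real (real j + \<alpha> + 1) + of_nat i \<noteq> 0" for i
  proof -
    have "real j + \<alpha> + 1 + real i > 0" using assms(1) by simp
    then show ?thesis by (metis of_real_add of_real_of_nat_eq of_real_eq_0_iff less_irrefl)
  qed
  have "complex_of_real (\<Sum>l<n. cauchy_inv \<alpha> n l k / (real j + real l + \<alpha> + 1))
      = of_real (cauchy_coeff \<alpha> n k) * (\<Sum>l<n. of_real (cauchy_coeff \<alpha> n l) / (of_real (real k + \<alpha> + 1 + real l) * (of_real (real j + \<alpha> + 1) + of_nat l)))"
    unfolding sum_distrib_left by (simp add: cauchy_inv_def add_ac mult_ac)
  also have "\<dots> = of_real (cauchy_coeff \<alpha> n k) * ((\<Prod>m\<in>{..<n}-{k}. of_nat m + of_real \<alpha> + 1 - complex_of_real (real j + \<alpha> + 1)) / pochhammer (complex_of_real (real j + \<alpha> + 1)) n)"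
    by (subst cauchy_partial_fraction[OF assms(1,2) nz]) simp
  also have "(\<Prod>m\<in>{..<n}-{k}. of_nat m + of_real \<alpha> + 1 - complex_of_real (real j + \<alpha> + 1)) = (\<Prod>m\<in>{..<n}-{k}. of_nat m - of_nat j)"
    by simp
  also have "pochhammer (complex_of_real (real j + \<alpha> + 1)) n = of_real (pochhammer (real j + \<alpha> + 1) n)"
    by (simp add: pochhammer_prod)
  also have "of_real (cauchy_coeff \<alpha> n k) * ((\<Prod>m\<in>{..<n}-{k}. of_nat m - of_nat j) / of_real (pochhammer (real j + \<alpha> + 1) n)) = (if j = k then 1 else (0::complex))"
  proof (cases "j = k")
    case True
    have "pochhammer (real k + \<alpha> + 1) n \<noteq> 0" using pochhammer_pos[OF pos, of n] True by simp
    moreover have "((-1) ^ k * (-1) ^ k :: complex) = 1" by (simp flip: power_mult_distrib)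
    ultimately show ?thesis
      unfolding True prod_differences_nat[OF assms(2)] cauchy_coeff_def by (simp add: divide_simps)
  next
    case False
    then have "(\<Prod>m\<in>{..<n}-{k}. of_nat m - of_nat j :: complex) = 0"
      using assms(3) by (intro prod_zero) auto
    then show ?thesis using False by simp
  qed
  finally have "complex_of_real (\<Sum>l<n. cauchy_inv \<alpha> n l k / (real j + real l + \<alpha> + 1)) = of_real (if j = k then 1 else 0)"
    by simp
  then show ?thesis by (simp only: of_real_eq_iff)
qed

subsection \<open>Moments and the finite kernels\<close>

definition stieltjes :: "real \<Rightarrow> real \<Rightarrow> real" where
  "stieltjes s y = (LINT t:{0<..}|lborel. t powr s * exp (- t) / (y + t))"

lemma has_integral_indicator_UNIV:
  fixes f :: "real \<Rightarrow> real"
  shows "(f has_integral I) S \<longleftrightarrow> ((\<lambda>x. indicator S x * f x) has_integral I) UNIV"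
proof -
  have "(\<lambda>x. indicator S x * f x) = (\<lambda>x. if x \<in> S then f x else 0)"
    by (auto simp: fun_eq_iff indicator_def)
  then show ?thesis by (simp only: has_integral_restrict_UNIV)
qed

text \<open>With c = y + t this writes 1 / (y + t) as a superposition of exponentials. Starting the
  range at 1 merges it with exp (- t) into exp (- (t * r)).\<close>

lemma nn_integral_exp_shift:
  assumes "c > 0"
  shows "(\<integral>\<^sup>+ r. ennreal (indicator {1..} r * exp (- (c * (r - 1)))) \<partial>lborel) = ennreal (1 / c)"
proof (rule nn_integral_has_integral_lborel)
  have "((\<lambda>x. exp (- c * x)) has_integral exp (- c * 1) / c) {1..}"
    by (rule has_integral_exp_minus_to_infinity) fact
  note has_integral_mult_right[OF this, of "exp c"]
  moreover have "exp c * exp (- c * r) = exp (- (c * (r - 1)))" for r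
    by (simp only: exp_add[symmetric]) (simp add: right_diff_distrib)
  moreover have "exp c * (exp (- c * 1) / c) = 1 / c"
    by (simp add: exp_minus)
  ultimately have "((\<lambda>r. exp (- (c * (r - 1)))) has_integral 1 / c) {1..}"
    by (simp only:)
  then show "((\<lambda>r. indicator {1..} r * exp (- (c * (r - 1)))) has_integral 1 / c) UNIV"
    by (rule has_integral_indicator_UNIV[THEN iffD1])
qed auto

lemma nn_integral_ennreal_cmult:
  assumes "\<And>r. f r = A * g r" "0 \<le> A" "g \<in> borel_measurable lborel"
  shows "(\<integral>\<^sup>+ r. ennreal (f r) \<partial>lborel) = ennreal A * (\<integral>\<^sup>+ r. ennreal (g r) \<partial>lborel)"
  using assms by (simp add: ennreal_mult' nn_integral_cmult)

lemma nn_integral_powr_exp: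
  assumes "s > -1" "r > 0"
  shows "(\<integral>\<^sup>+ t. ennreal (indicator {0<..} t * (t powr s * exp (- (t * r)))) \<partial>lborel) = ennreal (Gamma (s + 1) * r powr (- s - 1))"
proof -
  have 1: "(\<integral>\<^sup>+ t. ennreal (indicator {0<..} t * (t powr s * exp (- t))) \<partial>lborel) = ennreal (Gamma (s + 1))"
  proof (rule nn_integral_has_integral_lborel)
    have "((\<lambda>t. t powr (s + 1 - 1) / exp t) has_integral Gamma (s + 1)) {0..}"
      by (rule Gamma_integral_real) (use assms in simp)
    then have "((\<lambda>t. t powr s / exp t) has_integral Gamma (s + 1)) {0..}" by simp
    then have "((\<lambda>t. indicator {0..} t * (t powr s / exp t)) has_integral Gamma (s + 1)) UNIV"
      by (rule has_integral_indicator_UNIV[THEN iffD1])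
    moreover have "indicator {0..} t * (t powr s / exp t) = indicator {0<..} t * (t powr s * exp (- t))" for t
      by (auto simp: indicator_def exp_minus divide_inverse)
    ultimately show "((\<lambda>t. indicator {0<..} t * (t powr s * exp (- t))) has_integral Gamma (s + 1)) UNIV"
      by simp
  qed (use assms in auto)
  let ?I = "\<integral>\<^sup>+ t. ennreal (indicator {0<..} t * (t powr s * exp (- (t * r)))) \<partial>lborel"
  have "(\<integral>\<^sup>+ t. ennreal (indicator {0<..} t * (t powr s * exp (- t))) \<partial>lborel)
      = ennreal \<bar>r\<bar> * (\<integral>\<^sup>+ t. ennreal (indicator {0<..} (0 + r * t) * ((0 + r * t) powr s * exp (- (0 + r * t)))) \<partial>lborel)"
    using assms by (intro nn_integral_real_affine) auto
  also have "(\<integral>\<^sup>+ t. ennreal (indicator {0<..} (0 + r * t) * ((0 + r * t) powr s * exp (- (0 + r * t)))) \<partial>lborel) = ennreal (r powr s) * ?I"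
  proof (rule nn_integral_ennreal_cmult)
    fix t
    show "indicator {0<..} (0 + r * t) * ((0 + r * t) powr s * exp (- (0 + r * t))) = r powr s * (indicator {0<..} t * (t powr s * exp (- (t * r))))"
    proof (cases "t > 0")
      case True
      then show ?thesis using assms by (simp add: powr_mult mult_ac)
    next
      case False
      then show ?thesis using assms by (simp add: zero_less_mult_iff)
    qed
  qed auto
  finally have "ennreal (Gamma (s + 1)) = ennreal \<bar>r\<bar> * (ennreal (r powr s) * ?I)" unfolding 1 .
  also have "\<dots> = ennreal (r powr (s + 1)) * ?I"
  proof -
    have "ennreal \<bar>r\<bar> * ennreal (r powr s) = ennreal (\<bar>r\<bar> * r powr s)"
      by (rule ennreal_mult'[symmetric]) simp
    also have "\<bar>r\<bar> * r powr s = r powr (s + 1)" using assms by (simp add: powr_add)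
    finally have "ennreal \<bar>r\<bar> * ennreal (r powr s) = ennreal (r powr (s + 1))" .
    then show ?thesis by (simp only: mult.assoc[symmetric])
  qed
  finally have "ennreal (r powr (- s - 1)) * ennreal (Gamma (s + 1)) = (ennreal (r powr (- s - 1)) * ennreal (r powr (s + 1))) * ?I"
    by (simp only: mult.assoc)
  also have "ennreal (r powr (- s - 1)) * ennreal (r powr (s + 1)) = ennreal (r powr (- s - 1) * r powr (s + 1))"
    by (rule ennreal_mult'[symmetric]) simp
  also have "r powr (- s - 1) * r powr (s + 1) = 1" using assms powr_add[of r "- s - 1" "s + 1"] by simp
  finally have "?I = ennreal (r powr (- s - 1)) * ennreal (Gamma (s + 1))" by simp
  also have "\<dots> = ennreal (r powr (- s - 1) * Gamma (s + 1))" by (rule ennreal_mult'[symmetric]) simp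
  finally show ?thesis by (simp only: mult.commute)
qed

text \<open>Tonelli in the exponential representation of 1 / (y + t): the t-integral becomes a Gamma
  integral at scale r. Working with nonnegative integrals makes integrability a result instead of a
  premise.\<close>

lemma stieltjes_nn:
  assumes "s > -1" "y > 0"
  shows "(\<integral>\<^sup>+ t. ennreal (indicator {0<..} t * (t powr s * exp (- t) / (y + t))) \<partial>lborel)
    = (\<integral>\<^sup>+ r. ennreal (indicator {1..} r * (Gamma (s + 1) * exp y * (r powr (- s - 1) * exp (- (y * r))))) \<partial>lborel)"
proof -
  let ?F = "\<lambda>t r. ennreal (indicator {0<..} t * indicator {1..} r * (t powr s * exp (- (t * r)) * exp (- (y * (r - 1)))))"
  have "(\<integral>\<^sup>+ t. ennreal (indicator {0<..} t * (t powr s * exp (- t) / (y + t))) \<partial>lborel)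
     = (\<integral>\<^sup>+ t. \<integral>\<^sup>+ r. ?F t r \<partial>lborel \<partial>lborel)"
  proof (rule nn_integral_cong)
    fix t :: real
    have "(\<integral>\<^sup>+ r. ?F t r \<partial>lborel) = ennreal (indicator {0<..} t * (t powr s * exp (- t))) * (\<integral>\<^sup>+ r. ennreal (indicator {1..} r * exp (- ((y + t) * (r - 1)))) \<partial>lborel)"
    proof (rule nn_integral_ennreal_cmult)
      fix r
      have "- (t * r) + - (y * (r - 1)) = - t + - ((y + t) * (r - 1))" by (simp add: algebra_simps)
      then have "exp (- (t * r)) * exp (- (y * (r - 1))) = exp (- t) * exp (- ((y + t) * (r - 1)))"
        by (simp only: exp_add[symmetric])
      then show "indicator {0<..} t * indicator {1..} r * (t powr s * exp (- (t * r)) * exp (- (y * (r - 1))))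
          = indicator {0<..} t * (t powr s * exp (- t)) * (indicator {1..} r * exp (- ((y + t) * (r - 1))))"
        by (simp only: mult.assoc) (simp only: mult.left_commute mult.commute)
    qed auto
    also have "\<dots> = ennreal (indicator {0<..} t * (t powr s * exp (- t) / (y + t)))"
    proof (cases "t > 0")
      case True
      then show ?thesis using nn_integral_exp_shift[of "y + t"] assms by (simp add: ennreal_mult'[symmetric])
    qed simp
    finally show "ennreal (indicator {0<..} t * (t powr s * exp (- t) / (y + t))) = (\<integral>\<^sup>+ r. ?F t r \<partial>lborel)" by simp
  qed
  also have "\<dots> = (\<integral>\<^sup>+ r. \<integral>\<^sup>+ t. ?F t r \<partial>lborel \<partial>lborel)"
    by (subst lborel_pair.Fubini') auto
  also have "\<dots> = (\<integral>\<^sup>+ r. ennreal (indicator {1..} r * (Gamma (s + 1) * exp y * (r powr (- s - 1) * exp (- (y * r))))) \<partial>lborel)"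
  proof (rule nn_integral_cong)
    fix r :: real
    have "(\<integral>\<^sup>+ t. ?F t r \<partial>lborel) = ennreal (indicator {1..} r * exp (- (y * (r - 1)))) * (\<integral>\<^sup>+ t. ennreal (indicator {0<..} t * (t powr s * exp (- (t * r)))) \<partial>lborel)"
      by (rule nn_integral_ennreal_cmult) auto
    also have "\<dots> = ennreal (indicator {1..} r * (Gamma (s + 1) * exp y * (r powr (- s - 1) * exp (- (y * r)))))"
    proof (cases "r \<ge> 1")
      case True
      have "exp (- (y * (r - 1))) = exp y * exp (- (y * r))"
        by (simp only: exp_add[symmetric]) (simp add: algebra_simps)
      then have R: "indicator {1..} r * (Gamma (s + 1) * exp y * (r powr (- s - 1) * exp (- (y * r)))) = indicator {1..} r * exp (- (y * (r - 1))) * (Gamma (s + 1) * r powr (- s - 1))"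
        by simp
      have r0: "r > 0" using True by simp
      show ?thesis
        unfolding R nn_integral_powr_exp[OF assms(1) r0] by (rule ennreal_mult'[symmetric]) simp
    qed simp
    finally show "(\<integral>\<^sup>+ t. ?F t r \<partial>lborel) = ennreal (indicator {1..} r * (Gamma (s + 1) * exp y * (r powr (- s - 1) * exp (- (y * r)))))" .
  qed
  finally show ?thesis .
qed

lemma integrable_upper_gamma_scaled:
  fixes y s :: real
  assumes "y > 0" shows "set_integrable lborel {1..} (\<lambda>r. r powr (- s - 1) * exp (- (y * r)))"
proof -
  have i: "integrable lborel (\<lambda>t. indicator {y..} t *\<^sub>R (t powr (- s - 1) * exp (- t)))"
    using integrable_upper_gamma[OF assms] by (simp add: set_integrable_def)
  have "integrable lborel (\<lambda>r. y powr (s + 1) * (indicator {y..} (0 + y * r) *\<^sub>R ((0 + y * r) powr (- s - 1) * exp (- (0 + y * r)))))"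
    using lborel_integrable_real_affine[OF i, of y 0] assms by (intro integrable_mult_right) auto
  moreover have "(\<lambda>r. y powr (s + 1) * (indicator {y..} (0 + y * r) *\<^sub>R ((0 + y * r) powr (- s - 1) * exp (- (0 + y * r)))))
     = (\<lambda>r. indicator {1..} r *\<^sub>R (r powr (- s - 1) * exp (- (y * r))))"
  proof
    fix r :: real
    have e: "y powr (s + 1) * y powr (- s - 1) = 1" using assms powr_add[of y "s + 1" "- s - 1"] by simp
    show "y powr (s + 1) * (indicator {y..} (0 + y * r) *\<^sub>R ((0 + y * r) powr (- s - 1) * exp (- (0 + y * r))))
      = indicator {1..} r *\<^sub>R (r powr (- s - 1) * exp (- (y * r)))"
    proof (cases "r \<ge> 1")
      case True
      then have "(y * r) powr (- s - 1) = y powr (- s - 1) * r powr (- s - 1)" using assms by (simp add: powr_mult)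
      then have "y powr (s + 1) * ((y * r) powr (- s - 1) * exp (- (y * r))) = (y powr (s + 1) * y powr (- s - 1)) * (r powr (- s - 1) * exp (- (y * r)))"
        by (simp only: mult.assoc)
      then show ?thesis using True assms unfolding e by simp
    qed (use assms in simp)
  qed
  ultimately show ?thesis unfolding set_integrable_def by (simp only:)
qed

text \<open>The same incomplete Gamma function arises as a loop integral in
  \<open>cloop_Gamma_powr_pole\<close>; this match brings the Stieltjes transforms within reach of
  the contour representation.\<close>

lemma stieltjes_eq:
  assumes "s > -1" "y > 0"
  shows "set_integrable lborel {0<..} (\<lambda>t. t powr s * exp (- t) / (y + t))"
    and "stieltjes s y = Gamma (s + 1) * exp y * upper_gamma_scaled s y"
proof -
  let ?g = "\<lambda>r. indicator {1..} r * (Gamma (s + 1) * exp y * (r powr (- s - 1) * exp (- (y * r))))"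
  have G: "Gamma (s + 1) > 0" using assms by (intro Gamma_real_pos) simp
  have e: "?g = (\<lambda>r. Gamma (s + 1) * exp y * (indicator {1..} r *\<^sub>R (r powr (- s - 1) * exp (- (y * r)))))"
    by (auto simp: fun_eq_iff)
  have gi: "integrable lborel ?g"
    unfolding e using integrable_upper_gamma_scaled[OF assms(2), of s] unfolding set_integrable_def by (rule integrable_mult_right)
  have gv: "integral\<^sup>L lborel ?g = Gamma (s + 1) * exp y * upper_gamma_scaled s y"
    unfolding e upper_gamma_scaled_def set_lebesgue_integral_def by (rule integral_mult_right_zero)
  have "(\<integral>\<^sup>+ t. ennreal (indicator {0<..} t * (t powr s * exp (- t) / (y + t))) \<partial>lborel) = ennreal (integral\<^sup>L lborel ?g)"
    unfolding stieltjes_nn[OF assms] using G by (intro nn_integral_eq_integral gi AE_I2) (auto simp: indicator_def)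
  moreover have "0 \<le> integral\<^sup>L lborel ?g" using G by (intro integral_nonneg_AE AE_I2) (auto simp: indicator_def)
  ultimately have "has_bochner_integral lborel (\<lambda>t. indicator {0<..} t * (t powr s * exp (- t) / (y + t))) (integral\<^sup>L lborel ?g)"
    using assms by (intro has_bochner_integral_nn_integral AE_I2) (auto simp: indicator_def)
  then show "set_integrable lborel {0<..} (\<lambda>t. t powr s * exp (- t) / (y + t))"
    and "stieltjes s y = Gamma (s + 1) * exp y * upper_gamma_scaled s y"
    unfolding gv by (simp_all add: set_integrable_def stieltjes_def set_lebesgue_integral_def has_bochner_integral_iff)
qed

text \<open>The origin of the Cauchy matrix: exp (- x) cancels the exp x of the Stieltjes transform,
  the x-integral is a Gamma integral at scale r, and r powr (- s - q - 2) integrates over [1,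
  \<infinity>) to 1 / (s + q + 1).\<close>

lemma cauchy_moment:
  assumes "s > -1" "q > -1" "s + q > -1"
  shows "set_integrable lborel {0<..} (\<lambda>x. x powr q * exp (- x) * stieltjes s x)"
    and "(LINT x:{0<..}|lborel. x powr q * exp (- x) * stieltjes s x) = Gamma (q + 1) * Gamma (s + 1) / (s + q + 1)"
proof -
  have G: "Gamma (s + 1) > 0" "Gamma (q + 1) > 0" using assms by (auto intro!: Gamma_real_pos)
  let ?V = "Gamma (q + 1) * Gamma (s + 1) / (s + q + 1)"
  let ?F = "\<lambda>x r. ennreal (indicator {0<..} x * indicator {1..} r * (Gamma (s + 1) * (x powr q * exp (- (x * r))) * r powr (- s - 1)))"
  have ug: "ennreal (upper_gamma_scaled s x) = (\<integral>\<^sup>+ r. ennreal (indicator {1..} r * (r powr (- s - 1) * exp (- (x * r)))) \<partial>lborel)" if "x > 0" for x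
    unfolding upper_gamma_scaled_def set_lebesgue_integral_def
    using integrable_upper_gamma_scaled[OF that, of s] unfolding set_integrable_def
    by (subst nn_integral_eq_integral[symmetric]) (auto simp: indicator_def)
  have nnu: "0 \<le> upper_gamma_scaled s x" for x
    unfolding upper_gamma_scaled_def set_lebesgue_integral_def by (intro integral_nonneg_AE AE_I2) auto
  have "(\<integral>\<^sup>+ x. ennreal (indicator {0<..} x * (x powr q * exp (- x) * stieltjes s x)) \<partial>lborel) = (\<integral>\<^sup>+ x. \<integral>\<^sup>+ r. ?F x r \<partial>lborel \<partial>lborel)"
  proof (rule nn_integral_cong)
    fix x :: real
    show "ennreal (indicator {0<..} x * (x powr q * exp (- x) * stieltjes s x)) = (\<integral>\<^sup>+ r. ?F x r \<partial>lborel)"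
    proof (cases "x > 0")
      case True
      have *: "x powr q * exp (- x) * stieltjes s x = Gamma (s + 1) * x powr q * upper_gamma_scaled s x"
        unfolding stieltjes_eq(2)[OF assms(1) True] by (simp add: exp_minus field_simps)
      have "ennreal (indicator {0<..} x * (x powr q * exp (- x) * stieltjes s x)) = ennreal (Gamma (s + 1) * x powr q) * ennreal (upper_gamma_scaled s x)"
      proof -
        have "0 \<le> Gamma (s + 1) * x powr q" using G by simp
        with * True show ?thesis by (simp only: ennreal_mult'[symmetric] indicator_simps greaterThan_iff mult_1)
      qed
      also have "\<dots> = (\<integral>\<^sup>+ r. ?F x r \<partial>lborel)"
        unfolding ug[OF True] using True G by (intro nn_integral_ennreal_cmult[symmetric]) auto
      finally show ?thesis .
    qed simp
  qed
  also have "\<dots> = (\<integral>\<^sup>+ r. \<integral>\<^sup>+ x. ?F x r \<partial>lborel \<partial>lborel)"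
    by (subst lborel_pair.Fubini') auto
  also have "\<dots> = (\<integral>\<^sup>+ r. ennreal (indicator {1..} r * (Gamma (s + 1) * Gamma (q + 1) * r powr (- s - q - 2))) \<partial>lborel)"
  proof (rule nn_integral_cong)
    fix r :: real
    have "(\<integral>\<^sup>+ x. ?F x r \<partial>lborel) = ennreal (indicator {1..} r * Gamma (s + 1) * r powr (- s - 1)) * (\<integral>\<^sup>+ x. ennreal (indicator {0<..} x * (x powr q * exp (- (x * r)))) \<partial>lborel)"
      by (rule nn_integral_ennreal_cmult) (use G in auto)
    also have "\<dots> = ennreal (indicator {1..} r * (Gamma (s + 1) * Gamma (q + 1) * r powr (- s - q - 2)))"
    proof (cases "r \<ge> 1")
      case True
      have "r powr (- s - 1) * r powr (- q - 1) = r powr (- s - q - 2)"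
      proof -
        have "- s - 1 + (- q - 1) = - s - q - 2" by simp
        then show ?thesis by (simp only: powr_add[symmetric])
      qed
      then have R: "indicator {1..} r * (Gamma (s + 1) * Gamma (q + 1) * r powr (- s - q - 2)) = (indicator {1..} r * Gamma (s + 1) * r powr (- s - 1)) * (Gamma (q + 1) * r powr (- q - 1))"
        by (simp add: mult_ac)
      have r0: "r > 0" using True by simp
      show ?thesis
        unfolding R nn_integral_powr_exp[OF assms(2) r0] by (rule ennreal_mult'[symmetric]) (use G in simp)
    qed simp
    finally show "(\<integral>\<^sup>+ x. ?F x r \<partial>lborel) = ennreal (indicator {1..} r * (Gamma (s + 1) * Gamma (q + 1) * r powr (- s - q - 2)))" .
  qed
  also have "\<dots> = ennreal ?V"
  proof (rule nn_integral_has_integral_lborel)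
    have "((\<lambda>r. r powr (- s - q - 2)) has_integral - (1 powr (- s - q - 2 + 1)) / (- s - q - 2 + 1)) {1..}"
      by (rule has_integral_powr_to_inf) (use assms in auto)
    moreover have "- (1 powr (- s - q - 2 + 1)) / (- s - q - 2 + 1) = 1 / (s + q + 1)"
    proof -
      have "- s - q - 2 + 1 = - (s + q + 1)" by simp
      moreover have "- 1 / - d = 1 / d" for d :: real by simp
      ultimately show ?thesis by (simp only: powr_one_eq_one)
    qed
    ultimately have "((\<lambda>r. r powr (- s - q - 2)) has_integral 1 / (s + q + 1)) {1..}" by simp
    from has_integral_mult_right[OF this, of "Gamma (s + 1) * Gamma (q + 1)"]
    have "((\<lambda>r. Gamma (s + 1) * Gamma (q + 1) * r powr (- s - q - 2)) has_integral ?V) {1..}" by (simp add: mult_ac)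
    then show "((\<lambda>r. indicator {1..} r * (Gamma (s + 1) * Gamma (q + 1) * r powr (- s - q - 2))) has_integral ?V) UNIV"
      by (rule has_integral_indicator_UNIV[THEN iffD1])
  qed (use G in auto)
  finally have nn: "(\<integral>\<^sup>+ x. ennreal (indicator {0<..} x * (x powr q * exp (- x) * stieltjes s x)) \<partial>lborel) = ennreal ?V" .
  have "has_bochner_integral lborel (\<lambda>x. indicator {0<..} x * (x powr q * exp (- x) * stieltjes s x)) ?V"
  proof (rule has_bochner_integral_nn_integral[OF _ _ _ nn])
    have "stieltjes s \<in> borel_measurable borel"
      unfolding stieltjes_def set_lebesgue_integral_def by measurable
    then show "(\<lambda>x. indicator {0<..} x * (x powr q * exp (- x) * stieltjes s x)) \<in> borel_measurable lborel" by measurable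
    show "AE x in lborel. 0 \<le> indicator {0<..} x * (x powr q * exp (- x) * stieltjes s x)"
      using G nnu by (intro AE_I2) (auto simp: indicator_def stieltjes_eq(2)[OF assms(1)])
    show "0 \<le> ?V" using G assms by auto
  qed
  then show "set_integrable lborel {0<..} (\<lambda>x. x powr q * exp (- x) * stieltjes s x)"
    and "(LINT x:{0<..}|lborel. x powr q * exp (- x) * stieltjes s x) = ?V"
    by (simp_all add: set_integrable_def set_lebesgue_integral_def has_bochner_integral_iff)
qed

lemma poly_eq_sum_lessThan:
  fixes p :: "real poly"
  assumes "degree p < n" shows "poly p x = (\<Sum>i<n. coeff p i * x ^ i)"
  unfolding poly_altdef by (rule sum.mono_neutral_left) (use assms in \<open>auto simp: coeff_eq_0\<close>)

lemma stieltjes_power: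
  assumes "b > -1" "y > 0"
  shows "set_integrable lborel {0<..} (\<lambda>t. t ^ k * (t powr b * exp (- t) / (y + t)))"
    and "(LINT t:{0<..}|lborel. t ^ k * (t powr b * exp (- t) / (y + t))) = stieltjes (b + real k) y"
proof -
  have s: "b + real k > -1" using assms by simp
  have e: "indicator {0<..} t *\<^sub>R (t ^ k * (t powr b * exp (- t) / (y + t))) = indicator {0<..} t *\<^sub>R (t powr (b + real k) * exp (- t) / (y + t))" for t :: real
    by (cases "t > 0") (simp_all add: powr_add powr_realpow)
  show "set_integrable lborel {0<..} (\<lambda>t. t ^ k * (t powr b * exp (- t) / (y + t)))"
    using stieltjes_eq(1)[OF s assms(2)] unfolding set_integrable_def e .
  show "(LINT t:{0<..}|lborel. t ^ k * (t powr b * exp (- t) / (y + t))) = stieltjes (b + real k) y"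
    unfolding stieltjes_def set_lebesgue_integral_def e ..
qed

lemma stieltjes_poly:
  assumes "b > -1" "y > 0"
  shows "set_integrable lborel {0<..} (\<lambda>t. (\<Sum>k<n. c k * t ^ k) * (t powr b * exp (- t) / (y + t)))"
    and "(LBINT t=0..\<infinity>. (\<Sum>k<n. c k * t ^ k) * (t powr b * exp (- t) / (y + t))) = (\<Sum>k<n. c k * stieltjes (b + real k) y)"
proof -
  have e: "indicator {0<..} t *\<^sub>R ((\<Sum>k<n. c k * t ^ k) * (t powr b * exp (- t) / (y + t)))
     = (\<Sum>k<n. c k * (indicator {0<..} t *\<^sub>R (t ^ k * (t powr b * exp (- t) / (y + t)))))" for t :: real
    unfolding sum_distrib_right scaleR_sum_right by (intro sum.cong refl) simp
  note i = stieltjes_power(1)[OF assms, unfolded set_integrable_def]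
  show "set_integrable lborel {0<..} (\<lambda>t. (\<Sum>k<n. c k * t ^ k) * (t powr b * exp (- t) / (y + t)))"
    unfolding set_integrable_def e by (intro Bochner_Integration.integrable_sum integrable_mult_right i)
  show "(LBINT t=0..\<infinity>. (\<Sum>k<n. c k * t ^ k) * (t powr b * exp (- t) / (y + t))) = (\<Sum>k<n. c k * stieltjes (b + real k) y)"
    unfolding interval_lebesgue_integral_0_infty set_lebesgue_integral_def e
    by (subst Bochner_Integration.integral_sum, intro integrable_mult_right i)
       (simp only: integral_mult_right_zero stieltjes_power(2)[OF assms, unfolded set_lebesgue_integral_def])
qed

lemma LBINT_0_infty_cong:
  fixes f g :: "real \<Rightarrow> real"
  assumes "\<And>x. x > 0 \<Longrightarrow> f x = g x"
  shows "(LBINT x=0..\<infinity>. f x) = (LBINT x=0..\<infinity>. g x)"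
  unfolding interval_lebesgue_integral_0_infty set_lebesgue_integral_def
  by (intro Bochner_Integration.integral_cong refl) (auto simp: indicator_def assms)

lemma biorthogonality_moment:
  fixes P Q :: "real poly"
  assumes "a > -1" "b > -1" "a + b > -1" "degree P < n" "degree Q < n"
  shows "(LBINT x=0..\<infinity>. (LBINT y=0..\<infinity>. x powr a * y powr b * exp (- x - y) / (x + y) * poly P x * poly Q y))
    = (\<Sum>j<n. \<Sum>k<n. coeff P j * coeff Q k * (Gamma (a + real j + 1) * Gamma (b + real k + 1) / (real j + real k + a + b + 1)))"
proof -
  have "(LBINT x=0..\<infinity>. (LBINT y=0..\<infinity>. x powr a * y powr b * exp (- x - y) / (x + y) * poly P x * poly Q y))
      = (LBINT x=0..\<infinity>. (\<Sum>j<n. \<Sum>k<n. coeff P j * coeff Q k * (x powr (a + real j) * exp (- x) * stieltjes (b + real k) x)))"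
  proof (rule LBINT_0_infty_cong)
    fix x :: real assume x: "x > 0"
    have "(LBINT y=0..\<infinity>. x powr a * y powr b * exp (- x - y) / (x + y) * poly P x * poly Q y)
        = (LBINT y=0..\<infinity>. (x powr a * exp (- x) * poly P x) * ((\<Sum>k<n. coeff Q k * y ^ k) * (y powr b * exp (- y) / (x + y))))"
      by (intro LBINT_0_infty_cong) (simp add: poly_eq_sum_lessThan[OF assms(5)] exp_diff exp_minus divide_inverse)
    also have "\<dots> = (x powr a * exp (- x) * poly P x) * (\<Sum>k<n. coeff Q k * stieltjes (b + real k) x)"
      by (subst interval_lebesgue_integral_mult_right) (simp only: stieltjes_poly(2)[OF assms(2) x])
    also have "\<dots> = (\<Sum>j<n. \<Sum>k<n. coeff P j * coeff Q k * (x powr (a + real j) * exp (- x) * stieltjes (b + real k) x))"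
      unfolding poly_eq_sum_lessThan[OF assms(4)] sum_distrib_left sum_distrib_right
      using x by (subst sum.swap) (intro sum.cong refl, simp add: powr_add powr_realpow)
    finally show "(LBINT y=0..\<infinity>. x powr a * y powr b * exp (- x - y) / (x + y) * poly P x * poly Q y)
        = (\<Sum>j<n. \<Sum>k<n. coeff P j * coeff Q k * (x powr (a + real j) * exp (- x) * stieltjes (b + real k) x))" .
  qed
  also have "\<dots> = (\<Sum>j<n. \<Sum>k<n. coeff P j * coeff Q k * (Gamma (a + real j + 1) * Gamma (b + real k + 1) / (real j + real k + a + b + 1)))"
  proof -
    have e: "indicator {0<..} x *\<^sub>R (\<Sum>j<n. \<Sum>k<n. coeff P j * coeff Q k * (x powr (a + real j) * exp (- x) * stieltjes (b + real k) x))
       = (\<Sum>j<n. \<Sum>k<n. coeff P j * coeff Q k * (indicator {0<..} x *\<^sub>R (x powr (a + real j) * exp (- x) * stieltjes (b + real k) x)))" for x :: real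
      unfolding scaleR_sum_right by (intro sum.cong refl) simp
    have h: "b + real k > -1" "a + real j > -1" "b + real k + (a + real j) > -1" for j k
      using assms by auto
    note m = cauchy_moment[OF h, unfolded set_integrable_def set_lebesgue_integral_def]
    show ?thesis
      unfolding interval_lebesgue_integral_0_infty set_lebesgue_integral_def e
      by (subst Bochner_Integration.integral_sum; (intro Bochner_Integration.integrable_sum integrable_mult_right m(1))?)
         (intro sum.cong refl, subst Bochner_Integration.integral_sum, intro integrable_mult_right m(1),
          intro sum.cong refl, simp only: integral_mult_right_zero m(2), simp add: add_ac)
  qed
  finally show ?thesis .
qed

section \<open>Coefficients and expansions of the finite kernels\<close>

definition kernel_coeff :: "real \<Rightarrow> real \<Rightarrow> nat \<Rightarrow> nat \<Rightarrow> nat \<Rightarrow> real" where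
  "kernel_coeff a b n k l = cauchy_inv (a + b) n k l / (Gamma (a + real k + 1) * Gamma (b + real l + 1))"

text \<open>The coefficient matrices \<open>P\<close>, \<open>Q\<close> of the biorthonormal families satisfy \<open>P M Q\<^sup>T = 1\<close> for the
  moment matrix \<open>M\<close>, hence \<open>Q\<^sup>T P\<close> is the inverse of \<open>M\<close>, a diagonally scaled Cauchy matrix.\<close>

lemma kernel_coeff_eq:
  assumes "a > -1" "b > -1" "a + b > -1" "cauchy_laguerre_biorthonormal a b p q" "k < n" "l < n"
  shows "(\<Sum>j<n. coeff (p j) k * coeff (q j) l) = kernel_coeff a b n k l"
proof -
  define M where "M = Matrix.mat n n (\<lambda>(i, j). Gamma (a + real i + 1) * Gamma (b + real j + 1) / (real i + real j + a + b + 1))"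
  define P where "P = Matrix.mat n n (\<lambda>(i, j). coeff (p i) j)"
  define Q where "Q = Matrix.mat n n (\<lambda>(i, j). coeff (q j) i)"
  \<comment> \<open>The indices are transposed because the rows of Q P belong to the powers of y and
    its columns to those of x.\<close>
  define B where "B = Matrix.mat n n (\<lambda>(i, j). kernel_coeff a b n j i)"
  have c: "M \<in> carrier_mat n n" "P \<in> carrier_mat n n" "Q \<in> carrier_mat n n" "B \<in> carrier_mat n n"
    by (simp_all add: M_def P_def Q_def B_def)
  have deg: "degree (p j) = j" "degree (q j) = j" for j
    using assms(4) by (auto simp: cauchy_laguerre_biorthonormal_def)
  have bi: "(LBINT x=0..\<infinity>. (LBINT y=0..\<infinity>. x powr a * y powr b * exp (- x - y) / (x + y) * poly (p i) x * poly (q j) y)) = (if i = j then 1 else 0)" for i j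
    using assms(4) by (auto simp: cauchy_laguerre_biorthonormal_def)
  have "P * (M * Q) = 1\<^sub>m n"
  proof (rule eq_matI)
    fix i j assume "i < dim_row (1\<^sub>m n)" "j < dim_col (1\<^sub>m n)"
    then have ij: "i < n" "j < n" by auto
    have "(P * (M * Q)) $$ (i, j) = (\<Sum>s<n. coeff (p i) s * (\<Sum>t<n. Gamma (a + real s + 1) * Gamma (b + real t + 1) / (real s + real t + a + b + 1) * coeff (q j) t))"
      using ij c by (simp add: P_def M_def Q_def scalar_prod_def lessThan_atLeast0)
    also have "\<dots> = (\<Sum>s<n. \<Sum>t<n. coeff (p i) s * coeff (q j) t * (Gamma (a + real s + 1) * Gamma (b + real t + 1) / (real s + real t + a + b + 1)))"
      unfolding sum_distrib_left by (intro sum.cong refl) simp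
    also have "\<dots> = (if i = j then 1 else 0)"
      unfolding bi[symmetric] by (rule biorthogonality_moment[symmetric]) (use assms ij deg in auto)
    finally show "(P * (M * Q)) $$ (i, j) = 1\<^sub>m n $$ (i, j)" using ij by simp
  qed (use c in auto)
  \<comment> \<open>A one-sided inverse of a square matrix is two-sided, which moves P to the right
    of M Q.\<close>
  then have "(M * Q) * P = 1\<^sub>m n" using c by (intro mat_mult_left_right_inverse[of P n]) auto
  then have MQP: "M * (Q * P) = 1\<^sub>m n" using c by (simp add: assoc_mult_mat[of M n n Q n P n])
  have "B * M = 1\<^sub>m n"
  proof (rule eq_matI)
    fix i j assume "i < dim_row (1\<^sub>m n)" "j < dim_col (1\<^sub>m n)"
    then have ij: "i < n" "j < n" by auto
    have G: "Gamma (a + real s + 1) > 0" "Gamma (b + real s + 1) > 0" for s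
      using assms by (auto intro!: Gamma_real_pos)
    have "(B * M) $$ (i, j) = (\<Sum>s<n. kernel_coeff a b n s i * (Gamma (a + real s + 1) * Gamma (b + real j + 1) / (real s + real j + a + b + 1)))"
      using ij c by (simp add: B_def M_def scalar_prod_def lessThan_atLeast0)
    also have "\<dots> = (\<Sum>s<n. Gamma (b + real j + 1) / Gamma (b + real i + 1) * (cauchy_inv (a + b) n s i / (real j + real s + (a + b) + 1)))"
    proof (intro sum.cong refl)
      fix s
      have e: "real s + real j + a + b + 1 = real j + real s + (a + b) + 1" by simp
      show "kernel_coeff a b n s i * (Gamma (a + real s + 1) * Gamma (b + real j + 1) / (real s + real j + a + b + 1))
          = Gamma (b + real j + 1) / Gamma (b + real i + 1) * (cauchy_inv (a + b) n s i / (real j + real s + (a + b) + 1))"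
        unfolding e kernel_coeff_def using less_imp_neq[OF G(1)[of s]] by simp
    qed
    also have "\<dots> = Gamma (b + real j + 1) / Gamma (b + real i + 1) * (if j = i then 1 else 0)"
      unfolding sum_distrib_left[symmetric] cauchy_inv_inverse[OF assms(3) ij] ..
    also have "\<dots> = 1\<^sub>m n $$ (i, j)" using ij less_imp_neq[OF G(2)[of i]] by auto
    finally show "(B * M) $$ (i, j) = 1\<^sub>m n $$ (i, j)" .
  qed (use c in auto)
  \<comment> \<open>The left inverse B and the right inverse Q P of M coincide.\<close>
  then have "Q * P = B * M * (Q * P)" using c by simp
  also have "\<dots> = B * (M * (Q * P))" using c by (intro assoc_mult_mat) auto
  also have "\<dots> = B" unfolding MQP using c by simp
  finally have "(Q * P) $$ (l, k) = B $$ (l, k)" by simp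
  then show ?thesis
    using assms(5,6) c by (simp add: Q_def P_def B_def scalar_prod_def lessThan_atLeast0 mult.commute)
qed

lemma K00_expansion:
  assumes "a > -1" "b > -1" "a + b > -1" "cauchy_laguerre_biorthonormal a b p q"
  shows "K00 p q n x y = (\<Sum>l<n. (\<Sum>k<n. kernel_coeff a b n k l * x ^ k) * y ^ l)"
proof -
  have deg: "degree (p j) = j" "degree (q j) = j" for j
    using assms(4) by (auto simp: cauchy_laguerre_biorthonormal_def)
  have "K00 p q n x y = (\<Sum>j<n. (\<Sum>k<n. coeff (p j) k * x ^ k) * (\<Sum>l<n. coeff (q j) l * y ^ l))"
    unfolding K00_def by (intro sum.cong refl) (simp add: poly_eq_sum_lessThan[of _ n] deg)
  also have "\<dots> = (\<Sum>j<n. \<Sum>l<n. \<Sum>k<n. coeff (p j) k * coeff (q j) l * (x ^ k * y ^ l))"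
    unfolding sum_distrib_left sum_distrib_right by (intro sum.cong refl) simp
  also have "\<dots> = (\<Sum>l<n. \<Sum>j<n. \<Sum>k<n. coeff (p j) k * coeff (q j) l * (x ^ k * y ^ l))"
    by (rule sum.swap)
  also have "\<dots> = (\<Sum>l<n. \<Sum>k<n. \<Sum>j<n. coeff (p j) k * coeff (q j) l * (x ^ k * y ^ l))"
    by (intro sum.cong refl sum.swap)
  also have "\<dots> = (\<Sum>l<n. \<Sum>k<n. kernel_coeff a b n k l * (x ^ k * y ^ l))"
    unfolding sum_distrib_right[symmetric] by (intro sum.cong refl) (simp add: kernel_coeff_eq[OF assms])
  also have "\<dots> = (\<Sum>l<n. (\<Sum>k<n. kernel_coeff a b n k l * x ^ k) * y ^ l)"
    unfolding sum_distrib_right by (intro sum.cong refl) simp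
  finally show ?thesis .
qed

lemma K01_expansion:
  assumes "a > -1" "b > -1" "a + b > -1" "cauchy_laguerre_biorthonormal a b p q" "y > 0"
  shows "K01 b p q n x y = (\<Sum>l<n. (\<Sum>k<n. kernel_coeff a b n k l * x ^ k) * stieltjes (b + real l) y)"
  unfolding K01_def K00_expansion[OF assms(1-4)] by (rule stieltjes_poly(2)[OF assms(2,5)])

lemma K10_expansion:
  assumes "a > -1" "b > -1" "a + b > -1" "cauchy_laguerre_biorthonormal a b p q" "x > 0"
  shows "K10 a p q n x y = (\<Sum>k<n. (\<Sum>l<n. kernel_coeff a b n k l * y ^ l) * stieltjes (a + real k) x)"
proof -
  have "(\<Sum>l<n. (\<Sum>k<n. kernel_coeff a b n k l * x ^ k) * y ^ l) = (\<Sum>k<n. (\<Sum>l<n. kernel_coeff a b n k l * y ^ l) * x ^ k)" for x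
    unfolding sum_distrib_right by (subst sum.swap) (intro sum.cong refl, simp)
  then show ?thesis
    unfolding K10_def K00_expansion[OF assms(1-4)] by (simp only: stieltjes_poly(2)[OF assms(1,5)])
qed

text \<open>The inner integral is \<open>K01\<close> at x' times a factor in x'. As
  \<open>K01\<close> is again a polynomial in x', the one-variable formula applies a second
  time.\<close>

lemma K11_expansion:
  assumes "a > -1" "b > -1" "a + b > -1" "cauchy_laguerre_biorthonormal a b p q" "x > 0" "y > 0"
  shows "K11 a b p q n x y = (\<Sum>k<n. (\<Sum>l<n. kernel_coeff a b n k l * stieltjes (b + real l) y) * stieltjes (a + real k) x) - 1 / (x + y)"
proof -
  have "(LBINT y'=0..\<infinity>. K00 p q n x' y' * (x' powr a * exp (- x') / (x + x')) * (y' powr b * exp (- y') / (y + y')))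
     = (\<Sum>k<n. (\<Sum>l<n. kernel_coeff a b n k l * stieltjes (b + real l) y) * x' ^ k) * (x' powr a * exp (- x') / (x + x'))" for x'
  proof -
    have "(LBINT y'=0..\<infinity>. K00 p q n x' y' * (x' powr a * exp (- x') / (x + x')) * (y' powr b * exp (- y') / (y + y')))
       = (LBINT y'=0..\<infinity>. (x' powr a * exp (- x') / (x + x')) * (K00 p q n x' y' * (y' powr b * exp (- y') / (y + y'))))"
      by (intro LBINT_0_infty_cong) simp
    also have "\<dots> = (x' powr a * exp (- x') / (x + x')) * K01 b p q n x' y"
      unfolding K01_def by (rule interval_lebesgue_integral_mult_right)
    also have "K01 b p q n x' y = (\<Sum>k<n. (\<Sum>l<n. kernel_coeff a b n k l * stieltjes (b + real l) y) * x' ^ k)"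
      unfolding K01_expansion[OF assms(1-4,6)] sum_distrib_right by (subst sum.swap) (intro sum.cong refl, simp)
    finally show ?thesis by (simp only: mult.commute)
  qed
  then show ?thesis
    unfolding K11_def by (simp only: stieltjes_poly(2)[OF assms(1,5)])
qed

text \<open>The Boolean is the kernel index: \<open>True\<close> for 1 (a Stieltjes transform was taken), \<open>False\<close> for 0.\<close>

definition kernel_base :: "bool \<Rightarrow> real \<Rightarrow> real \<Rightarrow> nat \<Rightarrow> real" where
  "kernel_base i c x k = (if i then upper_gamma_scaled (c + real k) x else rGamma (c + real k + 1) * x powr (c + real k))"

text \<open>What remains of the kernels after the Gamma factors have cancelled and the exponentials
  have been pulled out.\<close>

definition kernel_sum :: "bool \<Rightarrow> bool \<Rightarrow> real \<Rightarrow> real \<Rightarrow> nat \<Rightarrow> real \<Rightarrow> real \<Rightarrow> real" where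
  "kernel_sum i j a b n x y = (\<Sum>k<n. \<Sum>l<n. cauchy_inv (a + b) n k l * kernel_base i a x k * kernel_base j b y l)"

lemma kernel_base_False:
  assumes "c > -1" "x > 0"
  shows "x powr c * x ^ k = Gamma (c + real k + 1) * kernel_base False c x k"
proof -
  have "Gamma (c + real k + 1) > 0" using assms by (intro Gamma_real_pos) simp
  then show ?thesis using assms(2) by (simp add: kernel_base_def rGamma_inverse_Gamma powr_add powr_realpow)
qed

lemma kernel_base_True:
  assumes "c > -1" "x > 0"
  shows "stieltjes (c + real k) x = Gamma (c + real k + 1) * exp x * kernel_base True c x k"
  using assms by (simp add: kernel_base_def stieltjes_eq(2))

lemma kernel_coeff_Gamma:
  assumes "a > -1" "b > -1"
  shows "kernel_coeff a b n k l * (Gamma (a + real k + 1) * u) * (Gamma (b + real l + 1) * v) = cauchy_inv (a + b) n k l * u * v"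
proof -
  have "Gamma (a + real k + 1) > 0" "Gamma (b + real l + 1) > 0" using assms by (auto intro!: Gamma_real_pos)
  then show ?thesis by (simp add: kernel_coeff_def)
qed

text \<open>Index 0 contributes the weight exp (- x) or exp (- y), index 1 the growing exponential
  of \<open>stieltjes_eq\<close>. The Gamma factors of the basis functions cancel the diagonal
  scaling in \<open>kernel_coeff\<close>.\<close>

lemma H_expansion:
  assumes "a > -1" "b > -1" "a + b > -1" "cauchy_laguerre_biorthonormal a b p q" "x > 0" "y > 0"
  shows "H00 a b p q n x y = exp (- x - y) * kernel_sum False False a b n x y"
    "H01 a b p q n x y = exp (- x + y) * kernel_sum False True a b n x y"
    "H10 a b p q n x y = exp (x - y) * kernel_sum True False a b n x y"
    "H11 a b p q n x y = exp (x + y) * kernel_sum True True a b n x y - 1 / (x + y)"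
proof -
  note G = kernel_coeff_Gamma[OF assms(1,2)]
  note FA = kernel_base_False[OF assms(1,5)] and FB = kernel_base_False[OF assms(2,6)]
  note TA = kernel_base_True[OF assms(1,5)] and TB = kernel_base_True[OF assms(2,6)]
  have "H00 a b p q n x y = exp (- x - y) * (\<Sum>k<n. \<Sum>l<n. kernel_coeff a b n k l * (x powr a * x ^ k) * (y powr b * y ^ l))"
    unfolding H00_def K00_expansion[OF assms(1-4)] sum_distrib_left sum_distrib_right
    by (subst sum.swap) (intro sum.cong refl, simp)
  then show "H00 a b p q n x y = exp (- x - y) * kernel_sum False False a b n x y"
    unfolding FA FB G kernel_sum_def .
  have "H01 a b p q n x y = exp (- x) * (\<Sum>k<n. \<Sum>l<n. kernel_coeff a b n k l * (x powr a * x ^ k) * stieltjes (b + real l) y)"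
    unfolding H01_def K01_expansion[OF assms(1-4,6)] sum_distrib_left sum_distrib_right
    by (subst sum.swap) (intro sum.cong refl, simp)
  also have "\<dots> = exp (- x) * (\<Sum>k<n. \<Sum>l<n. exp y * (kernel_coeff a b n k l * (Gamma (a + real k + 1) * kernel_base False a x k) * (Gamma (b + real l + 1) * kernel_base True b y l)))"
  proof -
    have "kernel_coeff a b n k l * (x powr a * x ^ k) * stieltjes (b + real l) y
       = exp y * (kernel_coeff a b n k l * (Gamma (a + real k + 1) * kernel_base False a x k) * (Gamma (b + real l + 1) * kernel_base True b y l))" for k l
      unfolding FA TB by simp
    then show ?thesis by (simp only:)
  qed
  also have "\<dots> = exp (- x + y) * kernel_sum False True a b n x y"
    unfolding G kernel_sum_def sum_distrib_left[symmetric] by (simp only: exp_add mult.assoc)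
  finally show "H01 a b p q n x y = exp (- x + y) * kernel_sum False True a b n x y" .
  have "H10 a b p q n x y = exp (- y) * (\<Sum>k<n. \<Sum>l<n. kernel_coeff a b n k l * stieltjes (a + real k) x * (y powr b * y ^ l))"
    unfolding H10_def K10_expansion[OF assms(1-5)] sum_distrib_left sum_distrib_right
    by (intro sum.cong refl) simp
  also have "\<dots> = exp (- y) * (\<Sum>k<n. \<Sum>l<n. exp x * (kernel_coeff a b n k l * (Gamma (a + real k + 1) * kernel_base True a x k) * (Gamma (b + real l + 1) * kernel_base False b y l)))"
  proof -
    have "kernel_coeff a b n k l * stieltjes (a + real k) x * (y powr b * y ^ l)
       = exp x * (kernel_coeff a b n k l * (Gamma (a + real k + 1) * kernel_base True a x k) * (Gamma (b + real l + 1) * kernel_base False b y l))" for k l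
      unfolding FB TA by simp
    then show ?thesis by (simp only:)
  qed
  also have "\<dots> = exp (x - y) * kernel_sum True False a b n x y"
    unfolding G kernel_sum_def sum_distrib_left[symmetric] by (simp add: exp_diff exp_minus divide_inverse)
  finally show "H10 a b p q n x y = exp (x - y) * kernel_sum True False a b n x y" .
  have "H11 a b p q n x y = (\<Sum>k<n. \<Sum>l<n. kernel_coeff a b n k l * stieltjes (a + real k) x * stieltjes (b + real l) y) - 1 / (x + y)"
    unfolding H11_def K11_expansion[OF assms] sum_distrib_right by (simp only: mult.assoc mult.commute mult.left_commute)
  also have "\<dots> = (\<Sum>k<n. \<Sum>l<n. exp (x + y) * (kernel_coeff a b n k l * (Gamma (a + real k + 1) * kernel_base True a x k) * (Gamma (b + real l + 1) * kernel_base True b y l))) - 1 / (x + y)"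
  proof -
    have "kernel_coeff a b n k l * stieltjes (a + real k) x * stieltjes (b + real l) y
       = exp (x + y) * (kernel_coeff a b n k l * (Gamma (a + real k + 1) * kernel_base True a x k) * (Gamma (b + real l + 1) * kernel_base True b y l))" for k l
      unfolding TA TB by (simp add: exp_add)
    then show ?thesis by (simp only:)
  qed
  also have "\<dots> = exp (x + y) * kernel_sum True True a b n x y - 1 / (x + y)"
    unfolding G kernel_sum_def sum_distrib_left[symmetric] ..
  finally show "H11 a b p q n x y = exp (x + y) * kernel_sum True True a b n x y - 1 / (x + y)" .
qed

subsection \<open>The finite kernels as products of loop integrals\<close>

lemma set_integrable_powr_01:
  fixes e :: real
  assumes "e > -1" shows "set_integrable lborel {0<..<1} (\<lambda>t. t powr e)"
proof -
  have "((\<lambda>t. t powr e) has_integral 1 powr (e + 1) / (e + 1)) {0..1}"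
    using has_integral_powr_from_0[of e 1] assms by simp
  then have "(\<lambda>t. t powr e) absolutely_integrable_on {0..1}"
    by (intro nonnegative_absolutely_integrable_1) auto
  then have "set_integrable lborel {0..1} (\<lambda>t. t powr e)"
    by (auto simp: set_integrable_def integrable_completion)
  then show ?thesis by (rule set_integrable_subset) auto
qed

lemma norm_powr_unit_le:
  assumes "t \<in> {0<..<1}" "Re u \<le> \<sigma>"
  shows "norm (complex_of_real t powr (- u)) \<le> t powr (- \<sigma>)"
  using assms by (simp add: norm_powr_real_powr powr_mono')

text \<open>Fubini with the majorant t powr (- \<rho> - \<sigma>) * |A v|, integrable at t = 0
  because \<sigma> + \<rho> < 1. The general factor \<phi> allows one application per loop.\<close>

lemma mellin_swap:
  fixes A \<phi> l :: "real \<Rightarrow> complex"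
  assumes A: "integrable lborel A" and l [measurable]: "l \<in> borel_measurable borel" and \<phi> [measurable]: "\<phi> \<in> borel_measurable borel"
    and le: "\<And>v. Re (l v) \<le> \<sigma>" and bd: "\<And>t. t \<in> {0<..<1} \<Longrightarrow> norm (\<phi> t) \<le> K * t powr (- \<rho>)" and "\<sigma> + \<rho> < 1"
  shows "(LINT t:{0<..<1}|lborel. \<phi> t * (LINT v|lborel. A v * of_real t powr (- l v)))
       = (LINT v|lborel. A v * (LINT t:{0<..<1}|lborel. \<phi> t * of_real t powr (- l v)))"
proof -
  have Am [measurable]: "A \<in> borel_measurable borel" using A by simp
  let ?F = "\<lambda>t v. indicator {0<..<1} t *\<^sub>R (\<phi> t * (A v * of_real t powr (- l v))) :: complex"
  have "integrable (lborel \<Otimes>\<^sub>M lborel) (\<lambda>(t, v). ?F t v)"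
  proof (rule Bochner_Integration.integrable_bound)
    have "integrable lborel (\<lambda>t. \<bar>K\<bar> * (indicator {0<..<1} t *\<^sub>R (t powr (- \<rho> - \<sigma>))))"
      using set_integrable_powr_01[of "- \<rho> - \<sigma>"] assms(6) by (simp add: set_integrable_def)
    from integrable_lborel_prod[OF this integrable_norm[OF A]]
    show "integrable (lborel \<Otimes>\<^sub>M lborel) (\<lambda>(t, v). \<bar>K\<bar> * (indicator {0<..<1} t *\<^sub>R (t powr (- \<rho> - \<sigma>))) * norm (A v))" .
    have "norm (?F t v) \<le> \<bar>K\<bar> * (indicator {0<..<1} t *\<^sub>R (t powr (- \<rho> - \<sigma>))) * norm (A v)" for t v
    proof (cases "t \<in> {0<..<1}")
      case True
      have "norm (\<phi> t) * norm (of_real t powr (- l v) :: complex) \<le> (\<bar>K\<bar> * t powr (- \<rho>)) * t powr (- \<sigma>)"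
      proof (intro mult_mono)
        show "norm (\<phi> t) \<le> \<bar>K\<bar> * t powr (- \<rho>)"
          by (rule order_trans[OF bd[OF True] mult_right_mono[OF abs_ge_self]]) simp
      qed (use True le norm_powr_unit_le in auto)
      also have "\<dots> = \<bar>K\<bar> * t powr (- \<rho> - \<sigma>)" by (simp add: powr_diff powr_minus divide_inverse)
      finally have "norm (\<phi> t) * norm (of_real t powr (- l v) :: complex) * norm (A v) \<le> \<bar>K\<bar> * t powr (- \<rho> - \<sigma>) * norm (A v)"
        by (rule mult_right_mono) simp
      then show ?thesis using True by (simp add: norm_mult mult_ac)
    qed simp
    then show "AE x in lborel \<Otimes>\<^sub>M lborel. norm (case x of (t, v) \<Rightarrow> ?F t v) \<le> norm (case x of (t, v) \<Rightarrow> \<bar>K\<bar> * (indicator {0<..<1} t *\<^sub>R (t powr (- \<rho> - \<sigma>))) * norm (A v))"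
      by (intro AE_I2) (auto intro: order_trans[OF _ abs_ge_self])
  qed measurable
  from lborel_pair.Fubini_integral[OF this]
  have "(LINT v|lborel. LINT t|lborel. ?F t v) = (LINT t|lborel. LINT v|lborel. ?F t v)" .
  moreover have "(LINT v|lborel. ?F t v) = indicator {0<..<1} t *\<^sub>R (\<phi> t * (LINT v|lborel. A v * of_real t powr (- l v)))" for t
    by simp
  moreover have "(LINT t|lborel. ?F t v) = A v * (LINT t:{0<..<1}|lborel. \<phi> t * of_real t powr (- l v))" for v
  proof -
    have "?F t v = A v * (indicator {0<..<1} t *\<^sub>R (\<phi> t * of_real t powr (- l v)))" for t by simp
    then show ?thesis by (simp only: set_lebesgue_integral_def integral_mult_right_zero)
  qed
  ultimately show ?thesis by (simp add: set_lebesgue_integral_def)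
qed

lemma mellin_transform_bound:
  fixes A l :: "real \<Rightarrow> complex"
  assumes A: "integrable lborel A" and [measurable]: "l \<in> borel_measurable borel" and le: "\<And>v. Re (l v) \<le> \<sigma>"
  shows "t \<in> {0<..<1} \<Longrightarrow> norm (LINT v|lborel. A v * of_real t powr (- l v)) \<le> (LINT v|lborel. norm (A v)) * t powr (- \<sigma>)"
    and "(\<lambda>t. LINT v|lborel. A v * of_real t powr (- l v)) \<in> borel_measurable borel"
proof -
  have Am [measurable]: "A \<in> borel_measurable borel" using A by simp
  show "(\<lambda>t. LINT v|lborel. A v * of_real t powr (- l v)) \<in> borel_measurable borel" by measurable
  assume t: "t \<in> {0<..<1}"
  have b: "norm (A v * of_real t powr (- l v)) \<le> norm (A v) * t powr (- \<sigma>)" for v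
    unfolding norm_mult by (intro mult_left_mono norm_powr_unit_le t le) simp
  have "integrable lborel (\<lambda>v. A v * of_real t powr (- l v))"
    by (rule Bochner_Integration.integrable_bound[of _ "\<lambda>v. norm (A v) * t powr (- \<sigma>)"])
       (use A b in \<open>auto intro: order_trans[OF _ abs_ge_self]\<close>)
  then have "norm (LINT v|lborel. A v * of_real t powr (- l v)) \<le> (LINT v|lborel. norm (A v) * t powr (- \<sigma>))"
    using A by (intro Bochner_Integration.integral_norm_bound_integral b) auto
  then show "norm (LINT v|lborel. A v * of_real t powr (- l v)) \<le> (LINT v|lborel. norm (A v)) * t powr (- \<sigma>)"
    by simp
qed

lemma mellin_denominator:
  assumes "Re u \<le> \<sigma>" "Re w \<le> \<sigma>'" "\<sigma> + \<sigma>' < 1"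
  shows "norm (1 / (1 - u - w)) \<le> 1 / (1 - \<sigma> - \<sigma>')" "1 - u - w \<noteq> 0"
proof -
  have "1 - \<sigma> - \<sigma>' \<le> Re (1 - u - w)" using assms by simp
  then have le: "1 - \<sigma> - \<sigma>' \<le> norm (1 - u - w)" using complex_Re_le_cmod order_trans by blast
  then show "norm (1 / (1 - u - w)) \<le> 1 / (1 - \<sigma> - \<sigma>')"
    unfolding norm_divide norm_one using assms by (intro divide_left_mono mult_pos_pos) auto
  show "1 - u - w \<noteq> 0" using le assms by auto
qed

text \<open>The t-integral of t powr (- u - w) is 1 / (1 - u - w) as long as Re u + Re w < 1, which
  the abscissae guarantee. Two successive interchanges turn the product of loop integrals into an
  iterated one.\<close>

lemma mellin_product:
  fixes A B l l' :: "real \<Rightarrow> complex"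
  assumes A: "integrable lborel A" and l [measurable]: "l \<in> borel_measurable borel" and le: "\<And>v. Re (l v) \<le> \<sigma>"
    and B: "integrable lborel B" and l' [measurable]: "l' \<in> borel_measurable borel" and le': "\<And>v. Re (l' v) \<le> \<sigma>'"
    and s: "\<sigma> + \<sigma>' < 1"
  shows "(LINT t:{0<..<1}|lborel. (LINT v|lborel. A v * of_real t powr (- l v)) * (LINT w|lborel. B w * of_real t powr (- l' w)))
       = (LINT w|lborel. B w * (LINT v|lborel. A v * (1 / (1 - l v - l' w))))"
    and "integrable lborel (\<lambda>w. B w * (LINT v|lborel. A v * (1 / (1 - l v - l' w))))"
    and "integrable lborel (\<lambda>v. A v * (1 / (1 - l v - l' w)))"
proof -
  have [measurable]: "A \<in> borel_measurable borel" "B \<in> borel_measurable borel" using A B by auto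
  let ?a = "\<lambda>t. LINT v|lborel. A v * of_real t powr (- l v)"
  note ab = mellin_transform_bound[OF A l le]
  have inner: "(LINT t:{0<..<1}|lborel. ?a t * of_real t powr (- l' w)) = (LINT v|lborel. A v * (1 / (1 - l v - l' w)))" for w
  proof -
    have "(LINT t:{0<..<1}|lborel. ?a t * of_real t powr (- l' w)) = (LINT t:{0<..<1}|lborel. of_real t powr (- l' w) * ?a t)"
      by (simp add: mult.commute)
    also have "\<dots> = (LINT v|lborel. A v * (LINT t:{0<..<1}|lborel. of_real t powr (- l' w) * of_real t powr (- l v)))"
    proof (rule mellin_swap[OF A l _ le])
      show "(\<lambda>t. complex_of_real t powr (- l' w)) \<in> borel_measurable borel" by measurable
      show "norm (complex_of_real t powr (- l' w)) \<le> 1 * t powr (- \<sigma>')" if "t \<in> {0<..<1}" for t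
        using norm_powr_unit_le[OF that le'] by simp
    qed (rule s)
    also have "\<dots> = (LINT v|lborel. A v * (1 / (1 - l v - l' w)))"
    proof (intro Bochner_Integration.integral_cong refl arg_cong2[where f = "(*)"])
      fix v
      define z where "z = 1 - l v - l' w"
      have z: "Re z > 0" using le[of v] le'[of w] s by (simp add: z_def)
      have "(LINT t:{0<..<1}|lborel. of_real t powr (- l' w) * of_real t powr (- l v)) = (LINT t:{0..1}|lborel. of_real t powr (z - 1))"
        unfolding set_lebesgue_integral_def
      proof (rule integral_cong_AE)
        have "AE t in lborel. t \<noteq> 0 \<and> t \<noteq> (1::real)" using AE_lborel_singleton[of 0] AE_lborel_singleton[of 1] by auto
        then show "AE t in lborel. indicator {0<..<1} t *\<^sub>R (of_real t powr (- l' w) * of_real t powr (- l v)) = (indicator {0..1} t *\<^sub>R (of_real t powr (z - 1)) :: complex)"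
        proof eventually_elim
          case (elim t)
          have "- l' w + - l v = z - 1" by (simp add: z_def)
          then have "complex_of_real t powr (- l' w) * of_real t powr (- l v) = of_real t powr (z - 1)"
            using elim by (metis powr_add)
          then show ?case using elim by (auto simp: indicator_def)
        qed
      qed measurable
      also have "\<dots> = 1 / z"
        using set_borel_integral_eq_integral(2)[OF set_integrable_powr_unit(1)[OF z]] integral_unique[OF has_integral_powr_unit[OF z]] by simp
      finally show "(LINT t:{0<..<1}|lborel. of_real t powr (- l' w) * of_real t powr (- l v)) = 1 / (1 - l v - l' w)"
        by (simp add: z_def)
    qed
    finally show ?thesis .
  qed
  show "(LINT t:{0<..<1}|lborel. (LINT v|lborel. A v * of_real t powr (- l v)) * (LINT w|lborel. B w * of_real t powr (- l' w)))
       = (LINT w|lborel. B w * (LINT v|lborel. A v * (1 / (1 - l v - l' w))))"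
    unfolding inner[symmetric]
    by (rule mellin_swap[OF B l' ab(2) le' ab(1)]) (use s in simp_all)
  show i: "integrable lborel (\<lambda>v. A v * (1 / (1 - l v - l' w)))" for w
  proof (rule Bochner_Integration.integrable_bound)
    show "integrable lborel (\<lambda>v. norm (A v) * (1 / (1 - \<sigma> - \<sigma>')))" using A by simp
    show "AE v in lborel. norm (A v * (1 / (1 - l v - l' w))) \<le> norm (norm (A v) * (1 / (1 - \<sigma> - \<sigma>')))"
    proof (intro AE_I2)
      fix v
      have "norm (A v) * norm (1 / (1 - l v - l' w)) \<le> norm (A v) * (1 / (1 - \<sigma> - \<sigma>'))"
        by (intro mult_left_mono mellin_denominator(1)[OF le le' s]) simp
      then show "norm (A v * (1 / (1 - l v - l' w))) \<le> norm (norm (A v) * (1 / (1 - \<sigma> - \<sigma>')))"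
        unfolding norm_mult[of "A v"] real_norm_def by (rule order_trans[OF _ abs_ge_self])
    qed
  qed measurable
  have b: "norm (LINT v|lborel. A v * (1 / (1 - l v - l' w))) \<le> (LINT v|lborel. norm (A v)) * (1 / (1 - \<sigma> - \<sigma>'))" for w
  proof -
    have "norm (LINT v|lborel. A v * (1 / (1 - l v - l' w))) \<le> (LINT v|lborel. norm (A v) * (1 / (1 - \<sigma> - \<sigma>')))"
    proof (rule Bochner_Integration.integral_norm_bound_integral[OF i])
      show "norm (A v * (1 / (1 - l v - l' w))) \<le> norm (A v) * (1 / (1 - \<sigma> - \<sigma>'))" for v
        unfolding norm_mult[of "A v"] by (intro mult_left_mono mellin_denominator(1)[OF le le' s]) simp
    qed (use A in simp)
    then show ?thesis by simp
  qed
  show "integrable lborel (\<lambda>w. B w * (LINT v|lborel. A v * (1 / (1 - l v - l' w))))"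
  proof (rule Bochner_Integration.integrable_bound)
    show "integrable lborel (\<lambda>w. norm (B w) * ((LINT v|lborel. norm (A v)) * (1 / (1 - \<sigma> - \<sigma>'))))" using B by simp
    show "AE w in lborel. norm (B w * (LINT v|lborel. A v * (1 / (1 - l v - l' w)))) \<le> norm (norm (B w) * ((LINT v|lborel. norm (A v)) * (1 / (1 - \<sigma> - \<sigma>'))))"
      unfolding norm_mult by (intro AE_I2 mult_mono order_trans[OF b]) (use s in \<open>auto simp: abs_mult\<close>)
  qed measurable
qed

section \<open>Loop functions and their bounds\<close>

definition loop_weight :: "bool \<Rightarrow> complex \<Rightarrow> complex" where
  "loop_weight i u = (if i then Gamma u else rGamma (1 - u))"

text \<open>One shape for all functions involved: h = \<open>gamma_quot\<close> gives the limit
  functions, \<open>cauchy_rat\<close> and \<open>scaled_rat\<close> their finite-n counterparts,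
  and h = 1 and h z = 1 / (z + k) the closed forms that lead to \<open>kernel_sum\<close>.\<close>

definition loop_fun :: "bool \<Rightarrow> real \<Rightarrow> real \<Rightarrow> real \<Rightarrow> (complex \<Rightarrow> complex) \<Rightarrow> real \<Rightarrow> complex" where
  "loop_fun i \<sigma> \<delta> c h x = 1 / (2 * of_real pi * \<i>) * cloop \<sigma> \<delta> (\<lambda>u. loop_weight i u * h (u + of_real c) * of_real x powr (- u))"

lemma loop_weight_bound:
  assumes "\<eta> > 0" "\<delta> > 0" "\<sigma> > 0"
  obtains C where "\<And>v. norm (loop_weight i (lpath \<sigma> \<delta> v)) \<le> C * exp (\<eta> * Re (lpath \<sigma> \<delta> v))"
proof (cases i)
  case True
  obtain C where "\<And>v. norm (Gamma (lpath \<sigma> \<delta> v)) \<le> C * exp (\<eta> * Re (lpath \<sigma> \<delta> v))"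
    using Gamma_loop_bound[OF assms] by blast
  with True show ?thesis by (intro that[of C]) (simp add: loop_weight_def del: Re_lpath)
next
  case False
  obtain C where "\<And>u. \<bar>Im u\<bar> \<le> \<delta> \<Longrightarrow> Re u \<le> \<sigma> \<Longrightarrow> norm (rGamma (1 - u)) \<le> C * exp (\<eta> * Re u)"
    using rGamma_strip_bound[OF assms(1), of \<delta> \<sigma>] by blast
  with False assms show ?thesis by (intro that[of C]) (auto simp add: loop_weight_def Re_lpath_le simp del: Re_lpath)
qed

lemma continuous_loop_weight:
  assumes "\<delta> > 0" "\<sigma> > 0" shows "continuous_on (range (lpath \<sigma> \<delta>)) (loop_weight i)"
proof (cases i)
  case True
  then have "loop_weight i = Gamma" by (auto simp: loop_weight_def)
  then show ?thesis using lpath_notin_nonpos_Ints[OF assms] by (auto intro!: continuous_on_Gamma)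
next
  case False
  then have "loop_weight i = (\<lambda>u. rGamma (1 - u))" by (auto simp: loop_weight_def)
  then show ?thesis
    by (simp add: continuous_on_compose2[OF continuous_on_rGamma[of UNIV]] continuous_intros)
qed

text \<open>The rate D + 1 + ln X demanded of the weight pays for the growth of h, for the power of
  x when x <= X, and for integrability. Small x enter only through x powr (- \<sigma>), which keeps
  the later t-integral under control at 0.\<close>

lemma loop_majorant:
  assumes "\<delta> > 0" "\<sigma> > 0" "D \<ge> 0" "X \<ge> 1"
  obtains W where "W \<ge> 0" "\<And>v x. 0 < x \<Longrightarrow> x \<le> X \<Longrightarrow>
    norm (loop_weight i (lpath \<sigma> \<delta> v)) * exp (- D * Re (lpath \<sigma> \<delta> v)) * norm (of_real x powr (- lpath \<sigma> \<delta> v) :: complex)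
      \<le> W * x powr (- \<sigma>) * exp (Re (lpath \<sigma> \<delta> v))"
proof -
  define \<eta> where "\<eta> = D + 1 + ln X"
  have lX: "ln X \<ge> 0" using assms by simp
  then have \<eta>: "\<eta> > 0" using assms(3) unfolding \<eta>_def by linarith
  obtain C where C: "\<And>v. norm (loop_weight i (lpath \<sigma> \<delta> v)) \<le> C * exp (\<eta> * Re (lpath \<sigma> \<delta> v))"
    using loop_weight_bound[OF \<eta> assms(1,2)] by blast
  show ?thesis
  proof (rule that[of "\<bar>C\<bar> * exp (ln X * \<sigma>)"])
    fix v x :: real assume x: "0 < x" "x \<le> X"
    define r where "r = Re (lpath \<sigma> \<delta> v)"
    have r: "r \<le> \<sigma>" unfolding r_def by (rule Re_lpath_le)
    have "norm (of_real x powr (- lpath \<sigma> \<delta> v) :: complex) = exp (- ln x * r)"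
      unfolding norm_of_real_powr_minus[OF x(1)] r_def ..
    also have "\<dots> = x powr (- \<sigma>) * exp (ln x * (\<sigma> - r))"
      using x by (simp add: powr_def exp_add[symmetric] algebra_simps)
    also have "\<dots> \<le> x powr (- \<sigma>) * exp (ln X * (\<sigma> - r))"
      using x r by (intro mult_left_mono iffD2[OF exp_le_cancel_iff] mult_right_mono) auto
    finally have 1: "norm (of_real x powr (- lpath \<sigma> \<delta> v) :: complex) \<le> x powr (- \<sigma>) * exp (ln X * (\<sigma> - r))" .
    have 2: "norm (loop_weight i (lpath \<sigma> \<delta> v)) \<le> \<bar>C\<bar> * exp (\<eta> * r)"
      by (rule order_trans[OF C[of v, folded r_def] mult_right_mono[OF abs_ge_self]]) simp
    have "norm (loop_weight i (lpath \<sigma> \<delta> v)) * exp (- D * r) * norm (of_real x powr (- lpath \<sigma> \<delta> v) :: complex)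
      \<le> (\<bar>C\<bar> * exp (\<eta> * r)) * exp (- D * r) * (x powr (- \<sigma>) * exp (ln X * (\<sigma> - r)))"
      by (intro mult_mono 1 2) auto
    also have "\<dots> = \<bar>C\<bar> * x powr (- \<sigma>) * (exp (\<eta> * r) * exp (- D * r) * exp (ln X * (\<sigma> - r)))" by simp
    also have "exp (\<eta> * r) * exp (- D * r) * exp (ln X * (\<sigma> - r)) = exp (ln X * \<sigma>) * exp r"
      unfolding \<eta>_def exp_add[symmetric] by (simp add: algebra_simps)
    finally show "norm (loop_weight i (lpath \<sigma> \<delta> v)) * exp (- D * Re (lpath \<sigma> \<delta> v)) * norm (of_real x powr (- lpath \<sigma> \<delta> v) :: complex)
      \<le> \<bar>C\<bar> * exp (ln X * \<sigma>) * x powr (- \<sigma>) * exp (Re (lpath \<sigma> \<delta> v))"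
      unfolding r_def[symmetric] by (simp add: mult_ac)
  qed simp
qed

abbreviation loop_integrand :: "bool \<Rightarrow> real \<Rightarrow> real \<Rightarrow> real \<Rightarrow> (complex \<Rightarrow> complex) \<Rightarrow> real \<Rightarrow> real \<Rightarrow> complex" where
  "loop_integrand i \<sigma> \<delta> c h x v \<equiv> loop_weight i (lpath \<sigma> \<delta> v) * h (lpath \<sigma> \<delta> v + of_real c) * of_real x powr (- lpath \<sigma> \<delta> v) * ldir \<delta> v"

text \<open>K is independent of h, C and x. Applied to the difference of \<open>scaled_rat\<close>
  and \<open>gamma_quot\<close> with C of order n^-2, it transfers the rate from the loop to the
  loop functions.\<close>

lemma loop_fun_estimate:
  assumes "\<delta> > 0" "\<sigma> > 0" "D \<ge> 0" "X \<ge> 1"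
  shows "\<exists>K\<ge>0. \<forall>h C x. continuous_on (range (lpath \<sigma> \<delta>)) (\<lambda>u. h (u + of_real c)) \<longrightarrow>
       (\<forall>v. norm (h (lpath \<sigma> \<delta> v + of_real c)) \<le> C * exp (- D * Re (lpath \<sigma> \<delta> v))) \<longrightarrow> 0 < x \<longrightarrow> x \<le> X \<longrightarrow>
       integrable lborel (loop_integrand i \<sigma> \<delta> c h x) \<and> norm (loop_fun i \<sigma> \<delta> c h x) \<le> K * C * x powr (- \<sigma>)"
proof -
  obtain W where W: "W \<ge> 0" "\<And>v x. 0 < x \<Longrightarrow> x \<le> X \<Longrightarrow>
    norm (loop_weight i (lpath \<sigma> \<delta> v)) * exp (- D * Re (lpath \<sigma> \<delta> v)) * norm (of_real x powr (- lpath \<sigma> \<delta> v) :: complex)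
      \<le> W * x powr (- \<sigma>) * exp (Re (lpath \<sigma> \<delta> v))"
    using loop_majorant[OF assms, of i] by blast
  define I where "I = (LINT v|lborel. exp (Re (lpath \<sigma> \<delta> v)))"
  have Ii: "integrable lborel (\<lambda>v. exp (Re (lpath \<sigma> \<delta> v)))"
    using integrable_exp_Re_lpath[of 1] by simp
  have I: "I \<ge> 0" unfolding I_def by (intro integral_nonneg_AE AE_I2) simp
  show ?thesis
  proof (intro exI[of _ "W * I"] conjI[OF mult_nonneg_nonneg[OF W(1) I]] allI impI)
    fix h :: "complex \<Rightarrow> complex" and C x :: real
    assume h: "continuous_on (range (lpath \<sigma> \<delta>)) (\<lambda>u. h (u + of_real c))"
      and hb': "\<forall>v. norm (h (lpath \<sigma> \<delta> v + of_real c)) \<le> C * exp (- D * Re (lpath \<sigma> \<delta> v))" and x: "0 < x" "x \<le> X"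
    note hb = hb'[rule_format]
    have C: "C \<ge> 0"
      using order_trans[OF norm_ge_zero hb[of 0]] by (simp add: zero_le_mult_iff)
    have cont: "continuous_on (range (lpath \<sigma> \<delta>)) (\<lambda>u. loop_weight i u * h (u + of_real c) * of_real x powr (- u))"
      using x by (intro continuous_intros h continuous_loop_weight assms) auto
    have b: "norm (loop_weight i (lpath \<sigma> \<delta> v) * h (lpath \<sigma> \<delta> v + of_real c) * of_real x powr (- lpath \<sigma> \<delta> v))
        \<le> (C * W * x powr (- \<sigma>)) * exp (1 * Re (lpath \<sigma> \<delta> v))" for v
    proof -
      have "norm (loop_weight i (lpath \<sigma> \<delta> v)) * norm (h (lpath \<sigma> \<delta> v + of_real c)) * norm (of_real x powr (- lpath \<sigma> \<delta> v) :: complex)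
        \<le> norm (loop_weight i (lpath \<sigma> \<delta> v)) * (C * exp (- D * Re (lpath \<sigma> \<delta> v))) * norm (of_real x powr (- lpath \<sigma> \<delta> v) :: complex)"
        by (intro mult_right_mono mult_left_mono hb) auto
      also have "\<dots> = C * (norm (loop_weight i (lpath \<sigma> \<delta> v)) * exp (- D * Re (lpath \<sigma> \<delta> v)) * norm (of_real x powr (- lpath \<sigma> \<delta> v) :: complex))"
        by simp
      also have "\<dots> \<le> C * (W * x powr (- \<sigma>) * exp (Re (lpath \<sigma> \<delta> v)))"
        by (intro mult_left_mono W C x)
      finally show ?thesis by (simp add: norm_mult mult_ac del: Re_lpath)
    qed
    have i: "integrable lborel (loop_integrand i \<sigma> \<delta> c h x)"
      by (rule integrable_cloop[OF cont _ b]) simp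
    have "norm (cloop \<sigma> \<delta> (\<lambda>u. loop_weight i u * h (u + of_real c) * of_real x powr (- u))) \<le> (LINT v|lborel. C * W * x powr (- \<sigma>) * exp (Re (lpath \<sigma> \<delta> v)))"
      unfolding cloop_def
      by (rule Bochner_Integration.integral_norm_bound_integral[OF i])
         (use Ii b in \<open>simp_all add: norm_mult del: Re_lpath\<close>)
    also have "\<dots> = C * W * x powr (- \<sigma>) * I" by (simp add: I_def del: Re_lpath)
    finally have n: "norm (cloop \<sigma> \<delta> (\<lambda>u. loop_weight i u * h (u + of_real c) * of_real x powr (- u))) \<le> W * I * C * x powr (- \<sigma>)"
      by (simp add: mult_ac)
    have "norm (1 / (2 * of_real pi * \<i>) :: complex) \<le> 1"
      using pi_ge_two by (simp add: norm_divide norm_mult divide_simps)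
    then have "norm (loop_fun i \<sigma> \<delta> c h x) \<le> 1 * (W * I * C * x powr (- \<sigma>))"
      unfolding loop_fun_def norm_mult[of "1 / (2 * of_real pi * \<i>)"] by (intro mult_mono n) auto
    with i show "integrable lborel (loop_integrand i \<sigma> \<delta> c h x) \<and> norm (loop_fun i \<sigma> \<delta> c h x) \<le> W * I * C * x powr (- \<sigma>)"
      by simp
  qed
qed

lemma loop_fun_diff:
  assumes "integrable lborel (loop_integrand i \<sigma> \<delta> c h x)" "integrable lborel (loop_integrand i \<sigma> \<delta> c g x)"
  shows "loop_fun i \<sigma> \<delta> c (\<lambda>u. h u - g u) x = loop_fun i \<sigma> \<delta> c h x - loop_fun i \<sigma> \<delta> c g x"
  unfolding loop_fun_def cloop_def right_diff_distrib[symmetric] Bochner_Integration.integral_diff[OF assms, symmetric]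
  by (simp add: algebra_simps)

lemma measurable_loop_integrand:
  assumes "\<delta> > 0" "\<sigma> > 0" "continuous_on (range (lpath \<sigma> \<delta>)) (\<lambda>u. h (u + of_real c))"
  shows "(\<lambda>t. loop_fun i \<sigma> \<delta> c h (t * x)) \<in> borel_measurable borel"
proof -
  have [measurable]: "(\<lambda>v. h (lpath \<sigma> \<delta> v + of_real c)) \<in> borel_measurable borel"
    by (rule measurable_on_lpath[OF assms(3)])
  have [measurable]: "(\<lambda>v. loop_weight i (lpath \<sigma> \<delta> v)) \<in> borel_measurable borel"
    by (rule measurable_on_lpath[OF continuous_loop_weight[OF assms(1,2)]])
  show ?thesis unfolding loop_fun_def cloop_def by measurable
qed

lemma loop_fun_scale:
  assumes "x > 0" "t > 0"
  shows "loop_fun i \<sigma> \<delta> c h (t * x) = 1 / (2 * of_real pi * \<i>) * (LINT v|lborel. loop_integrand i \<sigma> \<delta> c h x v * of_real t powr (- lpath \<sigma> \<delta> v))"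
proof -
  have "complex_of_real (t * x) powr u = of_real x powr u * of_real t powr u" for u
    using assms by (simp add: powr_def Ln_of_real ln_mult flip: exp_add of_real_mult) (simp add: algebra_simps)
  then show ?thesis unfolding loop_fun_def cloop_def by (simp add: mult_ac)
qed

lemma loop_fun_product:
  assumes "integrable lborel (loop_integrand i \<sigma> \<delta> a h x)" "integrable lborel (loop_integrand j \<sigma>' \<delta> b g y)"
    and "\<sigma> + \<sigma>' < 1" "x > 0" "y > 0"
  shows "(LINT t:{0<..<1}|lborel. loop_fun i \<sigma> \<delta> a h (t * x) * loop_fun j \<sigma>' \<delta> b g (t * y))
    = (1 / (2 * of_real pi * \<i>)) ^ 2 * (LINT w|lborel. loop_integrand j \<sigma>' \<delta> b g y w * (LINT v|lborel. loop_integrand i \<sigma> \<delta> a h x v * (1 / (1 - lpath \<sigma> \<delta> v - lpath \<sigma>' \<delta> w))))"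
proof -
  let ?c = "1 / (2 * of_real pi * \<i>) :: complex"
  have "(LINT t:{0<..<1}|lborel. loop_fun i \<sigma> \<delta> a h (t * x) * loop_fun j \<sigma>' \<delta> b g (t * y))
    = (LINT t:{0<..<1}|lborel. ?c ^ 2 * ((LINT v|lborel. loop_integrand i \<sigma> \<delta> a h x v * of_real t powr (- lpath \<sigma> \<delta> v)) * (LINT w|lborel. loop_integrand j \<sigma>' \<delta> b g y w * of_real t powr (- lpath \<sigma>' \<delta> w))))"
    by (intro set_lebesgue_integral_cong) (auto simp: loop_fun_scale[OF assms(4)] loop_fun_scale[OF assms(5)] power2_eq_square)
  also have "\<dots> = ?c ^ 2 * (LINT t:{0<..<1}|lborel. (LINT v|lborel. loop_integrand i \<sigma> \<delta> a h x v * of_real t powr (- lpath \<sigma> \<delta> v)) * (LINT w|lborel. loop_integrand j \<sigma>' \<delta> b g y w * of_real t powr (- lpath \<sigma>' \<delta> w)))"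
    by (rule set_integral_mult_right)
  also have "(LINT t:{0<..<1}|lborel. (LINT v|lborel. loop_integrand i \<sigma> \<delta> a h x v * of_real t powr (- lpath \<sigma> \<delta> v)) * (LINT w|lborel. loop_integrand j \<sigma>' \<delta> b g y w * of_real t powr (- lpath \<sigma>' \<delta> w)))
    = (LINT w|lborel. loop_integrand j \<sigma>' \<delta> b g y w * (LINT v|lborel. loop_integrand i \<sigma> \<delta> a h x v * (1 / (1 - lpath \<sigma> \<delta> v - lpath \<sigma>' \<delta> w))))"
    by (rule mellin_product(1)[OF assms(1) measurable_lpath Re_lpath_le assms(2) measurable_lpath Re_lpath_le assms(3)])
  finally show ?thesis .
qed

text \<open>Evaluates the contribution of the -1 in \<open>cauchy_inv_rat\<close>.\<close>

lemma loop_fun_one: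
  assumes "\<delta> > 0" "\<sigma> > 0" "0 < x" "x < 1"
  shows "loop_fun i \<sigma> \<delta> c (\<lambda>_. 1) x = (if i then of_real (exp (- x)) else 0)"
  using cloop_Gamma_powr[OF assms] cloop_rGamma_powr(1)[OF assms(1,3), of \<sigma>]
  by (simp add: loop_fun_def loop_weight_def)

lemma loop_fun_pole:
  assumes "\<delta> > 0" "\<sigma> > 0" "\<sigma> + c > 0" "0 < x" "x < 1"
  shows "loop_fun i \<sigma> \<delta> c (\<lambda>z. 1 / (z + of_nat k)) x = of_real (kernel_base i c x k)"
proof -
  have s: "\<sigma> + (c + real k) > 0" using assms by simp
  have e: "loop_weight i u * (1 / (u + of_real c + of_nat k)) * of_real x powr (- u) = loop_weight i u * of_real x powr (- u) / (u + of_real (c + real k))" for u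
    by (simp add: add.assoc)
  show ?thesis
    unfolding loop_fun_def e
    using cloop_Gamma_powr_pole[OF assms(1,2) s assms(4,5)] cloop_rGamma_powr(2)[OF assms(1,4) s]
    by (simp add: loop_weight_def kernel_base_def)
qed

text \<open>By \<open>cauchy_inv_rat\<close> at u + a and v + b the double sum becomes (f f - 1) /
  (1 - u - v) under two loop integrals. The product f f gives the t-integral. The -1 gives the same
  integral with f replaced by 1, which is nonzero only if both indices are 1 and is then
  elementary.\<close>

lemma kernel_sum_loop:
  fixes a b :: real
  defines "\<alpha> \<equiv> a + b"
  assumes "\<delta> > 0" "\<sigma> > 0" "\<sigma> + a > 0" "\<sigma>' > 0" "\<sigma>' + b > 0" "\<sigma> + \<sigma>' < 1" "\<alpha> > -1" "n > 0" "0 < x" "x < 1" "0 < y" "y < 1"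
    and int1: "integrable lborel (loop_integrand i \<sigma> \<delta> a (cauchy_rat \<alpha> n) x)" "integrable lborel (loop_integrand j \<sigma>' \<delta> b (cauchy_rat \<alpha> n) y)"
  shows "complex_of_real (kernel_sum i j a b n x y) =
     (LINT t:{0<..<1}|lborel. loop_fun i \<sigma> \<delta> a (cauchy_rat \<alpha> n) (t * x) * loop_fun j \<sigma>' \<delta> b (cauchy_rat \<alpha> n) (t * y))
     - of_bool (i \<and> j) * of_real ((1 - exp (- x - y)) / (x + y))"
proof -
  let ?L = "lpath \<sigma> \<delta>" and ?L' = "lpath \<sigma>' \<delta>" and ?f = "cauchy_rat \<alpha> n"
  define c :: complex where "c = 1 / (2 * of_real pi * \<i>)"
  define A where "A = loop_integrand i \<sigma> \<delta> a (\<lambda>_. 1) x"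
  define B where "B = loop_integrand j \<sigma>' \<delta> b (\<lambda>_. 1) y"
  have sb: "a < \<sigma>' + a + \<sigma>" using assms by simp
  \<comment> \<open>From \<sigma> + \<sigma>' < 1 together with \<sigma> > -a and \<sigma>' > -b.
    The first bound keeps the real part on the second loop, shifted by b, below \<alpha> + 1 as
    \<open>cauchy_inv_rat\<close> requires.\<close>
  have w1: "\<sigma>' < a + 1" "\<sigma> < b + 1" using assms by auto
  obtain K where "\<forall>h C x. continuous_on (range ?L) (\<lambda>u. h (u + of_real a)) \<longrightarrow>
       (\<forall>v. norm (h (?L v + of_real a)) \<le> C * exp (- 0 * Re (?L v))) \<longrightarrow> 0 < x \<longrightarrow> x \<le> 1 \<longrightarrow>
       integrable lborel (loop_integrand i \<sigma> \<delta> a h x) \<and> norm (loop_fun i \<sigma> \<delta> a h x) \<le> K * C * x powr (- \<sigma>)"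
    using loop_fun_estimate[OF assms(2,3) order_refl order_refl, where i = i and c = a] by blast
  note K = this[rule_format]
  obtain K' where "\<forall>h C x. continuous_on (range ?L') (\<lambda>u. h (u + of_real b)) \<longrightarrow>
       (\<forall>v. norm (h (?L' v + of_real b)) \<le> C * exp (- 0 * Re (?L' v))) \<longrightarrow> 0 < x \<longrightarrow> x \<le> 1 \<longrightarrow>
       integrable lborel (loop_integrand j \<sigma>' \<delta> b h x) \<and> norm (loop_fun j \<sigma>' \<delta> b h x) \<le> K' * C * x powr (- \<sigma>')"
    using loop_fun_estimate[OF assms(2,5) order_refl order_refl, where i = j and c = b] by blast
  note K' = this[rule_format]
  have iA: "integrable lborel A" unfolding A_def using K[of "\<lambda>_. 1" 1 x] assms by auto
  have iB: "integrable lborel B" unfolding B_def using K'[of "\<lambda>_. 1" 1 y] assms by auto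
  have nzA: "?L v + of_real a + of_nat k \<noteq> 0" for v k
    using lpath_add_nonzero[OF assms(2), of \<sigma> "a + real k" "?L v"] assms(4) by (simp add: add.assoc)
  have nzB: "?L' v + of_real b + of_nat k \<noteq> 0" for v k
    using lpath_add_nonzero[OF assms(2), of \<sigma>' "b + real k" "?L' v"] assms(6) by (simp add: add.assoc)
  have iAk: "integrable lborel (\<lambda>v. A v * (1 / (?L v + of_real a + of_nat k)))" for k
  proof -
    have s: "\<sigma> + (a + real k) > 0" using assms by simp
    have "integrable lborel (loop_integrand i \<sigma> \<delta> a (\<lambda>z. 1 / (z + of_nat k)) x)"
      using K[of "\<lambda>z. 1 / (z + of_nat k)" "1 / min \<delta> (\<sigma> + (a + real k))" x]
        continuous_lpath_inverse[OF assms(2) s] lpath_inverse_bound[OF assms(2) s] assms by (simp add: add.assoc)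
    then show ?thesis by (simp add: A_def mult_ac)
  qed
  have iBk: "integrable lborel (\<lambda>v. B v * (1 / (?L' v + of_real b + of_nat k)))" for k
  proof -
    have s: "\<sigma>' + (b + real k) > 0" using assms by simp
    have "integrable lborel (loop_integrand j \<sigma>' \<delta> b (\<lambda>z. 1 / (z + of_nat k)) y)"
      using K'[of "\<lambda>z. 1 / (z + of_nat k)" "1 / min \<delta> (\<sigma>' + (b + real k))" y]
        continuous_lpath_inverse[OF assms(2) s] lpath_inverse_bound[OF assms(2) s] assms by (simp add: add.assoc)
    then show ?thesis by (simp add: B_def mult_ac)
  qed
  have vA: "c * (LINT v|lborel. A v * (1 / (?L v + of_real a + of_nat k))) = of_real (kernel_base i a x k)" for k
    using loop_fun_pole[OF assms(2-4,10,11), of i k] assms by (simp add: loop_fun_def cloop_def A_def c_def mult_ac)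
  have vB: "c * (LINT v|lborel. B v * (1 / (?L' v + of_real b + of_nat k))) = of_real (kernel_base j b y k)" for k
    using loop_fun_pole[OF assms(2,5,6,12,13), of j k] assms by (simp add: loop_fun_def cloop_def B_def c_def mult_ac)
  have A1: "loop_integrand i \<sigma> \<delta> a ?f x v = A v * ?f (?L v + of_real a)" for v by (simp add: A_def mult_ac)
  have B1: "loop_integrand j \<sigma>' \<delta> b ?f y v = B v * ?f (?L' v + of_real b)" for v by (simp add: B_def mult_ac)
  define X1 where "X1 = (\<lambda>w. LINT v|lborel. loop_integrand i \<sigma> \<delta> a ?f x v * (1 / (1 - ?L v - ?L' w)))"
  define X0 where "X0 = (\<lambda>w. LINT v|lborel. A v * (1 / (1 - ?L v - ?L' w)))"
  note mp1 = mellin_product[OF int1(1) measurable_lpath[of \<sigma> \<delta>] Re_lpath_le int1(2) measurable_lpath[of \<sigma>' \<delta>] Re_lpath_le assms(7)]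
  note mp0 = mellin_product[OF iA measurable_lpath[of \<sigma> \<delta>] Re_lpath_le iB measurable_lpath[of \<sigma>' \<delta>] Re_lpath_le assms(7)]
  let ?Ak = "\<lambda>k. LINT v|lborel. A v * (1 / (?L v + of_real a + of_nat k))"
  \<comment> \<open>The identity is integrated over the inner loop first: X1 carries the product
    term, X0 the constant one, and the factors depending on l wait for the outer loop.\<close>
  have key: "B w * ?f (?L' w + of_real b) * X1 w - B w * X0 w
      = (\<Sum>k<n. \<Sum>l<n. of_real (cauchy_inv \<alpha> n k l) * ?Ak k * (B w * (1 / (?L' w + of_real b + of_nat l))))" for w
  proof -
    define W where "W = ?L' w + of_real b"
    have "?f W * X1 w - X0 w = (LINT v|lborel. ?f W * (loop_integrand i \<sigma> \<delta> a ?f x v * (1 / (1 - ?L v - ?L' w))) - A v * (1 / (1 - ?L v - ?L' w)))"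
    proof -
      have "?f W * X1 w = (LINT v|lborel. ?f W * (loop_integrand i \<sigma> \<delta> a ?f x v * (1 / (1 - ?L v - ?L' w))))"
        unfolding X1_def by (rule integral_mult_right_zero[symmetric])
      then show ?thesis
        unfolding X0_def
        by (simp only: Bochner_Integration.integral_diff[OF integrable_mult_right[OF mp1(3)] mp0(3)])
    qed
    also have "\<dots> = (LINT v|lborel. (\<Sum>k<n. \<Sum>l<n. of_real (cauchy_inv \<alpha> n k l) / (W + of_nat l) * (A v * (1 / (?L v + of_real a + of_nat k)))))"
    proof (intro Bochner_Integration.integral_cong refl)
      fix v
      define Z where "Z = ?L v + of_real a"
      have d: "1 - ?L v - ?L' w = of_real \<alpha> + 1 - Z - W" by (simp add: Z_def W_def \<alpha>_def)
      have d0: "of_real \<alpha> + 1 - Z - W \<noteq> 0"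
        unfolding d[symmetric] by (rule mellin_denominator(2)[OF Re_lpath_le Re_lpath_le assms(7)])
      have "(\<Sum>k<n. \<Sum>l<n. of_real (cauchy_inv \<alpha> n k l) / ((Z + of_nat k) * (W + of_nat l))) = (?f Z * ?f W - 1) / (of_real \<alpha> + 1 - Z - W)"
      proof (rule cauchy_inv_rat[OF assms(8,9)])
        show "Re W < \<alpha> + 1" using w1 Re_lpath_le[of \<sigma>' \<delta> w] by (simp add: W_def \<alpha>_def del: Re_lpath)
        show "Z + W \<noteq> of_real \<alpha> + 1" using d0 by (auto simp: algebra_simps)
      qed (use nzA nzB in \<open>auto simp: Z_def W_def\<close>)
      then have "A v * (\<Sum>k<n. \<Sum>l<n. of_real (cauchy_inv \<alpha> n k l) / ((Z + of_nat k) * (W + of_nat l))) = ?f W * (A v * ?f Z * (1 / (1 - ?L v - ?L' w))) - A v * (1 / (1 - ?L v - ?L' w))"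
        unfolding d by (simp add: diff_divide_distrib right_diff_distrib mult_ac)
      then show "?f W * (loop_integrand i \<sigma> \<delta> a ?f x v * (1 / (1 - ?L v - ?L' w))) - A v * (1 / (1 - ?L v - ?L' w))
         = (\<Sum>k<n. \<Sum>l<n. of_real (cauchy_inv \<alpha> n k l) / (W + of_nat l) * (A v * (1 / (?L v + of_real a + of_nat k))))"
        unfolding A1 unfolding Z_def[symmetric] sum_distrib_left by (simp add: mult_ac)
    qed
    also have "\<dots> = (\<Sum>k<n. \<Sum>l<n. of_real (cauchy_inv \<alpha> n k l) / (W + of_nat l) * ?Ak k)"
      by (subst Bochner_Integration.integral_sum; (intro Bochner_Integration.integrable_sum integrable_mult_right iAk)?)
         (intro sum.cong refl, subst Bochner_Integration.integral_sum, intro integrable_mult_right iAk, simp only: integral_mult_right_zero)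
    finally have "B w * (?f W * X1 w - X0 w) = B w * (\<Sum>k<n. \<Sum>l<n. of_real (cauchy_inv \<alpha> n k l) / (W + of_nat l) * ?Ak k)" by simp
    then show ?thesis unfolding W_def[symmetric] right_diff_distrib sum_distrib_left by (simp add: mult_ac)
  qed
  have T1: "(LINT t:{0<..<1}|lborel. loop_fun i \<sigma> \<delta> a ?f (t * x) * loop_fun j \<sigma>' \<delta> b ?f (t * y)) = c ^ 2 * (LINT w|lborel. B w * ?f (?L' w + of_real b) * X1 w)"
    unfolding loop_fun_product[OF int1 assms(7,10,12)] c_def[symmetric] X1_def B1 ..
  have T0: "(LINT t:{0<..<1}|lborel. loop_fun i \<sigma> \<delta> a (\<lambda>_. 1) (t * x) * loop_fun j \<sigma>' \<delta> b (\<lambda>_. 1) (t * y)) = c ^ 2 * (LINT w|lborel. B w * X0 w)"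
    using loop_fun_product[OF iA[unfolded A_def] iB[unfolded B_def] assms(7,10,12)] by (simp only: c_def[symmetric] X0_def A_def B_def)
  have i1: "integrable lborel (\<lambda>w. B w * ?f (?L' w + of_real b) * X1 w)"
    using mp1(2) unfolding X1_def B1 .
  have i0: "integrable lborel (\<lambda>w. B w * X0 w)"
    using mp0(2) unfolding X0_def .
  have "(LINT w|lborel. B w * ?f (?L' w + of_real b) * X1 w) - (LINT w|lborel. B w * X0 w)
     = (LINT w|lborel. (\<Sum>k<n. \<Sum>l<n. of_real (cauchy_inv \<alpha> n k l) * ?Ak k * (B w * (1 / (?L' w + of_real b + of_nat l)))))"
    unfolding key[symmetric] by (rule Bochner_Integration.integral_diff[symmetric, OF i1 i0])
  also have "\<dots> = (\<Sum>k<n. \<Sum>l<n. of_real (cauchy_inv \<alpha> n k l) * ?Ak k * (LINT w|lborel. B w * (1 / (?L' w + of_real b + of_nat l))))"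
    by (subst Bochner_Integration.integral_sum; (intro Bochner_Integration.integrable_sum integrable_mult_right iBk)?)
       (intro sum.cong refl, subst Bochner_Integration.integral_sum, intro integrable_mult_right iBk, simp only: integral_mult_right_zero)
  finally have "c ^ 2 * (LINT w|lborel. B w * ?f (?L' w + of_real b) * X1 w) - c ^ 2 * (LINT w|lborel. B w * X0 w)
     = (\<Sum>k<n. \<Sum>l<n. of_real (cauchy_inv \<alpha> n k l) * (c * ?Ak k) * (c * (LINT w|lborel. B w * (1 / (?L' w + of_real b + of_nat l)))))"
    unfolding right_diff_distrib[symmetric] sum_distrib_left by (simp add: sum_distrib_left power2_eq_square mult_ac)
  also have "\<dots> = of_real (kernel_sum i j a b n x y)"
    unfolding vA vB kernel_sum_def \<alpha>_def by simp
  finally have "complex_of_real (kernel_sum i j a b n x y) =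
     (LINT t:{0<..<1}|lborel. loop_fun i \<sigma> \<delta> a ?f (t * x) * loop_fun j \<sigma>' \<delta> b ?f (t * y))
     - (LINT t:{0<..<1}|lborel. loop_fun i \<sigma> \<delta> a (\<lambda>_. 1) (t * x) * loop_fun j \<sigma>' \<delta> b (\<lambda>_. 1) (t * y))"
    unfolding T1 T0 by simp
  \<comment> \<open>Each loop function with h = 1 is a decaying exponential for index 1 and 0 for
    index 0, so only i = j = True contributes.\<close>
  also have "(LINT t:{0<..<1}|lborel. loop_fun i \<sigma> \<delta> a (\<lambda>_. 1) (t * x) * loop_fun j \<sigma>' \<delta> b (\<lambda>_. 1) (t * y))
     = (LINT t:{0<..<1}|lborel. complex_of_real (of_bool (i \<and> j) * exp (- (t * (x + y)))))"
  proof (intro set_lebesgue_integral_cong allI impI)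
    fix t :: real assume t: "t \<in> {0<..<1}"
    have "0 < t * x" "t * x < 1" "0 < t * y" "t * y < 1"
      using t assms mult_strict_mono[of t 1 x 1] mult_strict_mono[of t 1 y 1] by auto
    then show "loop_fun i \<sigma> \<delta> a (\<lambda>_. 1) (t * x) * loop_fun j \<sigma>' \<delta> b (\<lambda>_. 1) (t * y) = complex_of_real (of_bool (i \<and> j) * exp (- (t * (x + y))))"
      using assms by (auto simp: loop_fun_one exp_of_real[symmetric] distrib_left simp flip: exp_add)
  qed simp
  also have "\<dots> = of_real (of_bool (i \<and> j) * (LINT t:{0<..<1}|lborel. exp (- (t * (x + y)))))"
  proof -
    have "(\<lambda>t. indicator {0<..<1} t *\<^sub>R complex_of_real (of_bool (i \<and> j) * exp (- (t * (x + y)))))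
       = (\<lambda>t. complex_of_real (of_bool (i \<and> j) * (indicator {0<..<1} t *\<^sub>R exp (- (t * (x + y))))))"
      by (auto simp: fun_eq_iff indicator_def)
    then show ?thesis
      by (simp only: set_lebesgue_integral_def integral_complex_of_real integral_mult_right_zero)
  qed
  also have "(LINT t:{0<..<1}|lborel. exp (- (t * (x + y)))) = (1 - exp (- x - y)) / (x + y)"
  proof -
    have "((\<lambda>t. exp (- (t * s))) has_integral (- exp (- (1 * s)) / s - (- exp (- (0 * s)) / s))) {0..1}" if "s > 0" for s :: real
      using that by (intro fundamental_theorem_of_calculus)
        (auto intro!: derivative_eq_intros simp: has_real_derivative_iff_has_vector_derivative[symmetric])
    from this[of "x + y"] have "((\<lambda>t. exp (- (t * (x + y)))) has_integral (- exp (- (1 * (x + y))) / (x + y) - (- exp (- (0 * (x + y))) / (x + y)))) {0..1}"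
      using assms(10,12) by simp
    moreover have "set_integrable lborel {0..1} (\<lambda>t. exp (- (t * (x + y))))"
      by (intro borel_integrable_atLeastAtMost') (auto intro!: continuous_intros)
    ultimately have "(LINT t:{0..1}|lborel. exp (- (t * (x + y)))) = (1 - exp (- x - y)) / (x + y)"
      by (simp add: set_borel_integral_eq_integral integral_unique diff_divide_distrib)
    moreover have "(LINT t:{0<..<1}|lborel. exp (- (t * (x + y)))) = (LINT t:{0..1}|lborel. exp (- (t * (x + y))))"
      unfolding set_lebesgue_integral_def
    proof (rule integral_cong_AE)
      have "AE t in lborel. t \<noteq> 0 \<and> t \<noteq> (1::real)" using AE_lborel_singleton[of 0] AE_lborel_singleton[of 1] by auto
      then show "AE t in lborel. indicator {0<..<1} t *\<^sub>R exp (- (t * (x + y))) = indicator {0..1} t *\<^sub>R exp (- (t * (x + y)))"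
        by eventually_elim (auto simp: indicator_def)
    qed auto
    ultimately show ?thesis by simp
  qed
  finally show ?thesis by simp
qed

subsection \<open>Hard edge limit of the kernels\<close>

text \<open>The argument u + c runs over a loop of the same kind with abscissa \<sigma> + c, where
  the asymptotics of \<open>scaled_rat\<close> are applied.\<close>

lemma lpath_shift: "lpath \<sigma> \<delta> v + of_real c = lpath (\<sigma> + c) \<delta> v"
  by (simp add: complex_eq_iff)

lemma continuous_gamma_quot_loop:
  assumes "\<delta> > 0" "\<sigma> + c > 0"
  shows "continuous_on (range (lpath \<sigma> \<delta>)) (\<lambda>u. gamma_quot \<alpha> (u + of_real c))"
proof -
  have "u + of_real c \<notin> \<int>\<^sub>\<le>\<^sub>0" if "u \<in> range (lpath \<sigma> \<delta>)" for u
    using that lpath_notin_nonpos_Ints[OF assms] by (auto simp: lpath_shift)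
  then show ?thesis
    unfolding gamma_quot_def
    by (intro continuous_intros continuous_on_Gamma continuous_on_compose2[OF continuous_on_rGamma[of UNIV]]
        continuous_on_compose2[OF continuous_on_Gamma[of "- \<int>\<^sub>\<le>\<^sub>0"]]) auto
qed

lemma continuous_cauchy_rat_loop:
  assumes "\<delta> > 0" "\<sigma> + c > 0"
  shows "continuous_on (range (lpath \<sigma> \<delta>)) (\<lambda>u. cauchy_rat \<alpha> n (u + of_real c))"
proof -
  have "pochhammer (u + of_real c) n \<noteq> 0" if "u \<in> range (lpath \<sigma> \<delta>)" for u
  proof -
    from that obtain v where "u = lpath \<sigma> \<delta> v" by auto
    then have v: "u + of_real c = lpath (\<sigma> + c) \<delta> v" by (simp only: lpath_shift)
    show ?thesis
      unfolding v pochhammer_eq_0_iff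
      using lpath_notin_nonpos_Ints[OF assms, of v] by (metis minus_of_nat_in_nonpos_Ints)
  qed
  then show ?thesis
    unfolding cauchy_rat_def by (intro continuous_intros) (auto simp: pochhammer_prod intro!: continuous_intros)
qed

lemma continuous_scaled_rat_loop:
  assumes "\<delta> > 0" "\<sigma> + c > 0" "n > 0"
  shows "continuous_on (range (lpath \<sigma> \<delta>)) (\<lambda>u. scaled_rat \<alpha> n (u + of_real c))"
  unfolding scaled_rat_def using edge_scale_pos[OF assms(3), of \<alpha>]
  by (intro continuous_intros continuous_cauchy_rat_loop assms) auto

text \<open>The estimates on the loop of abscissa \<sigma> + c, pulled back with the constant exp (-
  D * c), enter \<open>loop_fun_estimate\<close> for the limit and for the difference. The finite-n
  integrand is the sum of these two, hence integrable.\<close>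

lemma loop_fun_asymp:
  assumes "\<delta> > 0" "\<sigma> > 0" "\<sigma> + c > 0" "X \<ge> 1"
  shows "\<exists>K\<ge>0. \<exists>n0\<ge>1. \<forall>x. 0 < x \<longrightarrow> x \<le> X \<longrightarrow>
     integrable lborel (loop_integrand i \<sigma> \<delta> c (gamma_quot \<alpha>) x) \<and>
     norm (loop_fun i \<sigma> \<delta> c (gamma_quot \<alpha>) x) \<le> K * x powr (- \<sigma>) \<and>
     (\<forall>n\<ge>n0. integrable lborel (loop_integrand i \<sigma> \<delta> c (scaled_rat \<alpha> n) x) \<and>
        norm (loop_fun i \<sigma> \<delta> c (scaled_rat \<alpha> n) x - loop_fun i \<sigma> \<delta> c (gamma_quot \<alpha>) x) \<le> K / real n ^ 2 * x powr (- \<sigma>))"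
proof -
  obtain C D n0 where C: "C \<ge> 0" "D \<ge> 0" "n0 \<ge> 1"
    "\<And>v. norm (gamma_quot \<alpha> (lpath (\<sigma> + c) \<delta> v)) \<le> C * exp (- D * Re (lpath (\<sigma> + c) \<delta> v))"
    "\<And>n v. n \<ge> n0 \<Longrightarrow> norm (scaled_rat \<alpha> n (lpath (\<sigma> + c) \<delta> v) - gamma_quot \<alpha> (lpath (\<sigma> + c) \<delta> v))
        \<le> C / real n ^ 2 * exp (- D * Re (lpath (\<sigma> + c) \<delta> v))"
    using scaled_rat_asymp_loop[OF assms(1,3), of \<alpha>] by blast
  define C' where "C' = C * exp (- D * c)"
  have ex: "exp (- D * Re (lpath (\<sigma> + c) \<delta> v)) = exp (- D * c) * exp (- D * Re (lpath \<sigma> \<delta> v))" for v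
    by (simp flip: exp_add) (simp add: algebra_simps)
  have F: "norm (gamma_quot \<alpha> (lpath \<sigma> \<delta> v + of_real c)) \<le> C' * exp (- D * Re (lpath \<sigma> \<delta> v))" for v
    using C(4)[of v] unfolding ex unfolding lpath_shift[symmetric] by (simp add: C'_def mult.assoc del: Re_lpath)
  have E: "norm (scaled_rat \<alpha> n (lpath \<sigma> \<delta> v + of_real c) - gamma_quot \<alpha> (lpath \<sigma> \<delta> v + of_real c)) \<le> C' / real n ^ 2 * exp (- D * Re (lpath \<sigma> \<delta> v))" if "n \<ge> n0" for n v
    using C(5)[OF that, of v] unfolding ex unfolding lpath_shift[symmetric] by (simp add: C'_def mult_ac del: Re_lpath)
  have C': "C' \<ge> 0" using C by (simp add: C'_def)
  obtain K where K0: "K \<ge> 0" and "\<forall>h C x. continuous_on (range (lpath \<sigma> \<delta>)) (\<lambda>u. h (u + of_real c)) \<longrightarrow>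
       (\<forall>v. norm (h (lpath \<sigma> \<delta> v + of_real c)) \<le> C * exp (- D * Re (lpath \<sigma> \<delta> v))) \<longrightarrow> 0 < x \<longrightarrow> x \<le> X \<longrightarrow>
       integrable lborel (loop_integrand i \<sigma> \<delta> c h x) \<and> norm (loop_fun i \<sigma> \<delta> c h x) \<le> K * C * x powr (- \<sigma>)"
    using loop_fun_estimate[OF assms(1,2) C(2) assms(4), where i = i and c = c] by blast
  note K = this(2)[rule_format]
  show ?thesis
  proof (intro exI[of _ "K * C'"] conjI exI[of _ n0] allI impI)
    fix x assume x: "0 < x" "x \<le> X"
    have g: "integrable lborel (loop_integrand i \<sigma> \<delta> c (gamma_quot \<alpha>) x) \<and> norm (loop_fun i \<sigma> \<delta> c (gamma_quot \<alpha>) x) \<le> K * C' * x powr (- \<sigma>)"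
      using K[OF continuous_gamma_quot_loop[OF assms(1,3)] F x] .
    then show "integrable lborel (loop_integrand i \<sigma> \<delta> c (gamma_quot \<alpha>) x)" "norm (loop_fun i \<sigma> \<delta> c (gamma_quot \<alpha>) x) \<le> K * C' * x powr (- \<sigma>)"
      by auto
    fix n assume n: "n \<ge> n0"
    then have n1: "n > 0" using C by simp
    have d: "integrable lborel (loop_integrand i \<sigma> \<delta> c (\<lambda>z. scaled_rat \<alpha> n z - gamma_quot \<alpha> z) x) \<and>
       norm (loop_fun i \<sigma> \<delta> c (\<lambda>z. scaled_rat \<alpha> n z - gamma_quot \<alpha> z) x) \<le> K * (C' / real n ^ 2) * x powr (- \<sigma>)"
      using K[OF continuous_on_diff[OF continuous_scaled_rat_loop[OF assms(1,3) n1] continuous_gamma_quot_loop[OF assms(1,3)]] E[OF n] x] .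
    have "integrable lborel (\<lambda>v. loop_integrand i \<sigma> \<delta> c (\<lambda>z. scaled_rat \<alpha> n z - gamma_quot \<alpha> z) x v + loop_integrand i \<sigma> \<delta> c (gamma_quot \<alpha>) x v)"
      using d g by (intro Bochner_Integration.integrable_add) auto
    then show s: "integrable lborel (loop_integrand i \<sigma> \<delta> c (scaled_rat \<alpha> n) x)"
      by (simp add: algebra_simps)
    show "norm (loop_fun i \<sigma> \<delta> c (scaled_rat \<alpha> n) x - loop_fun i \<sigma> \<delta> c (gamma_quot \<alpha>) x) \<le> K * C' / real n ^ 2 * x powr (- \<sigma>)"
      using d loop_fun_diff[OF s conjunct1[OF g]] by simp
  qed (use K0 C' C in auto)
qed

section \<open>Independence of the contour\<close>

text \<open>The two truncated contours differ by the rectangle between the abscissae \<sigma> and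
  \<sigma>', which lies in the half-plane of holomorphy. The integrals therefore agree for each R >
  - \<sigma>, before the limit is taken.\<close>

lemma loop_integral_shift:
  assumes "\<delta> > 0" "s0 < \<sigma>" "\<sigma> \<le> \<sigma>'" "f holomorphic_on {u. s0 < Re u}" "continuous_on {u. \<bar>Im u\<bar> = \<delta>} f"
  shows "loop_integral \<sigma> \<delta> f = loop_integral \<sigma>' \<delta> f"
proof (cases "\<sigma> = \<sigma>'")
  case False
  then have lt: "\<sigma> < \<sigma>'" using assms(3) by simp
  have "\<forall>\<^sub>F R in at_top. contour_integral (truncated_loop \<sigma> \<delta> R) f = contour_integral (truncated_loop \<sigma>' \<delta> R) f"
    using eventually_gt_at_top[of "- \<sigma>"]
  proof eventually_elim
    case (elim R)
    let ?A = "Complex (-R) (-\<delta>)" and ?D = "Complex (-R) \<delta>"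
    let ?B = "Complex \<sigma> (-\<delta>)" and ?C = "Complex \<sigma> \<delta>" and ?B' = "Complex \<sigma>' (-\<delta>)" and ?C' = "Complex \<sigma>' \<delta>"
    have hor: "continuous_on (closed_segment (Complex p e) (Complex q e)) f" if "\<bar>e\<bar> = \<delta>" for p q e
      by (rule continuous_on_subset[OF assms(5)]) (use that in \<open>auto simp: closed_segment_same_Im\<close>)
    have ver: "continuous_on (closed_segment (Complex p e) (Complex p e')) f" if "s0 < p" for p e e'
      by (rule continuous_on_subset[OF holomorphic_on_imp_continuous_on[OF assms(4)]]) (use that in \<open>auto simp: closed_segment_same_Re\<close>)
    have i: "f contour_integrable_on linepath (Complex p e) (Complex q e)" if "\<bar>e\<bar> = \<delta>" for p q e
      by (rule contour_integrable_continuous_linepath[OF hor[OF that]])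
    have i': "f contour_integrable_on linepath (Complex p e) (Complex p e')" if "s0 < p" for p e e'
      by (rule contour_integrable_continuous_linepath[OF ver[OF that]])
    have "(f has_contour_integral 0) (rectpath ?B ?C')"
    proof (rule Cauchy_theorem_convex_simple[OF assms(4)])
      show "convex {u. s0 < Re u}" by (rule convex_halfspace_Re_gt)
      have "path_image (rectpath ?B ?C') \<subseteq> cbox ?B ?C'"
        using lt assms(1) by (intro path_image_rectpath_subset_cbox) auto
      also have "\<dots> \<subseteq> {u. s0 < Re u}" using assms(2) by (auto simp: in_cbox_complex_iff)
      finally show "path_image (rectpath ?B ?C') \<subseteq> {u. s0 < Re u}" .
    qed auto
    then have "(f has_contour_integral 0) (linepath ?B ?B' +++ linepath ?B' ?C' +++ linepath ?C' ?C +++ linepath ?C ?B)"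
      by (simp add: rectpath_def Let_def)
    then have "contour_integral (linepath ?B ?B' +++ linepath ?B' ?C' +++ linepath ?C' ?C +++ linepath ?C ?B) f = 0"
      by (rule contour_integral_unique)
    moreover have e: "\<bar>- \<delta>\<bar> = \<delta>" "\<bar>\<delta>\<bar> = \<delta>" "s0 < \<sigma>'" using assms by auto
    note ii = i[OF e(1), of \<sigma> \<sigma>'] i[OF e(2), of \<sigma>' \<sigma>] i'[OF e(3), of "-\<delta>" \<delta>] i'[OF assms(2), of \<delta> "-\<delta>"]
    ultimately have S1: "contour_integral (linepath ?B ?B') f + (contour_integral (linepath ?B' ?C') f + (contour_integral (linepath ?C' ?C) f + contour_integral (linepath ?C ?B) f)) = 0"
      using ii by simp
    have mem: "Complex q e \<in> closed_segment (Complex p e) (Complex r e)" if "p \<le> q \<and> q \<le> r \<or> r \<le> q \<and> q \<le> p" for p q r e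
      using that by (auto simp: closed_segment_same_Im closed_segment_eq_real_ivl)
    have AB: "contour_integral (linepath ?A ?B') f = contour_integral (linepath ?A ?B) f + contour_integral (linepath ?B ?B') f"
      by (rule contour_integral_split_linepath[OF hor[OF e(1)] mem]) (use elim lt in simp)
    have CD: "contour_integral (linepath ?C' ?D) f = contour_integral (linepath ?C' ?C) f + contour_integral (linepath ?C ?D) f"
      by (rule contour_integral_split_linepath[OF hor[OF e(2)] mem]) (use elim lt in simp)
    have CB: "contour_integral (linepath ?C ?B) f = - contour_integral (linepath ?B ?C) f"
      using contour_integral_reversepath[of "linepath ?B ?C" f] by simp
    have "contour_integral (truncated_loop s \<delta> R) f = contour_integral (linepath ?A (Complex s (-\<delta>))) f + (contour_integral (linepath (Complex s (-\<delta>)) (Complex s \<delta>)) f + contour_integral (linepath (Complex s \<delta>) ?D) f)" if "s0 < s" for s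
      unfolding truncated_loop_def using i[OF e(1), of "-R" s] i'[OF that, of "-\<delta>" \<delta>] i[OF e(2), of s "-R"] by simp
    from this[OF assms(2)] this[OF e(3)]
    have T: "contour_integral (truncated_loop \<sigma> \<delta> R) f = contour_integral (linepath ?A ?B) f + (contour_integral (linepath ?B ?C) f + contour_integral (linepath ?C ?D) f)"
      "contour_integral (truncated_loop \<sigma>' \<delta> R) f = contour_integral (linepath ?A ?B') f + (contour_integral (linepath ?B' ?C') f + contour_integral (linepath ?C' ?D) f)"
      by auto
    have alg: "ab + (bc + cd) = (ab + bb) + (b'c' + (c'c + cd))"
      if "bb + (b'c' + (c'c + cb)) = 0" "cb = - bc" for ab bc cd bb b'c' c'c cb :: complex
    proof -
      have "bb + (b'c' + c'c) - bc = 0" using that by (simp add: add_diff_eq)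
      then have "bc = bb + (b'c' + c'c)" by simp
      then show ?thesis by (simp add: add_ac)
    qed
    show ?case unfolding T AB CD by (rule alg[OF S1 CB])
  qed
  then show ?thesis unfolding loop_integral_def by (rule Lim_cong) simp
qed simp

text \<open>All poles are real and at most max 0 (- c), so they avoid both the half-plane and the
  two lines that carry the arms.\<close>

lemma holomorphic_meijer_integrand:
  assumes "\<delta> > 0" "\<zeta> > 0"
  shows "(\<lambda>u. k * (loop_weight i u * gamma_quot \<alpha> (u + of_real c) * of_real \<zeta> powr (- u))) holomorphic_on {u. max 0 (- c) < Re u}"
    and "continuous_on {u. \<bar>Im u\<bar> = \<delta>} (\<lambda>u. k * (loop_weight i u * gamma_quot \<alpha> (u + of_real c) * of_real \<zeta> powr (- u)))"
proof -
  have 1: "u \<notin> \<int>\<^sub>\<le>\<^sub>0" if "Re u > 0" for u using that by (auto elim!: nonpos_Ints_cases')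
  have 2: "u \<notin> \<int>\<^sub>\<le>\<^sub>0" if "\<bar>Im u\<bar> = \<delta>" for u using that assms(1) by (auto elim!: nonpos_Ints_cases')
  show "(\<lambda>u. k * (loop_weight i u * gamma_quot \<alpha> (u + of_real c) * of_real \<zeta> powr (- u))) holomorphic_on {u. max 0 (- c) < Re u}"
  proof -
    let ?S = "{u. max 0 (- c) < Re u}"
    have g: "Gamma holomorphic_on ?S" by (rule holomorphic_Gamma) (use 1 in auto)
    have g': "(\<lambda>u. Gamma (u + of_real c)) holomorphic_on ?S"
      by (rule holomorphic_Gamma') (use 1 in \<open>auto intro!: holomorphic_intros\<close>)
    have r: "(\<lambda>u. rGamma (1 - u)) holomorphic_on ?S" "(\<lambda>u. rGamma (of_real \<alpha> + 1 - (u + of_real c))) holomorphic_on ?S"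
      by (intro holomorphic_rGamma' holomorphic_intros)+
    have w: "loop_weight i holomorphic_on ?S"
      unfolding loop_weight_def using g r(1) by (cases i) (simp_all only: if_True if_False)
    show ?thesis
      unfolding gamma_quot_def by (intro holomorphic_on_mult holomorphic_on_const w g' r(2) holomorphic_on_powr_right holomorphic_on_minus holomorphic_on_id[unfolded id_def] holomorphic_on_ident)
  qed
  have h: "continuous_on {u. \<bar>Im u\<bar> = \<delta>} (\<lambda>u. rGamma (1 - u))" "continuous_on {u. \<bar>Im u\<bar> = \<delta>} (\<lambda>u. rGamma (of_real \<alpha> + 1 - (u + of_real c)))"
    by (intro continuous_on_compose2[OF continuous_on_rGamma[of UNIV]] continuous_intros; simp)+
  have g: "continuous_on {u. \<bar>Im u\<bar> = \<delta>} Gamma" by (intro continuous_on_Gamma) (use 2 in auto)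
  have g': "continuous_on {u. \<bar>Im u\<bar> = \<delta>} (\<lambda>u. Gamma (u + of_real c))"
    by (rule continuous_on_compose2[OF g]) (auto intro!: continuous_intros)
  show "continuous_on {u. \<bar>Im u\<bar> = \<delta>} (\<lambda>u. k * (loop_weight i u * gamma_quot \<alpha> (u + of_real c) * of_real \<zeta> powr (- u)))"
  proof -
    have w: "continuous_on {u. \<bar>Im u\<bar> = \<delta>} (loop_weight i)"
      unfolding loop_weight_def using g h(1) by (cases i) (simp_all only: if_True if_False)
    have e: "continuous_on {u. \<bar>Im u\<bar> = \<delta>} (\<lambda>u. complex_of_real \<zeta> powr (- u))"
      using assms(2) by (intro continuous_intros) auto
    show ?thesis
      unfolding gamma_quot_def by (intro continuous_on_mult continuous_on_const w g' h(2) e)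
  qed
qed

definition meijer_loop :: "bool \<Rightarrow> real \<Rightarrow> real \<Rightarrow> real \<Rightarrow> real \<Rightarrow> real \<Rightarrow> complex" where
  "meijer_loop i \<sigma> \<delta> \<alpha> c \<zeta> = (if i then meijer_Ht \<sigma> \<delta> \<alpha> c \<zeta> else meijer_H \<sigma> \<delta> \<alpha> c \<zeta>)"

text \<open>\<open>rGamma\<close> equals the inverse of \<open>Gamma\<close> everywhere, including
  the poles with library value 0, so the two forms of the integrand coincide without
  exception.\<close>

lemma meijer_loop_eq_loop_integral:
  "meijer_loop i \<sigma> \<delta> \<alpha> c \<zeta> = loop_integral \<sigma> \<delta> (\<lambda>u. 1 / (2 * of_real pi * \<i>) * (loop_weight i u * gamma_quot \<alpha> (u + of_real c) * of_real \<zeta> powr (- u)))"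
proof -
  have e: "of_real (\<alpha> - c + 1) - u = of_real \<alpha> + 1 - (u + of_real c)" for u :: complex by simp
  have t: "Gamma (u + of_real c) / (Gamma (1 - u) * Gamma (of_real (\<alpha> - c + 1) - u)) = loop_weight False u * gamma_quot \<alpha> (u + of_real c)"
    "Gamma u * Gamma (u + of_real c) / Gamma (of_real (\<alpha> - c + 1) - u) = loop_weight True u * gamma_quot \<alpha> (u + of_real c)" for u :: complex
    unfolding e by (simp_all only: loop_weight_def gamma_quot_def rGamma_inverse_Gamma divide_inverse inverse_mult_distrib if_True if_False) (simp_all only: mult_ac)
  show ?thesis
    by (cases i) (simp_all only: meijer_loop_def meijer_H_def meijer_Ht_def t if_True if_False mult.assoc)
qed

text \<open>
  Integrating the product of two loop integrals over \<open>t\<close> termwise needs abscissae with \<open>\<sigma> + \<sigma>' < 1\<close>; the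
  given common \<open>\<sigma>\<close> may be too large for that.
\<close>

lemma meijer_loop_shift:
  assumes "\<delta> > 0" "\<zeta> > 0" "\<sigma> > 0" "\<sigma> > - c" "\<sigma>' > 0" "\<sigma>' > - c"
  shows "meijer_loop i \<sigma> \<delta> \<alpha> c \<zeta> = meijer_loop i \<sigma>' \<delta> \<alpha> c \<zeta>"
proof -
  have *: "meijer_loop i s \<delta> \<alpha> c \<zeta> = meijer_loop i s' \<delta> \<alpha> c \<zeta>" if "s \<le> s'" "max 0 (- c) < s" for s s'
    unfolding meijer_loop_eq_loop_integral
    by (rule loop_integral_shift[OF assms(1) that(2,1) holomorphic_meijer_integrand[OF assms(1,2)]])
  have m: "max 0 (- c) < \<sigma>" "max 0 (- c) < \<sigma>'" using assms by auto
  show ?thesis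
  proof (cases "\<sigma> \<le> \<sigma>'")
    case True
    then show ?thesis using m(1) by (rule *)
  next
    case False
    then have "\<sigma>' \<le> \<sigma>" by simp
    then show ?thesis using m(2) by (rule *[symmetric])
  qed
qed

lemma meijer_loop_eq_loop_fun:
  assumes "\<delta> > 0" "\<sigma> > 0" "\<sigma> + c > 0" "\<zeta> > 0"
  shows "meijer_loop i \<sigma> \<delta> \<alpha> c \<zeta> = loop_fun i \<sigma> \<delta> c (gamma_quot \<alpha>) \<zeta>"
proof -
  let ?k = "1 / (2 * of_real pi * \<i>) :: complex"
  let ?f = "\<lambda>u. loop_weight i u * gamma_quot \<alpha> (u + of_real c) * of_real \<zeta> powr (- u)"
  have int: "integrable lborel (loop_integrand i \<sigma> \<delta> c (gamma_quot \<alpha>) \<zeta>)"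
    using loop_fun_asymp[OF assms(1-3) max.cobounded1, of \<zeta> i \<alpha>]
    by (elim exE conjE) (drule spec[of _ \<zeta>], drule mp[OF _ assms(4)], drule mp[OF _ max.cobounded2], elim conjE)
  have cont: "continuous_on (range (lpath \<sigma> \<delta>)) ?f"
    using assms(4) by (intro continuous_intros continuous_loop_weight continuous_gamma_quot_loop assms) auto
  have "loop_integral \<sigma> \<delta> (\<lambda>u. ?k * ?f u) = cloop \<sigma> \<delta> (\<lambda>u. ?k * ?f u)"
  proof (rule loop_integral_eq_cloop[OF assms(1) continuous_on_mult_left[OF cont]])
    show "integrable lborel (\<lambda>v. ?k * ?f (lpath \<sigma> \<delta> v) * ldir \<delta> v)"
      using integrable_mult_right[OF int, of ?k] by (simp only: mult.assoc)
  qed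
  then show ?thesis unfolding meijer_loop_eq_loop_integral cloop_cmult loop_fun_def .
qed

text \<open>The power of e * \<zeta> absorbs the part of the scaling that depends on u; the constant
  exponent (\<alpha> + 1) / 2 - c remains.\<close>

lemma scaled_rat_loop_integrand:
  fixes \<alpha> :: real and n :: nat
  assumes "n > 0" "\<zeta> > 0"
  defines "e \<equiv> edge_scale \<alpha> n"
  shows "loop_integrand i \<sigma> \<delta> c (scaled_rat \<alpha> n) \<zeta> v = of_real (e powr ((\<alpha> + 1) / 2 - c)) * loop_integrand i \<sigma> \<delta> c (cauchy_rat \<alpha> n) (e * \<zeta>) v"
proof -
  have e: "e > 0" unfolding e_def by (rule edge_scale_pos[OF assms(1)])
  have "of_real e powr (of_real ((\<alpha> + 1) / 2) - (u + of_real c)) * of_real \<zeta> powr (- u) = of_real (e powr ((\<alpha> + 1) / 2 - c)) * complex_of_real (e * \<zeta>) powr (- u)" for u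
  proof -
    have l: "Ln (complex_of_real e) = of_real (ln e)" "Ln (complex_of_real \<zeta>) = of_real (ln \<zeta>)" "Ln (complex_of_real (e * \<zeta>)) = of_real (ln e) + of_real (ln \<zeta>)"
      using e assms(2) by (simp_all only: Ln_of_real ln_mult_pos mult_pos_pos of_real_add)
    have nz: "complex_of_real e \<noteq> 0" "complex_of_real \<zeta> \<noteq> 0" "complex_of_real (e * \<zeta>) \<noteq> 0" using e assms(2) by auto
    have r: "complex_of_real (e powr ((\<alpha> + 1) / 2 - c)) = exp ((of_real ((\<alpha> + 1) / 2) - of_real c) * of_real (ln e))"
      using e by (simp add: powr_def flip: exp_of_real)
    show ?thesis
      unfolding r unfolding powr_def l using nz by (simp only: if_False exp_add[symmetric]) (simp add: algebra_simps)
  qed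
  then show ?thesis
    unfolding scaled_rat_def e_def[symmetric] by (simp add: mult_ac)
qed

lemma loop_fun_scaled_rat:
  fixes \<alpha> :: real and n :: nat
  assumes "n > 0" "\<zeta> > 0"
  defines "e \<equiv> edge_scale \<alpha> n"
  shows "loop_fun i \<sigma> \<delta> c (scaled_rat \<alpha> n) \<zeta> = of_real (e powr ((\<alpha> + 1) / 2 - c)) * loop_fun i \<sigma> \<delta> c (cauchy_rat \<alpha> n) (e * \<zeta>)"
  unfolding loop_fun_def cloop_def scaled_rat_loop_integrand[OF assms(1,2)] e_def[symmetric]
    integral_mult_right_zero by simp

text \<open>The constant exponents (\<alpha> + 1) / 2 - a and (\<alpha> + 1) / 2 - b of the two
  loops add to 1, which is the factor e in front of the kernel.\<close>

lemma scaled_kernel_sum: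
  fixes a b \<alpha> :: real and n :: nat
  defines "\<alpha> \<equiv> a + b"
  assumes "\<delta> > 0" "\<sigma> > 0" "\<sigma> + a > 0" "\<sigma>' > 0" "\<sigma>' + b > 0" "\<sigma> + \<sigma>' < 1" "\<alpha> > -1" "n > 0" "0 < \<zeta>" "0 < \<xi>"
    and "edge_scale \<alpha> n * \<zeta> < 1" "edge_scale \<alpha> n * \<xi> < 1"
    and int: "integrable lborel (loop_integrand i \<sigma> \<delta> a (scaled_rat \<alpha> n) \<zeta>)" "integrable lborel (loop_integrand j \<sigma>' \<delta> b (scaled_rat \<alpha> n) \<xi>)"
  defines "e \<equiv> edge_scale \<alpha> n"
  shows "complex_of_real (e * kernel_sum i j a b n (e * \<zeta>) (e * \<xi>)) =
     (LINT t:{0<..<1}|lborel. loop_fun i \<sigma> \<delta> a (scaled_rat \<alpha> n) (t * \<zeta>) * loop_fun j \<sigma>' \<delta> b (scaled_rat \<alpha> n) (t * \<xi>))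
     - of_bool (i \<and> j) * of_real ((1 - exp (- e * (\<zeta> + \<xi>))) / (\<zeta> + \<xi>))"
proof -
  have e: "e > 0" unfolding e_def by (rule edge_scale_pos[OF assms(9)])
  have int': "integrable lborel (loop_integrand i \<sigma> \<delta> a (cauchy_rat \<alpha> n) (e * \<zeta>))" "integrable lborel (loop_integrand j \<sigma>' \<delta> b (cauchy_rat \<alpha> n) (e * \<xi>))"
  proof -
    have gen: "integrable lborel f" if "integrable lborel (\<lambda>v. of_real (e powr r) * f v)" for f :: "real \<Rightarrow> complex" and r
      using integrable_mult_right[OF that, of "inverse (of_real (e powr r))"] e by (simp add: mult.assoc[symmetric])
    show "integrable lborel (loop_integrand i \<sigma> \<delta> a (cauchy_rat \<alpha> n) (e * \<zeta>))"
      by (rule gen[OF int(1)[unfolded scaled_rat_loop_integrand[OF assms(9,10)] e_def[symmetric]]])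
    show "integrable lborel (loop_integrand j \<sigma>' \<delta> b (cauchy_rat \<alpha> n) (e * \<xi>))"
      by (rule gen[OF int(2)[unfolded scaled_rat_loop_integrand[OF assms(9,11)] e_def[symmetric]]])
  qed
  let ?J = "LINT t:{0<..<1}|lborel. loop_fun i \<sigma> \<delta> a (cauchy_rat \<alpha> n) (t * (e * \<zeta>)) * loop_fun j \<sigma>' \<delta> b (cauchy_rat \<alpha> n) (t * (e * \<xi>))"
  have K: "complex_of_real (kernel_sum i j a b n (e * \<zeta>) (e * \<xi>)) = ?J - of_bool (i \<and> j) * of_real ((1 - exp (- (e * \<zeta>) - e * \<xi>)) / (e * \<zeta> + e * \<xi>))"
    using e assms(10,11) unfolding \<alpha>_def
    by (intro kernel_sum_loop[OF assms(2-7) assms(8)[unfolded \<alpha>_def] assms(9)] int'[unfolded \<alpha>_def]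
        assms(12,13)[folded e_def] mult_pos_pos)
  have "(LINT t:{0<..<1}|lborel. loop_fun i \<sigma> \<delta> a (scaled_rat \<alpha> n) (t * \<zeta>) * loop_fun j \<sigma>' \<delta> b (scaled_rat \<alpha> n) (t * \<xi>))
     = (LINT t:{0<..<1}|lborel. of_real e * (loop_fun i \<sigma> \<delta> a (cauchy_rat \<alpha> n) (t * (e * \<zeta>)) * loop_fun j \<sigma>' \<delta> b (cauchy_rat \<alpha> n) (t * (e * \<xi>))))"
  proof (intro set_lebesgue_integral_cong allI impI)
    fix t :: real assume t: "t \<in> {0<..<1}"
    have p: "0 < t * \<zeta>" "0 < t * \<xi>" using t assms by auto
    have "e powr ((\<alpha> + 1) / 2 - a) * e powr ((\<alpha> + 1) / 2 - b) = e powr 1"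
      unfolding powr_add[symmetric] by (rule arg_cong[where f = "(powr) e"]) (simp add: \<alpha>_def field_simps)
    then have pw: "e powr ((\<alpha> + 1) / 2 - a) * e powr ((\<alpha> + 1) / 2 - b) = e" using e by simp
    have c: "e * (t * \<zeta>) = t * (e * \<zeta>)" "e * (t * \<xi>) = t * (e * \<xi>)" by simp_all
    have "loop_fun i \<sigma> \<delta> a (scaled_rat \<alpha> n) (t * \<zeta>) * loop_fun j \<sigma>' \<delta> b (scaled_rat \<alpha> n) (t * \<xi>)
      = of_real (e powr ((\<alpha> + 1) / 2 - a) * e powr ((\<alpha> + 1) / 2 - b)) * (loop_fun i \<sigma> \<delta> a (cauchy_rat \<alpha> n) (t * (e * \<zeta>)) * loop_fun j \<sigma>' \<delta> b (cauchy_rat \<alpha> n) (t * (e * \<xi>)))"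
      unfolding loop_fun_scaled_rat[OF assms(9) p(1)] loop_fun_scaled_rat[OF assms(9) p(2)] e_def[symmetric] c by simp
    then show "loop_fun i \<sigma> \<delta> a (scaled_rat \<alpha> n) (t * \<zeta>) * loop_fun j \<sigma>' \<delta> b (scaled_rat \<alpha> n) (t * \<xi>)
      = of_real e * (loop_fun i \<sigma> \<delta> a (cauchy_rat \<alpha> n) (t * (e * \<zeta>)) * loop_fun j \<sigma>' \<delta> b (cauchy_rat \<alpha> n) (t * (e * \<xi>)))"
      unfolding pw .
  qed simp
  also have "\<dots> = of_real e * ?J" by (rule set_integral_mult_right)
  finally have J: "of_real e * ?J = (LINT t:{0<..<1}|lborel. loop_fun i \<sigma> \<delta> a (scaled_rat \<alpha> n) (t * \<zeta>) * loop_fun j \<sigma>' \<delta> b (scaled_rat \<alpha> n) (t * \<xi>))" by simp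
  have "e * ((1 - exp (- (e * \<zeta>) - e * \<xi>)) / (e * \<zeta> + e * \<xi>)) = (1 - exp (- e * (\<zeta> + \<xi>))) / (\<zeta> + \<xi>)"
  proof -
    have "e * (X / (e * S)) = X / S" for X S using e by simp
    from this[of "1 - exp (- (e * \<zeta>) - e * \<xi>)" "\<zeta> + \<xi>"] show ?thesis by (simp add: algebra_simps)
  qed
  then have "complex_of_real e * (of_bool (i \<and> j) * of_real ((1 - exp (- (e * \<zeta>) - e * \<xi>)) / (e * \<zeta> + e * \<xi>))) = of_bool (i \<and> j) * of_real ((1 - exp (- e * (\<zeta> + \<xi>))) / (\<zeta> + \<xi>))"
    by (simp only: mult.left_commute[of "complex_of_real e"] of_real_mult[symmetric])
  then show ?thesis
    unfolding of_real_mult[of e] K right_diff_distrib J by simp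
qed

section \<open>Estimate of the kernels, uniform on compact sets\<close>

lemma integral_powr_01:
  fixes e :: real
  assumes "e > -1" shows "(LINT t:{0<..<1}|lborel. t powr e) = 1 / (e + 1)"
proof -
  have hi: "((\<lambda>t. t powr e) has_integral 1 / (e + 1)) {0..1}"
    using has_integral_powr_from_0[of e 1] assms by simp
  have "((\<lambda>t. t powr e) has_integral 1 / (e + 1)) {0<..<1}"
    using hi unfolding has_integral_Icc_iff_Ioo .
  then show ?thesis
    using set_borel_integral_eq_integral(2)[OF set_integrable_powr_01[OF assms]] by (simp add: integral_unique)
qed

lemma exp_minus_one_bound: "\<bar>x\<bar> \<le> 1 \<Longrightarrow> \<bar>exp x - 1\<bar> \<le> 3 * \<bar>x\<bar>" for x :: real
proof -
  assume x: "\<bar>x\<bar> \<le> 1"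
  have "exp (complex_of_real x) - 1 = of_real (exp x - 1)" by (simp add: exp_of_real)
  then have "norm (exp (complex_of_real x) - 1) = \<bar>exp x - 1\<bar>" by (simp only: norm_of_real)
  then have "\<bar>exp x - 1\<bar> \<le> exp \<bar>x\<bar> * \<bar>x\<bar>" using Taylor_exp[of "complex_of_real x" 0] by simp
  also have "\<dots> \<le> 3 * \<bar>x\<bar>"
  proof (rule mult_right_mono)
    have "exp \<bar>x\<bar> \<le> exp 1" using x by simp
    then show "exp \<bar>x\<bar> \<le> 3" using exp_le by linarith
  qed simp
  finally show ?thesis .
qed

lemma integral_powr_bound:
  fixes f :: "real \<Rightarrow> complex"
  assumes [measurable]: "f \<in> borel_measurable borel" and b: "\<And>t. t \<in> {0<..<1} \<Longrightarrow> norm (f t) \<le> M * t powr (- \<rho>)" and "\<rho> < 1"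
  shows "set_integrable lborel {0<..<1} f" "norm (LINT t:{0<..<1}|lborel. f t) \<le> M / (1 - \<rho>)"
proof -
  have r: "- \<rho> > -1" using assms(3) by simp
  have g: "integrable lborel (\<lambda>t. M * (indicator {0<..<1} t *\<^sub>R t powr (- \<rho>)))"
    using set_integrable_powr_01[OF r] unfolding set_integrable_def by (rule integrable_mult_right)
  have b': "norm (indicator {0<..<1} t *\<^sub>R f t) \<le> M * (indicator {0<..<1} t *\<^sub>R t powr (- \<rho>))" for t
    using b[of t] by (cases "t \<in> {0<..<1}") auto
  show i: "set_integrable lborel {0<..<1} f"
    unfolding set_integrable_def
    by (rule Bochner_Integration.integrable_bound[OF g]) (use b' in \<open>auto intro: order_trans[OF _ abs_ge_self]\<close>)
  have "norm (LINT t:{0<..<1}|lborel. f t) \<le> (LINT t|lborel. M * (indicator {0<..<1} t *\<^sub>R t powr (- \<rho>)))"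
    unfolding set_lebesgue_integral_def
    by (rule Bochner_Integration.integral_norm_bound_integral[OF i[unfolded set_integrable_def] g b'])
  also have "\<dots> = M / (1 - \<rho>)"
    using integral_powr_01[OF r] by (simp add: set_lebesgue_integral_def)
  finally show "norm (LINT t:{0<..<1}|lborel. f t) \<le> M / (1 - \<rho>)" .
qed

lemma LBINT_0_1: "(LBINT t=0..1. f t) = (LINT t:{0<..<1}|lborel. f t)"
  by (simp add: interval_integral_Ioo)

lemma compact_pos_bounds:
  fixes S :: "(real \<times> real) set"
  assumes "compact S" "S \<subseteq> {0<..} \<times> {0<..}"
  obtains m X where "0 < m" "m \<le> 1" "X \<ge> 1" "\<And>\<zeta> \<xi>. (\<zeta>, \<xi>) \<in> S \<Longrightarrow> m \<le> \<zeta> \<and> m \<le> \<xi> \<and> \<zeta> \<le> X \<and> \<xi> \<le> X"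
proof -
  obtain B where B: "\<And>z. z \<in> S \<Longrightarrow> norm z \<le> B"
    using compact_imp_bounded[OF assms(1)] by (auto simp: bounded_iff)
  have "continuous_on S (\<lambda>z. (1 / fst z, 1 / snd z))"
    using assms(2) by (intro continuous_intros) auto
  then have "compact ((\<lambda>z. (1 / fst z, 1 / snd z)) ` S)" using assms(1) by (rule compact_continuous_image)
  from compact_imp_bounded[OF this] obtain B' where B': "\<And>z. z \<in> S \<Longrightarrow> norm (1 / fst z, 1 / snd z) \<le> B'"
    by (auto simp: bounded_iff)
  show ?thesis
  proof (rule that[of "1 / max 1 B'" "max 1 B"])
    fix \<zeta> \<xi> assume S: "(\<zeta>, \<xi>) \<in> S"
    then have p: "\<zeta> > 0" "\<xi> > 0" using assms(2) by auto
    have "\<bar>\<zeta>\<bar> \<le> B" "\<bar>\<xi>\<bar> \<le> B"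
      using B[OF S] norm_fst_le[of \<zeta> \<xi>] norm_snd_le[of \<xi> \<zeta>] by auto
    moreover have "\<bar>1 / \<zeta>\<bar> \<le> B'" "\<bar>1 / \<xi>\<bar> \<le> B'"
      using B'[OF S] norm_fst_le[of "1 / \<zeta>" "1 / \<xi>"] norm_snd_le[of "1 / \<xi>" "1 / \<zeta>"] by auto
    then have "1 / \<zeta> \<le> max 1 B'" "1 / \<xi> \<le> max 1 B'" using p by auto
    then have "1 / max 1 B' \<le> 1 / (1 / \<zeta>)" "1 / max 1 B' \<le> 1 / (1 / \<xi>)"
      using p by (intro divide_left_mono; simp)+
    ultimately show "1 / max 1 B' \<le> \<zeta> \<and> 1 / max 1 B' \<le> \<xi> \<and> \<zeta> \<le> max 1 B \<and> \<xi> \<le> max 1 B" by auto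
  qed (auto simp: divide_simps)
qed

definition kernel_sign :: "bool \<Rightarrow> real" where "kernel_sign i = (if i then 1 else - 1)"

text \<open>Common form of the four cases of \<open>H_expansion\<close>; \<open>kernel_sign\<close>
  records whether an index carries a growing or a decaying exponential.\<close>

definition finite_kernel :: "bool \<Rightarrow> bool \<Rightarrow> real \<Rightarrow> real \<Rightarrow> nat \<Rightarrow> real \<Rightarrow> real \<Rightarrow> real" where
  "finite_kernel i j a b n x y =
     exp (kernel_sign i * x + kernel_sign j * y) * kernel_sum i j a b n x y - of_bool (i \<and> j) / (x + y)"

definition limit_kernel :: "bool \<Rightarrow> bool \<Rightarrow> real \<Rightarrow> real \<Rightarrow> real \<Rightarrow> real \<Rightarrow> real \<Rightarrow> real \<Rightarrow> complex" where
  "limit_kernel i j \<sigma> \<delta> a b \<zeta> \<xi> =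
     (LBINT t=0..1. meijer_loop i \<sigma> \<delta> (a + b) a (t * \<zeta>) * meijer_loop j \<sigma> \<delta> (a + b) b (t * \<xi>))
       - of_bool (i \<and> j) * of_real (1 / (\<zeta> + \<xi>))"

text \<open>Once the given contour is exchanged for two with abscissae p and q, the integrands of
  the finite and the limiting kernel differ by O(n^-2) t powr (- (p + q)), which is integrable. The
  exponential prefactor differs from 1 by O(n^-2) as well, because the rescaled points are of that
  order.\<close>

lemma kernel_estimate:
  fixes a b \<sigma> \<delta> :: real
  assumes "a > -1" "b > -1" "a + b > -1" "\<sigma> > 0" "\<sigma> > - a" "\<sigma> > - b" "\<delta> > 0"
    and "compact S" "S \<subseteq> {0<..} \<times> {0<..}"
  shows "\<exists>C. \<forall>\<^sub>F n in sequentially. \<forall>(\<zeta>, \<xi>)\<in>S.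
     norm (of_real (edge_scale (a + b) n * finite_kernel i j a b n (edge_scale (a + b) n * \<zeta>) (edge_scale (a + b) n * \<xi>))
       - limit_kernel i j \<sigma> \<delta> a b \<zeta> \<xi>) \<le> C / real n ^ 2"
proof -
  define \<alpha> where "\<alpha> = a + b"
  \<comment> \<open>A third of the slack, positive because a, b and a + b all exceed -1. Each
    abscissa exceeds its lower bound by this amount, so p + q stays below 1.\<close>
  define s where "s = (1 - max 0 (- a) - max 0 (- b)) / 3"
  have s: "s > 0" using assms(1-3) by (auto simp: s_def max_def)
  define p where "p = max 0 (- a) + s"
  define q where "q = max 0 (- b) + s"
  have p: "p > 0" "p + a > 0" "p > - a" and q: "q > 0" "q + b > 0" "q > - b"
    using s by (auto simp: p_def q_def max_def)
  have "3 * s = 1 - max 0 (- a) - max 0 (- b)" by (simp add: s_def)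
  then have pq: "p + q < 1" using s unfolding p_def q_def by linarith
  obtain m X where mX: "0 < m" "m \<le> 1" "X \<ge> 1" "\<And>\<zeta> \<xi>. (\<zeta>, \<xi>) \<in> S \<Longrightarrow> m \<le> \<zeta> \<and> m \<le> \<xi> \<and> \<zeta> \<le> X \<and> \<xi> \<le> X"
    using compact_pos_bounds[OF assms(8,9)] by blast
  let ?U = "loop_fun i p \<delta> a (gamma_quot \<alpha>)" and ?V = "loop_fun j q \<delta> b (gamma_quot \<alpha>)"
  let ?Un = "\<lambda>n. loop_fun i p \<delta> a (scaled_rat \<alpha> n)" and ?Vn = "\<lambda>n. loop_fun j q \<delta> b (scaled_rat \<alpha> n)"
  obtain K1 n1 where K1: "K1 \<ge> 0" "n1 \<ge> 1" and U: "\<forall>x. 0 < x \<longrightarrow> x \<le> X \<longrightarrow>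
     integrable lborel (loop_integrand i p \<delta> a (gamma_quot \<alpha>) x) \<and> norm (?U x) \<le> K1 * x powr (- p) \<and>
     (\<forall>n\<ge>n1. integrable lborel (loop_integrand i p \<delta> a (scaled_rat \<alpha> n) x) \<and>
        norm (?Un n x - ?U x) \<le> K1 / real n ^ 2 * x powr (- p))"
    using loop_fun_asymp[OF assms(7) p(1,2) mX(3), of i \<alpha>] by blast
  obtain K2 n2 where K2: "K2 \<ge> 0" "n2 \<ge> 1" and V: "\<forall>x. 0 < x \<longrightarrow> x \<le> X \<longrightarrow>
     integrable lborel (loop_integrand j q \<delta> b (gamma_quot \<alpha>) x) \<and> norm (?V x) \<le> K2 * x powr (- q) \<and>
     (\<forall>n\<ge>n2. integrable lborel (loop_integrand j q \<delta> b (scaled_rat \<alpha> n) x) \<and>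
        norm (?Vn n x - ?V x) \<le> K2 / real n ^ 2 * x powr (- q))"
    using loop_fun_asymp[OF assms(7) q(1,2) mX(3), of j \<alpha>] by blast
  obtain c n3 where c: "c \<ge> 0" "n3 \<ge> 1" "\<And>n. n \<ge> n3 \<Longrightarrow> edge_scale \<alpha> n \<le> c / real n ^ 2"
    using edge_scale_defect[of \<alpha>] by metis
  define P where "P = K1 * m powr (- p)"
  define Q where "Q = K2 * m powr (- q)"
  have PQ: "P \<ge> 0" "Q \<ge> 0" using K1 K2 by (auto simp: P_def Q_def)
  define M where "M = 4 * (P * Q) / (1 - (p + q)) + 1 / (2 * m)"
  \<comment> \<open>The first part bounds |exp \<theta> - 1| times the bound M for the kernel, the
    second the error of the t-integral.\<close>
  define C where "C = 6 * X * c * M + 3 * (P * Q) / (1 - (p + q))"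
  \<comment> \<open>Puts e * \<zeta> and e * \<xi> below 1/2, so that the loop evaluations apply,
    and gives |\<theta>| < 1.\<close>
  have ev: "\<forall>\<^sub>F n in sequentially. 2 * X * (c / real n ^ 2) < 1" by real_asymp
  have "\<forall>\<^sub>F n in sequentially. \<forall>(\<zeta>, \<xi>)\<in>S.
     norm (of_real (edge_scale \<alpha> n * finite_kernel i j a b n (edge_scale \<alpha> n * \<zeta>) (edge_scale \<alpha> n * \<xi>))
       - limit_kernel i j \<sigma> \<delta> a b \<zeta> \<xi>) \<le> C / real n ^ 2"
    using ev eventually_ge_at_top[of "max n1 (max n2 n3)"]
  proof eventually_elim
    case (elim n)
    then have n: "n \<ge> n1" "n \<ge> n2" "n \<ge> n3" "n > 0" using K1(2) by auto
    define e where "e = edge_scale \<alpha> n"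
    have e0: "e > 0" unfolding e_def by (rule edge_scale_pos[OF n(4)])
    have ec: "e \<le> c / real n ^ 2" unfolding e_def by (rule c(3)[OF n(3)])
    have n2: "1 / real n ^ 2 \<le> 1" using n(4) by (simp add: divide_simps)
    show ?case
    proof (clarify)
      fix \<zeta> \<xi> assume S: "(\<zeta>, \<xi>) \<in> S"
      have z: "m \<le> \<zeta>" "m \<le> \<xi>" "\<zeta> \<le> X" "\<xi> \<le> X" "\<zeta> > 0" "\<xi> > 0" using mX(4)[OF S] mX(1) by auto
      have eX: "e * \<zeta> \<le> e * X" "e * \<xi> \<le> e * X" using z e0 by auto
      have "2 * X * e \<le> 2 * X * (c / real n ^ 2)" using ec mX(3) by (intro mult_left_mono) auto
      then have eX1: "2 * X * e < 1" using elim(1) by linarith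
      then have lt1: "e * \<zeta> < 1" "e * \<xi> < 1" using eX mX(3) e0 mult_pos_pos[of X e] unfolding mult.commute[of e X] by linarith+
      have tz: "0 < t * x \<and> t * x \<le> X \<and> (t * x) powr (- r) \<le> m powr (- r) * t powr (- r)" if "t \<in> {0<..<1}" "m \<le> x" "x \<le> X" "r > 0" for t x r
      proof -
        have x: "x > 0" using that mX(1) by simp
        have "t * x \<le> 1 * X" using that x by (intro mult_mono) auto
        moreover have "(t * x) powr (- r) = t powr (- r) * x powr (- r)" using that x by (simp add: powr_mult)
        moreover have "x powr (- r) \<le> m powr (- r)" using that mX(1) by (intro powr_mono2') auto
        ultimately show ?thesis using that x by (simp add: mult.commute mult_left_mono)
      qed
      have Ub: "norm (?U (t * \<zeta>)) \<le> P * t powr (- p)" "norm (?Un n (t * \<zeta>) - ?U (t * \<zeta>)) \<le> P / real n ^ 2 * t powr (- p)" if t: "t \<in> {0<..<1}" for t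
      proof -
        note h = tz[OF t z(1,3) p(1)]
        have 1: "K * (t * \<zeta>) powr (- p) \<le> K * m powr (- p) * t powr (- p)" if "K \<ge> 0" for K
          using mult_left_mono[OF conjunct2[OF conjunct2[OF h]] that] by (simp add: mult.assoc)
        show "norm (?U (t * \<zeta>)) \<le> P * t powr (- p)"
          using U h 1[OF K1(1)] unfolding P_def by (meson order_trans)
        have "norm (?Un n (t * \<zeta>) - ?U (t * \<zeta>)) \<le> K1 / real n ^ 2 * (t * \<zeta>) powr (- p)" using U h n(1) by blast
        also have "\<dots> \<le> K1 / real n ^ 2 * m powr (- p) * t powr (- p)" by (rule 1) (use K1 in simp)
        finally show "norm (?Un n (t * \<zeta>) - ?U (t * \<zeta>)) \<le> P / real n ^ 2 * t powr (- p)" by (simp add: P_def)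
      qed
      have Vb: "norm (?V (t * \<xi>)) \<le> Q * t powr (- q)" "norm (?Vn n (t * \<xi>) - ?V (t * \<xi>)) \<le> Q / real n ^ 2 * t powr (- q)" if t: "t \<in> {0<..<1}" for t
      proof -
        note h = tz[OF t z(2,4) q(1)]
        have 1: "K * (t * \<xi>) powr (- q) \<le> K * m powr (- q) * t powr (- q)" if "K \<ge> 0" for K
          using mult_left_mono[OF conjunct2[OF conjunct2[OF h]] that] by (simp add: mult.assoc)
        show "norm (?V (t * \<xi>)) \<le> Q * t powr (- q)"
          using V h 1[OF K2(1)] unfolding Q_def by (meson order_trans)
        have "norm (?Vn n (t * \<xi>) - ?V (t * \<xi>)) \<le> K2 / real n ^ 2 * (t * \<xi>) powr (- q)" using V h n(2) by blast
        also have "\<dots> \<le> K2 / real n ^ 2 * m powr (- q) * t powr (- q)" by (rule 1) (use K2 in simp)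
        finally show "norm (?Vn n (t * \<xi>) - ?V (t * \<xi>)) \<le> Q / real n ^ 2 * t powr (- q)" by (simp add: Q_def)
      qed
      have Vnb: "norm (?Vn n (t * \<xi>)) \<le> 2 * Q * t powr (- q)" if t: "t \<in> {0<..<1}" for t
      proof -
        have "Q * (1 / real n ^ 2) * t powr (- q) \<le> Q * 1 * t powr (- q)"
          using n2 PQ by (intro mult_right_mono mult_left_mono) auto
        then show ?thesis
          using norm_triangle_sub[of "?Vn n (t * \<xi>)" "?V (t * \<xi>)"] Vb[OF t] by simp
      qed
      have tpq: "t powr (- p) * t powr (- q) = t powr (- (p + q))" for t :: real by (simp flip: powr_add)
      have mU: "(\<lambda>t. ?U (t * \<zeta>)) \<in> borel_measurable borel" "(\<lambda>t. ?V (t * \<xi>)) \<in> borel_measurable borel"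
        "(\<lambda>t. ?Un n (t * \<zeta>)) \<in> borel_measurable borel" "(\<lambda>t. ?Vn n (t * \<xi>)) \<in> borel_measurable borel"
        by (intro measurable_loop_integrand continuous_gamma_quot_loop continuous_scaled_rat_loop assms p q n)+
      define J where "J = (LINT t:{0<..<1}|lborel. ?U (t * \<zeta>) * ?V (t * \<xi>))"
      define Jn where "Jn = (LINT t:{0<..<1}|lborel. ?Un n (t * \<zeta>) * ?Vn n (t * \<xi>))"
      have b0: "norm (?U (t * \<zeta>) * ?V (t * \<xi>)) \<le> P * Q * t powr (- (p + q))" if t: "t \<in> {0<..<1}" for t
        unfolding norm_mult tpq[symmetric] using mult_mono[OF Ub(1)[OF t] Vb(1)[OF t]] PQ by (simp add: mult_ac)
      \<comment> \<open>The difference of products is split as (U_n - U) V_n + U (V_n - V). As V_n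
        is bounded by twice the bound for V, the constants add to 2 + 1 = 3.\<close>
      have b1: "norm (?Un n (t * \<zeta>) * ?Vn n (t * \<xi>) - ?U (t * \<zeta>) * ?V (t * \<xi>)) \<le> 3 * (P * Q) / real n ^ 2 * t powr (- (p + q))" if t: "t \<in> {0<..<1}" for t
      proof -
        have "?Un n (t * \<zeta>) * ?Vn n (t * \<xi>) - ?U (t * \<zeta>) * ?V (t * \<xi>) = (?Un n (t * \<zeta>) - ?U (t * \<zeta>)) * ?Vn n (t * \<xi>) + ?U (t * \<zeta>) * (?Vn n (t * \<xi>) - ?V (t * \<xi>))"
          by (simp add: algebra_simps)
        also have "norm \<dots> \<le> norm (?Un n (t * \<zeta>) - ?U (t * \<zeta>)) * norm (?Vn n (t * \<xi>)) + norm (?U (t * \<zeta>)) * norm (?Vn n (t * \<xi>) - ?V (t * \<xi>))"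
          by (intro norm_triangle_le) (simp add: norm_mult)
        also have "\<dots> \<le> (P / real n ^ 2 * t powr (- p)) * (2 * Q * t powr (- q)) + (P * t powr (- p)) * (Q / real n ^ 2 * t powr (- q))"
          by (intro add_mono mult_mono Ub[OF t] Vb[OF t] Vnb[OF t]) (use PQ in auto)
        also have "\<dots> = 3 * (P * Q) / real n ^ 2 * (t powr (- p) * t powr (- q))"
          by (simp add: field_simps)
        finally show ?thesis unfolding tpq .
      qed
      have mm: "(\<lambda>t. ?U (t * \<zeta>) * ?V (t * \<xi>)) \<in> borel_measurable borel" "(\<lambda>t. ?Un n (t * \<zeta>) * ?Vn n (t * \<xi>) - ?U (t * \<zeta>) * ?V (t * \<xi>)) \<in> borel_measurable borel"
        using mU by measurable
      note i0 = integral_powr_bound[OF mm(1) b0 pq] and i1 = integral_powr_bound[OF mm(2) b1 pq]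
      have "(LINT t:{0<..<1}|lborel. (?Un n (t * \<zeta>) * ?Vn n (t * \<xi>) - ?U (t * \<zeta>) * ?V (t * \<xi>)) + ?U (t * \<zeta>) * ?V (t * \<xi>))
         = (LINT t:{0<..<1}|lborel. ?Un n (t * \<zeta>) * ?Vn n (t * \<xi>) - ?U (t * \<zeta>) * ?V (t * \<xi>)) + J"
        unfolding J_def by (rule set_integral_add(2)[OF i1(1) i0(1)])
      then have JJ: "norm (Jn - J) \<le> 3 * (P * Q) / (1 - (p + q)) / real n ^ 2"
        using i1(2) by (simp add: Jn_def mult.commute)
      have J0: "norm J \<le> P * Q / (1 - (p + q))" using i0(2) by (simp add: J_def)
      define g where "g = of_bool (i \<and> j) * complex_of_real (1 / (\<zeta> + \<xi>))"
      have lim: "limit_kernel i j \<sigma> \<delta> a b \<zeta> \<xi> = J - g"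
      proof -
        have "(LINT t:{0<..<1}|lborel. meijer_loop i \<sigma> \<delta> (a + b) a (t * \<zeta>) * meijer_loop j \<sigma> \<delta> (a + b) b (t * \<xi>)) = J"
          unfolding J_def
        proof (intro set_lebesgue_integral_cong allI impI)
          fix t :: real assume t: "t \<in> {0<..<1}"
          have pos: "t * \<zeta> > 0" "t * \<xi> > 0" using t z by auto
          show "meijer_loop i \<sigma> \<delta> (a + b) a (t * \<zeta>) * meijer_loop j \<sigma> \<delta> (a + b) b (t * \<xi>) = ?U (t * \<zeta>) * ?V (t * \<xi>)"
            unfolding meijer_loop_shift[OF assms(7) pos(1) assms(4,5) p(1,3)] meijer_loop_shift[OF assms(7) pos(2) assms(4,6) q(1,3)]
              meijer_loop_eq_loop_fun[OF assms(7) p(1,2) pos(1)] meijer_loop_eq_loop_fun[OF assms(7) q(1,2) pos(2)] \<alpha>_def ..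
        qed simp
        then show ?thesis by (simp only: limit_kernel_def LBINT_0_1 g_def)
      qed
      define \<theta> where "\<theta> = kernel_sign i * (e * \<zeta>) + kernel_sign j * (e * \<xi>)"
      \<comment> \<open>For i = j = True the elementary term and the subtracted 1 / (x + y) combine
        exactly: exp \<theta> (Jn - (1 - exp (- \<theta>)) g) - g = exp \<theta> (Jn - g), the same
        shape as the limit J - g.\<close>
      have fin: "complex_of_real (e * finite_kernel i j a b n (e * \<zeta>) (e * \<xi>)) = of_real (exp \<theta>) * (Jn - g)"
      proof -
        have ks: "complex_of_real (e * kernel_sum i j a b n (e * \<zeta>) (e * \<xi>)) = Jn - of_bool (i \<and> j) * of_real ((1 - exp (- e * (\<zeta> + \<xi>))) / (\<zeta> + \<xi>))"
          unfolding Jn_def e_def \<alpha>_def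
          by (rule scaled_kernel_sum) (use assms p q pq n z lt1 U V in \<open>auto simp: e_def \<alpha>_def\<close>)
        have er: "e * (of_bool (i \<and> j) / (e * \<zeta> + e * \<xi>)) = of_bool (i \<and> j) * (1 / (\<zeta> + \<xi>))"
          using e0 by (simp add: distrib_left[symmetric])
        have "complex_of_real (e * finite_kernel i j a b n (e * \<zeta>) (e * \<xi>)) = of_real (exp \<theta>) * of_real (e * kernel_sum i j a b n (e * \<zeta>) (e * \<xi>)) - of_real (e * (of_bool (i \<and> j) / (e * \<zeta> + e * \<xi>)))"
          unfolding finite_kernel_def \<theta>_def by (simp add: right_diff_distrib mult_ac)
        also have "\<dots> = of_real (exp \<theta>) * Jn - of_bool (i \<and> j) * (of_real (exp \<theta> * ((1 - exp (- e * (\<zeta> + \<xi>))) / (\<zeta> + \<xi>)) + 1 / (\<zeta> + \<xi>)))"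
          unfolding ks er by (simp add: algebra_simps)
        also have "\<dots> = of_real (exp \<theta>) * Jn - of_bool (i \<and> j) * of_real (exp \<theta> * (1 / (\<zeta> + \<xi>)))"
        proof (cases "i \<and> j")
          case True
          then have "\<theta> = e * (\<zeta> + \<xi>)" by (simp add: \<theta>_def kernel_sign_def distrib_left)
          then have "exp \<theta> * exp (- e * (\<zeta> + \<xi>)) = 1" by (simp flip: exp_add)
          then have "exp \<theta> * ((1 - exp (- e * (\<zeta> + \<xi>))) / (\<zeta> + \<xi>)) + 1 / (\<zeta> + \<xi>) = exp \<theta> * (1 / (\<zeta> + \<xi>))"
            by (simp only: times_divide_eq_right right_diff_distrib add_divide_distrib[symmetric]) simp
          then show ?thesis by (simp only:)
        next
          case False
          then have "(of_bool (i \<and> j) :: complex) = 0" by (simp only: of_bool_eq(1))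
          then show ?thesis by (simp only: mult_zero_left)
        qed
        finally show ?thesis by (simp add: g_def right_diff_distrib)
      qed
      have th: "\<bar>\<theta>\<bar> \<le> 2 * X * e"
      proof -
        have "\<bar>\<theta>\<bar> \<le> e * \<zeta> + e * \<xi>"
          using z e0 mult_pos_pos[of e \<zeta>] mult_pos_pos[of e \<xi>] by (auto simp: \<theta>_def kernel_sign_def abs_if)
        also have "\<dots> \<le> e * X + e * X" using eX by (rule add_mono)
        also have "\<dots> = 2 * X * e" by simp
        finally show ?thesis .
      qed
      have "\<bar>exp \<theta> - 1\<bar> \<le> 3 * \<bar>\<theta>\<bar>" by (rule exp_minus_one_bound) (use th eX1 in linarith)
      also have "\<dots> \<le> 6 * X * e" using th by simp
      also have "\<dots> \<le> 6 * X * (c / real n ^ 2)" using ec mX(3) by (intro mult_left_mono) auto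
      finally have exb: "\<bar>exp \<theta> - 1\<bar> \<le> 6 * X * (c / real n ^ 2)" .
      have gb: "norm g \<le> 1 / (2 * m)"
      proof -
        have "1 / (\<zeta> + \<xi>) \<le> 1 / (2 * m)" using z mX(1) by (intro divide_left_mono) auto
        then show ?thesis using z mX(1) by (auto simp: g_def norm_mult norm_divide simp flip: of_real_add)
      qed
      have "3 * (P * Q) / (1 - (p + q)) * (1 / real n ^ 2) \<le> 3 * (P * Q) / (1 - (p + q)) * 1"
        using n2 PQ pq by (intro mult_left_mono) auto
      then have "norm (Jn - J) \<le> 3 * (P * Q) / (1 - (p + q))" using JJ by simp
      moreover have "norm (Jn - g) \<le> norm (Jn - J) + norm J + norm g"
        using norm_triangle_ineq4[of "(Jn - J) + J" g] norm_triangle_ineq[of "Jn - J" J] by simp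
      ultimately have Mb: "norm (Jn - g) \<le> M" using J0 gb by (simp add: M_def add_divide_distrib[symmetric] algebra_simps)
      have "of_real (exp \<theta>) * (Jn - g) - (J - g) = of_real (exp \<theta> - 1) * (Jn - g) + (Jn - J)"
        by (simp add: algebra_simps)
      also have "norm \<dots> \<le> \<bar>exp \<theta> - 1\<bar> * norm (Jn - g) + norm (Jn - J)"
        using norm_triangle_ineq[of "of_real (exp \<theta> - 1) * (Jn - g)" "Jn - J"] by (simp only: norm_mult norm_of_real)
      also have "\<dots> \<le> 6 * X * (c / real n ^ 2) * M + 3 * (P * Q) / (1 - (p + q)) / real n ^ 2"
        by (intro add_mono mult_mono exb Mb JJ) (use c mX in auto)
      also have "\<dots> = C / real n ^ 2" by (simp add: C_def add_divide_distrib)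
      finally show "norm (of_real (edge_scale \<alpha> n * finite_kernel i j a b n (edge_scale \<alpha> n * \<zeta>) (edge_scale \<alpha> n * \<xi>)) - limit_kernel i j \<sigma> \<delta> a b \<zeta> \<xi>) \<le> C / real n ^ 2"
        unfolding lim e_def[symmetric] fin .
    qed
  qed
  then show ?thesis unfolding \<alpha>_def by blast
qed

subsection \<open>Determinants and correlation functions\<close>

text \<open>The Leibniz sum reduces limits of block determinants to limits of entries and lets the
  power e^(r + s) be distributed as one factor per row.\<close>

lemma two_level_det_expand:
  "two_level_det A B C D r s x y =
     (\<Sum>p\<in>{p. p permutes {0..<r + s}}. of_int (sign p) * (\<Prod>i = 0..<r + s.
        (if i < r then if p i < r then A (x i) (x (p i)) else B (x i) (y (p i - r))
         else if p i < r then C (y (i - r)) (x (p i)) else D (y (i - r)) (y (p i - r)))))"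
proof -
  let ?M = "four_block_mat
       (Matrix.mat r r (\<lambda>(i, j). A (x i) (x j))) (Matrix.mat r s (\<lambda>(i, j). B (x i) (y j)))
       (Matrix.mat s r (\<lambda>(i, j). C (y i) (x j))) (Matrix.mat s s (\<lambda>(i, j). D (y i) (y j)))"
  have "?M \<in> carrier_mat (r + s) (r + s)" by (intro four_block_carrier_mat) auto
  note d = det_def'[OF this]
  show ?thesis
    unfolding two_level_det_def d
  proof (intro sum.cong refl arg_cong2[where f = "(*)"] prod.cong)
    fix p i assume p: "p \<in> {p. p permutes {0..<r + s}}" and i: "i \<in> {0..<r + s}"
    then have "p i < r + s" using permutes_in_image[of p "{0..<r + s}" i] by simp
    with i show "?M $$ (i, p i) = (if i < r then if p i < r then A (x i) (x (p i)) else B (x i) (y (p i - r))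
         else if p i < r then C (y (i - r)) (x (p i)) else D (y (i - r)) (y (p i - r)))"
      by (simp add: less_diff_conv2 add.commute)
  qed
qed

lemma tendsto_two_level_det:
  fixes A B C D :: "nat \<Rightarrow> real \<Rightarrow> real \<Rightarrow> real" and A' B' C' D' :: "real \<Rightarrow> real \<Rightarrow> complex"
  assumes A: "\<And>i j. i < r \<Longrightarrow> j < r \<Longrightarrow> (\<lambda>n. of_real (e n * A n (e n * x i) (e n * x j))) \<longlonglongrightarrow> A' (x i) (x j)"
    and B: "\<And>i j. i < r \<Longrightarrow> j < s \<Longrightarrow> (\<lambda>n. of_real (e n * B n (e n * x i) (e n * y j))) \<longlonglongrightarrow> B' (x i) (y j)"
    and C: "\<And>i j. i < s \<Longrightarrow> j < r \<Longrightarrow> (\<lambda>n. of_real (e n * C n (e n * y i) (e n * x j))) \<longlonglongrightarrow> C' (y i) (x j)"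
    and D: "\<And>i j. i < s \<Longrightarrow> j < s \<Longrightarrow> (\<lambda>n. of_real (e n * D n (e n * y i) (e n * y j))) \<longlonglongrightarrow> D' (y i) (y j)"
  shows "(\<lambda>n. of_real (e n ^ (r + s) * two_level_det (A n) (B n) (C n) (D n) r s
            (\<lambda>i\<in>{..<r}. e n * x i) (\<lambda>j\<in>{..<s}. e n * y j))) \<longlonglongrightarrow> two_level_det A' B' C' D' r s x y"
proof -
  let ?E = "\<lambda>n i j. if i < r then if j < r then A n (e n * x i) (e n * x j) else B n (e n * x i) (e n * y (j - r))
         else if j < r then C n (e n * y (i - r)) (e n * x j) else D n (e n * y (i - r)) (e n * y (j - r))"
  let ?E' = "\<lambda>i j. if i < r then if j < r then A' (x i) (x j) else B' (x i) (y (j - r))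
         else if j < r then C' (y (i - r)) (x j) else D' (y (i - r)) (y (j - r))"
  have 1: "complex_of_real (e n ^ (r + s) * two_level_det (A n) (B n) (C n) (D n) r s (\<lambda>i\<in>{..<r}. e n * x i) (\<lambda>j\<in>{..<s}. e n * y j))
     = (\<Sum>p\<in>{p. p permutes {0..<r + s}}. of_int (sign p) * (\<Prod>i = 0..<r + s. of_real (e n * ?E n i (p i))))" for n
  proof -
    have "e n ^ (r + s) * two_level_det (A n) (B n) (C n) (D n) r s (\<lambda>i\<in>{..<r}. e n * x i) (\<lambda>j\<in>{..<s}. e n * y j)
      = (\<Sum>p\<in>{p. p permutes {0..<r + s}}. of_int (sign p) * (\<Prod>i = 0..<r + s. e n * ?E n i (p i)))"
      unfolding two_level_det_expand sum_distrib_left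
    proof (rule sum.cong[OF refl])
      fix p assume p: "p \<in> {p. p permutes {0..<r + s}}"
      have "p i < r + s" if "i < r + s" for i using permutes_in_image[of p "{0..<r + s}" i] p that by simp
      then have "(\<Prod>i = 0..<r + s.
        (if i < r then if p i < r then A n ((\<lambda>i\<in>{..<r}. e n * x i) i) ((\<lambda>i\<in>{..<r}. e n * x i) (p i)) else B n ((\<lambda>i\<in>{..<r}. e n * x i) i) ((\<lambda>j\<in>{..<s}. e n * y j) (p i - r))
         else if p i < r then C n ((\<lambda>j\<in>{..<s}. e n * y j) (i - r)) ((\<lambda>i\<in>{..<r}. e n * x i) (p i)) else D n ((\<lambda>j\<in>{..<s}. e n * y j) (i - r)) ((\<lambda>j\<in>{..<s}. e n * y j) (p i - r))))
        = (\<Prod>i = 0..<r + s. ?E n i (p i))"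
        by (intro prod.cong refl) (auto simp: restrict_apply less_diff_conv2 add.commute)
      moreover have "e n ^ (r + s) * (\<Prod>i = 0..<r + s. ?E n i (p i)) = (\<Prod>i = 0..<r + s. e n * ?E n i (p i))"
        unfolding prod.distrib by simp
      ultimately show "e n ^ (r + s) * (of_int (sign p) * (\<Prod>i = 0..<r + s.
        (if i < r then if p i < r then A n ((\<lambda>i\<in>{..<r}. e n * x i) i) ((\<lambda>i\<in>{..<r}. e n * x i) (p i)) else B n ((\<lambda>i\<in>{..<r}. e n * x i) i) ((\<lambda>j\<in>{..<s}. e n * y j) (p i - r))
         else if p i < r then C n ((\<lambda>j\<in>{..<s}. e n * y j) (i - r)) ((\<lambda>i\<in>{..<r}. e n * x i) (p i)) else D n ((\<lambda>j\<in>{..<s}. e n * y j) (i - r)) ((\<lambda>j\<in>{..<s}. e n * y j) (p i - r)))))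
        = of_int (sign p) * (\<Prod>i = 0..<r + s. e n * ?E n i (p i))"
        by (simp only: mult.left_commute[of "e n ^ (r + s)"])
    qed
    then show ?thesis by (simp only: of_real_sum of_real_mult of_real_prod of_real_of_int_eq)
  qed
  show ?thesis
    unfolding 1 unfolding two_level_det_expand
  proof (intro tendsto_sum tendsto_mult tendsto_const tendsto_prod)
    fix p i assume p: "p \<in> {p. p permutes {0..<r + s}}" and i: "i \<in> {0..<r + s}"
    then have "p i < r + s" using permutes_in_image[of p "{0..<r + s}" i] by simp
    with i show "(\<lambda>n. complex_of_real (e n * ?E n i (p i))) \<longlonglongrightarrow> ?E' i (p i)"
      using A[of i "p i"] B[of i "p i - r"] C[of "i - r" "p i"] D[of "i - r" "p i - r"]
      by (cases "i < r"; cases "p i < r") (simp_all add: less_diff_conv2 add.commute)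
  qed
qed

text \<open>Applied to a singleton, the uniform estimate gives pointwise convergence, so both halves
  of \<open>hard_edge_limit\<close> come from \<open>kernel_estimate\<close>.\<close>

lemma hard_edge_limit_kernel:
  assumes "a > -1" "b > -1" "a + b > -1" "\<sigma> > 0" "\<sigma> > - a" "\<sigma> > - b" "\<delta> > 0"
    and H: "\<And>n x y. x > 0 \<Longrightarrow> y > 0 \<Longrightarrow> H n x y = finite_kernel i j a b n x y"
    and G: "\<And>\<zeta> \<xi>. G \<zeta> \<xi> = limit_kernel i j \<sigma> \<delta> a b \<zeta> \<xi>"
  shows "hard_edge_limit (a + b) H G"
proof -
  have u: "\<exists>C. \<forall>\<^sub>F n in sequentially. \<forall>(\<zeta>, \<xi>)\<in>S.
           norm (of_real (edge_scale (a + b) n * H n (edge_scale (a + b) n * \<zeta>) (edge_scale (a + b) n * \<xi>)) - G \<zeta> \<xi>)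
             \<le> C / real n ^ 2" if S: "compact S" "S \<subseteq> {0<..} \<times> {0<..}" for S
  proof -
    obtain C where "\<forall>\<^sub>F n in sequentially. \<forall>(\<zeta>, \<xi>)\<in>S.
     norm (of_real (edge_scale (a + b) n * finite_kernel i j a b n (edge_scale (a + b) n * \<zeta>) (edge_scale (a + b) n * \<xi>))
       - limit_kernel i j \<sigma> \<delta> a b \<zeta> \<xi>) \<le> C / real n ^ 2"
      using kernel_estimate[OF assms(1-7) S, of i j] by (elim exE)
    then have "\<forall>\<^sub>F n in sequentially. \<forall>(\<zeta>, \<xi>)\<in>S.
           norm (of_real (edge_scale (a + b) n * H n (edge_scale (a + b) n * \<zeta>) (edge_scale (a + b) n * \<xi>)) - G \<zeta> \<xi>)
             \<le> C / real n ^ 2"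
      using eventually_gt_at_top[of 0]
    proof eventually_elim
      case (elim n)
      have e: "edge_scale (a + b) n > 0" by (rule edge_scale_pos[OF elim(2)])
      show ?case
      proof clarify
        fix \<zeta> \<xi> assume m: "(\<zeta>, \<xi>) \<in> S"
        then have "edge_scale (a + b) n * \<zeta> > 0" "edge_scale (a + b) n * \<xi> > 0" using S(2) e by auto
        note h = H[OF this]
        show "norm (of_real (edge_scale (a + b) n * H n (edge_scale (a + b) n * \<zeta>) (edge_scale (a + b) n * \<xi>)) - G \<zeta> \<xi>) \<le> C / real n ^ 2"
          unfolding h G using bspec[OF elim(1) m] by (simp only: prod.case)
      qed
    qed
    then show ?thesis by (rule exI)
  qed
  have l: "(\<lambda>n. of_real (edge_scale (a + b) n * H n (edge_scale (a + b) n * \<zeta>) (edge_scale (a + b) n * \<xi>))) \<longlonglongrightarrow> G \<zeta> \<xi>"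
    if "\<zeta> > 0" "\<xi> > 0" for \<zeta> \<xi>
  proof -
    have "compact {(\<zeta>, \<xi>)}" "{(\<zeta>, \<xi>)} \<subseteq> {0<..} \<times> {0<..}" using that by auto
    from u[OF this] obtain C where C: "\<forall>\<^sub>F n in sequentially. \<forall>(\<zeta>, \<xi>)\<in>{(\<zeta>, \<xi>)}.
           norm (of_real (edge_scale (a + b) n * H n (edge_scale (a + b) n * \<zeta>) (edge_scale (a + b) n * \<xi>)) - G \<zeta> \<xi>)
             \<le> C / real n ^ 2" by (elim exE)
    have "(\<lambda>n. C / real n ^ 2) \<longlonglongrightarrow> 0" by real_asymp
    from Lim_null_comparison[OF _ this]
    have "(\<lambda>n. of_real (edge_scale (a + b) n * H n (edge_scale (a + b) n * \<zeta>) (edge_scale (a + b) n * \<xi>)) - G \<zeta> \<xi>) \<longlonglongrightarrow> 0"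
      using C by simp
    then show ?thesis by (simp only: LIM_zero_iff)
  qed
  show ?thesis unfolding hard_edge_limit_def using u l by blast
qed

lemma hard_edge_limits:
  assumes "a > -1" "b > -1" "a + b > -1" "\<sigma> > 0" "\<sigma> > - a" "\<sigma> > - b" "\<delta> > 0"
    and "cauchy_laguerre_biorthonormal a b p q"
  shows "hard_edge_limit (a + b) (H01 a b p q) (G01 \<sigma> \<delta> a b)"
    "hard_edge_limit (a + b) (H00 a b p q) (G00 \<sigma> \<delta> a b)"
    "hard_edge_limit (a + b) (H11 a b p q) (G11 \<sigma> \<delta> a b)"
    "hard_edge_limit (a + b) (H10 a b p q) (G10 \<sigma> \<delta> a b)"
proof -
  note H = H_expansion[OF assms(1-3) assms(8)]
  show "hard_edge_limit (a + b) (H01 a b p q) (G01 \<sigma> \<delta> a b)"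
    by (rule hard_edge_limit_kernel[OF assms(1-7), where i = False and j = True])
      (simp_all add: H finite_kernel_def kernel_sign_def G01_def limit_kernel_def meijer_loop_def)
  show "hard_edge_limit (a + b) (H00 a b p q) (G00 \<sigma> \<delta> a b)"
    by (rule hard_edge_limit_kernel[OF assms(1-7), where i = False and j = False])
      (simp_all add: H finite_kernel_def kernel_sign_def G00_def limit_kernel_def meijer_loop_def)
  show "hard_edge_limit (a + b) (H11 a b p q) (G11 \<sigma> \<delta> a b)"
    by (rule hard_edge_limit_kernel[OF assms(1-7), where i = True and j = True])
      (simp_all add: H finite_kernel_def kernel_sign_def G11_def limit_kernel_def meijer_loop_def)
  show "hard_edge_limit (a + b) (H10 a b p q) (G10 \<sigma> \<delta> a b)"
    by (rule hard_edge_limit_kernel[OF assms(1-7), where i = True and j = False])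
      (simp_all add: H finite_kernel_def kernel_sign_def G10_def limit_kernel_def meijer_loop_def)
qed

section \<open>Uniqueness of continuous correlation functions\<close>

text \<open>Tuples are functions on all naturals, frozen at \<open>undefined\<close> outside
  \<open>{..<r}\<close>. Hence only the finitely many coordinates below r of a basic open set in the
  product topology constrain the box.\<close>

lemma open_contains_extensional_box:
  fixes A :: "(nat \<Rightarrow> real) set"
  assumes "open A" "x \<in> A" "x \<in> extensional {..<r}"
  shows "\<exists>e>0. \<forall>d. 0 < d \<longrightarrow> d \<le> e \<longrightarrow> (\<Pi>\<^sub>E i\<in>{..<r}. {x i - d<..<x i + d}) \<subseteq> A"
proof -
  have "openin (product_topology (\<lambda>_. euclidean) UNIV) A"
    using assms(1) by (simp only: euclidean_product_topology open_openin[symmetric])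
  from product_topology_open_contains_basis[OF this assms(2)] obtain X where
    X: "x \<in> (\<Pi>\<^sub>E i\<in>UNIV. X i)" "\<And>i. open (X i)" "(\<Pi>\<^sub>E i\<in>UNIV. X i) \<subseteq> A"
    by (simp only: open_openin[symmetric]) blast
  have "\<forall>i. \<exists>e>0. \<forall>y. dist y (x i) < e \<longrightarrow> y \<in> X i"
    using X(1,2) unfolding open_dist by (metis PiE_mem UNIV_I)
  then obtain e where e: "\<And>i. e i > 0" "\<And>i y. dist y (x i) < e i \<Longrightarrow> y \<in> X i" by metis
  \<comment> \<open>Inserting 1 keeps the minimum meaningful when r = 0.\<close>
  define m where "m = Min (insert 1 (e ` {..<r}))"
  have m: "m > 0" "\<And>i. i < r \<Longrightarrow> m \<le> e i" using e(1) by (auto simp: m_def)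
  show ?thesis
  proof (intro exI[of _ m] conjI allI impI m(1) subsetI)
    fix d w assume d: "0 < d" "d \<le> m" and w: "w \<in> (\<Pi>\<^sub>E i\<in>{..<r}. {x i - d<..<x i + d})"
    have "w i \<in> X i" for i
    proof (cases "i < r")
      case True
      then have "w i \<in> {x i - d<..<x i + d}" using w by (auto simp: PiE_def)
      then have "dist (w i) (x i) < e i" using d m(2)[OF True] by (auto simp: dist_real_def abs_less_iff)
      then show ?thesis by (rule e(2))
    next
      case False
      then have "w i = x i" using w assms(3) by (auto simp: PiE_def extensional_def)
      then show ?thesis using X(1) by (auto simp: PiE_def)
    qed
    then show "w \<in> A" using X(3) by (auto simp: PiE_def)
  qed
qed

text \<open>A product of two small cubes around z serves as test set for densities. For r = s = 0 it
  is a single point of measure 1.\<close>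

lemma pos_orthant_box:
  assumes "open A" "z \<in> A" "z \<in> pos_orthant r s"
  shows "\<exists>B\<in>sets (tuple_lebesgue r s). B \<subseteq> A \<inter> pos_orthant r s \<and>
    emeasure (tuple_lebesgue r s) B \<noteq> 0 \<and> emeasure (tuple_lebesgue r s) B \<noteq> \<infinity>"
proof -
  obtain x y where z: "z = (x, y)" by (cases z)
  have xy: "x \<in> ({..<r} \<rightarrow>\<^sub>E {0<..})" "y \<in> ({..<s} \<rightarrow>\<^sub>E {0<..})" using assms(3) by (auto simp: z pos_orthant_def)
  obtain A1 A2 where A: "open A1" "open A2" "z \<in> A1 \<times> A2" "A1 \<times> A2 \<subseteq> A"
    using open_prod_elim[OF assms(1,2)] by metis
  then have x: "x \<in> A1" "y \<in> A2" by (auto simp: z)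
  have ex: "x \<in> extensional {..<r}" "y \<in> extensional {..<s}" using xy by (auto simp: PiE_def)
  obtain e1 where e1: "e1 > 0" "\<And>d. 0 < d \<Longrightarrow> d \<le> e1 \<Longrightarrow> (\<Pi>\<^sub>E i\<in>{..<r}. {x i - d<..<x i + d}) \<subseteq> A1"
    using open_contains_extensional_box[OF A(1) x(1) ex(1)] by metis
  obtain e2 where e2: "e2 > 0" "\<And>d. 0 < d \<Longrightarrow> d \<le> e2 \<Longrightarrow> (\<Pi>\<^sub>E i\<in>{..<s}. {y i - d<..<y i + d}) \<subseteq> A2"
    using open_contains_extensional_box[OF A(2) x(2) ex(2)] by metis
  define d where "d = Min ({e1, e2} \<union> x ` {..<r} \<union> y ` {..<s})"
  have pos: "x i > 0" if "i < r" for i using xy(1) that by (auto simp: PiE_def)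
  have pos': "y i > 0" if "i < s" for i using xy(2) that by (auto simp: PiE_def)
  have d: "d > 0" "d \<le> e1" "d \<le> e2" "\<And>i. i < r \<Longrightarrow> d \<le> x i" "\<And>i. i < s \<Longrightarrow> d \<le> y i"
  proof -
    have fin: "finite ({e1, e2} \<union> x ` {..<r} \<union> y ` {..<s})" by simp
    show "d > 0" using e1(1) e2(1) pos pos' by (auto simp: d_def)
    show "d \<le> e1" "d \<le> e2" "\<And>i. i < r \<Longrightarrow> d \<le> x i" "\<And>i. i < s \<Longrightarrow> d \<le> y i"
      unfolding d_def by (rule Min_le[OF fin]; blast)+
  qed
  let ?I = "\<Pi>\<^sub>E i\<in>{..<r}. {x i - d<..<x i + d}" and ?J = "\<Pi>\<^sub>E i\<in>{..<s}. {y i - d<..<y i + d}"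
  interpret product_sigma_finite "\<lambda>_::nat. lborel :: real measure" by standard
  interpret S: sigma_finite_measure "PiM {..<s} (\<lambda>_. lborel :: real measure)" by (rule sigma_finite) simp
  have IJ: "?I \<in> sets (PiM {..<r} (\<lambda>_. lborel))" "?J \<in> sets (PiM {..<s} (\<lambda>_. lborel))"
    by (intro sets_PiM_I_finite; simp)+
  have em: "emeasure (tuple_lebesgue r s) (?I \<times> ?J) = ennreal ((2 * d) ^ r * (2 * d) ^ s)"
  proof -
    have p: "emeasure (PiM {..<m} (\<lambda>_. lborel)) (\<Pi>\<^sub>E i\<in>{..<m}. {v i - d<..<v i + d}) = ennreal ((2 * d) ^ m)" for m and v :: "nat \<Rightarrow> real"
      by (subst emeasure_PiM) (use d(1) in \<open>simp_all add: ennreal_power\<close>)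
    show ?thesis
      unfolding tuple_lebesgue_def S.emeasure_pair_measure_Times[OF IJ] p using d(1) by (simp add: ennreal_mult)
  qed
  show ?thesis
  proof (intro bexI[of _ "?I \<times> ?J"] conjI)
    show "?I \<times> ?J \<in> sets (tuple_lebesgue r s)" unfolding tuple_lebesgue_def by (intro pair_measureI IJ)
    have "?I \<times> ?J \<subseteq> A1 \<times> A2" using e1(2)[OF d(1,2)] e2(2)[OF d(1,3)] by (intro Sigma_mono)
    then have "?I \<times> ?J \<subseteq> A" using A(4) by (rule order_trans)
    moreover have "?I \<subseteq> {..<r} \<rightarrow>\<^sub>E {0<..}" "?J \<subseteq> {..<s} \<rightarrow>\<^sub>E {0<..}"
      using d(4,5) by (intro PiE_mono; force)+
    then have "?I \<times> ?J \<subseteq> pos_orthant r s" unfolding pos_orthant_def by (rule Sigma_mono)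
    ultimately show "?I \<times> ?J \<subseteq> A \<inter> pos_orthant r s" by (rule Int_greatest)
    show "emeasure (tuple_lebesgue r s) (?I \<times> ?J) \<noteq> 0" "emeasure (tuple_lebesgue r s) (?I \<times> ?J) \<noteq> \<infinity>"
      unfolding em using mult_pos_pos[of "(2 * d) ^ r" "(2 * d) ^ s"] d(1) by (simp_all add: ennreal_eq_0_iff not_le del: power_mult_distrib)
  qed
qed

text \<open>Both functions have the same integrals over test sets. If \<rho> z > \<rho>' z,
  continuity gives a small box on which \<rho> exceeds c1 and \<rho>' stays below c2 < c1, and the
  integrals over it differ. Exchanging the roles gives equality on the orthant.\<close>

lemma eigenvalue_correlation_le:
  assumes R: "eigenvalue_correlation a b n r s \<rho>" and R': "eigenvalue_correlation a b n r s \<rho>'" and z: "z \<in> pos_orthant r s"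
  shows "\<rho> z \<le> \<rho>' z"
proof (rule ccontr)
  assume "\<not> \<rho> z \<le> \<rho>' z"
  then have lt: "\<rho>' z < \<rho> z" by simp
  then obtain c1 where c1: "\<rho>' z < c1" "c1 < \<rho> z" using dense by blast
  then obtain c2 where c2: "\<rho>' z < c2" "c2 < c1" using dense by blast
  have "0 \<le> \<rho>' z" using R' z by (simp add: eigenvalue_correlation_def)
  then have c0: "0 \<le> c2" using c2 by simp
  have cont: "continuous_on (pos_orthant r s) \<rho>" "continuous_on (pos_orthant r s) \<rho>'"
    using R R' by (simp_all add: eigenvalue_correlation_def)
  obtain A where A: "open A" "z \<in> A" "\<And>w. w \<in> pos_orthant r s \<Longrightarrow> w \<in> A \<Longrightarrow> \<rho> w \<in> {c1<..}"
    using cont(1) z c1(2) unfolding continuous_on_topological by (metis greaterThan_iff open_greaterThan)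
  obtain A' where A': "open A'" "z \<in> A'" "\<And>w. w \<in> pos_orthant r s \<Longrightarrow> w \<in> A' \<Longrightarrow> \<rho>' w \<in> {..<c2}"
    using cont(2) z c2(1) unfolding continuous_on_topological by (metis lessThan_iff open_lessThan)
  have "open (A \<inter> A')" "z \<in> A \<inter> A'" using A A' by auto
  from pos_orthant_box[OF this z] obtain B where B: "B \<in> sets (tuple_lebesgue r s)" "B \<subseteq> A \<inter> A' \<inter> pos_orthant r s"
    "emeasure (tuple_lebesgue r s) B \<noteq> 0" "emeasure (tuple_lebesgue r s) B \<noteq> \<infinity>" by metis
  have "B \<subseteq> pos_orthant r s" using B(2) by blast
  then have eq: "(\<integral>\<^sup>+w\<in>B. ennreal (\<rho> w) \<partial>tuple_lebesgue r s) = (\<integral>\<^sup>+w\<in>B. ennreal (\<rho>' w) \<partial>tuple_lebesgue r s)"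
  proof -
    have *: "(\<integral>\<^sup>+\<omega>. of_nat (eigenvalue_tuple_count n r s B \<omega>) \<partial>matrix_model a b n) = (\<integral>\<^sup>+w\<in>B. ennreal (f w) \<partial>tuple_lebesgue r s)"
      if "eigenvalue_correlation a b n r s f" for f
      using that[unfolded eigenvalue_correlation_def, THEN conjunct2, THEN conjunct2, THEN conjunct2] B(1) \<open>B \<subseteq> pos_orthant r s\<close> by simp
    show ?thesis unfolding *[OF R, symmetric] *[OF R', symmetric] ..
  qed
  have "ennreal c1 * emeasure (tuple_lebesgue r s) B = (\<integral>\<^sup>+w\<in>B. ennreal c1 \<partial>tuple_lebesgue r s)"
    using B(1) by (rule nn_integral_cmult_indicator[symmetric])
  also have "\<dots> \<le> (\<integral>\<^sup>+w\<in>B. ennreal (\<rho> w) \<partial>tuple_lebesgue r s)"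
  proof (rule nn_integral_mono)
    fix w show "ennreal c1 * indicator B w \<le> ennreal (\<rho> w) * indicator B w"
    proof (cases "w \<in> B")
      case True
      then have "w \<in> pos_orthant r s" "w \<in> A" using B(2) by auto
      from A(3)[OF this] have "c1 \<le> \<rho> w" by simp
      then show ?thesis using True by (simp add: ennreal_leI)
    qed simp
  qed
  also have "\<dots> \<le> (\<integral>\<^sup>+w\<in>B. ennreal c2 \<partial>tuple_lebesgue r s)"
    unfolding eq
  proof (rule nn_integral_mono)
    fix w show "ennreal (\<rho>' w) * indicator B w \<le> ennreal c2 * indicator B w"
    proof (cases "w \<in> B")
      case True
      then have "w \<in> pos_orthant r s" "w \<in> A'" using B(2) by auto
      from A'(3)[OF this] have "\<rho>' w \<le> c2" by simp
      then show ?thesis using True by (simp add: ennreal_leI)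
    qed simp
  qed
  also have "\<dots> = ennreal c2 * emeasure (tuple_lebesgue r s) B"
    using B(1) by (rule nn_integral_cmult_indicator)
  finally have "ennreal c1 * emeasure (tuple_lebesgue r s) B \<le> ennreal c2 * emeasure (tuple_lebesgue r s) B" .
  moreover obtain t where t: "emeasure (tuple_lebesgue r s) B = ennreal t" "t \<ge> 0"
    using B(4) by (cases "emeasure (tuple_lebesgue r s) B") auto
  ultimately have "c1 * t \<le> c2 * t" using c0 c2(2) by (simp flip: ennreal_mult)
  moreover have "t > 0" using t B(3) by (cases "t = 0") auto
  ultimately show False using c2(2) by simp
qed

text \<open>The determinantal formula for finite n enters as the premise of the last clause. A
  density is fixed only up to null sets, so the passage to arbitrary correlation functions at
  prescribed points rests on their continuity, through
  \<open>eigenvalue_correlation_le\<close>.\<close>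

theorem theorem2p2:
  fixes a b \<sigma> \<delta> :: real and p q :: "nat \<Rightarrow> real poly"
  assumes "a > -1" and "b > -1" and "a + b > -1"
    and "cauchy_laguerre_biorthonormal a b p q"
    and "\<sigma> > 0" and "\<sigma> > - a" and "\<sigma> > - b" and "\<delta> > 0"
  shows
    "hard_edge_limit (a + b) (H01 a b p q) (G01 \<sigma> \<delta> a b) \<and>
     hard_edge_limit (a + b) (H00 a b p q) (G00 \<sigma> \<delta> a b) \<and>
     hard_edge_limit (a + b) (H11 a b p q) (G11 \<sigma> \<delta> a b) \<and>
     hard_edge_limit (a + b) (H10 a b p q) (G10 \<sigma> \<delta> a b) \<and>
     (\<forall>r s \<zeta> \<xi>. (\<forall>i<r. 0 < \<zeta> i) \<and> (\<forall>j<s. 0 < \<xi> j) \<longrightarrow>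
        (\<lambda>n. of_real (edge_scale (a + b) n ^ (r + s) *
               kernel_correlation a b p q n r s
                 (\<lambda>i\<in>{..<r}. edge_scale (a + b) n * \<zeta> i, \<lambda>j\<in>{..<s}. edge_scale (a + b) n * \<xi> j)))
          \<longlonglongrightarrow> two_level_det (G01 \<sigma> \<delta> a b) (G00 \<sigma> \<delta> a b) (G11 \<sigma> \<delta> a b) (G10 \<sigma> \<delta> a b) r s \<zeta> \<xi>) \<and>
     ((\<forall>n\<ge>1. \<forall>r\<le>n. \<forall>s\<le>n. eigenvalue_correlation a b n r s (kernel_correlation a b p q n r s)) \<longrightarrow>
      (\<forall>r s \<rho>. (\<forall>n\<ge>1. r \<le> n \<and> s \<le> n \<longrightarrow> eigenvalue_correlation a b n r s (\<rho> n)) \<longrightarrow>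
        (\<forall>\<zeta> \<xi>. (\<forall>i<r. 0 < \<zeta> i) \<and> (\<forall>j<s. 0 < \<xi> j) \<longrightarrow>
          (\<lambda>n. of_real (edge_scale (a + b) n ^ (r + s) *
                 \<rho> n (\<lambda>i\<in>{..<r}. edge_scale (a + b) n * \<zeta> i, \<lambda>j\<in>{..<s}. edge_scale (a + b) n * \<xi> j)))
            \<longlonglongrightarrow> two_level_det (G01 \<sigma> \<delta> a b) (G00 \<sigma> \<delta> a b) (G11 \<sigma> \<delta> a b) (G10 \<sigma> \<delta> a b) r s \<zeta> \<xi>)))"
proof -
  note L = hard_edge_limits[OF assms(1-3,5-8,4)]
  let ?e = "edge_scale (a + b)"
  let ?G = "two_level_det (G01 \<sigma> \<delta> a b) (G00 \<sigma> \<delta> a b) (G11 \<sigma> \<delta> a b) (G10 \<sigma> \<delta> a b)"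
  let ?z = "\<lambda>n r s \<zeta> \<xi>. (\<lambda>i\<in>{..<r}. ?e n * \<zeta> i, \<lambda>j\<in>{..<s}. ?e n * \<xi> j)"
  have pt: "(\<lambda>n. of_real (?e n * H n (?e n * x) (?e n * y))) \<longlonglongrightarrow> G x y"
    if "hard_edge_limit (a + b) H G" "x > 0" "y > 0" for H G x y
    using that unfolding hard_edge_limit_def by blast
  have K: "(\<lambda>n. of_real (?e n ^ (r + s) * kernel_correlation a b p q n r s (?z n r s \<zeta> \<xi>))) \<longlonglongrightarrow> ?G r s \<zeta> \<xi>"
    if "\<forall>i<r. 0 < \<zeta> i" "\<forall>j<s. 0 < \<xi> j" for r s \<zeta> \<xi>
    unfolding kernel_correlation_def fst_conv snd_conv
    by (rule tendsto_two_level_det; rule pt[OF L(1)] pt[OF L(2)] pt[OF L(3)] pt[OF L(4)]; use that in blast)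
  have R: "(\<lambda>n. of_real (?e n ^ (r + s) * \<rho> n (?z n r s \<zeta> \<xi>))) \<longlonglongrightarrow> ?G r s \<zeta> \<xi>"
    if k: "\<forall>n\<ge>1. \<forall>r\<le>n. \<forall>s\<le>n. eigenvalue_correlation a b n r s (kernel_correlation a b p q n r s)"
      and \<rho>: "\<forall>n\<ge>1. r \<le> n \<and> s \<le> n \<longrightarrow> eigenvalue_correlation a b n r s (\<rho> n)"
      and pos: "\<forall>i<r. 0 < \<zeta> i" "\<forall>j<s. 0 < \<xi> j" for r s \<rho> \<zeta> \<xi>
  proof (rule Lim_transform_eventually[OF K[OF pos]])
    show "\<forall>\<^sub>F n in sequentially. complex_of_real (?e n ^ (r + s) * kernel_correlation a b p q n r s (?z n r s \<zeta> \<xi>))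
        = of_real (?e n ^ (r + s) * \<rho> n (?z n r s \<zeta> \<xi>))"
      \<comment> \<open>Correlation functions are specified for r, s <= n only, and n >= 1 makes the
        scale positive; finitely many n do not affect the limit.\<close>
      using eventually_ge_at_top[of "max 1 (max r s)"]
    proof eventually_elim
      case (elim n)
      then have n: "n \<ge> 1" "r \<le> n" "s \<le> n" by auto
      then have "?e n > 0" by (intro edge_scale_pos) simp
      then have z: "?z n r s \<zeta> \<xi> \<in> pos_orthant r s" using pos by (auto simp: pos_orthant_def)
      have c: "eigenvalue_correlation a b n r s (kernel_correlation a b p q n r s)" "eigenvalue_correlation a b n r s (\<rho> n)"
        using k \<rho> n by blast+
      have "kernel_correlation a b p q n r s (?z n r s \<zeta> \<xi>) = \<rho> n (?z n r s \<zeta> \<xi>)"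
        by (intro antisym eigenvalue_correlation_le[OF c z] eigenvalue_correlation_le[OF c(2,1) z])
      then show ?case by (simp only:)
    qed
  qed
  show ?thesis
    apply (intro conjI L allI impI)
     apply (elim conjE, rule K; assumption)
    apply (elim conjE, rule R; assumption)
    done
qed

end
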